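(* Let $(\mathcal{E},D(\mathcal{E}))$ be a transient symmetric regular Dirichlet form on $L^2(E;m)$ with generator $L$ and extended Dirichlet space $D_e(\mathcal{E})$. Assume that every sequence $\{u_n\}\subset D_e(\mathcal{E})$ with $\sup_{n\ge1}\mathcal{E}(u_n,u_n)<\infty$ has a subsequence which converges $m$-a.e. Let $\mu\in\mathcal{M}_{0,b}$ be a diffuse measure and let $f:E\times\mathbb{R}\to\mathbb{R}$ be a Carathéodory function such that $$f(x,0)=0,\qquad f(x,y)y\le 0,\qquad x\in E,\ y\in\mathbb{R},$$ and such that for every $a>0$ the function $F_a(x)=\sup_{|y|\le a}|f(x,y)|$, $x\in E$, belongs to $L^1(E;m)$. Then there exists a solution $u$ (in the sense of duality) of the equation $-Lu=f(\cdot,u)+\mu$. Moreover, for every $k\ge0$, $T_k(u)\in D_e(\mathcal{E})$ and $$\mathcal{E}(T_k(u),T_k(u))\le 2k\|\mu\|_{TV}.$$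
   Context: Setting. $E$ is a locally compact separable metric space; $m$ is a Radon measure on $E$ (nonnegative Borel measure, finite on compact sets) with $\mathrm{supp}[m]=E$; $(\cdot,\cdot)$ is the inner product of $L^2(E;m)$. $(\mathcal{E},D(\mathcal{E}))$ is a symmetric regular Dirichlet form on $L^2(E;m)$ which is transient: there is a bounded $g\in L^1(E;m)$, $g>0$ $m$-a.e., with $\int_E|u|g\,dm\le\mathcal{E}(u,u)^{1/2}$ for all $u\in D(\mathcal{E})$. $L$ is the unique nonpositive self-adjoint operator on $L^2(E;m)$ with $D(L)\subset D(\mathcal{E})$ and $\mathcal{E}(u,v)=(-Lu,v)$ for $u\in D(L)$, $v\in D(\mathcal{E})$. The extended Dirichlet space $D_e(\mathcal{E})$ consists of ($m$-classes of) $m$-a.e. finite measurable functions $u$ that are $m$-a.e. limits of $\mathcal{E}$-Cauchy sequences $\{u_n\}\subset D(\mathcal{E})$, with $\mathcal{E}(u,u)=\lim_n\mathcal{E}(u_n,u_n)$; $V:=(D_e(\mathcal{E}),\mathcal{E})$ is a Hilbert space, with dual $V'$. Capacity. For $U\subset E$ open, $\mathrm{Cap}_{(0)}(U)=\inf\{\mathcal{E}(u,u):u\in D_e(\mathcal{E}),\,u\ge1\ m\text{-a.e. on }U\}$ ($\inf\emptyset=\infty$); for arbitrary $A\subset E$, $\mathrm{Cap}_{(0)}(A)=\inf\{\mathrm{Cap}_{(0)}(U):U\supset A\text{ open}\}$. "q.e." means outside a set of $\mathrm{Cap}_{(0)}$ zero. A function is quasi-continuous if for every $\varepsilon>0$ there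 is an open $U$ with $\mathrm{Cap}_{(0)}(U)<\varepsilon$ such that its restriction to $E\setminus U$ is continuous. $\tilde u$ denotes a quasi-continuous $m$-version of $u$ (one exists for every $u\in D_e(\mathcal{E})$). Measures. $\mathcal{M}_b$ is the space of finite signed Borel measures on $E$ with $\|\mu\|_{TV}=|\mu|(E)$; $\mathcal{M}_{0,b}\subset\mathcal{M}_b$ is the subspace of measures charging no set of $\mathrm{Cap}_{(0)}$ zero (diffuse measures). Potentials. $(G_\alpha)_{\alpha>0}$ is the $L^2(E;m)$-resolvent of $\mathcal{E}$, extended to nonnegative Borel functions by monotone limits; for nonnegative Borel $\eta$, $G\eta=\sup_{\alpha>0}G_\alpha\eta$ $m$-a.e.; for signed $\eta$ with $G|\eta|<\infty$ $m$-a.e., $G\eta=G\eta^+-G\eta^-$. For $\eta\in L^1(E;m)$, $G\eta$ has a quasi-continuous $m$-version $\widetilde{G\eta}$. Carathéodory: $f(\cdot,y)$ is measurable for each $y$, and $f(x,\cdot)$ is continuous for each $x$. Solution. $u:E\to\mathbb{R}$ (measurable) is a solution of $-Lu=f(\cdot,u)+\mu$ in the sense of duality if (a) $f(\cdot,u)\in L^1(E;m)$, and (b) for every $\eta\in L^1(E;m)$ such that $G|\eta|$ is bounded, $$\int_E u\,\eta\,dm=\int_E f(x,u(x))\,G\eta(x)\,m(dx)+\int_E\widetilde{G\eta}\,d\mu .$$ Truncation: $T_k(u)(x)=((-k)\vee u(x))\wedge k$. *)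

theory Defs
  imports "HOL-Analysis.Analysis"
begin

text \<open>
  The state space is a type \<open>'a\<close> of sort metric space with second countable topology (for metric
  spaces: the separable ones); local compactness is a separate hypothesis.  Elements of
  \<open>L\<^sup>2(E;m)\<close> and of the form domain are represented by real functions rather than
  by \<open>m\<close>-classes: the domain is a set of functions closed under \<open>m\<close>-a.e. equality
  and the form depends on its arguments only up to \<open>m\<close>-a.e. equality.
\<close>

definition radon_full_support :: "'a::topological_space measure \<Rightarrow> bool" where
  "radon_full_support m \<longleftrightarrow>
     sets m = sets borel \<and>
     (\<forall>K. compact K \<longrightarrow> emeasure m K < \<infinity>) \<and>
     (\<forall>U. open U \<longrightarrow> U \<noteq> {} \<longrightarrow> emeasure m U > 0)"

subsection \<open>Dirichlet forms\<close>

definition L2 :: "'a measure \<Rightarrow> ('a \<Rightarrow> real) set" where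
  "L2 m = {u \<in> borel_measurable m. integrable m (\<lambda>x. (u x)\<^sup>2)}"

definition inner_L2 :: "'a measure \<Rightarrow> ('a \<Rightarrow> real) \<Rightarrow> ('a \<Rightarrow> real) \<Rightarrow> real" where
  "inner_L2 m u v = (\<integral>x. u x * v x \<partial>m)"

definition energy1 ::
  "'a measure \<Rightarrow> (('a \<Rightarrow> real) \<Rightarrow> ('a \<Rightarrow> real) \<Rightarrow> real) \<Rightarrow> ('a \<Rightarrow> real) \<Rightarrow> real" where
  "energy1 m \<E> u = \<E> u u + inner_L2 m u u"

definition symmetric_form ::
  "'a measure \<Rightarrow> ('a \<Rightarrow> real) set \<Rightarrow> (('a \<Rightarrow> real) \<Rightarrow> ('a \<Rightarrow> real) \<Rightarrow> real) \<Rightarrow> bool" where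
  "symmetric_form m D \<E> \<longleftrightarrow>
     D \<subseteq> L2 m \<and>
     (\<lambda>x. 0) \<in> D \<and>
     (\<forall>u\<in>D. \<forall>v\<in>D. (\<lambda>x. u x + v x) \<in> D) \<and>
     (\<forall>c. \<forall>u\<in>D. (\<lambda>x. c * u x) \<in> D) \<and>
     (\<forall>u\<in>D. \<forall>v\<in>borel_measurable m. (AE x in m. u x = v x) \<longrightarrow>
        v \<in> D \<and> (\<forall>w\<in>D. \<E> u w = \<E> v w)) \<and>
     (\<forall>u\<in>L2 m. \<forall>\<epsilon>>0. \<exists>v\<in>D. inner_L2 m (\<lambda>x. u x - v x) (\<lambda>x. u x - v x) < \<epsilon>) \<and>
     (\<forall>u\<in>D. \<forall>v\<in>D. \<E> u v = \<E> v u) \<and>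
     (\<forall>u\<in>D. \<forall>v\<in>D. \<forall>w\<in>D. \<E> (\<lambda>x. u x + v x) w = \<E> u w + \<E> v w) \<and>
     (\<forall>c. \<forall>u\<in>D. \<forall>w\<in>D. \<E> (\<lambda>x. c * u x) w = c * \<E> u w) \<and>
     (\<forall>u\<in>D. 0 \<le> \<E> u u)"

definition closed_form ::
  "'a measure \<Rightarrow> ('a \<Rightarrow> real) set \<Rightarrow> (('a \<Rightarrow> real) \<Rightarrow> ('a \<Rightarrow> real) \<Rightarrow> real) \<Rightarrow> bool" where
  "closed_form m D \<E> \<longleftrightarrow>
     (\<forall>u :: nat \<Rightarrow> 'a \<Rightarrow> real.
        (\<forall>n. u n \<in> D) \<and>
        (\<forall>\<epsilon>>0. \<exists>N. \<forall>i\<ge>N. \<forall>j\<ge>N. energy1 m \<E> (\<lambda>x. u i x - u j x) < \<epsilon>) \<longrightarrow>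
        (\<exists>v\<in>D. (\<lambda>n. energy1 m \<E> (\<lambda>x. u n x - v x)) \<longlonglongrightarrow> 0))"

definition markovian_form ::
  "('a \<Rightarrow> real) set \<Rightarrow> (('a \<Rightarrow> real) \<Rightarrow> ('a \<Rightarrow> real) \<Rightarrow> real) \<Rightarrow> bool" where
  "markovian_form D \<E> \<longleftrightarrow>
     (\<forall>u\<in>D. (\<lambda>x. min (max (u x) 0) 1) \<in> D \<and>
        \<E> (\<lambda>x. min (max (u x) 0) 1) (\<lambda>x. min (max (u x) 0) 1) \<le> \<E> u u)"

definition dirichlet_form ::
  "'a measure \<Rightarrow> ('a \<Rightarrow> real) set \<Rightarrow> (('a \<Rightarrow> real) \<Rightarrow> ('a \<Rightarrow> real) \<Rightarrow> real) \<Rightarrow> bool" where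
  "dirichlet_form m D \<E> \<longleftrightarrow>
     symmetric_form m D \<E> \<and> closed_form m D \<E> \<and> markovian_form D \<E>"

definition C_c :: "('a::topological_space \<Rightarrow> real) set" where
  "C_c = {u. continuous_on UNIV u \<and> compact (closure {x. u x \<noteq> 0})}"

definition regular_form ::
  "'a::topological_space measure \<Rightarrow> ('a \<Rightarrow> real) set
     \<Rightarrow> (('a \<Rightarrow> real) \<Rightarrow> ('a \<Rightarrow> real) \<Rightarrow> real) \<Rightarrow> bool" where
  "regular_form m D \<E> \<longleftrightarrow>
     (\<forall>u\<in>D. \<forall>\<epsilon>>0. \<exists>v\<in>D \<inter> C_c. energy1 m \<E> (\<lambda>x. u x - v x) < \<epsilon>) \<and>
     (\<forall>u\<in>C_c. \<forall>\<epsilon>>0. \<exists>v\<in>D \<inter> C_c. \<forall>x. \<bar>u x - v x\<bar> < \<epsilon>)"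

definition transient_form ::
  "'a measure \<Rightarrow> ('a \<Rightarrow> real) set \<Rightarrow> (('a \<Rightarrow> real) \<Rightarrow> ('a \<Rightarrow> real) \<Rightarrow> real) \<Rightarrow> bool" where
  "transient_form m D \<E> \<longleftrightarrow>
     (\<exists>g. integrable m g \<and> bounded (range g) \<and> (AE x in m. 0 < g x) \<and>
        (\<forall>u\<in>D. (\<integral>\<^sup>+x. ennreal (\<bar>u x\<bar> * g x) \<partial>m) \<le> ennreal (sqrt (\<E> u u))))"

subsection \<open>The extended Dirichlet space\<close>

definition approx_seq ::
  "'a measure \<Rightarrow> ('a \<Rightarrow> real) set \<Rightarrow> (('a \<Rightarrow> real) \<Rightarrow> ('a \<Rightarrow> real) \<Rightarrow> real)
     \<Rightarrow> (nat \<Rightarrow> 'a \<Rightarrow> real) \<Rightarrow> ('a \<Rightarrow> real) \<Rightarrow> bool" where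
  "approx_seq m D \<E> un u \<longleftrightarrow>
     (\<forall>n. un n \<in> D) \<and>
     (\<forall>\<epsilon>>0. \<exists>N. \<forall>i\<ge>N. \<forall>j\<ge>N. \<E> (\<lambda>x. un i x - un j x) (\<lambda>x. un i x - un j x) < \<epsilon>) \<and>
     (AE x in m. (\<lambda>n. un n x) \<longlonglongrightarrow> u x)"

definition ext_space ::
  "'a measure \<Rightarrow> ('a \<Rightarrow> real) set \<Rightarrow> (('a \<Rightarrow> real) \<Rightarrow> ('a \<Rightarrow> real) \<Rightarrow> real)
     \<Rightarrow> ('a \<Rightarrow> real) set" where
  "ext_space m D \<E> = {u \<in> borel_measurable m. \<exists>un. approx_seq m D \<E> un u}"

text \<open>The value \<open>\<E>(u,u)\<close> of the extended form, for \<open>u\<close> in the extended Dirichlet space;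
  the limit does not depend on the approximating sequence.\<close>

definition ext_energy ::
  "'a measure \<Rightarrow> ('a \<Rightarrow> real) set \<Rightarrow> (('a \<Rightarrow> real) \<Rightarrow> ('a \<Rightarrow> real) \<Rightarrow> real)
     \<Rightarrow> ('a \<Rightarrow> real) \<Rightarrow> real" where
  "ext_energy m D \<E> u =
     (THE l. \<exists>un. approx_seq m D \<E> un u \<and> (\<lambda>n. \<E> (un n) (un n)) \<longlonglongrightarrow> l)"

subsection \<open>Capacity and quasi-continuity\<close>

definition cap0_open ::
  "'a measure \<Rightarrow> ('a \<Rightarrow> real) set \<Rightarrow> (('a \<Rightarrow> real) \<Rightarrow> ('a \<Rightarrow> real) \<Rightarrow> real)
     \<Rightarrow> 'a set \<Rightarrow> ennreal" where
  "cap0_open m D \<E> U =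
     (INF u \<in> {u \<in> ext_space m D \<E>. AE x in m. x \<in> U \<longrightarrow> 1 \<le> u x}. ennreal (ext_energy m D \<E> u))"

definition cap0 ::
  "'a::topological_space measure \<Rightarrow> ('a \<Rightarrow> real) set
     \<Rightarrow> (('a \<Rightarrow> real) \<Rightarrow> ('a \<Rightarrow> real) \<Rightarrow> real) \<Rightarrow> 'a set \<Rightarrow> ennreal" where
  "cap0 m D \<E> A = (INF U \<in> {U. open U \<and> A \<subseteq> U}. cap0_open m D \<E> U)"

definition quasi_continuous ::
  "'a::topological_space measure \<Rightarrow> ('a \<Rightarrow> real) set
     \<Rightarrow> (('a \<Rightarrow> real) \<Rightarrow> ('a \<Rightarrow> real) \<Rightarrow> real) \<Rightarrow> ('a \<Rightarrow> real) \<Rightarrow> bool" where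
  "quasi_continuous m D \<E> u \<longleftrightarrow>
     (\<forall>\<epsilon>::real. \<epsilon> > 0 \<longrightarrow> (\<exists>U. open U \<and> cap0 m D \<E> U < ennreal \<epsilon> \<and> continuous_on (- U) u))"

text \<open>A quasi-continuous \<open>m\<close>-version of \<open>u\<close>, chosen Borel: a quasi-continuous function
  coincides with a Borel one outside a Borel set of capacity zero, and two quasi-continuous
  \<open>m\<close>-versions agree outside a set of capacity zero, so integrals with respect to measures
  charging no set of capacity zero do not depend on the choice.\<close>

definition qc_version ::
  "'a::topological_space measure \<Rightarrow> ('a \<Rightarrow> real) set
     \<Rightarrow> (('a \<Rightarrow> real) \<Rightarrow> ('a \<Rightarrow> real) \<Rightarrow> real) \<Rightarrow> ('a \<Rightarrow> real) \<Rightarrow> ('a \<Rightarrow> real)" where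
  "qc_version m D \<E> u =
     (SOME w. w \<in> borel_measurable borel \<and> quasi_continuous m D \<E> w \<and> (AE x in m. w x = u x))"

subsection \<open>Finite signed Borel measures\<close>

text \<open>A signed measure is a real set function; only its values on Borel sets matter.\<close>

definition finite_signed_measure :: "('a::topological_space set \<Rightarrow> real) \<Rightarrow> bool" where
  "finite_signed_measure \<mu> \<longleftrightarrow>
     \<mu> {} = 0 \<and>
     (\<forall>A :: nat \<Rightarrow> 'a set. range A \<subseteq> sets borel \<and> disjoint_family A \<longrightarrow>
        (\<lambda>i. \<mu> (A i)) sums \<mu> (\<Union>i. A i))"

text \<open>Jordan decomposition: \<open>\<mu>\<^sup>+(A) = sup {\<mu>(B) | B \<subseteq> A Borel}\<close> and
  \<open>\<mu>\<^sup>- = (-\<mu>)\<^sup>+\<close>.\<close>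

definition jordan_pos :: "('a::topological_space set \<Rightarrow> real) \<Rightarrow> 'a measure" where
  "jordan_pos \<mu> =
     measure_of UNIV (sets borel) (\<lambda>A. SUP B \<in> {B \<in> sets borel. B \<subseteq> A}. ennreal (\<mu> B))"

definition jordan_neg :: "('a::topological_space set \<Rightarrow> real) \<Rightarrow> 'a measure" where
  "jordan_neg \<mu> = jordan_pos (\<lambda>A. - \<mu> A)"

definition variation :: "('a::topological_space set \<Rightarrow> real) \<Rightarrow> 'a set \<Rightarrow> real" where
  "variation \<mu> A = measure (jordan_pos \<mu>) A + measure (jordan_neg \<mu>) A"

definition tv_norm :: "('a::topological_space set \<Rightarrow> real) \<Rightarrow> real" where
  "tv_norm \<mu> = variation \<mu> UNIV"

definition signed_integral ::
  "('a::topological_space set \<Rightarrow> real) \<Rightarrow> ('a \<Rightarrow> real) \<Rightarrow> real" where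
  "signed_integral \<mu> h = (\<integral>x. h x \<partial>jordan_pos \<mu>) - (\<integral>x. h x \<partial>jordan_neg \<mu>)"

definition diffuse_measure ::
  "'a::topological_space measure \<Rightarrow> ('a \<Rightarrow> real) set
     \<Rightarrow> (('a \<Rightarrow> real) \<Rightarrow> ('a \<Rightarrow> real) \<Rightarrow> real) \<Rightarrow> ('a set \<Rightarrow> real) \<Rightarrow> bool" where
  "diffuse_measure m D \<E> \<mu> \<longleftrightarrow>
     finite_signed_measure \<mu> \<and>
     (\<forall>A\<in>sets borel. cap0 m D \<E> A = 0 \<longrightarrow> variation \<mu> A = 0)"

subsection \<open>Resolvent and potentials\<close>

text \<open>The resolvent on \<open>L\<^sup>2(E;m)\<close>: \<open>G\<^sub>\<alpha> h\<close> is the \<open>m\<close>-a.e. unique element of the domain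
  with \<open>\<E>(G\<^sub>\<alpha> h, v) + \<alpha> (G\<^sub>\<alpha> h, v) = (h, v)\<close> for all \<open>v\<close> in the domain.\<close>

definition resolvent ::
  "'a measure \<Rightarrow> ('a \<Rightarrow> real) set \<Rightarrow> (('a \<Rightarrow> real) \<Rightarrow> ('a \<Rightarrow> real) \<Rightarrow> real)
     \<Rightarrow> real \<Rightarrow> ('a \<Rightarrow> real) \<Rightarrow> ('a \<Rightarrow> real)" where
  "resolvent m D \<E> \<alpha> h =
     (SOME u. u \<in> D \<and> (\<forall>v\<in>D. \<E> u v + \<alpha> * inner_L2 m u v = inner_L2 m h v))"

text \<open>The extension of \<open>G\<^sub>\<alpha>\<close> to nonnegative Borel \<open>\<eta>\<close> along a sequence of nonnegative
  functions in \<open>L\<^sup>2(E;m)\<close> increasing to \<open>\<eta>\<close>; up to \<open>m\<close>-null sets the result does not depend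
  on the sequence.\<close>

definition resolvent_nonneg ::
  "'a measure \<Rightarrow> ('a \<Rightarrow> real) set \<Rightarrow> (('a \<Rightarrow> real) \<Rightarrow> ('a \<Rightarrow> real) \<Rightarrow> real)
     \<Rightarrow> real \<Rightarrow> ('a \<Rightarrow> real) \<Rightarrow> ('a \<Rightarrow> ennreal)" where
  "resolvent_nonneg m D \<E> \<alpha> \<eta> =
     (let h = (SOME h :: nat \<Rightarrow> 'a \<Rightarrow> real.
                 (\<forall>n. h n \<in> L2 m) \<and> (\<forall>n x. 0 \<le> h n x) \<and>
                 (\<forall>x. incseq (\<lambda>n. h n x)) \<and> (\<forall>x. (\<lambda>n. h n x) \<longlonglongrightarrow> \<eta> x))
      in (\<lambda>x. SUP n. ennreal (resolvent m D \<E> \<alpha> (h n) x)))"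

text \<open>\<open>G\<^sub>\<alpha> \<eta>\<close> is only determined \<open>m\<close>-a.e., so the supremum over \<open>\<alpha> > 0\<close> is taken
  along the sequence \<open>\<alpha> = 1/(n+1)\<close>; as \<open>G\<^sub>\<alpha> \<eta>\<close> increases \<open>m\<close>-a.e. when \<open>\<alpha>\<close> decreases, this
  is the (essential) supremum over all \<open>\<alpha> > 0\<close>.\<close>

definition potential_nonneg ::
  "'a measure \<Rightarrow> ('a \<Rightarrow> real) set \<Rightarrow> (('a \<Rightarrow> real) \<Rightarrow> ('a \<Rightarrow> real) \<Rightarrow> real)
     \<Rightarrow> ('a \<Rightarrow> real) \<Rightarrow> ('a \<Rightarrow> ennreal)" where
  "potential_nonneg m D \<E> \<eta> x = (SUP n::nat. resolvent_nonneg m D \<E> (1 / real (Suc n)) \<eta> x)"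

definition potential ::
  "'a measure \<Rightarrow> ('a \<Rightarrow> real) set \<Rightarrow> (('a \<Rightarrow> real) \<Rightarrow> ('a \<Rightarrow> real) \<Rightarrow> real)
     \<Rightarrow> ('a \<Rightarrow> real) \<Rightarrow> ('a \<Rightarrow> real)" where
  "potential m D \<E> \<eta> x =
     enn2real (potential_nonneg m D \<E> (\<lambda>y. max (\<eta> y) 0) x) -
     enn2real (potential_nonneg m D \<E> (\<lambda>y. max (- \<eta> y) 0) x)"

subsection \<open>Solutions of \<open>-Lu = f(\<cdot>,u) + \<mu>\<close>\<close>

definition caratheodory :: "('a::topological_space \<Rightarrow> real \<Rightarrow> real) \<Rightarrow> bool" where
  "caratheodory f \<longleftrightarrow>
     (\<forall>y. (\<lambda>x. f x y) \<in> borel_measurable borel) \<and> (\<forall>x. continuous_on UNIV (f x))"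

text \<open>The operator \<open>L\<close> enters only through its potential operator \<open>G = (-L)\<inverse>\<close>.  Since the
  Bochner integral of a non-integrable function is \<open>0\<close> by convention, integrability of
  \<open>u \<eta>\<close> is made explicit; the integrands on the right-hand side are products of an integrable
  and a bounded function, respectively bounded outside a set of capacity zero.\<close>

definition duality_solution ::
  "'a::topological_space measure \<Rightarrow> ('a \<Rightarrow> real) set
     \<Rightarrow> (('a \<Rightarrow> real) \<Rightarrow> ('a \<Rightarrow> real) \<Rightarrow> real)
     \<Rightarrow> ('a \<Rightarrow> real \<Rightarrow> real) \<Rightarrow> ('a set \<Rightarrow> real) \<Rightarrow> ('a \<Rightarrow> real) \<Rightarrow> bool" where
  "duality_solution m D \<E> f \<mu> u \<longleftrightarrow>
     u \<in> borel_measurable m \<and>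
     integrable m (\<lambda>x. f x (u x)) \<and>
     (\<forall>\<eta>. integrable m \<eta> \<and>
          (\<exists>C::real. AE x in m. potential_nonneg m D \<E> (\<lambda>y. \<bar>\<eta> y\<bar>) x \<le> ennreal C) \<longrightarrow>
        integrable m (\<lambda>x. u x * \<eta> x) \<and>
        (\<integral>x. u x * \<eta> x \<partial>m) =
          (\<integral>x. f x (u x) * potential m D \<E> \<eta> x \<partial>m) +
          signed_integral \<mu> (qc_version m D \<E> (potential m D \<E> \<eta>)))"

definition trunc :: "real \<Rightarrow> ('a \<Rightarrow> real) \<Rightarrow> ('a \<Rightarrow> real)" where
  "trunc k u x = min (max (- k) (u x)) k"

end

theory Submission
  imports Defs "HOL-Library.Diagonal_Subsequence"
begin

text \<open>
  A diffuse measure \<open>\<mu>\<close> enters the problem only through the functional \<open>v \<mapsto> \<integral> v~ d\<mu>\<close> on the bounded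
  elements of the extended Dirichlet space, where \<open>v~\<close> is the quasi-continuous version of \<open>v\<close>. This
  functional is bounded for the supremum norm and continuous along uniformly bounded
  \<open>\<E>\<close>-convergent sequences, so no approximation of \<open>\<mu>\<close> by measures of finite energy is needed:
  the functional \<open>\<E>(v,v)/2 - \<integral> H(x,v) dm - \<integral> v~ d\<mu>\<close>, with \<open>H\<close> a primitive of \<open>f\<close> in its second
  variable, has a minimizer \<open>u\<^sub>j\<close> among the \<open>v\<close> with \<open>\<bar>v\<bar> \<le> j\<close>. Lower semicontinuity comes from the
  compactness assumption and Mazur's lemma.

  Testing the variational inequality for \<open>u\<^sub>j\<close> with truncations of \<open>u\<^sub>j\<close> bounds the energy of
  \<open>T\<^sub>k u\<^sub>j\<close> by \<open>k \<parallel>\<mu>\<parallel>\<close> and the integral of \<open>\<bar>f(x,u\<^sub>j)\<bar>\<close> over \<open>{\<bar>u\<^sub>j\<bar> \<ge> k + 1}\<close> by the value of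
  the functional for \<open>\<bar>\<mu>\<bar>\<close> at \<open>(\<bar>u\<^sub>j\<bar> \<and> k)/k\<close>, a function of energy at most \<open>\<parallel>\<mu>\<parallel>/k\<close>. Hence the \<open>f(x,u\<^sub>j)\<close>
  are equi-integrable. The \<open>u\<^sub>j\<close> are dominated by the increasing solutions of the linear obstacle
  problems (\<open>f = 0\<close>) for \<open>\<mu>\<^sup>+\<close> and \<open>\<mu>\<^sup>-\<close>, whose limits are finite and integrable against \<open>\<bar>\<eta>\<bar>\<close>.
  Testing with \<open>T\<^sub>j (u\<^sub>j \<plusminus> G\<eta>)\<close> and letting \<open>j\<close> tend to infinity gives the duality identity.
\<close>

section \<open>Quadratic forms on spaces of functions\<close>

text \<open>The obstacle is forced by the functional: a diffuse \<open>\<mu>\<close> need not be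
  bounded in energy, so without \<open>\<bar>v\<bar> \<le> j\<close> the functional need not be
  bounded below. The price is a variational inequality instead of an equation. It does no harm in
  the limit: for \<open>z = u + h\<close> the remainder of the truncation of \<open>z\<close> at
  level \<open>j\<close> pairs nonnegatively with \<open>z\<close> in the form, and it lives only
  where \<open>\<bar>u\<bar>\<close> is close to \<open>j\<close>. Since \<open>f\<close> is not
  assumed monotone in its second variable, the functional need not be convex and minimizing
  sequences need not be Cauchy. The two terms therefore need different convergences:
  \<open>f\<close> needs convergence a.e., supplied by compactness, and \<open>\<mu>\<close> needs
  convergence in energy, supplied by convex combinations. The Markov property acts through one
  device: if \<open>v\<close> is the contraction of \<open>v + t w\<close> for all small
  \<open>t > 0\<close>, then the energy along this ray is minimal at \<open>t = 0\<close>, and the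
  lemma below gives a sign for the form at \<open>(v, w)\<close>. All truncation inequalities come
  from this. Continuity of the functional of \<open>\<mu>\<close> is a Borel-Cantelli argument for
  capacities.\<close>

lemma quadratic_nonneg_imp_linear_nonneg:
  fixes b c :: real
  assumes "\<And>t. t > 0 \<Longrightarrow> 0 \<le> 2 * t * b + t\<^sup>2 * c"
  shows "0 \<le> b"
proof (rule ccontr)
  assume "\<not> 0 \<le> b"
  then have b: "b < 0" by simp
  \<comment> \<open>This \<open>t\<close> makes \<open>t * \<bar>c\<bar>\<close> smaller than
    \<open>- b\<close>, so the quadratic term cannot compensate even half of the linear one.\<close>
  define t where "t = - b / (\<bar>c\<bar> + 1)"
  have t: "t > 0" unfolding t_def using b by (simp add: field_simps)
  have "t * c \<le> t * \<bar>c\<bar>" using t by (simp add: mult_left_mono)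
  also have "\<dots> < - b" unfolding t_def using b by (simp add: field_simps)
  finally have "2 * b + t * c < 0" using b by simp
  then have "t * (2 * b + t * c) < 0" using t by (simp add: mult_pos_neg)
  moreover have "t * (2 * b + t * c) = 2 * t * b + t\<^sup>2 * c"
    by (simp add: power2_eq_square algebra_simps)
  ultimately show False using assms[OF t] by simp
qed

text \<open>Kept abstract because it is instantiated with L2, with \<open>D\<close> under
  \<open>\<E>\<close> and under each \<open>Ea \<alpha>\<close>, and with the extended Dirichlet
  space. Elements are functions, so \<open>AE_mem\<close> and \<open>AE_form\<close> take the place
  of passing to classes, and the form is allowed to be degenerate.\<close>

locale form_space =
  fixes m :: "'a measure" and V :: "('a \<Rightarrow> real) set"
    and B :: "('a \<Rightarrow> real) \<Rightarrow> ('a \<Rightarrow> real) \<Rightarrow> real"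
  assumes measurable: "u \<in> V \<Longrightarrow> u \<in> borel_measurable m"
    and zero_mem [simp]: "(\<lambda>x. 0) \<in> V"
    and add_mem [simp]: "u \<in> V \<Longrightarrow> v \<in> V \<Longrightarrow> (\<lambda>x. u x + v x) \<in> V"
    and scale_mem [simp]: "u \<in> V \<Longrightarrow> (\<lambda>x. c * u x) \<in> V"
    and AE_mem: "u \<in> V \<Longrightarrow> v \<in> borel_measurable m \<Longrightarrow> AE x in m. u x = v x \<Longrightarrow> v \<in> V"
    and AE_form: "u \<in> V \<Longrightarrow> v \<in> V \<Longrightarrow> w \<in> V \<Longrightarrow> AE x in m. u x = v x \<Longrightarrow> B u w = B v w"
    and form_sym: "u \<in> V \<Longrightarrow> v \<in> V \<Longrightarrow> B u v = B v u"
    and form_add_left: "u \<in> V \<Longrightarrow> v \<in> V \<Longrightarrow> w \<in> V \<Longrightarrow> B (\<lambda>x. u x + v x) w = B u w + B v w"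
    and form_scale_left: "u \<in> V \<Longrightarrow> w \<in> V \<Longrightarrow> B (\<lambda>x. c * u x) w = c * B u w"
    and form_nonneg [simp]: "u \<in> V \<Longrightarrow> 0 \<le> B u u"
begin

lemma uminus_mem [simp]: "u \<in> V \<Longrightarrow> (\<lambda>x. - u x) \<in> V"
  using scale_mem[of u "-1"] by simp

lemma diff_mem [simp]: "u \<in> V \<Longrightarrow> v \<in> V \<Longrightarrow> (\<lambda>x. u x - v x) \<in> V"
  using add_mem[of u "\<lambda>x. - v x"] by simp

lemma form_add_right: "u \<in> V \<Longrightarrow> v \<in> V \<Longrightarrow> w \<in> V \<Longrightarrow> B w (\<lambda>x. u x + v x) = B w u + B w v"
  by (simp add: form_sym[of w] form_add_left)

lemma form_scale_right: "u \<in> V \<Longrightarrow> w \<in> V \<Longrightarrow> B w (\<lambda>x. c * u x) = c * B w u"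
  by (simp add: form_sym[of w] form_scale_left)

lemma form_uminus_left: "u \<in> V \<Longrightarrow> w \<in> V \<Longrightarrow> B (\<lambda>x. - u x) w = - B u w"
  using form_scale_left[of u w "-1"] by simp

lemma form_uminus_right: "u \<in> V \<Longrightarrow> w \<in> V \<Longrightarrow> B w (\<lambda>x. - u x) = - B w u"
  using form_scale_right[of u w "-1"] by simp

lemma form_diff_left: "u \<in> V \<Longrightarrow> v \<in> V \<Longrightarrow> w \<in> V \<Longrightarrow> B (\<lambda>x. u x - v x) w = B u w - B v w"
  using form_add_left[of u "\<lambda>x. - v x" w] by (simp add: form_uminus_left)

lemma form_diff_right: "u \<in> V \<Longrightarrow> v \<in> V \<Longrightarrow> w \<in> V \<Longrightarrow> B w (\<lambda>x. u x - v x) = B w u - B w v"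
  by (simp add: form_sym[of w] form_diff_left)

lemma form_zero_left: "w \<in> V \<Longrightarrow> B (\<lambda>x. 0) w = 0"
  using form_scale_left[of "\<lambda>x. 0" w 0] by simp

lemma form_zero_right: "w \<in> V \<Longrightarrow> B w (\<lambda>x. 0) = 0"
  by (simp add: form_sym[of w] form_zero_left)

lemmas form_linear =
  form_add_left form_add_right form_scale_left form_scale_right form_uminus_left form_uminus_right
  form_diff_left form_diff_right form_zero_left form_zero_right

lemma form_add_scale_sq:
  assumes "u \<in> V" "v \<in> V"
  shows "B (\<lambda>x. u x + t * v x) (\<lambda>x. u x + t * v x) = B u u + 2 * t * B u v + t\<^sup>2 * B v v"
  using assms form_sym[of u v] by (simp add: form_linear power2_eq_square algebra_simps)

lemma form_diff_sq:
  assumes "u \<in> V" "v \<in> V"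
  shows "B (\<lambda>x. u x - v x) (\<lambda>x. u x - v x) = B u u - 2 * B u v + B v v"
  using assms form_sym[of u v] by (simp add: form_linear)

lemma form_diff_commute:
  assumes "u \<in> V" "v \<in> V"
  shows "B (\<lambda>x. u x - v x) (\<lambda>x. u x - v x) = B (\<lambda>x. v x - u x) (\<lambda>x. v x - u x)"
  using assms form_sym[of u v] by (simp add: form_linear)

definition nrm :: "('a \<Rightarrow> real) \<Rightarrow> real" where "nrm u = sqrt (B u u)"

lemma nrm_nonneg [simp]: "u \<in> V \<Longrightarrow> 0 \<le> nrm u"
  by (simp add: nrm_def)

lemma nrm_sq: "u \<in> V \<Longrightarrow> (nrm u)\<^sup>2 = B u u"
  by (simp add: nrm_def)

lemma Cauchy_Schwarz:
  assumes [simp]: "u \<in> V" "v \<in> V"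
  shows "\<bar>B u v\<bar> \<le> nrm u * nrm v"
proof -
  have "(B u v)\<^sup>2 \<le> B u u * B v v"
  proof (cases "B v v = 0")
    \<comment> \<open>The form may be degenerate, so \<open>B v v = 0\<close> says nothing about
      \<open>v\<close> itself. That \<open>B u v\<close> vanishes is the first-order condition in
      the directions \<open>u\<close> seen from \<open>v\<close> and from
      \<open>- v\<close>.\<close>
    case True
    have "0 \<le> 2 * t * (s * B u v) + t\<^sup>2 * B u u" if "t > 0" "s = 1 \<or> s = -1" for t s :: real
    proof -
      have "0 \<le> B (\<lambda>x. s * v x + t * u x) (\<lambda>x. s * v x + t * u x)" by simp
      also have "\<dots> = s\<^sup>2 * B v v + 2 * t * (s * B u v) + t\<^sup>2 * B u u"
        by (subst form_add_scale_sq) (simp_all add: form_linear form_sym[of v u] power2_eq_square)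
      finally show ?thesis using True by simp
    qed
    from quadratic_nonneg_imp_linear_nonneg[OF this]
    have "0 \<le> 1 * B u v" "0 \<le> -1 * B u v" by blast+
    then show ?thesis using True by simp
  next
    case False
    then have pos: "B v v > 0" using form_nonneg[of v] by (simp add: less_le)
    define t where "t = - B u v / B v v"
    have "0 \<le> B (\<lambda>x. u x + t * v x) (\<lambda>x. u x + t * v x)" by simp
    also have "\<dots> = B u u - (B u v)\<^sup>2 / B v v"
      unfolding form_add_scale_sq[OF assms] t_def using pos
      by (simp add: power2_eq_square field_simps)
    finally show ?thesis using pos by (simp add: field_simps)
  qed
  then have "sqrt ((B u v)\<^sup>2) \<le> sqrt (B u u * B v v)" by (rule real_sqrt_le_mono)
  then show ?thesis by (simp add: nrm_def real_sqrt_mult)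
qed

lemma nrm_triangle:
  assumes [simp]: "u \<in> V" "v \<in> V"
  shows "nrm (\<lambda>x. u x + v x) \<le> nrm u + nrm v"
proof (rule power2_le_imp_le)
  have "(nrm (\<lambda>x. u x + v x))\<^sup>2 = B u u + 2 * B u v + B v v"
    using form_add_scale_sq[of u v 1] by (simp add: nrm_sq)
  also have "\<dots> \<le> (nrm u)\<^sup>2 + 2 * (nrm u * nrm v) + (nrm v)\<^sup>2"
    using Cauchy_Schwarz[of u v] by (simp add: nrm_sq)
  finally show "(nrm (\<lambda>x. u x + v x))\<^sup>2 \<le> (nrm u + nrm v)\<^sup>2" by (simp add: power2_sum)
qed simp

lemma nrm_scale: "u \<in> V \<Longrightarrow> nrm (\<lambda>x. c * u x) = \<bar>c\<bar> * nrm u"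
  by (simp add: nrm_def form_linear real_sqrt_mult flip: mult.assoc)

lemma nrm_diff_commute: "u \<in> V \<Longrightarrow> v \<in> V \<Longrightarrow> nrm (\<lambda>x. u x - v x) = nrm (\<lambda>x. v x - u x)"
  unfolding nrm_def using form_diff_commute by simp

lemma nrm_zero [simp]: "nrm (\<lambda>x. 0) = 0"
  by (simp add: nrm_def form_linear)

lemma nrm_triangle_diff:
  assumes "u \<in> V" "v \<in> V" "w \<in> V"
  shows "nrm (\<lambda>x. u x - w x) \<le> nrm (\<lambda>x. u x - v x) + nrm (\<lambda>x. v x - w x)"
  using nrm_triangle[of "\<lambda>x. u x - v x" "\<lambda>x. v x - w x"] assms by simp

lemma nrm_diff_abs:
  assumes "u \<in> V" "v \<in> V"
  shows "\<bar>nrm u - nrm v\<bar> \<le> nrm (\<lambda>x. u x - v x)"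
  using nrm_triangle[of "\<lambda>x. u x - v x" v] nrm_triangle[of "\<lambda>x. v x - u x" u] assms
    nrm_diff_commute[OF assms] by simp

lemma nrm_sum:
  "finite I \<Longrightarrow> (\<And>i. i \<in> I \<Longrightarrow> u i \<in> V) \<Longrightarrow>
    (\<lambda>x. \<Sum>i\<in>I. u i x) \<in> V \<and> nrm (\<lambda>x. \<Sum>i\<in>I. u i x) \<le> (\<Sum>i\<in>I. nrm (u i))"
proof (induction I rule: finite_induct)
  case (insert a I)
  then show ?case
    using nrm_triangle[of "u a" "\<lambda>x. \<Sum>i\<in>I. u i x"] by auto
qed simp

definition form_Cauchy :: "(nat \<Rightarrow> 'a \<Rightarrow> real) \<Rightarrow> bool" where
  "form_Cauchy u \<longleftrightarrow>
     (\<forall>\<epsilon>>0. \<exists>N. \<forall>i\<ge>N. \<forall>j\<ge>N. B (\<lambda>x. u i x - u j x) (\<lambda>x. u i x - u j x) < \<epsilon>)"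

lemma form_CauchyI:
  assumes u: "\<And>n. u n \<in> V"
    and b: "b \<longlonglongrightarrow> 0" "\<And>i j. i \<le> j \<Longrightarrow> B (\<lambda>x. u i x - u j x) (\<lambda>x. u i x - u j x) \<le> b i"
  shows "form_Cauchy u"
  unfolding form_Cauchy_def
proof (intro allI impI)
  fix \<epsilon> :: real assume "\<epsilon> > 0"
  then obtain N where N: "\<And>n. n \<ge> N \<Longrightarrow> \<bar>b n\<bar> < \<epsilon>"
    using b(1) by (auto simp: LIMSEQ_iff)
  show "\<exists>N. \<forall>i\<ge>N. \<forall>j\<ge>N. B (\<lambda>x. u i x - u j x) (\<lambda>x. u i x - u j x) < \<epsilon>"
  proof (intro exI allI impI)
    fix i j assume ij: "i \<ge> N" "j \<ge> N"
    show "B (\<lambda>x. u i x - u j x) (\<lambda>x. u i x - u j x) < \<epsilon>"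
      using b(2)[of i j] b(2)[of j i] N[of i] N[of j] ij form_diff_commute[OF u u, of i j]
      by (cases "i \<le> j") force+
  qed
qed

lemma form_Cauchy_bounded:
  assumes u: "\<And>n. u n \<in> V" and c: "form_Cauchy u"
  obtains K where "\<And>n. nrm (u n) \<le> K"
proof -
  obtain N where N: "\<And>i j. i \<ge> N \<Longrightarrow> j \<ge> N \<Longrightarrow> B (\<lambda>x. u i x - u j x) (\<lambda>x. u i x - u j x) < 1"
    using c unfolding form_Cauchy_def by (meson zero_less_one)
  define K where "K = Max ((\<lambda>n. nrm (u n)) ` {..N}) + 1"
  have le: "nrm (u n) \<le> K - 1" if "n \<le> N" for n
    unfolding K_def using that by auto
  have "nrm (u n) \<le> K" for n
  proof (cases "n \<le> N")
    case True
    then show ?thesis using le[of n] by simp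
  next
    case False
    have "nrm (\<lambda>x. u n x - u N x) < 1"
      unfolding nrm_def using N[of n N] False by simp
    then show ?thesis using nrm_diff_abs[of "u n" "u N"] u le[of N] by simp
  qed
  then show ?thesis using that by blast
qed

lemma nrm_tendsto_iff:
  assumes "\<And>n. u n \<in> V"
  shows "(\<lambda>n. nrm (u n)) \<longlonglongrightarrow> 0 \<longleftrightarrow> (\<lambda>n. B (u n) (u n)) \<longlonglongrightarrow> 0"
proof
  assume "(\<lambda>n. nrm (u n)) \<longlonglongrightarrow> 0"
  from tendsto_power[OF this, of 2] show "(\<lambda>n. B (u n) (u n)) \<longlonglongrightarrow> 0"
    using assms by (simp add: nrm_sq)
next
  assume "(\<lambda>n. B (u n) (u n)) \<longlonglongrightarrow> 0"
  from tendsto_real_sqrt[OF this] show "(\<lambda>n. nrm (u n)) \<longlonglongrightarrow> 0"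
    by (simp add: nrm_def)
qed

lemma form_tendsto:
  assumes u: "\<And>n. u n \<in> V" "u0 \<in> V" "(\<lambda>n. nrm (\<lambda>x. u n x - u0 x)) \<longlonglongrightarrow> 0"
    and v: "\<And>n. v n \<in> V" "v0 \<in> V" "(\<lambda>n. nrm (\<lambda>x. v n x - v0 x)) \<longlonglongrightarrow> 0"
  shows "(\<lambda>n. B (u n) (v n)) \<longlonglongrightarrow> B u0 v0"
proof -
  have "(\<lambda>n. (nrm (\<lambda>x. u n x - u0 x) + nrm u0) * nrm (\<lambda>x. v n x - v0 x)
      + nrm (\<lambda>x. u n x - u0 x) * nrm v0) \<longlonglongrightarrow> (0 + nrm u0) * 0 + 0 * nrm v0"
    by (intro tendsto_intros u v)
  then have lim0: "(\<lambda>n. (nrm (\<lambda>x. u n x - u0 x) + nrm u0) * nrm (\<lambda>x. v n x - v0 x)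
      + nrm (\<lambda>x. u n x - u0 x) * nrm v0) \<longlonglongrightarrow> 0" by simp
  have le: "norm (B (u n) (v n) - B u0 v0)
      \<le> (nrm (\<lambda>x. u n x - u0 x) + nrm u0) * nrm (\<lambda>x. v n x - v0 x)
        + nrm (\<lambda>x. u n x - u0 x) * nrm v0" for n
  proof -
    have "B (u n) (v n) - B u0 v0 = B (u n) (\<lambda>x. v n x - v0 x) + B (\<lambda>x. u n x - u0 x) v0"
      using u v by (simp add: form_linear)
    then have "\<bar>B (u n) (v n) - B u0 v0\<bar>
        \<le> nrm (u n) * nrm (\<lambda>x. v n x - v0 x) + nrm (\<lambda>x. u n x - u0 x) * nrm v0"
      using Cauchy_Schwarz[of "u n" "\<lambda>x. v n x - v0 x"] Cauchy_Schwarz[of "\<lambda>x. u n x - u0 x" v0] u v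
      by auto
    also have "\<dots> \<le> (nrm (\<lambda>x. u n x - u0 x) + nrm u0) * nrm (\<lambda>x. v n x - v0 x)
        + nrm (\<lambda>x. u n x - u0 x) * nrm v0"
      using nrm_diff_abs[of "u n" u0] u v by (intro add_mono mult_right_mono) auto
    finally show ?thesis by simp
  qed
  show ?thesis
    by (rule LIM_zero_cancel, rule Lim_null_comparison[OF always_eventually[OF allI[OF le]] lim0])
qed

text \<open>By the parallelogram law, minimizing sequences of a quadratic functional over a
  midpoint-convex set are Cauchy.\<close>

lemma parallelogram:
  assumes [simp]: "u \<in> V" "v \<in> V"
  shows "B (\<lambda>x. u x - v x) (\<lambda>x. u x - v x)
    = 2 * B u u + 2 * B v v - 4 * B (\<lambda>x. (1/2) * u x + (1/2) * v x) (\<lambda>x. (1/2) * u x + (1/2) * v x)"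
proof -
  have "B (\<lambda>x. c * u x + c * v x) (\<lambda>x. c * u x + c * v x) = c\<^sup>2 * (B u u + 2 * B u v + B v v)" for c
    using form_sym[of u v] by (simp add: form_linear power2_eq_square algebra_simps)
  from this[of "1/2"] show ?thesis
    by (simp add: form_diff_sq power2_eq_square)
qed

lemma minimizing_sequence:
  assumes C: "C \<subseteq> V" "C \<noteq> {}" "\<And>u v. u \<in> C \<Longrightarrow> v \<in> C \<Longrightarrow> (\<lambda>x. (1/2) * u x + (1/2) * v x) \<in> C"
    and L: "\<And>u v. u \<in> C \<Longrightarrow> v \<in> C \<Longrightarrow> L (\<lambda>x. (1/2) * u x + (1/2) * v x) = (1/2) * L u + (1/2) * (L v :: real)"
    and bdd: "\<And>u. u \<in> C \<Longrightarrow> K \<le> B u u - 2 * L u"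
  obtains d u where "\<And>n. u n \<in> C" "\<And>v. v \<in> C \<Longrightarrow> d \<le> B v v - 2 * L v"
    "\<And>n. B (u n) (u n) - 2 * L (u n) \<le> d + 1 / real (Suc n)" "form_Cauchy u"
proof -
  define J where "J u = B u u - 2 * L u" for u
  define d where "d = (INF u\<in>C. J u)"
  have bd: "bdd_below (J ` C)" using bdd by (auto simp: J_def intro!: bdd_belowI[of _ K])
  have d: "d \<le> J v" if "v \<in> C" for v unfolding d_def by (rule cINF_lower[OF bd that])
  have "\<exists>u\<in>C. J u \<le> d + 1 / real (Suc n)" for n
  proof -
    have "d < d + 1 / real (Suc n)" by simp
    then obtain u where "u \<in> C" "J u < d + 1 / real (Suc n)"
      unfolding d_def using cINF_less_iff[OF C(2) bd] by blast
    then show ?thesis by (auto intro: less_imp_le)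
  qed
  then obtain u where u: "\<And>n. u n \<in> C" "\<And>n. J (u n) \<le> d + 1 / real (Suc n)" by metis
  have uV: "u n \<in> V" for n using u C by auto
  have "form_Cauchy u"
  proof (rule form_CauchyI[OF uV])
    show "(\<lambda>i. 4 * (1 / real (Suc i))) \<longlonglongrightarrow> 0"
      using tendsto_mult_right_zero[OF LIMSEQ_inverse_real_of_nat, of 4] by (simp add: inverse_eq_divide)
    fix i j :: nat assume "i \<le> j"
    \<comment> \<open>\<open>L\<close> respects midpoints, so its contributions cancel and the
      parallelogram law holds for \<open>J\<close> in place of the quadratic form. The midpoint is
      in \<open>C\<close>, where \<open>J\<close> is at least \<open>d\<close>.\<close>
    have "B (\<lambda>x. u i x - u j x) (\<lambda>x. u i x - u j x)
        = 2 * J (u i) + 2 * J (u j) - 4 * J (\<lambda>x. (1/2) * u i x + (1/2) * u j x)"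
      unfolding parallelogram[OF uV uV] J_def L[OF u(1) u(1)] by simp
    also have "\<dots> \<le> 2 * (1 / real (Suc i)) + 2 * (1 / real (Suc j))"
      using u(2)[of i] u(2)[of j] d[OF C(3)[OF u(1) u(1), of i j]] by linarith
    also have "\<dots> \<le> 4 * (1 / real (Suc i))"
      using \<open>i \<le> j\<close> frac_le[of 1 1 "real (Suc i)" "real (Suc j)"] by simp
    finally show "B (\<lambda>x. u i x - u j x) (\<lambda>x. u i x - u j x) \<le> 4 * (1 / real (Suc i))" .
  qed
  then show ?thesis using that u d unfolding J_def by blast
qed

end

section \<open>Complete forms: Riesz representation and orthogonal projection\<close>

locale complete_form_space = form_space +
  assumes complete: "(\<And>n. u n \<in> V) \<Longrightarrow> form_Cauchy u \<Longrightarrow>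
    \<exists>v\<in>V. (\<lambda>n. B (\<lambda>x. u n x - v x) (\<lambda>x. u n x - v x)) \<longlonglongrightarrow> 0"
begin

text \<open>The solution is the minimizer of \<open>B u u - 2 * L u\<close>, which is bounded below
  by \<open>- K\<^sup>2\<close> after completing the square. The first-order condition in the
  directions \<open>v\<close> and \<open>- v\<close> is the asserted equation. Uniqueness would fail
  for a degenerate form and is not claimed.\<close>

lemma Riesz:
  assumes L_add: "\<And>u v. u \<in> V \<Longrightarrow> v \<in> V \<Longrightarrow> L (\<lambda>x. u x + v x) = L u + L v"
    and L_scale: "\<And>c u. u \<in> V \<Longrightarrow> L (\<lambda>x. c * u x) = c * (L u :: real)"
    and L_bdd: "\<And>u. u \<in> V \<Longrightarrow> \<bar>L u\<bar> \<le> K * nrm u"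
  shows "\<exists>u\<in>V. \<forall>v\<in>V. B u v = L v"
proof -
  have lower: "- K\<^sup>2 \<le> B u u - 2 * L u" if "u \<in> V" for u
  proof -
    have "0 \<le> (nrm u - K)\<^sup>2" by simp
    then have "- K\<^sup>2 \<le> (nrm u)\<^sup>2 - 2 * (K * nrm u)" by (simp add: power2_diff algebra_simps)
    then show ?thesis using L_bdd[OF that] nrm_sq[OF that] by linarith
  qed
  have ne: "V \<noteq> {}" using zero_mem by blast
  have Lmid: "L (\<lambda>x. (1/2) * u x + (1/2) * v x) = (1/2) * L u + (1/2) * L v"
    if "u \<in> V" "v \<in> V" for u v
    using L_add[OF scale_mem[OF that(1), of "1/2"] scale_mem[OF that(2), of "1/2"]]
      L_scale[OF that(1), of "1/2"] L_scale[OF that(2), of "1/2"] by simp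
  obtain d u where u: "\<And>n. u n \<in> V" "\<And>v. v \<in> V \<Longrightarrow> d \<le> B v v - 2 * L v"
    "\<And>n. B (u n) (u n) - 2 * L (u n) \<le> d + 1 / real (Suc n)" "form_Cauchy u"
    by (rule minimizing_sequence[OF subset_refl ne add_mem[OF scale_mem scale_mem] Lmid lower]) (assumption+, rule that, assumption+)
  obtain w where w: "w \<in> V" "(\<lambda>n. B (\<lambda>x. u n x - w x) (\<lambda>x. u n x - w x)) \<longlonglongrightarrow> 0"
    using complete[OF u(1,4)] by blast
  have nrm0: "(\<lambda>n. nrm (\<lambda>x. u n x - w x)) \<longlonglongrightarrow> 0"
    using w u by (subst nrm_tendsto_iff) auto
  have "(\<lambda>n. L (u n)) \<longlonglongrightarrow> L w"
  proof (rule LIM_zero_cancel, rule Lim_null_comparison)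
    show "\<forall>\<^sub>F n in sequentially. norm (L (u n) - L w) \<le> K * nrm (\<lambda>x. u n x - w x)"
    proof (rule always_eventually, intro allI)
      fix n
      have "L (u n) - L w = L (\<lambda>x. u n x - w x)"
        using L_add[of "u n" "\<lambda>x. -1 * w x"] L_scale[of w "-1"] u w by simp
      then show "norm (L (u n) - L w) \<le> K * nrm (\<lambda>x. u n x - w x)"
        using L_bdd[of "\<lambda>x. u n x - w x"] u w by simp
    qed
    show "(\<lambda>n. K * nrm (\<lambda>x. u n x - w x)) \<longlonglongrightarrow> 0"
      using tendsto_mult_right_zero[OF nrm0] by simp
  qed
  then have "(\<lambda>n. B (u n) (u n) - 2 * L (u n)) \<longlonglongrightarrow> B w w - 2 * L w"
    using form_tendsto[OF u(1) w(1) nrm0 u(1) w(1) nrm0] by (intro tendsto_intros)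
  moreover have "(\<lambda>n. d + 1 / real (Suc n)) \<longlonglongrightarrow> d + 0"
    using LIMSEQ_inverse_real_of_nat by (intro tendsto_intros) (simp add: inverse_eq_divide)
  ultimately have min: "B w w - 2 * L w \<le> d"
    using u(3) by (intro LIMSEQ_le[of _ "B w w - 2 * L w" "\<lambda>n. d + 1 / real (Suc n)" d]) auto
  have "B w v - L v \<ge> 0" if v: "v \<in> V" for v
  proof (rule quadratic_nonneg_imp_linear_nonneg)
    fix t :: real
    have "d \<le> B w w + 2 * t * B w v + t\<^sup>2 * B v v - 2 * (L w + t * L v)"
      using u(2)[of "\<lambda>x. w x + t * v x"] w v form_add_scale_sq[OF w(1) v] L_add L_scale by simp
    then show "0 \<le> 2 * t * (B w v - L v) + t\<^sup>2 * B v v"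
      using min by (simp add: algebra_simps)
  qed
  from this this[OF scale_mem[of _ "-1"]] have "B w v = L v" if "v \<in> V" for v
    using that L_scale[of v "-1"] w by (force simp: form_linear)
  then show ?thesis using w by blast
qed

text \<open>Projection onto a subspace that is not closed: the differences \<open>u - s\<close> of
  nearly minimal norm form a Cauchy sequence, whose limit \<open>p\<close> is orthogonal to
  \<open>S\<close>. If orthogonality forces \<open>B p p = 0\<close>, the distance from
  \<open>u\<close> to \<open>S\<close> is zero.\<close>

lemma dense_if_orthogonal_trivial:
  assumes S: "S \<subseteq> V" "(\<lambda>x. 0) \<in> S" "\<And>u v. u \<in> S \<Longrightarrow> v \<in> S \<Longrightarrow> (\<lambda>x. u x + v x) \<in> S"
    "\<And>c u. u \<in> S \<Longrightarrow> (\<lambda>x. c * u x) \<in> S"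
    and orth: "\<And>p. p \<in> V \<Longrightarrow> (\<And>s. s \<in> S \<Longrightarrow> B p s = 0) \<Longrightarrow> B p p = 0"
    and u: "u \<in> V" and \<epsilon>: "\<epsilon> > 0"
  shows "\<exists>s\<in>S. B (\<lambda>x. u x - s x) (\<lambda>x. u x - s x) < \<epsilon>"
proof -
  define C where "C = (\<lambda>s x. u x - s x) ` S"
  have CV: "C \<subseteq> V" using S u by (auto simp: C_def)
  have mid: "(\<lambda>x. (1/2) * a x + (1/2) * b x) \<in> C" if ab: "a \<in> C" "b \<in> C" for a b
  proof -
    obtain s where s: "s \<in> S" "a = (\<lambda>x. u x - s x)" using ab(1) unfolding C_def by blast
    obtain t where t: "t \<in> S" "b = (\<lambda>x. u x - t x)" using ab(2) unfolding C_def by blast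
    have eq: "(\<lambda>x. (1/2) * a x + (1/2) * b x) = (\<lambda>x. u x - ((1/2) * s x + (1/2) * t x))"
      unfolding s t by (rule ext) (simp add: field_simps)
    show ?thesis unfolding C_def
      by (rule image_eqI, rule eq, rule S(3)[OF S(4)[OF s(1)] S(4)[OF t(1)]])
  qed
  obtain d v where v: "\<And>n. v n \<in> C" "\<And>w. w \<in> C \<Longrightarrow> d \<le> B w w - 2 * 0"
    "\<And>n. B (v n) (v n) - 2 * 0 \<le> d + 1 / real (Suc n)" "form_Cauchy v"
    by (rule minimizing_sequence[where C = C and L = "\<lambda>_. 0" and K = 0])
      (use CV mid S(2) in \<open>auto simp: C_def\<close>)
  have vV: "v n \<in> V" for n using v CV by auto
  obtain p where p: "p \<in> V" "(\<lambda>n. B (\<lambda>x. v n x - p x) (\<lambda>x. v n x - p x)) \<longlonglongrightarrow> 0"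
    using complete[OF vV v(4)] by blast
  have nrm0: "(\<lambda>n. nrm (\<lambda>x. v n x - p x)) \<longlonglongrightarrow> 0"
    using p vV by (subst nrm_tendsto_iff) auto
  have lim: "(\<lambda>n. B (v n) (v n)) \<longlonglongrightarrow> B p p"
    by (rule form_tendsto[OF vV p(1) nrm0 vV p(1) nrm0])
  have dlim: "(\<lambda>n. d + 1 / real (Suc n)) \<longlonglongrightarrow> d + 0"
    using LIMSEQ_inverse_real_of_nat by (intro tendsto_intros) (simp add: inverse_eq_divide)
  have pd: "B p p \<le> d"
    using v(3) by (intro LIMSEQ_le[OF lim dlim[simplified]]) auto
  have ge: "0 \<le> B p s" if s: "s \<in> S" for s
  proof (rule quadratic_nonneg_imp_linear_nonneg)
    fix t :: real
    have sV: "s \<in> V" using s S by auto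
    \<comment> \<open>\<open>p\<close> need not have the form \<open>u - s\<close> with
      \<open>s\<close> in \<open>S\<close>, so minimality is used for the perturbed approximants
      \<open>v n + t * s\<close> and passed to the limit.\<close>
    have "(\<lambda>n. B (v n) (v n) + 2 * t * B (v n) s + t\<^sup>2 * B s s)
        \<longlonglongrightarrow> B p p + 2 * t * B p s + t\<^sup>2 * B s s"
      by (intro tendsto_intros lim form_tendsto[OF vV p(1) nrm0]) (use sV in auto)
    moreover have "d \<le> B (v n) (v n) + 2 * t * B (v n) s + t\<^sup>2 * B s s" for n
    proof -
      obtain r where r: "r \<in> S" "v n = (\<lambda>x. u x - r x)" using v(1)[of n] by (auto simp: C_def)
      have eq: "(\<lambda>x. v n x + t * s x) = (\<lambda>x. u x - (r x + (-t) * s x))"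
        unfolding r by (simp add: field_simps)
      have "(\<lambda>x. v n x + t * s x) \<in> C"
        unfolding C_def by (rule image_eqI, rule eq, rule S(3)[OF r(1) S(4)[OF s]])
      from v(2)[OF this] show ?thesis
        using form_add_scale_sq[OF vV sV] by simp
    qed
    ultimately have "d \<le> B p p + 2 * t * B p s + t\<^sup>2 * B s s"
      by (meson LIMSEQ_le_const)
    then show "0 \<le> 2 * t * B p s + t\<^sup>2 * B s s" using pd by simp
  qed
  have "B p s = 0" if s: "s \<in> S" for s
    using ge[OF s] ge[OF S(4)[OF s, of "-1"]] S(1) s p by (force simp: form_linear)
  from orth[OF p(1) this] have "B p p = 0" .
  then have "\<forall>\<^sub>F n in sequentially. B (v n) (v n) < \<epsilon>"
    using lim \<epsilon> by (intro order_tendstoD) auto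
  then obtain n where "B (v n) (v n) < \<epsilon>" by (auto simp: eventually_sequentially)
  then show ?thesis using v(1)[of n] by (auto simp: C_def)
qed

end

subsection \<open>Convex combinations\<close>

text \<open>The convex hull, generated by binary combinations so that facts about convex
  combinations are proved by rule induction instead of on weighted sums.\<close>

inductive_set mix :: "('a \<Rightarrow> real) set \<Rightarrow> ('a \<Rightarrow> real) set" for A where
  base: "u \<in> A \<Longrightarrow> u \<in> mix A"
| comb: "u \<in> mix A \<Longrightarrow> v \<in> mix A \<Longrightarrow> 0 \<le> t \<Longrightarrow> t \<le> 1 \<Longrightarrow> (\<lambda>x. t * u x + (1 - t) * v x) \<in> mix A"

lemma mix_mono: "A \<subseteq> A' \<Longrightarrow> mix A \<subseteq> mix A'"
proof
  fix u assume "u \<in> mix A" "A \<subseteq> A'" then show "u \<in> mix A'"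
    by (induction rule: mix.induct) (auto intro: mix.intros)
qed

lemma convex_comb_abs_le:
  fixes a b r t :: real
  assumes "\<bar>a\<bar> \<le> r" "\<bar>b\<bar> \<le> r" "0 \<le> t" "t \<le> 1"
  shows "\<bar>t * a + (1 - t) * b\<bar> \<le> r"
proof -
  have "\<bar>t * a + (1 - t) * b\<bar> \<le> t * \<bar>a\<bar> + (1 - t) * \<bar>b\<bar>"
    using assms abs_triangle_ineq[of "t * a" "(1 - t) * b"] by (simp add: abs_mult)
  also have "\<dots> \<le> t * r + (1 - t) * r"
    using assms by (intro add_mono mult_left_mono) auto
  finally show ?thesis by (simp add: algebra_simps)
qed

lemma mix_pointwise_bound:
  assumes "w \<in> mix A" "\<And>u. u \<in> A \<Longrightarrow> \<bar>u x - c\<bar> \<le> r"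
  shows "\<bar>w x - c\<bar> \<le> r"
  using assms(1)
proof induction
  case (comb u v t)
  have "t * u x + (1 - t) * v x - c = t * (u x - c) + (1 - t) * (v x - c)"
    by (simp add: algebra_simps)
  also have "\<bar>\<dots>\<bar> \<le> r"
    using comb by (intro convex_comb_abs_le)
  finally show ?case .
qed (use assms in auto)

text \<open>Balls are convex: once all members of a tail are within a distance of \<open>c\<close>
  at \<open>x\<close>, so are their combinations. This identifies the limit in Mazur's
  lemma.\<close>

lemma mix_tendsto:
  assumes w: "\<And>N. w N \<in> mix {v n | n. n \<ge> N}" and v: "(\<lambda>n. v n x) \<longlonglongrightarrow> (c::real)"
  shows "(\<lambda>N. w N x) \<longlonglongrightarrow> c"
proof (rule LIMSEQ_I)
  fix r :: real assume "r > 0"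
  then obtain N where N: "\<And>n. n \<ge> N \<Longrightarrow> \<bar>v n x - c\<bar> < r / 2"
    using LIMSEQ_D[OF v, of "r / 2"] by auto
  have "\<bar>w M x - c\<bar> \<le> r / 2" if "M \<ge> N" for M
    by (rule mix_pointwise_bound[OF w]) (use N that in \<open>auto intro: less_imp_le\<close>)
  then show "\<exists>N. \<forall>M\<ge>N. norm (w M x - c) < r"
    using \<open>r > 0\<close> by (intro exI[of _ N]) force
qed

context form_space
begin

lemma mix_mem: "w \<in> mix A \<Longrightarrow> A \<subseteq> V \<Longrightarrow> w \<in> V"
  by (induction rule: mix.induct) auto

lemma nrm_mix:
  assumes "w \<in> mix A" "A \<subseteq> V" "\<And>u. u \<in> A \<Longrightarrow> nrm u \<le> K"
  shows "nrm w \<le> K"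
  using assms(1)
proof induction
  case (comb u v t)
  have "u \<in> V" "v \<in> V" using comb mix_mem assms by auto
  then have "nrm (\<lambda>x. t * u x + (1 - t) * v x) \<le> t * nrm u + (1 - t) * nrm v"
    using comb nrm_triangle[of "\<lambda>x. t * u x" "\<lambda>x. (1 - t) * v x"] by (simp add: nrm_scale)
  also have "\<dots> \<le> t * K + (1 - t) * K"
    using comb by (intro add_mono mult_left_mono) auto
  finally show ?case by (simp add: algebra_simps)
qed (use assms in auto)

text \<open>The \<open>w N\<close> are elements of almost minimal norm in the convex hulls of the tails.\<close>

lemma mix_Cauchy:
  assumes v: "\<And>n. v n \<in> V" and K: "\<And>n. B (v n) (v n) \<le> K"
  obtains w where "\<And>N. w N \<in> mix {v n | n. n \<ge> N}" "form_Cauchy w"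
proof -
  define C where "C N = mix {v n | n. n \<ge> N}" for N
  have CV: "C N \<subseteq> V" for N unfolding C_def using v mix_mem by blast
  have vC: "v n \<in> C N" if "n \<ge> N" for n N unfolding C_def using that by (auto intro: mix.base)
  have Canti: "C M \<subseteq> C N" if "N \<le> M" for M N
    unfolding C_def using that by (intro mix_mono) auto
  define d where "d N = (INF u\<in>C N. B u u)" for N
  have bd: "bdd_below ((\<lambda>u. B u u) ` C N)" for N
    using CV[of N] form_nonneg by (intro bdd_belowI[of _ 0]) (auto dest: subsetD)
  have ne: "C N \<noteq> {}" for N using vC[of N N] by auto
  have d_le: "d N \<le> B u u" if "u \<in> C N" for u N unfolding d_def by (rule cINF_lower[OF bd that])
  have "\<exists>w\<in>C N. B w w < d N + 1 / real (Suc N)" for N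
  proof -
    have "d N < d N + 1 / real (Suc N)" by simp
    then show ?thesis unfolding d_def[of N] cINF_less_iff[OF ne bd] by blast
  qed
  then obtain w where w: "\<And>N. w N \<in> C N" "\<And>N. B (w N) (w N) < d N + 1 / real (Suc N)" by metis
  have wV: "w N \<in> V" for N using w CV by auto
  have d_inc: "incseq d"
    unfolding d_def by (intro incseq_SucI cINF_superset_mono bd ne Canti) auto
  have "d N \<le> K" for N using d_le[OF vC[of N N]] K[of N] by simp
  then obtain l where l: "d \<longlonglongrightarrow> l" "\<And>i. d i \<le> l"
    using incseq_convergent[OF d_inc] by blast
  have "form_Cauchy w"
  proof (rule form_CauchyI[OF wV])
    have "(\<lambda>i. 2 * (l - d i) + 4 * (1 / real (Suc i))) \<longlonglongrightarrow> 2 * (l - l) + 4 * 0"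
      using LIMSEQ_inverse_real_of_nat by (intro tendsto_intros l) (simp add: inverse_eq_divide)
    then show "(\<lambda>i. 2 * (l - d i) + 4 * (1 / real (Suc i))) \<longlonglongrightarrow> 0" by simp
    fix i j :: nat assume ij: "i \<le> j"
    \<comment> \<open>Both \<open>w i\<close> and \<open>w j\<close> belong to the larger hull
      \<open>C i\<close>, so their midpoint has energy at least \<open>d i\<close>. The defect in
      the parallelogram law is then governed by \<open>d j - d i\<close>, which is small because
      \<open>d\<close> increases to \<open>l\<close>.\<close>
    have "(\<lambda>x. (1/2) * w i x + (1 - 1/2) * w j x) \<in> C i"
      using w(1)[of i] w(1)[of j] Canti[OF ij] unfolding C_def by (intro mix.comb) auto
    then have "d i \<le> B (\<lambda>x. (1/2) * w i x + (1/2) * w j x) (\<lambda>x. (1/2) * w i x + (1/2) * w j x)"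
      using d_le by simp
    then have "B (\<lambda>x. w i x - w j x) (\<lambda>x. w i x - w j x)
      \<le> 2 * (d i + 1 / real (Suc i)) + 2 * (d j + 1 / real (Suc j)) - 4 * d i"
      unfolding parallelogram[OF wV wV] using w(2)[of i] w(2)[of j]
      by (intro diff_mono add_mono mult_left_mono) auto
    also have "\<dots> \<le> 2 * (l - d i) + 4 * (1 / real (Suc i))"
      using l(2)[of j] ij frac_le[of 1 1 "real (Suc i)" "real (Suc j)"] by simp
    finally show "B (\<lambda>x. w i x - w j x) (\<lambda>x. w i x - w j x) \<le> 2 * (l - d i) + 4 * (1 / real (Suc i))" .
  qed
  then show ?thesis using that w(1) unfolding C_def by blast
qed

end

section \<open>Markovian forms\<close>

definition clip :: "real \<Rightarrow> ('a \<Rightarrow> real) \<Rightarrow> 'a \<Rightarrow> real" where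
  "clip k u x = min (max (u x) 0) k"

lemma clip_bounds: "0 \<le> k \<Longrightarrow> 0 \<le> clip k u x" "clip k u x \<le> k"
  by (auto simp: clip_def)

lemma clip_iff:
  assumes "0 < k"
  shows "0 < clip k u x \<longleftrightarrow> 0 < u x" "clip k u x < k \<longleftrightarrow> u x < k"
    "clip k u x = k \<longleftrightarrow> k \<le> u x" "clip k u x = 0 \<longleftrightarrow> u x \<le> 0"
  using assms by (auto simp: clip_def)

lemma trunc_eq_clip: "0 < k \<Longrightarrow> trunc k u x = clip k u x - clip k (\<lambda>x. - u x) x"
  by (auto simp: trunc_def clip_def min_def max_def)

lemma min_abs_eq_clip: "0 < k \<Longrightarrow> min \<bar>u x\<bar> k = clip k u x + clip k (\<lambda>x. - u x) x"
  by (auto simp: clip_def min_def max_def)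

lemma abs_trunc: "0 \<le> k \<Longrightarrow> \<bar>trunc k u x\<bar> = min \<bar>u x\<bar> k"
  by (auto simp: trunc_def min_def max_def)

lemma trunc_tendsto: "(\<lambda>n. v n x) \<longlonglongrightarrow> u x \<Longrightarrow> (\<lambda>n. trunc k (v n) x) \<longlonglongrightarrow> trunc k u x"
  unfolding trunc_def by (intro tendsto_intros)

lemma borel_measurable_trunc [measurable]:
  "u \<in> borel_measurable m \<Longrightarrow> trunc k u \<in> borel_measurable m"
  unfolding trunc_def by (intro borel_measurable_min borel_measurable_max) auto

lemma trunc_eq: "\<bar>u x\<bar> \<le> k \<Longrightarrow> trunc k u x = u x"
  by (auto simp: trunc_def)

locale markov_form = form_space +
  assumes unit_mem: "u \<in> V \<Longrightarrow> (\<lambda>x. min (max (u x) 0) 1) \<in> V"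
    and unit_le: "u \<in> V \<Longrightarrow>
      B (\<lambda>x. min (max (u x) 0) 1) (\<lambda>x. min (max (u x) 0) 1) \<le> B u u"
begin

lemma
  assumes u: "u \<in> V" and k: "0 < k"
  shows clip_mem [simp]: "clip k u \<in> V" and form_clip_le: "B (clip k u) (clip k u) \<le> B u u"
proof -
  define v where "v x = min (max ((1/k) * u x) 0) 1" for x
  have kv: "clip k u = (\<lambda>x. k * v x)"
    using k by (auto simp: clip_def v_def fun_eq_iff min_def max_def field_simps)
  have v: "v \<in> V" unfolding v_def by (rule unit_mem[OF scale_mem[OF u]])
  then show "clip k u \<in> V" unfolding kv by simp
  have "B v v \<le> B (\<lambda>x. (1/k) * u x) (\<lambda>x. (1/k) * u x)"
    unfolding v_def by (rule unit_le[OF scale_mem[OF u]])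
  also have "\<dots> = (1/k)\<^sup>2 * B u u"
    by (simp only: form_linear u scale_mem power2_eq_square mult.assoc)
  finally have "k\<^sup>2 * B v v \<le> k\<^sup>2 * ((1/k)\<^sup>2 * B u u)" by (intro mult_left_mono) auto
  also have "\<dots> = B u u" using k by (simp add: power2_eq_square)
  finally show "B (clip k u) (clip k u) \<le> B u u"
    unfolding kv using v by (simp add: form_linear power2_eq_square mult.assoc)
qed

text \<open>The conditions on \<open>w\<close> say that \<open>v\<close> is the contraction of \<open>v + t w\<close> for every \<open>t \<ge> 0\<close>,
  so that \<open>t \<mapsto> B (v + t w) (v + t w)\<close> is minimal at \<open>t = 0\<close>.\<close>

lemma form_nonneg_complementary:
  assumes v: "v \<in> V" and w: "w \<in> V" and k: "0 < k"
    and vk: "\<And>x. 0 \<le> v x" "\<And>x. v x \<le> k"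
    and wz: "\<And>x. 0 < v x \<Longrightarrow> v x < k \<Longrightarrow> w x = 0"
      "\<And>x. v x = k \<Longrightarrow> 0 \<le> w x" "\<And>x. v x = 0 \<Longrightarrow> w x \<le> 0"
  shows "0 \<le> B v w"
proof (rule quadratic_nonneg_imp_linear_nonneg)
  fix t :: real assume t: "t > 0"
  have "clip k (\<lambda>x. v x + t * w x) x = v x" for x
  proof -
    consider "v x = 0" | "v x = k" | "0 < v x" "v x < k" using vk[of x] by fastforce
    then show ?thesis
    proof cases
      case 1
      then have "t * w x \<le> 0" using wz(3)[of x] t by (simp add: mult_nonneg_nonpos)
      then show ?thesis using 1 k by (simp add: clip_def)
    next
      case 2
      then have "t * w x \<ge> 0" using wz(2)[of x] t by simp
      then show ?thesis using 2 k by (simp add: clip_def)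
    qed (use wz(1)[of x] in \<open>simp add: clip_def\<close>)
  qed
  then have "clip k (\<lambda>x. v x + t * w x) = v" by auto
  with form_clip_le[of "\<lambda>x. v x + t * w x" k] v w k
  have "B v v \<le> B (\<lambda>x. v x + t * w x) (\<lambda>x. v x + t * w x)" by simp
  then show "0 \<le> 2 * t * B v w + t\<^sup>2 * B w w"
    unfolding form_add_scale_sq[OF v w] by simp
qed

lemma form_clip_rest:
  assumes "u \<in> V" "0 < k"
  shows "0 \<le> B (clip k u) (\<lambda>x. u x - clip k u x)"
  by (rule form_nonneg_complementary[of _ _ k]) (use assms in \<open>simp_all add: clip_bounds clip_iff, simp_all add: clip_def\<close>)

text \<open>The two clips live on the disjoint sets where \<open>u\<close> is positive and where it
  is negative. This sign is the reason why passing from \<open>u\<close> to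
  \<open>\<bar>u\<bar>\<close> does not increase the energy.\<close>

lemma form_clip_cross:
  assumes "u \<in> V" "0 < k" "0 < l"
  shows "B (clip k u) (clip l (\<lambda>x. - u x)) \<le> 0"
proof -
  have "0 \<le> B (clip k u) (\<lambda>x. - clip l (\<lambda>x. - u x) x)"
    by (rule form_nonneg_complementary[of _ _ k]) (use assms in \<open>simp_all add: clip_bounds clip_iff, simp_all add: clip_def\<close>)
  then show ?thesis using assms by (simp add: form_linear)
qed

lemma trunc_mem [simp]:
  assumes "u \<in> V" "0 < k" shows "trunc k u \<in> V"
proof -
  have "trunc k u = (\<lambda>x. clip k u x - clip k (\<lambda>x. - u x) x)"
    by (rule ext) (rule trunc_eq_clip[OF assms(2)])
  then show ?thesis using assms by simp
qed

text \<open>The remainder is nonnegative where \<open>u\<close> exceeds \<open>k\<close>,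
  nonpositive where \<open>u\<close> is below \<open>- k\<close> and zero between. Thus the
  complementarity principle applies to each of the two clips that make up the truncation.\<close>

lemma form_trunc_rest:
  assumes "u \<in> V" "0 < k"
  shows "0 \<le> B (trunc k u) (\<lambda>x. u x - trunc k u x)"
proof -
  have eq: "trunc k u = (\<lambda>x. clip k u x - clip k (\<lambda>x. - u x) x)"
    by (rule ext) (rule trunc_eq_clip[OF assms(2)])
  have "0 \<le> B (clip k u) (\<lambda>x. u x - trunc k u x)"
    by (rule form_nonneg_complementary[of _ _ k])
      (use assms in \<open>simp_all add: clip_bounds clip_iff, simp_all add: clip_def trunc_def\<close>)
  moreover have "0 \<le> B (clip k (\<lambda>x. - u x)) (\<lambda>x. trunc k u x - u x)"
    by (rule form_nonneg_complementary[of _ _ k])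
      (use assms in \<open>simp_all add: clip_bounds clip_iff, simp_all add: clip_def trunc_def\<close>)
  moreover have "B (trunc k u) (\<lambda>x. u x - trunc k u x)
      = B (clip k u) (\<lambda>x. u x - trunc k u x) + B (clip k (\<lambda>x. - u x)) (\<lambda>x. trunc k u x - u x)"
  proof -
    have "B (trunc k u) (\<lambda>x. u x - trunc k u x)
      = B (\<lambda>x. clip k u x - clip k (\<lambda>x. - u x) x) (\<lambda>x. u x - trunc k u x)"
      using eq by simp
    then show ?thesis using assms by (simp add: form_linear)
  qed
  ultimately show ?thesis by simp
qed

lemma form_trunc_le:
  assumes "u \<in> V" "0 < k"
  shows "B (trunc k u) (trunc k u) \<le> B u (trunc k u)" "B (trunc k u) (trunc k u) \<le> B u u"
proof -
  let ?r = "\<lambda>x. u x - trunc k u x"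
  have r: "0 \<le> B (trunc k u) ?r" by (rule form_trunc_rest[OF assms])
  then show 1: "B (trunc k u) (trunc k u) \<le> B u (trunc k u)"
    using assms form_sym[of u "trunc k u"] by (simp add: form_linear)
  have "0 \<le> B ?r ?r" using assms by simp
  then show "B (trunc k u) (trunc k u) \<le> B u u"
    using 1 assms form_sym[of u "trunc k u"] by (simp add: form_linear)
qed

lemma
  assumes "u \<in> V" "0 < k"
  shows min_abs_mem [simp]: "(\<lambda>x. min \<bar>u x\<bar> k) \<in> V"
    and form_min_abs_le: "B (\<lambda>x. min \<bar>u x\<bar> k) (\<lambda>x. min \<bar>u x\<bar> k) \<le> B (trunc k u) (trunc k u)"
proof -
  have eq: "(\<lambda>x. min \<bar>u x\<bar> k) = (\<lambda>x. clip k u x + clip k (\<lambda>x. - u x) x)"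
    by (rule ext) (rule min_abs_eq_clip[OF assms(2)])
  have eq': "trunc k u = (\<lambda>x. clip k u x - clip k (\<lambda>x. - u x) x)"
    by (rule ext) (rule trunc_eq_clip[OF assms(2)])
  show "(\<lambda>x. min \<bar>u x\<bar> k) \<in> V" unfolding eq using assms by simp
  show "B (\<lambda>x. min \<bar>u x\<bar> k) (\<lambda>x. min \<bar>u x\<bar> k) \<le> B (trunc k u) (trunc k u)"
    unfolding eq eq' using assms form_clip_cross[OF assms assms(2)]
      form_sym[of "clip k u" "clip k (\<lambda>x. - u x)"]
    by (simp add: form_linear)
qed

text \<open>For the positive side, with \<open>a\<close> the clip of \<open>u\<close> at
  \<open>k\<close> and \<open>p\<close> the layer above it, write
  \<open>u = a + p + (u - a - p)\<close>: each summand pairs nonnegatively with \<open>p\<close>.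
  The negative side is the same statement for \<open>- u\<close>. This lets the energy term be
  dropped when an equation is tested with a layer.\<close>

lemma form_layer_nonneg:
  assumes u: "u \<in> V" and k: "0 < k"
  shows "0 \<le> B u (\<lambda>x. trunc (k + 1) u x - trunc k u x)"
proof -
  define p where "p u = (\<lambda>x. clip 1 (\<lambda>x. u x - clip k u x) x)" for u :: "'a \<Rightarrow> real"
  have p: "p u \<in> V" if "u \<in> V" for u unfolding p_def using that k by simp
  have ge: "0 \<le> B u (p u)" if u: "u \<in> V" for u
  proof -
    let ?a = "clip k u"
    have "0 \<le> B (p u) (\<lambda>x. (u x - ?a x) - p u x)"
      unfolding p_def by (rule form_clip_rest) (use u k in auto)
    moreover have "0 \<le> B ?a (p u)"
      by (rule form_nonneg_complementary[of _ _ k])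
        (use u k p[OF u] in \<open>simp_all add: p_def clip_bounds clip_iff, simp_all add: clip_def\<close>)
    moreover have "0 \<le> B (p u) (p u)" using p[OF u] by simp
    moreover have "B (p u) (\<lambda>x. (u x - ?a x) - p u x) = B u (p u) - B ?a (p u) - B (p u) (p u)"
      using u k p[OF u] form_sym[of u "p u"] form_sym[of ?a "p u"] by (simp add: form_linear)
    ultimately show ?thesis by linarith
  qed
  have eq: "(\<lambda>x. trunc (k + 1) u x - trunc k u x) = (\<lambda>x. p u x - p (\<lambda>x. - u x) x)"
    using k by (auto simp: p_def trunc_def clip_def min_def max_def fun_eq_iff)
  show ?thesis unfolding eq
    using ge[OF u] ge[of "\<lambda>x. - u x"] u p[OF u] p[of "\<lambda>x. - u x"] by (simp add: form_linear)
qed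

text \<open>For bounded \<open>u\<close> the positive part is a clip at a level above the bound, so
  only contractions onto bounded intervals are involved.\<close>

lemma
  assumes u: "u \<in> V" and C: "\<And>x. \<bar>u x\<bar> \<le> C"
  shows pos_part_mem: "(\<lambda>x. max (u x) 0) \<in> V"
    and form_pos_part: "B (\<lambda>x. max (u x) 0) (\<lambda>x. max (u x) 0) \<le> B u (\<lambda>x. max (u x) 0)"
proof -
  have C0: "0 < C + 1" using C[of undefined] by simp
  have eq: "(\<lambda>x. max (u x) 0) = clip (C + 1) u"
  proof
    fix x show "max (u x) 0 = clip (C + 1) u x" using C[of x] by (auto simp: clip_def)
  qed
  show "(\<lambda>x. max (u x) 0) \<in> V" unfolding eq using u C0 by simp
  show "B (\<lambda>x. max (u x) 0) (\<lambda>x. max (u x) 0) \<le> B u (\<lambda>x. max (u x) 0)"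
    unfolding eq using form_clip_rest[OF u C0] form_sym[of "clip (C + 1) u" u] u C0
    by (simp add: form_linear)
qed

end

locale definite_markov_form = markov_form +
  assumes definite: "u \<in> V \<Longrightarrow> B u u = 0 \<Longrightarrow> AE x in m. u x = 0"
begin

text \<open>Weak maximum principle: the test function is the negative part of \<open>u\<close>
  clipped at 1. It vanishes exactly where \<open>u\<close> is nonnegative, and contraction together
  with the hypothesis shows that its energy is at most zero.\<close>

lemma nonneg_if_form_nonneg:
  assumes u: "u \<in> V"
    and test: "\<And>v. v \<in> V \<Longrightarrow> (\<And>x. 0 \<le> v x) \<Longrightarrow> (\<And>x. v x \<le> 1) \<Longrightarrow> 0 \<le> B u v"
  shows "AE x in m. 0 \<le> u x"
proof -
  let ?v = "clip 1 (\<lambda>x. - u x)"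
  have v: "?v \<in> V" using u by simp
  have "0 \<le> B ?v (\<lambda>x. - u x - ?v x)" by (rule form_clip_rest) (use u in auto)
  moreover have "0 \<le> B u ?v" by (rule test) (auto simp: v clip_bounds)
  ultimately have "B ?v ?v \<le> 0" using u v form_sym[of u ?v] by (simp add: form_linear)
  then have "B ?v ?v = 0" using form_nonneg[OF v] by simp
  from definite[OF v this] show ?thesis by eventually_elim (auto simp: clip_def min_def max_def split: if_splits)
qed

end

section \<open>Transient Dirichlet forms and their resolvents\<close>

lemma L2_mult_integrable:
  assumes "u \<in> L2 m" "v \<in> L2 m"
  shows "integrable m (\<lambda>x. u x * v x)"
proof (rule Bochner_Integration.integrable_bound)
  show "integrable m (\<lambda>x. (u x)\<^sup>2 + (v x)\<^sup>2)" using assms by (auto simp: L2_def)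
  have "\<bar>a * b\<bar> \<le> a\<^sup>2 + b\<^sup>2" for a b :: real
  proof -
    have "0 \<le> (\<bar>a\<bar> - \<bar>b\<bar>)\<^sup>2" by simp
    then have "2 * \<bar>a * b\<bar> \<le> a\<^sup>2 + b\<^sup>2" by (simp add: power2_diff abs_mult)
    then show ?thesis by linarith
  qed
  then show "AE x in m. norm (u x * v x) \<le> norm ((u x)\<^sup>2 + (v x)\<^sup>2)"
    by (auto simp: abs_of_nonneg)
qed (use assms in \<open>auto simp: L2_def\<close>)

lemma L2_bounded_by:
  assumes "u \<in> borel_measurable m" "v \<in> L2 m" "AE x in m. \<bar>u x\<bar> \<le> \<bar>v x\<bar>"
  shows "u \<in> L2 m"
proof -
  have "integrable m (\<lambda>x. (v x)\<^sup>2)" using assms by (auto simp: L2_def)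
  then have "integrable m (\<lambda>x. (u x)\<^sup>2)"
  proof (rule Bochner_Integration.integrable_bound)
    show "AE x in m. norm ((u x)\<^sup>2) \<le> norm ((v x)\<^sup>2)"
      using assms(3) by eventually_elim (simp add: abs_le_square_iff)
  qed (use assms(1) in auto)
  then show ?thesis using assms by (auto simp: L2_def)
qed

lemma L2_if_integrable_bounded:
  assumes "integrable m u" "AE x in m. \<bar>u x\<bar> \<le> C"
  shows "u \<in> L2 m"
proof -
  have *: "integrable m (\<lambda>x. C * \<bar>u x\<bar>)" using assms(1) by simp
  have ae: "AE x in m. norm ((u x)\<^sup>2) \<le> norm (C * \<bar>u x\<bar>)"
    using assms(2)
  proof eventually_elim
    case (elim x)
    have "(u x)\<^sup>2 = \<bar>u x\<bar> * \<bar>u x\<bar>" by (simp add: power2_eq_square)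
    also have "\<dots> \<le> C * \<bar>u x\<bar>" using elim by (intro mult_right_mono) auto
    finally show ?case by simp
  qed
  have "integrable m (\<lambda>x. (u x)\<^sup>2)"
    by (rule Bochner_Integration.integrable_bound[OF * _ ae]) (use assms(1) in auto)
  then show ?thesis using assms by (auto simp: L2_def)
qed

lemma form_space_L2: "form_space m (L2 m) (inner_L2 m)"
proof
  fix u v w :: "'a \<Rightarrow> real" and c :: real
  show "(\<lambda>x. 0) \<in> L2 m" by (simp add: L2_def)
  show "u \<in> borel_measurable m" if "u \<in> L2 m" using that by (simp add: L2_def)
  show "(\<lambda>x. u x + v x) \<in> L2 m" if "u \<in> L2 m" "v \<in> L2 m"
    using that L2_mult_integrable[OF that] by (auto simp: L2_def power2_sum mult.assoc)
  show "(\<lambda>x. c * u x) \<in> L2 m" if "u \<in> L2 m"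
    using that by (auto simp: L2_def power_mult_distrib)
  show "v \<in> L2 m" if "u \<in> L2 m" "v \<in> borel_measurable m" "AE x in m. u x = v x"
    by (rule L2_bounded_by[OF that(2,1)]) (use that(3) in auto)
  show "inner_L2 m u w = inner_L2 m v w" if "u \<in> L2 m" "v \<in> L2 m" "w \<in> L2 m" "AE x in m. u x = v x"
    unfolding inner_L2_def using that by (intro integral_cong_AE) (auto simp: L2_def)
  show "inner_L2 m u v = inner_L2 m v u" unfolding inner_L2_def by (simp add: mult.commute)
  show "inner_L2 m (\<lambda>x. u x + v x) w = inner_L2 m u w + inner_L2 m v w"
    if "u \<in> L2 m" "v \<in> L2 m" "w \<in> L2 m"
    unfolding inner_L2_def using that by (simp add: distrib_right L2_mult_integrable)
  show "inner_L2 m (\<lambda>x. c * u x) w = c * inner_L2 m u w"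
    unfolding inner_L2_def by (simp add: mult.assoc)
  show "0 \<le> inner_L2 m u u" unfolding inner_L2_def by simp
qed

lemma inner_L2_self_zero:
  assumes "u \<in> L2 m" "inner_L2 m u u = 0" shows "AE x in m. u x = 0"
proof -
  have "integrable m (\<lambda>x. u x * u x)" by (rule L2_mult_integrable[OF assms(1,1)])
  from integral_nonneg_eq_0_iff_AE[OF this] assms(2) show ?thesis
    by (simp add: inner_L2_def)
qed

text \<open>Fatou's lemma in the shape needed throughout: a bound on weighted L1 norms survives a.e.
  limits. The weights will be \<open>ref\<close>, \<open>res 1 ref\<close>, their sum,
  \<open>\<bar>\<eta>\<bar>\<close> and 1.\<close>

lemma nn_integral_weighted_Fatou:
  fixes f :: "nat \<Rightarrow> 'a \<Rightarrow> real"
  assumes [measurable]: "\<And>n. f n \<in> borel_measurable m" "r \<in> borel_measurable m"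
    and lim: "AE x in m. (\<lambda>n. f n x) \<longlonglongrightarrow> g x"
    and le: "eventually (\<lambda>n. (\<integral>\<^sup>+x. ennreal (\<bar>f n x\<bar> * r x) \<partial>m) \<le> K) sequentially"
  shows "(\<integral>\<^sup>+x. ennreal (\<bar>g x\<bar> * r x) \<partial>m) \<le> K"
proof -
  have "(\<integral>\<^sup>+x. ennreal (\<bar>g x\<bar> * r x) \<partial>m) = (\<integral>\<^sup>+x. liminf (\<lambda>n. ennreal (\<bar>f n x\<bar> * r x)) \<partial>m)"
  proof (rule nn_integral_cong_AE, use lim in eventually_elim)
    case (elim x)
    then have "(\<lambda>n. ennreal (\<bar>f n x\<bar> * r x)) \<longlonglongrightarrow> ennreal (\<bar>g x\<bar> * r x)"
      by (intro tendsto_intros)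
    then show ?case by (simp add: lim_imp_Liminf)
  qed
  also have "\<dots> \<le> liminf (\<lambda>n. \<integral>\<^sup>+x. ennreal (\<bar>f n x\<bar> * r x) \<partial>m)"
    by (rule nn_integral_liminf) simp
  also have "\<dots> \<le> K"
    using le by (simp add: Liminf_le)
  finally show ?thesis .
qed

locale dirichlet_space =
  fixes m :: "'a measure" and D \<E>
  assumes dirichlet: "dirichlet_form m D \<E>" and transient: "transient_form m D \<E>"

sublocale dirichlet_space \<subseteq> L2: form_space m "L2 m" "inner_L2 m"
  by (rule form_space_L2)

sublocale dirichlet_space \<subseteq> D: markov_form m D \<E>
proof -
  have s: "symmetric_form m D \<E>" and mk: "markovian_form D \<E>"
    using dirichlet by (auto simp: dirichlet_form_def)
  note sd = s[unfolded symmetric_form_def]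
  show "markov_form m D \<E>"
  proof
    fix u v w :: "'a \<Rightarrow> real" and c :: real
    show meas: "u \<in> borel_measurable m" if "u \<in> D" for u using that sd by (auto simp: L2_def)
    show "(\<lambda>x. 0) \<in> D" using sd by blast
    show "(\<lambda>x. u x + v x) \<in> D" if "u \<in> D" "v \<in> D" using that sd by blast
    show "(\<lambda>x. c * u x) \<in> D" if "u \<in> D" using that sd by blast
    show "v \<in> D" if "u \<in> D" "v \<in> borel_measurable m" "AE x in m. u x = v x" using that sd by blast
    show "\<E> u w = \<E> v w" if "u \<in> D" "v \<in> D" "w \<in> D" "AE x in m. u x = v x"
      using that sd meas[OF that(2)] by blast
    show "\<E> u v = \<E> v u" if "u \<in> D" "v \<in> D" using that sd by blast
    show "\<E> (\<lambda>x. u x + v x) w = \<E> u w + \<E> v w" if "u \<in> D" "v \<in> D" "w \<in> D" using that sd by blast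
    show "\<E> (\<lambda>x. c * u x) w = c * \<E> u w" if "u \<in> D" "w \<in> D" using that sd by blast
    show "0 \<le> \<E> u u" if "u \<in> D" using that sd by blast
    show "(\<lambda>x. min (max (u x) 0) 1) \<in> D"
      "\<E> (\<lambda>x. min (max (u x) 0) 1) (\<lambda>x. min (max (u x) 0) 1) \<le> \<E> u u" if "u \<in> D"
      using that mk by (auto simp: markovian_form_def)
  qed
qed

context dirichlet_space
begin

lemma D_L2: "u \<in> D \<Longrightarrow> u \<in> L2 m"
  using dirichlet by (auto simp: dirichlet_form_def symmetric_form_def)

definition Ea :: "real \<Rightarrow> ('a \<Rightarrow> real) \<Rightarrow> ('a \<Rightarrow> real) \<Rightarrow> real" where
  "Ea \<alpha> u v = \<E> u v + \<alpha> * inner_L2 m u v"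

lemma markov_Ea:
  assumes \<alpha>: "0 < \<alpha>" shows "definite_markov_form m D (Ea \<alpha>)"
proof
  fix u v w :: "'a \<Rightarrow> real" and c :: real
  show "u \<in> borel_measurable m" if "u \<in> D" using that D.measurable by blast
  show "(\<lambda>x. 0) \<in> D" by simp
  show "(\<lambda>x. u x + v x) \<in> D" if "u \<in> D" "v \<in> D" using that by simp
  show "(\<lambda>x. c * u x) \<in> D" if "u \<in> D" using that by simp
  show "v \<in> D" if "u \<in> D" "v \<in> borel_measurable m" "AE x in m. u x = v x" using that D.AE_mem by blast
  show "Ea \<alpha> u w = Ea \<alpha> v w" if "u \<in> D" "v \<in> D" "w \<in> D" "AE x in m. u x = v x"
    unfolding Ea_def using that D.AE_form[of u v w] L2.AE_form[of u v w] D_L2 by simp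
  show "Ea \<alpha> u v = Ea \<alpha> v u" if "u \<in> D" "v \<in> D"
    unfolding Ea_def using that D.form_sym[of u v] L2.form_sym[of u v] D_L2 by simp
  show "Ea \<alpha> (\<lambda>x. u x + v x) w = Ea \<alpha> u w + Ea \<alpha> v w" if "u \<in> D" "v \<in> D" "w \<in> D"
    unfolding Ea_def using that D_L2 by (simp add: D.form_add_left L2.form_add_left distrib_left)
  show "Ea \<alpha> (\<lambda>x. c * u x) w = c * Ea \<alpha> u w" if "u \<in> D" "w \<in> D"
    unfolding Ea_def using that D_L2 by (simp add: D.form_scale_left L2.form_scale_left distrib_left)
  show "0 \<le> Ea \<alpha> u u" if "u \<in> D" unfolding Ea_def using that D_L2 \<alpha> by simp
  show "(\<lambda>x. min (max (u x) 0) 1) \<in> D" if "u \<in> D" using that by (rule D.unit_mem)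
  show "Ea \<alpha> (\<lambda>x. min (max (u x) 0) 1) (\<lambda>x. min (max (u x) 0) 1) \<le> Ea \<alpha> u u" if u: "u \<in> D"
  proof -
    let ?c = "\<lambda>x. min (max (u x) 0) 1"
    have "inner_L2 m ?c ?c \<le> inner_L2 m u u"
      unfolding inner_L2_def
    proof (rule integral_mono)
      show "integrable m (\<lambda>x. ?c x * ?c x)"
        using D_L2[OF D.unit_mem[OF u]] L2_mult_integrable by blast
      show "integrable m (\<lambda>x. u x * u x)" using D_L2[OF u] L2_mult_integrable by blast
      fix x
      have "\<bar>?c x\<bar> \<le> \<bar>u x\<bar>" by auto
      then show "?c x * ?c x \<le> u x * u x"
        by (simp only: abs_le_square_iff power2_eq_square)
    qed
    then show ?thesis unfolding Ea_def using D.unit_le[OF u] \<alpha> by (intro add_mono mult_left_mono) auto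
  qed
  show "AE x in m. u x = 0" if "u \<in> D" "Ea \<alpha> u u = 0"
  proof -
    have "0 \<le> \<E> u u" "0 \<le> inner_L2 m u u" using that D_L2 by auto
    then have "inner_L2 m u u = 0" using that(2) \<alpha> unfolding Ea_def
      by (smt (verit) mult_pos_pos)
    then show ?thesis using inner_L2_self_zero D_L2 that by blast
  qed
qed

lemma complete_Ea:
  assumes \<alpha>: "0 < \<alpha>" shows "complete_form_space m D (Ea \<alpha>)"
proof -
  interpret A: definite_markov_form m D "Ea \<alpha>" by (rule markov_Ea[OF \<alpha>])
  show ?thesis
  proof
    fix u assume u: "\<And>n. u n \<in> D" and c: "A.form_Cauchy u"
    \<comment> \<open>Closedness is stated for the form with parameter 1, so it has to be
      transported to parameter \<open>\<alpha>\<close>. The factors \<open>1 + 1/\<alpha>\<close>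
      here and \<open>1 + \<alpha>\<close> below are chosen so that the differences are visibly sums
      of nonnegative terms.\<close>
    have le: "energy1 m \<E> w \<le> (1 + 1/\<alpha>) * Ea \<alpha> w w" if "w \<in> D" for w
    proof -
      have "0 \<le> \<E> w w" "0 \<le> inner_L2 m w w" using that D_L2 by auto
      then have "0 \<le> 1/\<alpha> * \<E> w w + \<alpha> * inner_L2 m w w" using \<alpha> by simp
      also have "1/\<alpha> * \<E> w w + \<alpha> * inner_L2 m w w = (1 + 1/\<alpha>) * Ea \<alpha> w w - energy1 m \<E> w"
        using \<alpha> by (simp add: Ea_def energy1_def field_simps)
      finally show ?thesis by simp
    qed
    have "\<forall>\<epsilon>>0. \<exists>N. \<forall>i\<ge>N. \<forall>j\<ge>N. energy1 m \<E> (\<lambda>x. u i x - u j x) < \<epsilon>"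
    proof (intro allI impI)
      fix \<epsilon> :: real assume "\<epsilon> > 0"
      then have "\<epsilon> / (1 + 1/\<alpha>) > 0" using \<alpha> by (simp add: add_pos_pos)
      then obtain N where N: "\<And>i j. i \<ge> N \<Longrightarrow> j \<ge> N \<Longrightarrow>
        Ea \<alpha> (\<lambda>x. u i x - u j x) (\<lambda>x. u i x - u j x) < \<epsilon> / (1 + 1/\<alpha>)"
        using c unfolding A.form_Cauchy_def by meson
      show "\<exists>N. \<forall>i\<ge>N. \<forall>j\<ge>N. energy1 m \<E> (\<lambda>x. u i x - u j x) < \<epsilon>"
      proof (intro exI allI impI)
        fix i j assume "i \<ge> N" "j \<ge> N"
        have "0 < 1 + 1/\<alpha>" using \<alpha> by (simp add: add_pos_pos)
        then have "(1 + 1/\<alpha>) * Ea \<alpha> (\<lambda>x. u i x - u j x) (\<lambda>x. u i x - u j x) < \<epsilon>"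
          using N[OF \<open>i \<ge> N\<close> \<open>j \<ge> N\<close>] by (simp only: pos_less_divide_eq mult.commute)
        then show "energy1 m \<E> (\<lambda>x. u i x - u j x) < \<epsilon>"
          using le[of "\<lambda>x. u i x - u j x"] u by simp
      qed
    qed
    then obtain v where v: "v \<in> D" "(\<lambda>n. energy1 m \<E> (\<lambda>x. u n x - v x)) \<longlonglongrightarrow> 0"
      using dirichlet u unfolding dirichlet_form_def closed_form_def by blast
    have lim: "(\<lambda>n. (1 + \<alpha>) * energy1 m \<E> (\<lambda>x. u n x - v x)) \<longlonglongrightarrow> 0"
      using tendsto_mult_right_zero[OF v(2)] by simp
    have "(\<lambda>n. Ea \<alpha> (\<lambda>x. u n x - v x) (\<lambda>x. u n x - v x)) \<longlonglongrightarrow> 0"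
    proof (rule tendsto_sandwich[OF _ _ tendsto_const lim]; intro always_eventually allI)
      fix n
      let ?w = "\<lambda>x. u n x - v x"
      have w: "?w \<in> D" using u v by simp
      then have "0 \<le> \<E> ?w ?w" "0 \<le> inner_L2 m ?w ?w" using D_L2 by auto
      then have "0 \<le> \<alpha> * \<E> ?w ?w + inner_L2 m ?w ?w" using \<alpha> by simp
      then show "Ea \<alpha> ?w ?w \<le> (1 + \<alpha>) * energy1 m \<E> ?w"
        by (simp add: Ea_def energy1_def algebra_simps)
      show "0 \<le> Ea \<alpha> ?w ?w" using w by simp
    qed
    then show "\<exists>v\<in>D. (\<lambda>n. Ea \<alpha> (\<lambda>x. u n x - v x) (\<lambda>x. u n x - v x)) \<longlonglongrightarrow> 0"
      using v by blast
  qed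
qed

section \<open>The resolvent: existence, order properties, contraction in energy\<close>

abbreviation res :: "real \<Rightarrow> ('a \<Rightarrow> real) \<Rightarrow> 'a \<Rightarrow> real" where
  "res \<equiv> resolvent m D \<E>"

text \<open>This justifies the choice made in \<open>resolvent\<close>. The constant in the Riesz
  bound comes from \<open>\<alpha> * inner_L2 m u u \<le> Ea \<alpha> u u\<close>.\<close>

lemma
  assumes \<alpha>: "0 < \<alpha>" and h: "h \<in> L2 m"
  shows res_mem [simp]: "res \<alpha> h \<in> D"
    and Ea_res: "\<And>v. v \<in> D \<Longrightarrow> Ea \<alpha> (res \<alpha> h) v = inner_L2 m h v"
proof -
  interpret A: complete_form_space m D "Ea \<alpha>" by (rule complete_Ea[OF \<alpha>])
  have "\<exists>u\<in>D. \<forall>v\<in>D. Ea \<alpha> u v = inner_L2 m h v"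
  proof (rule A.Riesz[where K = "L2.nrm h / sqrt \<alpha>"])
    fix u v c assume u: "u \<in> D"
    show "inner_L2 m h (\<lambda>x. c * u x) = c * inner_L2 m h u"
      using u h D_L2 by (simp add: L2.form_scale_right)
    show "inner_L2 m h (\<lambda>x. u x + v x) = inner_L2 m h u + inner_L2 m h v" if "v \<in> D"
      using u h that D_L2 by (simp add: L2.form_add_right)
    have "inner_L2 m u u \<le> Ea \<alpha> u u / \<alpha>"
      using u \<alpha> D.form_nonneg[OF u] by (simp add: Ea_def field_simps)
    then have "L2.nrm u \<le> A.nrm u / sqrt \<alpha>"
      unfolding L2.nrm_def A.nrm_def real_sqrt_divide[symmetric] by (rule real_sqrt_le_mono)
    then have "L2.nrm h * L2.nrm u \<le> L2.nrm h * (A.nrm u / sqrt \<alpha>)"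
      using h by (intro mult_left_mono) auto
    then show "\<bar>inner_L2 m h u\<bar> \<le> L2.nrm h / sqrt \<alpha> * A.nrm u"
      using L2.Cauchy_Schwarz[OF h D_L2[OF u]] by simp
  qed
  then have "\<exists>u. u \<in> D \<and> (\<forall>v\<in>D. \<E> u v + \<alpha> * inner_L2 m u v = inner_L2 m h v)"
    unfolding Ea_def by blast
  from someI_ex[OF this, folded resolvent_def]
  show "res \<alpha> h \<in> D" "\<And>v. v \<in> D \<Longrightarrow> Ea \<alpha> (res \<alpha> h) v = inner_L2 m h v"
    unfolding Ea_def by blast+
qed

text \<open>Comparison with supersolutions, by the weak maximum principle for
  \<open>Ea \<alpha>\<close>. Monotonicity in the right-hand side and antitonicity in
  \<open>\<alpha>\<close> follow by taking another resolvent for \<open>u\<close>.\<close>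

lemma res_compare:
  assumes \<alpha>: "0 < \<alpha>" and h: "h \<in> L2 m" and u: "u \<in> D"
    and le: "\<And>v. v \<in> D \<Longrightarrow> (\<And>x. 0 \<le> v x) \<Longrightarrow> inner_L2 m h v \<le> Ea \<alpha> u v"
  shows "AE x in m. res \<alpha> h x \<le> u x"
proof -
  interpret A: definite_markov_form m D "Ea \<alpha>" by (rule markov_Ea[OF \<alpha>])
  have "AE x in m. 0 \<le> u x - res \<alpha> h x"
    by (rule A.nonneg_if_form_nonneg) (use \<alpha> h u le in \<open>simp_all add: A.form_linear Ea_res\<close>)
  then show ?thesis by simp
qed

lemma inner_L2_mono:
  assumes "h \<in> L2 m" "h' \<in> L2 m" "v \<in> L2 m" "\<And>x. 0 \<le> v x" "AE x in m. h x \<le> h' x"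
  shows "inner_L2 m h v \<le> inner_L2 m h' v"
  unfolding inner_L2_def using assms L2_mult_integrable
  by (intro integral_mono_AE) (auto elim!: eventually_mono intro: mult_right_mono)

lemma res_mono:
  assumes "0 < \<alpha>" "h \<in> L2 m" "h' \<in> L2 m" "AE x in m. h x \<le> h' x"
  shows "AE x in m. res \<alpha> h x \<le> res \<alpha> h' x"
  by (rule res_compare) (use assms D_L2 inner_L2_mono in \<open>simp_all add: Ea_res\<close>)

lemma res_zero: "0 < \<alpha> \<Longrightarrow> AE x in m. res \<alpha> (\<lambda>x. 0) x = 0"
proof -
  assume \<alpha>: "0 < \<alpha>"
  interpret A: definite_markov_form m D "Ea \<alpha>" by (rule markov_Ea[OF \<alpha>])
  have "Ea \<alpha> (res \<alpha> (\<lambda>x. 0)) (res \<alpha> (\<lambda>x. 0)) = 0"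
    using Ea_res[OF \<alpha>, of "\<lambda>x. 0" "res \<alpha> (\<lambda>x. 0)"] \<alpha> by (simp add: inner_L2_def)
  then show ?thesis using A.definite \<alpha> by simp
qed

lemma res_nonneg:
  assumes "0 < \<alpha>" "h \<in> L2 m" "AE x in m. 0 \<le> h x"
  shows "AE x in m. 0 \<le> res \<alpha> h x"
  using res_mono[OF assms(1) _ assms(2,3)] res_zero[OF assms(1)] by auto

lemma res_antimono:
  assumes "0 < \<alpha>" "\<alpha> \<le> \<beta>" "h \<in> L2 m" "AE x in m. 0 \<le> h x"
  shows "AE x in m. res \<beta> h x \<le> res \<alpha> h x"
proof (rule res_compare)
  fix v assume v: "v \<in> D" "\<And>x. 0 \<le> v x"
  have "0 \<le> inner_L2 m (res \<alpha> h) v"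
    using inner_L2_mono[of "\<lambda>x. 0" "res \<alpha> h" v] res_nonneg[OF assms(1,3,4)] v D_L2 assms
    by (simp add: inner_L2_def)
  then have "0 \<le> (\<beta> - \<alpha>) * inner_L2 m (res \<alpha> h) v" using assms by simp
  also have "\<dots> = Ea \<beta> (res \<alpha> h) v - Ea \<alpha> (res \<alpha> h) v" by (simp add: Ea_def algebra_simps)
  finally show "inner_L2 m h v \<le> Ea \<beta> (res \<alpha> h) v" using Ea_res[OF assms(1,3) v(1)] by simp
qed (use assms in auto)

lemma res_abs_le:
  assumes "0 < \<alpha>" "h \<in> L2 m" "h' \<in> L2 m" "AE x in m. \<bar>h x\<bar> \<le> h' x"
  shows "AE x in m. \<bar>res \<alpha> h x\<bar> \<le> res \<alpha> h' x"
proof -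
  interpret A: definite_markov_form m D "Ea \<alpha>" by (rule markov_Ea[OF assms(1)])
  have "AE x in m. res \<alpha> h x \<le> res \<alpha> h' x"
    using assms by (intro res_mono) auto
  moreover have "AE x in m. res \<alpha> (\<lambda>x. - h x) x \<le> res \<alpha> h' x"
    using assms by (intro res_mono) auto
  moreover have "AE x in m. - res \<alpha> h x \<le> res \<alpha> (\<lambda>x. - h x) x"
  proof -
    have "AE x in m. 0 \<le> res \<alpha> (\<lambda>x. - h x) x + res \<alpha> h x"
      by (rule A.nonneg_if_form_nonneg)
        (use assms D_L2 in \<open>simp_all add: A.form_linear Ea_res L2.form_linear\<close>)
    then show ?thesis by eventually_elim simp
  qed
  ultimately show ?thesis by eventually_elim linarith
qed

text \<open>With \<open>z = res 1 u\<close> the resolvent equation reads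
  \<open>\<E> z v = inner_L2 m (u - z) v\<close>. For \<open>v = z - u\<close> the right-hand side
  is minus a square, so \<open>\<E> z z \<le> \<E> z u\<close>, and Cauchy-Schwarz finishes.\<close>

lemma nrm_res_le:
  assumes u: "u \<in> D"
  shows "D.nrm (res 1 u) \<le> D.nrm u"
proof -
  let ?z = "res 1 u"
  have z: "?z \<in> D" using u D_L2 by simp
  have "\<E> ?z ?z - \<E> ?z u = - inner_L2 m (\<lambda>x. ?z x - u x) (\<lambda>x. ?z x - u x)"
    using Ea_res[of 1 u ?z] Ea_res[of 1 u u] u z D_L2 L2.form_sym[of u ?z]
    by (simp add: Ea_def L2.form_linear)
  also have "\<dots> \<le> 0" using z u D_L2 by simp
  finally have "\<E> ?z ?z \<le> \<E> ?z u" by simp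
  also have "\<dots> \<le> D.nrm ?z * D.nrm u" using D.Cauchy_Schwarz[OF z u] by simp
  finally have "D.nrm ?z * D.nrm ?z \<le> D.nrm ?z * D.nrm u"
    using D.nrm_sq[OF z] by (simp add: power2_eq_square)
  then show ?thesis using D.nrm_nonneg[OF z] D.nrm_nonneg[OF u]
    by (cases "D.nrm ?z = 0") (auto simp: mult_le_cancel_left)
qed

section \<open>The reference density of a transient form and its resolvent\<close>

definition ref :: "'a \<Rightarrow> real" where
  "ref = (SOME g. integrable m g \<and> (\<forall>x. 0 \<le> g x) \<and> (\<exists>C. \<forall>x. g x \<le> C) \<and> (AE x in m. 0 < g x) \<and>
     (\<forall>u\<in>D. (\<integral>\<^sup>+x. ennreal (\<bar>u x\<bar> * g x) \<partial>m) \<le> ennreal (D.nrm u)))"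

text \<open>The density given by transience is positive only a.e.; its positive part agrees with it
  a.e. and is nonnegative at every point, which later allows pointwise estimates.\<close>

lemma ref_ex: "integrable m ref \<and> (\<forall>x. 0 \<le> ref x) \<and> (\<exists>C. \<forall>x. ref x \<le> C) \<and> (AE x in m. 0 < ref x) \<and>
     (\<forall>u\<in>D. (\<integral>\<^sup>+x. ennreal (\<bar>u x\<bar> * ref x) \<partial>m) \<le> ennreal (D.nrm u))"
proof -
  obtain g where g: "integrable m g" "bounded (range g)" "AE x in m. 0 < g x"
    "\<And>u. u \<in> D \<Longrightarrow> (\<integral>\<^sup>+x. ennreal (\<bar>u x\<bar> * g x) \<partial>m) \<le> ennreal (sqrt (\<E> u u))"
    using transient unfolding transient_form_def by blast
  obtain C where C: "\<And>x. \<bar>g x\<bar> \<le> C" using g(2) by (auto simp: bounded_iff)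
  let ?g = "\<lambda>x. max (g x) 0"
  have "(\<integral>\<^sup>+x. ennreal (\<bar>u x\<bar> * ?g x) \<partial>m) \<le> ennreal (D.nrm u)" if "u \<in> D" for u
  proof -
    have "(\<integral>\<^sup>+x. ennreal (\<bar>u x\<bar> * ?g x) \<partial>m) = (\<integral>\<^sup>+x. ennreal (\<bar>u x\<bar> * g x) \<partial>m)"
      by (rule nn_integral_cong_AE) (use g(3) in \<open>auto elim!: eventually_mono\<close>)
    then show ?thesis using g(4)[OF that] by (simp add: D.nrm_def)
  qed
  moreover have "?g x \<le> C" for x using C[of x] by auto
  moreover have "AE x in m. 0 < ?g x" using g(3) by eventually_elim simp
  moreover have "integrable m ?g" using g(1) by (intro integrable_max) auto
  ultimately have "\<exists>g. integrable m g \<and> (\<forall>x. 0 \<le> g x) \<and> (\<exists>C. \<forall>x. g x \<le> C) \<and> (AE x in m. 0 < g x) \<and>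
     (\<forall>u\<in>D. (\<integral>\<^sup>+x. ennreal (\<bar>u x\<bar> * g x) \<partial>m) \<le> ennreal (D.nrm u))"
    by (intro exI[of _ ?g]) auto
  from someI_ex[OF this, folded ref_def] show ?thesis .
qed

lemma ref_integrable: "integrable m ref"
  and ref_nonneg: "0 \<le> ref x"
  and ref_pos: "AE x in m. 0 < ref x"
  and ref_le_nrm: "u \<in> D \<Longrightarrow> (\<integral>\<^sup>+x. ennreal (\<bar>u x\<bar> * ref x) \<partial>m) \<le> ennreal (D.nrm u)"
  using ref_ex by auto

lemma ref_measurable [measurable]: "ref \<in> borel_measurable m"
  using ref_integrable by auto

lemma ref_L2: "ref \<in> L2 m"
proof -
  obtain C where "\<And>x. ref x \<le> C" using ref_ex by blast
  then show ?thesis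
    by (intro L2_if_integrable_bounded[OF ref_integrable, of C]) (auto simp: ref_nonneg abs_of_nonneg)
qed

text \<open>By symmetry the resolvent moves from \<open>ref\<close> to the other factor, where the
  transience inequality and the contraction in energy apply. The argument is run for
  \<open>min \<bar>u\<bar> n\<close>, which lies in \<open>D\<close> and has no more energy than
  \<open>u\<close>; Fatou's lemma removes the cut-off.\<close>

lemma res_ref_le_nrm:
  assumes u: "u \<in> D"
  shows "(\<integral>\<^sup>+x. ennreal (\<bar>u x\<bar> * res 1 ref x) \<partial>m) \<le> ennreal (D.nrm u)"
proof -
  have G: "res 1 ref \<in> D" using ref_L2 by simp
  have G0: "AE x in m. 0 \<le> res 1 ref x" using ref_L2 ref_nonneg by (intro res_nonneg) auto
  note meas [measurable] = D.measurable[OF u] D.measurable[OF G]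
  have bound: "(\<integral>\<^sup>+x. ennreal (\<bar>min \<bar>u x\<bar> (real (Suc n))\<bar> * res 1 ref x) \<partial>m) \<le> ennreal (D.nrm u)" for n
  proof -
    let ?w = "\<lambda>x. min \<bar>u x\<bar> (real (Suc n))"
    have w: "?w \<in> D" using u by (intro D.min_abs_mem) auto
    then have z: "res 1 ?w \<in> D" using D_L2 by simp
    have "(\<integral>\<^sup>+x. ennreal (\<bar>?w x\<bar> * res 1 ref x) \<partial>m) = ennreal (inner_L2 m (?w) (res 1 ref))"
      unfolding inner_L2_def
      by (subst nn_integral_eq_integral) (use L2_mult_integrable[OF D_L2[OF w] D_L2[OF G]] G0 in auto)
    also have "inner_L2 m ?w (res 1 ref) = Ea 1 (res 1 ?w) (res 1 ref)"
      using w G D_L2 by (simp add: Ea_res)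
    also have "\<dots> = Ea 1 (res 1 ref) (res 1 ?w)"
      unfolding Ea_def using D.form_sym[OF z G] L2.form_sym[OF D_L2[OF z] D_L2[OF G]] by simp
    also have "\<dots> = inner_L2 m ref (res 1 ?w)" using z ref_L2 by (simp add: Ea_res)
    also have "ennreal \<dots> \<le> (\<integral>\<^sup>+x. ennreal (\<bar>res 1 ?w x\<bar> * ref x) \<partial>m)"
    proof -
      have int: "integrable m (\<lambda>x. ref x * res 1 ?w x)"
        using L2_mult_integrable ref_L2 D_L2[OF z] by blast
      have "inner_L2 m ref (res 1 ?w) \<le> (\<integral>x. \<bar>ref x * res 1 ?w x\<bar> \<partial>m)"
        unfolding inner_L2_def by (intro integral_mono int integrable_abs) auto
      also have "ennreal \<dots> = (\<integral>\<^sup>+x. ennreal (\<bar>res 1 ?w x\<bar> * ref x) \<partial>m)"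
        by (subst nn_integral_eq_integral[symmetric])
          (use integrable_abs[OF int] ref_nonneg in \<open>auto simp: abs_mult mult.commute\<close>)
      finally show ?thesis by (simp add: ennreal_leI)
    qed
    also have "\<dots> \<le> ennreal (D.nrm (res 1 ?w))" by (rule ref_le_nrm[OF z])
    also have "\<dots> \<le> ennreal (D.nrm u)"
    proof (rule ennreal_leI)
      have "D.nrm (res 1 ?w) \<le> D.nrm ?w" by (rule nrm_res_le[OF w])
      also have "\<dots> \<le> D.nrm u"
        unfolding D.nrm_def using D.form_min_abs_le[OF u, of "real (Suc n)"] D.form_trunc_le(2)[OF u, of "real (Suc n)"]
        by simp
      finally show "D.nrm (res 1 ?w) \<le> D.nrm u" .
    qed
    finally show ?thesis .
  qed
  have "(\<integral>\<^sup>+x. ennreal (\<bar>\<bar>u x\<bar>\<bar> * res 1 ref x) \<partial>m) \<le> ennreal (D.nrm u)"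
  proof (rule nn_integral_weighted_Fatou[OF _ _ _ always_eventually[OF allI[OF bound]]])
    show "AE x in m. (\<lambda>n. min \<bar>u x\<bar> (real (Suc n))) \<longlonglongrightarrow> \<bar>u x\<bar>"
    proof (rule AE_I2)
      fix x
      obtain N :: nat where "\<bar>u x\<bar> \<le> real N" using real_arch_simple by blast
      then have "\<forall>\<^sub>F n in sequentially. min \<bar>u x\<bar> (real (Suc n)) = \<bar>u x\<bar>"
        by (intro eventually_sequentiallyI[of N]) auto
      then show "(\<lambda>n. min \<bar>u x\<bar> (real (Suc n))) \<longlonglongrightarrow> \<bar>u x\<bar>" by (rule tendsto_eventually)
    qed
  qed auto
  then show ?thesis by simp
qed

text \<open>Well-definedness of the extended form.  The functions \<open>res 1 h\<close> with \<open>\<bar>h\<bar> \<le> ref\<close> are total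
  in \<open>D\<close>, and pairing with them is continuous for a weighted \<open>L\<^sup>1\<close>-norm dominated by the form.\<close>

lemma form_Cauchy_AE_null:
  assumes u: "\<And>n. u n \<in> D" and c: "D.form_Cauchy u" and ae: "AE x in m. (\<lambda>n. u n x) \<longlonglongrightarrow> 0"
  shows "(\<lambda>n. \<E> (u n) (u n)) \<longlonglongrightarrow> 0"
proof -
  interpret A: complete_form_space m D "Ea 1" by (rule complete_Ea) simp
  have G: "res 1 ref \<in> D" using ref_L2 by simp
  have G0: "AE x in m. 0 \<le> res 1 ref x" using ref_L2 ref_nonneg by (intro res_nonneg) auto
  note meas [measurable] = D.measurable[OF u] D.measurable[OF G]
  define I where "I n = (\<integral>\<^sup>+x. ennreal (\<bar>u n x\<bar> * (ref x + res 1 ref x)) \<partial>m)" for n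
  have rho: "(\<integral>\<^sup>+x. ennreal (\<bar>w x\<bar> * (ref x + res 1 ref x)) \<partial>m) \<le> ennreal (2 * D.nrm w)" if w: "w \<in> D" for w
  proof -
    note [measurable] = D.measurable[OF w]
    have "(\<integral>\<^sup>+x. ennreal (\<bar>w x\<bar> * (ref x + res 1 ref x)) \<partial>m)
      = (\<integral>\<^sup>+x. ennreal (\<bar>w x\<bar> * ref x) + ennreal (\<bar>w x\<bar> * res 1 ref x) \<partial>m)"
      by (rule nn_integral_cong_AE)
        (use G0 in \<open>eventually_elim, simp add: distrib_left ref_nonneg\<close>)
    also have "\<dots> = (\<integral>\<^sup>+x. ennreal (\<bar>w x\<bar> * ref x) \<partial>m) + (\<integral>\<^sup>+x. ennreal (\<bar>w x\<bar> * res 1 ref x) \<partial>m)"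
      by (rule nn_integral_add) auto
    also have "\<dots> \<le> ennreal (D.nrm w) + ennreal (D.nrm w)"
      by (intro add_mono ref_le_nrm res_ref_le_nrm w)
    finally show ?thesis using w by (simp flip: ennreal_plus)
  qed
  have I0: "I \<longlonglongrightarrow> 0"
  proof (rule tendsto_0_if_Limsup_eq_0_ennreal, rule antisym[OF _ zero_le])
    show "limsup I \<le> 0"
    proof (rule ennreal_le_epsilon)
      fix e :: real assume e: "0 < e"
      then have "(e / 2)\<^sup>2 > 0" by simp
      then obtain N where N: "\<And>i j. i \<ge> N \<Longrightarrow> j \<ge> N \<Longrightarrow>
        \<E> (\<lambda>x. u i x - u j x) (\<lambda>x. u i x - u j x) < (e / 2)\<^sup>2"
        using c unfolding D.form_Cauchy_def by meson
      \<comment> \<open>Fatou in the second index with \<open>i\<close> fixed: since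
        \<open>u j\<close> tends to 0 a.e., \<open>u i - u j\<close> tends to \<open>u i\<close>,
        while the Cauchy property bounds the energy of the differences.\<close>
      have "I i \<le> ennreal e" if i: "i \<ge> N" for i
        unfolding I_def
      proof (rule nn_integral_weighted_Fatou[where f = "\<lambda>j x. u i x - u j x"])
        show "AE x in m. (\<lambda>n. u i x - u n x) \<longlonglongrightarrow> u i x"
          using ae by eventually_elim (auto intro!: tendsto_eq_intros)
        show "\<forall>\<^sub>F j in sequentially. (\<integral>\<^sup>+x. ennreal (\<bar>u i x - u j x\<bar> * (ref x + res 1 ref x)) \<partial>m) \<le> ennreal e"
        proof (rule eventually_sequentiallyI[of N])
          fix j assume j: "N \<le> j"
          have "D.nrm (\<lambda>x. u i x - u j x) \<le> e / 2"
            unfolding D.nrm_def using N[OF i j] e by (intro real_le_lsqrt) auto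
          then have "ennreal (2 * D.nrm (\<lambda>x. u i x - u j x)) \<le> ennreal e"
            by (intro ennreal_leI) simp
          then show "(\<integral>\<^sup>+x. ennreal (\<bar>u i x - u j x\<bar> * (ref x + res 1 ref x)) \<partial>m) \<le> ennreal e"
            using rho[of "\<lambda>x. u i x - u j x"] u order_trans by auto
        qed
      qed auto
      then show "limsup I \<le> 0 + ennreal e"
        by (intro Limsup_bounded eventually_sequentiallyI[of N]) auto
    qed
  qed
  \<comment> \<open>The directions in which \<open>u n\<close> tends weakly to zero. Once
    \<open>S\<close> is dense, the Cauchy property upgrades weak convergence to convergence of the
    energies.\<close>
  define S where "S = {v \<in> D. (\<lambda>n. \<E> (u n) v) \<longlonglongrightarrow> 0}"
  have resS: "res 1 h \<in> S" if h: "h \<in> L2 m" "\<And>x. \<bar>h x\<bar> \<le> ref x" for h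
  proof -
    have s: "res 1 h \<in> D" using h by simp
    note [measurable] = D.measurable[OF s] L2.measurable[OF h(1)]
    have le: "AE x in m. \<bar>res 1 h x\<bar> \<le> res 1 ref x"
      by (rule res_abs_le) (use h ref_L2 in auto)
    have bd: "\<bar>\<E> (u n) (res 1 h)\<bar> \<le> enn2real (I n)" for n
    proof -
      have int: "integrable m (\<lambda>x. u n x * (h x - res 1 h x))"
        by (rule L2_mult_integrable) (use h s D_L2 u in auto)
      have "\<E> (u n) (res 1 h) = inner_L2 m (u n) (\<lambda>x. h x - res 1 h x)"
        using Ea_res[of 1 h "u n"] h u s D_L2 D.form_sym[of "u n" "res 1 h"]
          L2.form_sym[of "u n" "res 1 h"] L2.form_sym[of "u n" h]
        by (simp add: Ea_def L2.form_linear)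
      then have "\<bar>\<E> (u n) (res 1 h)\<bar> \<le> (\<integral>x. \<bar>u n x * (h x - res 1 h x)\<bar> \<partial>m)"
        unfolding inner_L2_def by (simp only: integral_abs_bound)
      then have "ennreal \<bar>\<E> (u n) (res 1 h)\<bar> \<le> (\<integral>\<^sup>+x. ennreal \<bar>u n x * (h x - res 1 h x)\<bar> \<partial>m)"
        by (subst nn_integral_eq_integral) (use int in \<open>auto intro: ennreal_leI\<close>)
      also have "\<dots> \<le> I n"
        unfolding I_def
      proof (rule nn_integral_mono_AE, use le in eventually_elim)
        case (elim x)
        have "\<bar>h x - res 1 h x\<bar> \<le> ref x + res 1 ref x" using elim h(2)[of x] by linarith
        then show ?case by (intro ennreal_leI) (simp add: abs_mult mult_left_mono)
      qed
      finally have le: "ennreal \<bar>\<E> (u n) (res 1 h)\<bar> \<le> I n" .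
      have "I n \<le> ennreal (2 * D.nrm (u n))" unfolding I_def by (rule rho[OF u])
      then have "I n < top" using ennreal_less_top le_less_trans by blast
      with le have "enn2real (ennreal \<bar>\<E> (u n) (res 1 h)\<bar>) \<le> enn2real (I n)"
        by (intro enn2real_mono)
      then show ?thesis by simp
    qed
    have "(\<lambda>n. enn2real (I n)) \<longlonglongrightarrow> 0"
      by (rule tendsto_enn2real) (simp_all add: I0)
    then have "(\<lambda>n. \<E> (u n) (res 1 h)) \<longlonglongrightarrow> 0"
      by (rule Lim_null_comparison[rotated]) (intro always_eventually allI, simp add: bd)
    then show ?thesis using s by (simp add: S_def)
  qed
  have dense: "\<exists>s\<in>S. Ea 1 (\<lambda>x. v x - s x) (\<lambda>x. v x - s x) < \<epsilon>" if "v \<in> D" "\<epsilon> > 0" for v \<epsilon>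
  proof (rule A.dense_if_orthogonal_trivial[OF _ _ _ _ _ that])
    show "S \<subseteq> D" by (auto simp: S_def)
    show "(\<lambda>x. 0) \<in> S" by (simp add: S_def D.form_zero_right u)
    show "(\<lambda>x. a x + b x) \<in> S" if "a \<in> S" "b \<in> S" for a b
      using that u tendsto_add_zero[of "\<lambda>n. \<E> (u n) a" _ "\<lambda>n. \<E> (u n) b"]
      by (simp add: S_def D.form_add_right)
    show "(\<lambda>x. k * a x) \<in> S" if "a \<in> S" for a k
      using that u tendsto_mult_right_zero[of "\<lambda>n. \<E> (u n) a" _ k]
      by (simp add: S_def D.form_scale_right)
    fix p assume p: "p \<in> D" and orth: "\<And>s. s \<in> S \<Longrightarrow> Ea 1 p s = 0"
    note [measurable] = D.measurable[OF p]
    \<comment> \<open>\<open>p\<close> truncated to the interval between \<open>- ref\<close> and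
      \<open>ref\<close>. The product \<open>h * p\<close> is nonnegative and, where
      \<open>ref\<close> is positive, vanishes only if \<open>p\<close> does; orthogonality to
      \<open>res 1 h\<close> says that its integral is zero.\<close>
    define h where "h x = min (ref x) (max (- ref x) (p x))" for x
    have hb: "\<bar>h x\<bar> \<le> ref x" for x unfolding h_def using ref_nonneg[of x] by auto
    have "h \<in> borel_measurable m" unfolding h_def by (intro borel_measurable_min borel_measurable_max) auto
    then have h: "h \<in> L2 m"
      by (rule L2_bounded_by[OF _ ref_L2]) (use hb in \<open>auto simp: ref_nonneg\<close>)
    have "inner_L2 m h p = 0"
      using orth[OF resS[OF h hb]] Ea_res[OF _ h p, of 1] h p D_L2 A.form_sym[of p "res 1 h"] by simp
    then have 0: "(\<integral>x. h x * p x \<partial>m) = 0" by (simp add: inner_L2_def)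
    have nn: "0 \<le> h x * p x" for x
      unfolding h_def using ref_nonneg[of x] by (auto simp: min_def max_def zero_le_mult_iff)
    have "AE x in m. h x * p x = 0"
      using integral_nonneg_eq_0_iff_AE[OF L2_mult_integrable[OF h D_L2[OF p]]] nn 0 by auto
    then have "AE x in m. p x = 0"
      using ref_pos by eventually_elim (auto simp: h_def min_def max_def split: if_splits)
    then show "Ea 1 p p = 0" using A.AE_form[of p "\<lambda>x. 0" p] p A.form_zero_left by simp
  qed
  obtain K where K: "\<And>n. D.nrm (u n) \<le> K" by (rule D.form_Cauchy_bounded[OF u c]) (rule that)
  have K0: "0 \<le> K" using K[of 0] D.nrm_nonneg[OF u[of 0]] by linarith
  show ?thesis
  proof (rule LIMSEQ_I)
    fix r :: real assume r: "r > 0"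
    \<comment> \<open>The energy of \<open>u n\<close> is split through \<open>u N\<close> and
      \<open>s\<close>. Two of the three terms are bounded by \<open>K * e\<close>, hence by
      \<open>r / 3\<close>; adding 1 to \<open>K\<close> avoids division by zero.\<close>
    define e where "e = r / (3 * (K + 1))"
    have e: "e > 0" using r K0 by (simp add: e_def)
    have eK: "K * e \<le> r / 3" unfolding e_def using K0 r by (simp add: field_simps)
    obtain N where N: "\<And>i j. i \<ge> N \<Longrightarrow> j \<ge> N \<Longrightarrow> \<E> (\<lambda>x. u i x - u j x) (\<lambda>x. u i x - u j x) < e\<^sup>2"
      using c e unfolding D.form_Cauchy_def by (meson zero_less_power)
    obtain s where s: "s \<in> S" "Ea 1 (\<lambda>x. u N x - s x) (\<lambda>x. u N x - s x) < e\<^sup>2"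
      using dense[OF u, of "e\<^sup>2" N] e by auto
    have sD: "s \<in> D" using s by (simp add: S_def)
    have "0 \<le> inner_L2 m (\<lambda>x. u N x - s x) (\<lambda>x. u N x - s x)" using u sD D_L2 by simp
    then have "\<E> (\<lambda>x. u N x - s x) (\<lambda>x. u N x - s x) \<le> e\<^sup>2" using s(2) by (simp add: Ea_def)
    then have sN: "D.nrm (\<lambda>x. u N x - s x) \<le> e" unfolding D.nrm_def using e by (simp add: real_le_lsqrt)
    have "(\<lambda>n. \<E> (u n) s) \<longlonglongrightarrow> 0" using s by (simp add: S_def)
    from LIMSEQ_D[OF this, of "r/3"] r obtain M where M: "\<And>n. n \<ge> M \<Longrightarrow> \<bar>\<E> (u n) s\<bar> < r / 3" by auto
    show "\<exists>N. \<forall>n\<ge>N. norm (\<E> (u n) (u n) - 0) < r"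
    proof (intro exI[of _ "max M N"] allI impI)
      fix n assume n: "n \<ge> max M N"
      have "D.nrm (\<lambda>x. u n x - u N x) \<le> e"
        unfolding D.nrm_def using N[of n N] n e by (simp add: real_le_lsqrt less_imp_le)
      then have "D.nrm (u n) * D.nrm (\<lambda>x. u n x - u N x) \<le> K * e"
        using K[of n] u e K0 by (intro mult_mono) auto
      moreover have "D.nrm (u n) * D.nrm (\<lambda>x. u N x - s x) \<le> K * e"
        using K[of n] u sN K0 sD by (intro mult_mono) auto
      moreover have "\<E> (u n) (u n) = \<E> (u n) (\<lambda>x. u n x - u N x) + \<E> (u n) (\<lambda>x. u N x - s x) + \<E> (u n) s"
        using u sD by (simp add: D.form_linear)
      moreover have "0 \<le> \<E> (u n) (u n)" using u by simp
      ultimately show "norm (\<E> (u n) (u n) - 0) < r"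
        using D.Cauchy_Schwarz[OF u[of n] D.diff_mem[OF u[of n] u[of N]]]
          D.Cauchy_Schwarz[OF u[of n] D.diff_mem[OF u[of N] sD]] M[of n] n eK
        unfolding real_norm_def by linarith
    qed
  qed
qed

end

section \<open>The extended Dirichlet space as a Hilbert space\<close>

context dirichlet_space
begin

abbreviation De :: "('a \<Rightarrow> real) set" where "De \<equiv> ext_space m D \<E>"

abbreviation approx :: "(nat \<Rightarrow> 'a \<Rightarrow> real) \<Rightarrow> ('a \<Rightarrow> real) \<Rightarrow> bool" where
  "approx \<equiv> approx_seq m D \<E>"

lemma approx_iff:
  "approx un u \<longleftrightarrow> (\<forall>n. un n \<in> D) \<and> D.form_Cauchy un \<and> (AE x in m. (\<lambda>n. un n x) \<longlonglongrightarrow> u x)"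
  by (simp add: approx_seq_def D.form_Cauchy_def)

lemma De_approx: "u \<in> De \<Longrightarrow> \<exists>un. approx un u"
  by (simp add: ext_space_def)

lemma De_measurable: "u \<in> De \<Longrightarrow> u \<in> borel_measurable m"
  by (simp add: ext_space_def)

lemma D_Cauchy_nrm:
  assumes "\<And>n. u n \<in> D" "D.form_Cauchy u" "e > 0"
  obtains N where "\<And>i j. i \<ge> N \<Longrightarrow> j \<ge> N \<Longrightarrow> D.nrm (\<lambda>x. u i x - u j x) < e"
proof -
  have "e\<^sup>2 > 0" using assms by simp
  then obtain N where N: "\<And>i j. i \<ge> N \<Longrightarrow> j \<ge> N \<Longrightarrow> \<E> (\<lambda>x. u i x - u j x) (\<lambda>x. u i x - u j x) < e\<^sup>2"
    using assms(2) unfolding D.form_Cauchy_def by meson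
  show ?thesis
  proof (rule that)
    fix i j assume "i \<ge> N" "j \<ge> N"
    from N[OF this] show "D.nrm (\<lambda>x. u i x - u j x) < e"
      unfolding D.nrm_def using assms(3) by (intro real_less_lsqrt) auto
  qed
qed

lemma D_CauchyI:
  assumes "\<And>n. u n \<in> D" "\<And>e. e > 0 \<Longrightarrow> \<exists>N. \<forall>i\<ge>N. \<forall>j\<ge>N. D.nrm (\<lambda>x. u i x - u j x) < e"
  shows "D.form_Cauchy u"
  unfolding D.form_Cauchy_def
proof (intro allI impI)
  fix e :: real assume "e > 0"
  then obtain N where N: "\<And>i j. i \<ge> N \<Longrightarrow> j \<ge> N \<Longrightarrow> D.nrm (\<lambda>x. u i x - u j x) < sqrt e"
    using assms(2)[of "sqrt e"] by auto
  then have "\<E> (\<lambda>x. u i x - u j x) (\<lambda>x. u i x - u j x) < e" if "i \<ge> N" "j \<ge> N" for i j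
    using N[OF that] by (simp add: D.nrm_def)
  then show "\<exists>N. \<forall>i\<ge>N. \<forall>j\<ge>N. \<E> (\<lambda>x. u i x - u j x) (\<lambda>x. u i x - u j x) < e" by blast
qed

lemma approx_add:
  assumes "approx un u" "approx vn v"
  shows "approx (\<lambda>n x. un n x + vn n x) (\<lambda>x. u x + v x)"
proof -
  have un: "un n \<in> D" "D.form_Cauchy un" and vn: "vn n \<in> D" "D.form_Cauchy vn" for n
    using assms by (auto simp: approx_iff)
  have "D.form_Cauchy (\<lambda>n x. un n x + vn n x)"
  proof (rule D_CauchyI)
    fix e :: real assume "e > 0"
    then have e2: "e / 2 > 0" by simp
    obtain N where N: "\<And>i j. i \<ge> N \<Longrightarrow> j \<ge> N \<Longrightarrow> D.nrm (\<lambda>x. un i x - un j x) < e / 2"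
      by (rule D_Cauchy_nrm[OF un e2]) blast
    obtain M where M: "\<And>i j. i \<ge> M \<Longrightarrow> j \<ge> M \<Longrightarrow> D.nrm (\<lambda>x. vn i x - vn j x) < e / 2"
      by (rule D_Cauchy_nrm[OF vn e2]) blast
    show "\<exists>N. \<forall>i\<ge>N. \<forall>j\<ge>N. D.nrm (\<lambda>x. (un i x + vn i x) - (un j x + vn j x)) < e"
    proof (intro exI[of _ "max N M"] allI impI)
      fix i j assume ij: "i \<ge> max N M" "j \<ge> max N M"
      have "D.nrm (\<lambda>x. (un i x - un j x) + (vn i x - vn j x)) < e"
        using D.nrm_triangle[of "\<lambda>x. un i x - un j x" "\<lambda>x. vn i x - vn j x"] N[of i j] M[of i j] ij un vn
        by simp
      then show "D.nrm (\<lambda>x. (un i x + vn i x) - (un j x + vn j x)) < e"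
        by (simp add: algebra_simps)
    qed
  qed (use un vn in auto)
  moreover have "AE x in m. (\<lambda>n. un n x + vn n x) \<longlonglongrightarrow> u x + v x"
    using assms unfolding approx_iff by (auto elim!: eventually_elim2 intro: tendsto_add)
  ultimately show ?thesis using un vn by (simp add: approx_iff)
qed

lemma approx_scale:
  assumes "approx un u"
  shows "approx (\<lambda>n x. c * un n x) (\<lambda>x. c * u x)"
proof -
  have un: "un n \<in> D" "D.form_Cauchy un" for n
    using assms by (auto simp: approx_iff)
  have "D.form_Cauchy (\<lambda>n x. c * un n x)"
  proof (rule D_CauchyI)
    fix e :: real assume e: "e > 0"
    then have e2: "e / (\<bar>c\<bar> + 1) > 0" by simp
    obtain N where N: "\<And>i j. i \<ge> N \<Longrightarrow> j \<ge> N \<Longrightarrow> D.nrm (\<lambda>x. un i x - un j x) < e / (\<bar>c\<bar> + 1)"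
      by (rule D_Cauchy_nrm[OF un e2]) blast
    show "\<exists>N. \<forall>i\<ge>N. \<forall>j\<ge>N. D.nrm (\<lambda>x. c * un i x - c * un j x) < e"
    proof (intro exI[of _ N] allI impI)
      fix i j assume ij: "i \<ge> N" "j \<ge> N"
      have "D.nrm (\<lambda>x. c * un i x - c * un j x) = D.nrm (\<lambda>x. c * (un i x - un j x))"
        by (simp add: algebra_simps)
      also have "\<dots> = \<bar>c\<bar> * D.nrm (\<lambda>x. un i x - un j x)" using un by (simp add: D.nrm_scale)
      also have "\<dots> \<le> \<bar>c\<bar> * (e / (\<bar>c\<bar> + 1))" using N[OF ij] by (intro mult_left_mono) auto
      also have "\<dots> < e" using e by (simp add: field_simps)
      finally show "D.nrm (\<lambda>x. c * un i x - c * un j x) < e" .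
    qed
  qed (use un in auto)
  moreover have "AE x in m. (\<lambda>n. c * un n x) \<longlonglongrightarrow> c * u x"
    using assms unfolding approx_iff by (auto elim!: eventually_mono intro: tendsto_mult_left)
  ultimately show ?thesis using un by (simp add: approx_iff)
qed

lemma approx_diff:
  assumes "approx un u" "approx vn v"
  shows "approx (\<lambda>n x. un n x - vn n x) (\<lambda>x. u x - v x)"
  using approx_add[OF assms(1) approx_scale[OF assms(2), of "-1"]] by simp

lemma approx_const: "u \<in> D \<Longrightarrow> approx (\<lambda>_. u) u"
  by (auto simp: approx_iff D.form_Cauchy_def D.form_zero_left)

lemma approx_cong: "approx un u \<Longrightarrow> AE x in m. u x = v x \<Longrightarrow> approx un v"
  unfolding approx_iff by (auto elim!: eventually_elim2)

text \<open>Makes the definite description in \<open>ext_energy\<close> meaningful: the difference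
  of two sequences approximating \<open>u\<close> is Cauchy and tends to 0 a.e., so its energy tends
  to 0 by \<open>form_Cauchy_AE_null\<close>.\<close>

lemma approx_energy_tendsto:
  assumes "approx un u"
  shows "(\<lambda>n. \<E> (un n) (un n)) \<longlonglongrightarrow> ext_energy m D \<E> u"
proof -
  have un: "un n \<in> D" "D.form_Cauchy un" for n
    using assms by (auto simp: approx_iff)
  have "Cauchy (\<lambda>n. D.nrm (un n))"
  proof (rule CauchyI)
    fix e :: real assume "e > 0"
    then obtain N where N: "\<And>i j. i \<ge> N \<Longrightarrow> j \<ge> N \<Longrightarrow> D.nrm (\<lambda>x. un i x - un j x) < e"
      using D_Cauchy_nrm[OF un] by blast
    have "norm (D.nrm (un i) - D.nrm (un j)) < e" if "i \<ge> N" "j \<ge> N" for i j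
      using D.nrm_diff_abs[OF un(1) un(1), of i j] N[OF that] by simp
    then show "\<exists>N. \<forall>i\<ge>N. \<forall>j\<ge>N. norm (D.nrm (un i) - D.nrm (un j)) < e" by blast
  qed
  then obtain l where "(\<lambda>n. D.nrm (un n)) \<longlonglongrightarrow> l"
    using Cauchy_convergent convergent_def by blast
  from tendsto_power[OF this, of 2] have l: "(\<lambda>n. \<E> (un n) (un n)) \<longlonglongrightarrow> l\<^sup>2"
    using un by (simp add: D.nrm_sq)
  have "l' = l\<^sup>2" if v: "approx vn u" "(\<lambda>n. \<E> (vn n) (vn n)) \<longlonglongrightarrow> l'" for vn l'
  proof -
    have vn: "vn n \<in> D" for n using v by (auto simp: approx_iff)
    have d: "approx (\<lambda>n x. un n x - vn n x) (\<lambda>x. 0)" using approx_diff[OF assms v(1)] by simp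
    then have "(\<lambda>n. \<E> (\<lambda>x. un n x - vn n x) (\<lambda>x. un n x - vn n x)) \<longlonglongrightarrow> 0"
      by (intro form_Cauchy_AE_null) (auto simp: approx_iff)
    then have "(\<lambda>n. D.nrm (\<lambda>x. un n x - vn n x)) \<longlonglongrightarrow> 0"
      using un vn by (subst D.nrm_tendsto_iff) auto
    then have "(\<lambda>n. D.nrm (un n) - D.nrm (vn n)) \<longlonglongrightarrow> 0"
      by (rule Lim_null_comparison[rotated]) (use D.nrm_diff_abs un vn in auto)
    moreover have "(\<lambda>n. D.nrm (un n) - D.nrm (vn n)) \<longlonglongrightarrow> sqrt (l\<^sup>2) - sqrt l'"
      unfolding D.nrm_def by (intro tendsto_intros l v)
    ultimately have "sqrt (l\<^sup>2) = sqrt l'" using LIMSEQ_unique by fastforce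
    then show ?thesis by (simp only: real_sqrt_eq_iff)
  qed
  then have "ext_energy m D \<E> u = l\<^sup>2"
    unfolding ext_energy_def using assms l by (intro the_equality) blast+
  then show ?thesis using l by simp
qed

text \<open>Polarization, because the extended form is given only on the diagonal.\<close>

definition Be :: "('a \<Rightarrow> real) \<Rightarrow> ('a \<Rightarrow> real) \<Rightarrow> real" where
  "Be u v = (ext_energy m D \<E> (\<lambda>x. u x + v x) - ext_energy m D \<E> (\<lambda>x. u x - v x)) / 4"

lemma approx_form_tendsto:
  assumes "approx un u" "approx vn v"
  shows "(\<lambda>n. \<E> (un n) (vn n)) \<longlonglongrightarrow> Be u v"
proof -
  have un: "un n \<in> D" and vn: "vn n \<in> D" for n
    using assms by (auto simp: approx_iff)
  have "(\<lambda>n. (\<E> (\<lambda>x. un n x + vn n x) (\<lambda>x. un n x + vn n x)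
      - \<E> (\<lambda>x. un n x - vn n x) (\<lambda>x. un n x - vn n x)) / 4) \<longlonglongrightarrow> Be u v"
    unfolding Be_def using approx_energy_tendsto[OF approx_add[OF assms]]
      approx_energy_tendsto[OF approx_diff[OF assms]] by (intro tendsto_intros) auto
  moreover have "(\<E> (\<lambda>x. un n x + vn n x) (\<lambda>x. un n x + vn n x)
      - \<E> (\<lambda>x. un n x - vn n x) (\<lambda>x. un n x - vn n x)) / 4 = \<E> (un n) (vn n)" for n
    using un vn D.form_sym[OF un vn, of n n] by (simp add: D.form_linear)
  ultimately show ?thesis by simp
qed

lemma Be_self: "u \<in> De \<Longrightarrow> Be u u = ext_energy m D \<E> u"
  using De_approx approx_form_tendsto approx_energy_tendsto LIMSEQ_unique by metis

end

sublocale dirichlet_space \<subseteq> V: form_space m De Be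
proof
  fix u v w :: "'a \<Rightarrow> real" and c :: real
  show "u \<in> borel_measurable m" if "u \<in> De" using that De_measurable by blast
  show "(\<lambda>x. 0) \<in> De"
    using approx_const[OF D.zero_mem] by (auto simp: ext_space_def)
  show "(\<lambda>x. u x + v x) \<in> De" if "u \<in> De" "v \<in> De"
    using that approx_add by (fastforce simp: ext_space_def)
  show "(\<lambda>x. c * u x) \<in> De" if "u \<in> De"
    using that approx_scale by (fastforce simp: ext_space_def)
  show "v \<in> De" if "u \<in> De" "v \<in> borel_measurable m" "AE x in m. u x = v x"
    using that approx_cong by (auto simp: ext_space_def)
  show "Be u w = Be v w" if h: "u \<in> De" "v \<in> De" "w \<in> De" and ae: "AE x in m. u x = v x"
  proof -
    obtain un wn where un: "approx un u" "approx wn w" using h De_approx by meson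
    show ?thesis
      using LIMSEQ_unique[OF approx_form_tendsto[OF un] approx_form_tendsto[OF approx_cong[OF un(1) ae] un(2)]] .
  qed
  show "Be u v = Be v u" if h: "u \<in> De" "v \<in> De"
  proof -
    obtain un vn where un: "approx un u" "approx vn v" using h De_approx by meson
    have "\<E> (un n) (vn n) = \<E> (vn n) (un n)" for n
      using un by (intro D.form_sym) (auto simp: approx_iff)
    then show ?thesis
      using LIMSEQ_unique[OF approx_form_tendsto[OF un]] approx_form_tendsto[OF un(2,1)] by simp
  qed
  show "Be (\<lambda>x. u x + v x) w = Be u w + Be v w" if h: "u \<in> De" "v \<in> De" "w \<in> De"
  proof -
    obtain un vn wn where un: "approx un u" "approx vn v" "approx wn w" using h De_approx by meson
    have "\<E> (\<lambda>x. un n x + vn n x) (wn n) = \<E> (un n) (wn n) + \<E> (vn n) (wn n)" for n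
      using un by (intro D.form_add_left) (auto simp: approx_iff)
    then show ?thesis
      using LIMSEQ_unique[OF approx_form_tendsto[OF approx_add[OF un(1,2)] un(3)]]
        tendsto_add[OF approx_form_tendsto[OF un(1,3)] approx_form_tendsto[OF un(2,3)]] by simp
  qed
  show "Be (\<lambda>x. c * u x) w = c * Be u w" if h: "u \<in> De" "w \<in> De"
  proof -
    obtain un wn where un: "approx un u" "approx wn w" using h De_approx by meson
    have "\<E> (\<lambda>x. c * un n x) (wn n) = c * \<E> (un n) (wn n)" for n
      using un by (intro D.form_scale_left) (auto simp: approx_iff)
    then show ?thesis
      using LIMSEQ_unique[OF approx_form_tendsto[OF approx_scale[OF un(1)] un(2)]]
        tendsto_mult_left[OF approx_form_tendsto[OF un]] by simp
  qed
  show "0 \<le> Be u u" if h: "u \<in> De"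
  proof -
    obtain un where un: "approx un u" using h De_approx by meson
    then have "0 \<le> \<E> (un n) (un n)" for n by (auto simp: approx_iff)
    then show ?thesis using LIMSEQ_le_const[OF approx_form_tendsto[OF un un]] by blast
  qed
qed

context dirichlet_space
begin

lemma D_subset_De: "u \<in> D \<Longrightarrow> u \<in> De"
  using approx_const D.measurable by (auto simp: ext_space_def)

lemma Be_D: "u \<in> D \<Longrightarrow> v \<in> D \<Longrightarrow> Be u v = \<E> u v"
  using approx_form_tendsto[OF approx_const approx_const] LIMSEQ_unique tendsto_const by metis

lemma V_nrm_D: "u \<in> D \<Longrightarrow> V.nrm u = D.nrm u"
  by (simp add: V.nrm_def D.nrm_def Be_D)

lemma approx_mem: "approx un u \<Longrightarrow> u \<in> borel_measurable m \<Longrightarrow> u \<in> De"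
  by (auto simp: ext_space_def)

lemma approx_nrm_tendsto:
  assumes a: "approx un u" and u: "u \<in> De"
  shows "(\<lambda>n. V.nrm (\<lambda>x. un n x - u x)) \<longlonglongrightarrow> 0"
proof -
  have un: "un n \<in> D" "D.form_Cauchy un" for n
    using a by (auto simp: approx_iff)
  have mem: "(\<lambda>x. un n x - u x) \<in> De" for n using un u D_subset_De by simp
  have "(\<lambda>n. Be (\<lambda>x. un n x - u x) (\<lambda>x. un n x - u x)) \<longlonglongrightarrow> 0"
  proof (rule LIMSEQ_I)
    fix e :: real assume "e > 0"
    then have "e / 2 > 0" by simp
    then obtain N where N: "\<And>i j. i \<ge> N \<Longrightarrow> j \<ge> N \<Longrightarrow> \<E> (\<lambda>x. un i x - un j x) (\<lambda>x. un i x - un j x) < e / 2"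
      using un(2) unfolding D.form_Cauchy_def by meson
    have "Be (\<lambda>x. un i x - u x) (\<lambda>x. un i x - u x) \<le> e / 2" if i: "i \<ge> N" for i
    proof -
      have ap: "approx (\<lambda>j x. un i x - un j x) (\<lambda>x. un i x - u x)"
        by (rule approx_diff[OF approx_const[OF un(1)] a])
      show ?thesis
        by (rule LIMSEQ_le_const2[OF approx_form_tendsto[OF ap ap]]) (use N i in \<open>auto intro: less_imp_le\<close>)
    qed
    moreover have "0 \<le> Be (\<lambda>x. un i x - u x) (\<lambda>x. un i x - u x)" for i using mem by simp
    ultimately show "\<exists>N. \<forall>n\<ge>N. norm (Be (\<lambda>x. un n x - u x) (\<lambda>x. un n x - u x) - 0) < e"
      using \<open>e > 0\<close> by (intro exI[of _ N]) (force simp: abs_of_nonneg)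
  qed
  then show ?thesis using mem by (subst V.nrm_tendsto_iff) auto
qed

lemma De_approximable:
  assumes "u \<in> De" "e > 0"
  shows "\<exists>v\<in>D. V.nrm (\<lambda>x. u x - v x) < e"
proof -
  obtain un where un: "approx un u" using assms De_approx by blast
  from order_tendstoD(2)[OF approx_nrm_tendsto[OF un assms(1)] assms(2)]
  obtain n where "V.nrm (\<lambda>x. un n x - u x) < e" by (auto simp: eventually_sequentially)
  moreover have "un n \<in> D" using un by (simp add: approx_iff)
  ultimately show ?thesis using V.nrm_diff_commute[OF D_subset_De assms(1)] by auto
qed

section \<open>Consequences of transience on the extended space: definiteness, completeness, lower
  semicontinuity\<close>

lemma ref_le_V_nrm:
  assumes u: "u \<in> De"
  shows "(\<integral>\<^sup>+x. ennreal (\<bar>u x\<bar> * ref x) \<partial>m) \<le> ennreal (V.nrm u)"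
proof (rule ennreal_le_epsilon)
  fix e :: real assume e: "0 < e"
  obtain un where un: "approx un u" using u De_approx by blast
  then have unD: "un n \<in> D" for n by (simp add: approx_iff)
  note [measurable] = D.measurable[OF unD]
  have "(\<lambda>n. D.nrm (un n)) \<longlonglongrightarrow> V.nrm u"
    unfolding D.nrm_def V.nrm_def by (intro tendsto_real_sqrt approx_form_tendsto un)
  then have "\<forall>\<^sub>F n in sequentially. D.nrm (un n) < V.nrm u + e"
    using e by (intro order_tendstoD) auto
  then have "\<forall>\<^sub>F n in sequentially. (\<integral>\<^sup>+x. ennreal (\<bar>un n x\<bar> * ref x) \<partial>m) \<le> ennreal (V.nrm u + e)"
  proof eventually_elim
    case (elim n)
    show ?case
      by (rule order_trans[OF ref_le_nrm[OF unD]]) (use elim in \<open>simp add: ennreal_leI\<close>)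
  qed
  then have "(\<integral>\<^sup>+x. ennreal (\<bar>u x\<bar> * ref x) \<partial>m) \<le> ennreal (V.nrm u + e)"
    using un by (intro nn_integral_weighted_Fatou[of un]) (auto simp: approx_iff)
  then show "(\<integral>\<^sup>+x. ennreal (\<bar>u x\<bar> * ref x) \<partial>m) \<le> ennreal (V.nrm u) + ennreal e"
    using e u by (simp flip: ennreal_plus)
qed

lemma V_definite:
  assumes u: "u \<in> De" and z: "Be u u = 0"
  shows "AE x in m. u x = 0"
proof -
  note [measurable] = De_measurable[OF u]
  have "(\<integral>\<^sup>+x. ennreal (\<bar>u x\<bar> * ref x) \<partial>m) = 0"
    using ref_le_V_nrm[OF u] z by (simp add: V.nrm_def)
  then have "AE x in m. ennreal (\<bar>u x\<bar> * ref x) = 0"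
    by (subst (asm) nn_integral_0_iff_AE) auto
  then show ?thesis using ref_pos
    by eventually_elim (simp add: ennreal_eq_0_iff mult_le_0_iff)
qed

text \<open>The weighted L1 norm with density \<open>ref\<close> is dominated by the energy norm, so
  the weighted integrals are summable and the sum of the integrands is finite a.e.; dividing by
  \<open>ref\<close> needs only its positivity a.e.\<close>

lemma AE_summable_if_nrm_geometric:
  assumes w: "\<And>n. w n \<in> De" and le: "\<And>n. V.nrm (w n) \<le> C * (1/2)^n"
  shows "AE x in m. summable (\<lambda>n. \<bar>w n x\<bar>)"
proof -
  note [measurable] = De_measurable[OF w]
  have C: "0 \<le> C" using order_trans[OF V.nrm_nonneg[OF w[of 0]] le[of 0]] by simp
  have "(\<integral>\<^sup>+x. (\<Sum>n. ennreal (\<bar>w n x\<bar> * ref x)) \<partial>m) = (\<Sum>n. \<integral>\<^sup>+x. ennreal (\<bar>w n x\<bar> * ref x) \<partial>m)"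
    by (rule nn_integral_suminf) simp
  also have "\<dots> \<le> (\<Sum>n. ennreal (C * (1/2)^n))"
    by (intro suminf_le order_trans[OF ref_le_V_nrm[OF w]] ennreal_leI le) auto
  also have "\<dots> = ennreal (\<Sum>n. C * (1/2)^n)"
    using C by (intro suminf_ennreal2 summable_mult summable_geometric) auto
  also have "\<dots> < top" by simp
  finally have "(\<integral>\<^sup>+x. (\<Sum>n. ennreal (\<bar>w n x\<bar> * ref x)) \<partial>m) \<noteq> \<infinity>" by simp
  then have "AE x in m. (\<Sum>n. ennreal (\<bar>w n x\<bar> * ref x)) \<noteq> \<infinity>"
    by (rule nn_integral_noteq_infinite[rotated]) simp
  then show ?thesis using ref_pos
  proof eventually_elim
    case (elim x)
    have "summable (\<lambda>n. \<bar>w n x\<bar> * ref x)"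
      by (rule summable_suminf_not_top) (use elim ref_nonneg in auto)
    then have "summable (\<lambda>n. (\<bar>w n x\<bar> * ref x) * (1 / ref x))" by (rule summable_mult2)
    then show ?case using elim(2) by simp
  qed
qed

lemma AE_tendsto_zero_if_nrm_geometric:
  assumes "\<And>n. w n \<in> De" "\<And>n. V.nrm (w n) \<le> C * (1/2)^n"
  shows "AE x in m. (\<lambda>n. w n x) \<longlonglongrightarrow> 0"
  using AE_summable_if_nrm_geometric[OF assms]
  by eventually_elim (rule tendsto_rabs_zero_cancel[OF summable_LIMSEQ_zero])

text \<open>Replace \<open>w n\<close> by an element \<open>d n\<close> of \<open>D\<close> at
  distance below \<open>(1/2)^n\<close>. The geometric rate makes \<open>w n - d n\<close> tend to 0
  a.e., so \<open>d\<close> is an approximating sequence for \<open>v\<close> in the sense of the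
  definition of the extended space.\<close>

lemma V_complete_AE:
  assumes w: "\<And>n. w n \<in> De" and c: "V.form_Cauchy w"
    and v: "v \<in> borel_measurable m" "AE x in m. (\<lambda>n. w n x) \<longlonglongrightarrow> v x"
  shows "v \<in> De" "(\<lambda>n. V.nrm (\<lambda>x. w n x - v x)) \<longlonglongrightarrow> 0"
proof -
  have "\<exists>d\<in>D. V.nrm (\<lambda>x. w n x - d x) < (1/2)^n" for n
    by (rule De_approximable[OF w]) simp
  then obtain d where d: "\<And>n. d n \<in> D" "\<And>n. V.nrm (\<lambda>x. w n x - d n x) < (1/2)^n" by metis
  have dV: "d n \<in> De" for n using d D_subset_De by blast
  have wd0: "(\<lambda>n. V.nrm (\<lambda>x. w n x - d n x)) \<longlonglongrightarrow> 0"
  proof (rule Lim_null_comparison)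
    show "(\<lambda>n. (1/2)^n :: real) \<longlonglongrightarrow> 0" by (rule LIMSEQ_realpow_zero) auto
    show "\<forall>\<^sub>F n in sequentially. norm (V.nrm (\<lambda>x. w n x - d n x)) \<le> (1/2)^n"
      using d(2) w dV by (intro always_eventually allI) (simp add: less_imp_le)
  qed
  have "AE x in m. (\<lambda>n. w n x - d n x) \<longlonglongrightarrow> 0"
    by (rule AE_tendsto_zero_if_nrm_geometric[where C = 1]) (use d(2) w dV in \<open>auto intro: less_imp_le\<close>)
  with v(2) have dlim: "AE x in m. (\<lambda>n. d n x) \<longlonglongrightarrow> v x"
  proof eventually_elim
    case (elim x)
    from tendsto_diff[OF elim] show ?case by simp
  qed
  have "D.form_Cauchy d"
  proof (rule D_CauchyI[OF d(1)])
    fix e :: real assume e: "e > 0"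
    then have "(e/3)\<^sup>2 > 0" by simp
    then obtain N where N: "\<And>i j. i \<ge> N \<Longrightarrow> j \<ge> N \<Longrightarrow> Be (\<lambda>x. w i x - w j x) (\<lambda>x. w i x - w j x) < (e/3)\<^sup>2"
      using c unfolding V.form_Cauchy_def by meson
    have "e/3 > 0" using e by simp
    from order_tendstoD(2)[OF wd0 this] obtain M
      where M: "\<And>n. n \<ge> M \<Longrightarrow> V.nrm (\<lambda>x. w n x - d n x) < e/3"
      unfolding eventually_sequentially by blast
    show "\<exists>N. \<forall>i\<ge>N. \<forall>j\<ge>N. D.nrm (\<lambda>x. d i x - d j x) < e"
    proof (intro exI[of _ "max M N"] allI impI)
      fix i j assume ij: "i \<ge> max M N" "j \<ge> max M N"
      have "V.nrm (\<lambda>x. w i x - w j x) < e/3"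
        unfolding V.nrm_def using N[of i j] ij e by (intro real_less_lsqrt) auto
      then have "V.nrm (\<lambda>x. d i x - d j x) < e"
        using V.nrm_triangle_diff[OF dV[of i] w[of i] dV[of j]]
          V.nrm_triangle_diff[OF w[of i] w[of j] dV[of j]] M[of i] M[of j] ij
          V.nrm_diff_commute[OF dV[of i] w[of i]] by auto
      then show "D.nrm (\<lambda>x. d i x - d j x) < e" using V_nrm_D d by simp
    qed
  qed
  then have ap: "approx d v" using d dlim by (simp add: approx_iff)
  show vDe: "v \<in> De" by (rule approx_mem[OF ap v(1)])
  show "(\<lambda>n. V.nrm (\<lambda>x. w n x - v x)) \<longlonglongrightarrow> 0"
  proof (rule tendsto_sandwich[OF _ _ tendsto_const])
    show "(\<lambda>n. V.nrm (\<lambda>x. w n x - d n x) + V.nrm (\<lambda>x. d n x - v x)) \<longlonglongrightarrow> 0"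
      using tendsto_add[OF wd0 approx_nrm_tendsto[OF ap vDe]] by simp
  qed (use V.nrm_triangle_diff[OF w dV vDe] w vDe in auto)
qed

text \<open>No weak topology is involved: nearly minimal elements in the hulls of the tails are
  Cauchy, and they keep the a.e. limit of the sequence, which identifies their limit in
  energy.\<close>

lemma Mazur:
  assumes v: "\<And>n. v n \<in> De" and K: "\<And>n. Be (v n) (v n) \<le> K"
    and u: "u \<in> borel_measurable m" "AE x in m. (\<lambda>n. v n x) \<longlonglongrightarrow> u x"
  obtains w where "u \<in> De" "\<And>N. w N \<in> mix {v n | n. n \<ge> N}" "(\<lambda>n. V.nrm (\<lambda>x. w n x - u x)) \<longlonglongrightarrow> 0"
    "AE x in m. (\<lambda>n. w n x) \<longlonglongrightarrow> u x"
proof -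
  obtain w where w: "\<And>N. w N \<in> mix {v n | n. n \<ge> N}" "V.form_Cauchy w"
    by (rule V.mix_Cauchy[OF v K]) (rule that)
  have wV: "w N \<in> De" for N by (rule V.mix_mem[OF w(1)]) (use v in auto)
  have "AE x in m. (\<lambda>n. w n x) \<longlonglongrightarrow> u x"
    using u(2) by eventually_elim (rule mix_tendsto[OF w(1)])
  with V_complete_AE[OF wV w(2) u(1)] w(1) that show ?thesis by blast
qed

text \<open>From some index on all energies are below \<open>b + e\<close>. Norm balls are convex,
  so the Mazur combinations of that tail obey the same bound and transmit it to the limit.\<close>

lemma form_lower_semicontinuous:
  assumes v: "\<And>n. v n \<in> De" and a: "\<And>n. Be (v n) (v n) \<le> a n" "a \<longlonglongrightarrow> b"
    and u: "u \<in> borel_measurable m" "AE x in m. (\<lambda>n. v n x) \<longlonglongrightarrow> u x"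
  shows "u \<in> De" "Be u u \<le> b"
proof -
  have step: "u \<in> De \<and> Be u u \<le> b + e" if "e > 0" for e
  proof -
    have "\<forall>\<^sub>F n in sequentially. a n < b + e" using a(2) that by (intro order_tendstoD) auto
    then obtain N where N: "\<And>n. n \<ge> N \<Longrightarrow> a n < b + e" by (auto simp: eventually_sequentially)
    have le: "Be (v (n + N)) (v (n + N)) \<le> b + e" for n
      using a(1)[of "n + N"] N[of "n + N"] by simp
    have ae: "AE x in m. (\<lambda>n. v (n + N) x) \<longlonglongrightarrow> u x"
      using u(2) by eventually_elim (rule LIMSEQ_ignore_initial_segment)
    obtain w where w: "u \<in> De" "\<And>M. w M \<in> mix {v (n + N) | n. n \<ge> M}"
      "(\<lambda>n. V.nrm (\<lambda>x. w n x - u x)) \<longlonglongrightarrow> 0"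
      by (rule Mazur[OF v le u(1) ae]) (rule that)
    have wV: "w M \<in> De" for M by (rule V.mix_mem[OF w(2)]) (use v in auto)
    have "V.nrm (w M) \<le> sqrt (b + e)" for M
      by (rule V.nrm_mix[OF w(2)]) (use v le in \<open>auto simp: V.nrm_def\<close>)
    moreover have "(\<lambda>n. V.nrm (w n)) \<longlonglongrightarrow> V.nrm u"
      unfolding V.nrm_def by (intro tendsto_real_sqrt V.form_tendsto wV w)
    ultimately have "V.nrm u \<le> sqrt (b + e)" by (intro LIMSEQ_le_const2) auto
    then show ?thesis using w(1) by (simp add: V.nrm_def)
  qed
  show "u \<in> De" using step[of 1] by simp
  show "Be u u \<le> b" by (rule field_le_epsilon) (use step in auto)
qed

end

text \<open>Contracting an approximating sequence preserves convergence a.e. but possibly not the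
  Cauchy property. Bounded energies and lower semicontinuity are enough to carry the Markov property
  over.\<close>

sublocale dirichlet_space \<subseteq> V: definite_markov_form m De Be
proof
  fix u assume u: "u \<in> De"
  then show "AE x in m. u x = 0" if "Be u u = 0" using V_definite that by blast
  let ?c = "\<lambda>u x. min (max (u x) 0) 1 :: real"
  obtain un where un: "approx un u" using u De_approx by blast
  then have unD: "un n \<in> D" for n by (simp add: approx_iff)
  note [measurable] = De_measurable[OF u]
  have c: "?c (un n) \<in> De" for n using D.unit_mem[OF unD] D_subset_De by blast
  have le: "Be (?c (un n)) (?c (un n)) \<le> \<E> (un n) (un n)" for n
    using D.unit_mem[OF unD] D.unit_le[OF unD] Be_D by simp
  have ae: "AE x in m. (\<lambda>n. ?c (un n) x) \<longlonglongrightarrow> ?c u x"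
    using un unfolding approx_iff by (auto elim!: eventually_mono intro!: tendsto_intros)
  show "?c u \<in> De" "Be (?c u) (?c u) \<le> Be u u"
    using form_lower_semicontinuous[OF c le approx_form_tendsto[OF un un] _ ae] by auto
qed

context dirichlet_space
begin

text \<open>Truncating an approximating sequence only keeps its energies bounded. Mazur's lemma
  restores convergence in energy, and convex combinations respect the bound \<open>C\<close> as well
  as membership in \<open>D\<close>.\<close>

lemma bounded_approximation:
  assumes v: "v \<in> De" and C: "0 < C" "\<And>x. \<bar>v x\<bar> \<le> C"
  obtains d where "\<And>n. d n \<in> D" "\<And>n x. \<bar>d n x\<bar> \<le> C" "AE x in m. (\<lambda>n. d n x) \<longlonglongrightarrow> v x"
    "(\<lambda>n. V.nrm (\<lambda>x. d n x - v x)) \<longlonglongrightarrow> 0"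
proof -
  obtain un where un: "approx un v" using v De_approx by blast
  then have unD: "un n \<in> D" "D.form_Cauchy un" for n by (auto simp: approx_iff)
  obtain K where K: "\<And>n. D.nrm (un n) \<le> K" by (rule D.form_Cauchy_bounded[OF unD]) (rule that)
  let ?t = "\<lambda>n. trunc C (un n)"
  have tD: "?t n \<in> D" for n using unD C by simp
  have tK: "Be (?t n) (?t n) \<le> K\<^sup>2" for n
  proof -
    have "Be (?t n) (?t n) \<le> (D.nrm (un n))\<^sup>2"
      using D.form_trunc_le(2)[OF unD(1) C(1)] tD by (simp add: Be_D D.nrm_sq unD)
    also have "\<dots> \<le> K\<^sup>2" using K[of n] unD by (intro power_mono) auto
    finally show ?thesis .
  qed
  have ae: "AE x in m. (\<lambda>n. ?t n x) \<longlonglongrightarrow> v x"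
  proof -
    have "AE x in m. (\<lambda>n. un n x) \<longlonglongrightarrow> v x" using un by (simp add: approx_iff)
    then show ?thesis
      by eventually_elim (use trunc_tendsto[where u = v and k = C] trunc_eq[where u = v and k = C] C in metis)
  qed
  obtain w where w: "\<And>N. w N \<in> mix {?t n | n. n \<ge> N}" "(\<lambda>n. V.nrm (\<lambda>x. w n x - v x)) \<longlonglongrightarrow> 0"
    "AE x in m. (\<lambda>n. w n x) \<longlonglongrightarrow> v x"
    by (rule Mazur[OF D_subset_De[OF tD] tK De_measurable[OF v] ae]) (rule that)
  have "w N \<in> D" for N by (rule D.mix_mem[OF w(1)]) (use tD in auto)
  moreover have "\<bar>w N x\<bar> \<le> C" for N x
  proof -
    have "\<bar>w N x - 0\<bar> \<le> C"
      by (rule mix_pointwise_bound[OF w(1)]) (use C in \<open>auto simp: abs_trunc\<close>)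
    then show ?thesis by simp
  qed
  ultimately show ?thesis using that w by blast
qed

end

section \<open>Potentials\<close>

context dirichlet_space
begin

definition L2_incseq :: "('a \<Rightarrow> real) \<Rightarrow> (nat \<Rightarrow> 'a \<Rightarrow> real) \<Rightarrow> bool" where
  "L2_incseq \<eta> h \<longleftrightarrow> (\<forall>n. h n \<in> L2 m) \<and> (\<forall>n x. 0 \<le> h n x) \<and>
     (\<forall>x. incseq (\<lambda>n. h n x)) \<and> (\<forall>x. (\<lambda>n. h n x) \<longlonglongrightarrow> \<eta> x)"

text \<open>Names the sequence picked inside \<open>resolvent_nonneg\<close>; nothing is known about
  it beyond \<open>L2_incseq\<close>.\<close>

definition L2_seq :: "('a \<Rightarrow> real) \<Rightarrow> nat \<Rightarrow> 'a \<Rightarrow> real" where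
  "L2_seq \<eta> = (SOME h. L2_incseq \<eta> h)"

lemma resolvent_nonneg_eq:
  "resolvent_nonneg m D \<E> \<alpha> \<eta> x = (SUP n. ennreal (res \<alpha> (L2_seq \<eta> n) x))"
  by (simp add: resolvent_nonneg_def L2_seq_def L2_incseq_def Let_def)

lemma L2_incseq_L2_seq:
  assumes p: "integrable m p" "\<And>x. 0 \<le> p x"
  shows "L2_incseq p (L2_seq p)"
  unfolding L2_seq_def
proof (rule someI[of "L2_incseq p"])
  let ?h = "\<lambda>n x. min (p x) (real n)"
  have "?h n \<in> L2 m" for n
  proof (rule L2_if_integrable_bounded[where C = "real n"])
    show "integrable m (?h n)"
      by (rule Bochner_Integration.integrable_bound[OF p(1)]) (use p in auto)
  qed (use p in auto)
  moreover have "(\<lambda>n. ?h n x) \<longlonglongrightarrow> p x" for x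
  proof (rule tendsto_eventually)
    obtain N :: nat where "p x \<le> real N" using real_arch_simple by blast
    then show "\<forall>\<^sub>F n in sequentially. ?h n x = p x"
      by (intro eventually_sequentiallyI[of N]) auto
  qed
  ultimately show "L2_incseq p ?h"
    using p by (auto simp: L2_incseq_def incseq_def intro!: min.coboundedI2)
qed

lemma
  assumes "L2_incseq p h"
  shows L2_incseq_L2: "h n \<in> L2 m" and L2_incseq_nonneg: "0 \<le> h n x"
    and L2_incseq_mono: "i \<le> j \<Longrightarrow> h i x \<le> h j x"
    and L2_incseq_tendsto: "(\<lambda>n. h n x) \<longlonglongrightarrow> p x" and L2_incseq_le: "h n x \<le> p x"
  using assms by (auto simp: L2_incseq_def incseq_def intro!: incseq_le)

lemma inner_L2_mono_AE:
  assumes "h \<in> L2 m" "h' \<in> L2 m" "v \<in> L2 m" "v' \<in> L2 m"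
    "AE x in m. h x * v x \<le> h' x * v' x"
  shows "inner_L2 m h v \<le> inner_L2 m h' v'"
  unfolding inner_L2_def using assms L2_mult_integrable
  by (intro integral_mono_AE) auto

text \<open>Monotone continuity of the resolvent, tested against \<open>ref\<close>: the functions
  \<open>min h (k j)\<close> increase to \<open>h\<close>, and by symmetry the
  \<open>ref\<close>-weighted integral of the difference of resolvents equals the integral of
  \<open>h - min h (k j)\<close> against \<open>res \<alpha> ref\<close>, which tends to 0.\<close>

lemma res_le_SUP:
  assumes \<alpha>: "0 < \<alpha>" and h: "h \<in> L2 m" "\<And>x. 0 \<le> h x" and k: "L2_incseq q k" and le: "\<And>x. h x \<le> q x"
  shows "AE x in m. ennreal (res \<alpha> h x) \<le> (SUP j. ennreal (res \<alpha> (k j) x))"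
proof -
  define hj where "hj j x = min (h x) (k j x)" for j x
  have k': "k j \<in> L2 m" "0 \<le> k j x" for j x
    using k by (auto intro: L2_incseq_L2 L2_incseq_nonneg)
  have hjb: "0 \<le> hj j x" "hj j x \<le> h x" for j x
    using h(2)[of x] k'(2)[of j x] by (auto simp: hj_def)
  have hj: "hj j \<in> L2 m" for j
  proof (rule L2_bounded_by[OF _ h(1)])
    show "hj j \<in> borel_measurable m"
      unfolding hj_def using L2.measurable[OF h(1)] L2.measurable[OF k'(1)] by measurable
  qed (use hjb h in \<open>simp add: abs_of_nonneg\<close>)
  have w: "res \<alpha> h \<in> D" and wj: "res \<alpha> (hj j) \<in> D" and rk: "res \<alpha> (k j) \<in> D" and r: "res \<alpha> ref \<in> D" for j
    using \<alpha> h hj k' ref_L2 by auto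
  note [measurable] = D.measurable[OF w] D.measurable[OF wj] D.measurable[OF rk] D.measurable[OF r]
    L2.measurable[OF h(1)] L2.measurable[OF hj]
  let ?S = "\<lambda>x. SUP j. ennreal (res \<alpha> (k j) x)"
  have r0: "AE x in m. 0 \<le> res \<alpha> ref x" using \<alpha> ref_L2 ref_nonneg by (intro res_nonneg) auto
  have lim: "(\<lambda>j. \<integral>x. (h x - hj j x) * res \<alpha> ref x \<partial>m) \<longlonglongrightarrow> (\<integral>x. 0 \<partial>m)"
  proof (rule integral_dominated_convergence)
    show "integrable m (\<lambda>x. h x * res \<alpha> ref x)" using L2_mult_integrable h D_L2[OF r] by blast
    show "AE x in m. (\<lambda>j. (h x - hj j x) * res \<alpha> ref x) \<longlonglongrightarrow> 0"
    proof (rule AE_I2)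
      fix x
      have "(\<lambda>j. (h x - min (h x) (k j x)) * res \<alpha> ref x) \<longlonglongrightarrow> (h x - min (h x) (q x)) * res \<alpha> ref x"
        by (intro tendsto_intros L2_incseq_tendsto[OF k])
      then show "(\<lambda>j. (h x - hj j x) * res \<alpha> ref x) \<longlonglongrightarrow> 0" using le[of x] by (simp add: hj_def)
    qed
    show "AE x in m. norm ((h x - hj j x) * res \<alpha> ref x) \<le> h x * res \<alpha> ref x" for j
      using r0 by eventually_elim (use hjb in \<open>auto simp: abs_mult intro!: mult_right_mono\<close>)
  qed auto
  have le_j: "(\<integral>\<^sup>+x. (ennreal (res \<alpha> h x) - ?S x) * ennreal (ref x) \<partial>m) \<le> ennreal (\<integral>x. (h x - hj j x) * res \<alpha> ref x \<partial>m)" for j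
  proof -
    have ge: "AE x in m. res \<alpha> (hj j) x \<le> res \<alpha> (k j) x"
      by (rule res_mono) (use \<alpha> hj k' in \<open>auto simp: hj_def\<close>)
    have ge': "AE x in m. res \<alpha> (hj j) x \<le> res \<alpha> h x"
      by (rule res_mono) (use \<alpha> hj h hjb in auto)
    have nn: "AE x in m. 0 \<le> res \<alpha> (hj j) x"
      by (rule res_nonneg) (use \<alpha> hj hjb in auto)
    have int: "integrable m (\<lambda>x. (res \<alpha> h x - res \<alpha> (hj j) x) * ref x)"
      by (rule L2_mult_integrable) (use w wj D_L2 ref_L2 in auto)
    have "(\<integral>\<^sup>+x. (ennreal (res \<alpha> h x) - ?S x) * ennreal (ref x) \<partial>m)
        \<le> (\<integral>\<^sup>+x. ennreal ((res \<alpha> h x - res \<alpha> (hj j) x) * ref x) \<partial>m)"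
    proof (rule nn_integral_mono_AE, use ge ge' nn in eventually_elim)
      case (elim x)
      have "ennreal (res \<alpha> (hj j) x) \<le> ennreal (res \<alpha> (k j) x)" using elim by (simp add: ennreal_leI)
      also have "\<dots> \<le> ?S x" by (rule SUP_upper) simp
      finally have "ennreal (res \<alpha> h x) - ?S x \<le> ennreal (res \<alpha> h x) - ennreal (res \<alpha> (hj j) x)"
        by (rule ennreal_minus_mono[OF order_refl])
      also have "\<dots> = ennreal (res \<alpha> h x - res \<alpha> (hj j) x)" using elim by (simp add: ennreal_minus)
      finally show ?case using elim ref_nonneg[of x] by (simp add: ennreal_mult mult_right_mono)
    qed
    also have "\<dots> = ennreal (\<integral>x. (res \<alpha> h x - res \<alpha> (hj j) x) * ref x \<partial>m)"
      by (rule nn_integral_eq_integral[OF int]) (use ge' ref_nonneg in auto)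
    also have "(\<integral>x. (res \<alpha> h x - res \<alpha> (hj j) x) * ref x \<partial>m) = inner_L2 m (\<lambda>x. res \<alpha> h x - res \<alpha> (hj j) x) ref"
      by (simp add: inner_L2_def)
    also have "\<dots> = inner_L2 m (\<lambda>x. h x - hj j x) (res \<alpha> ref)"
    proof -
      have *: "inner_L2 m (res \<alpha> f) ref = inner_L2 m f (res \<alpha> ref)" if f: "f \<in> L2 m" for f
      proof -
        have fD: "res \<alpha> f \<in> D" using \<alpha> f by simp
        have "inner_L2 m (res \<alpha> f) ref = inner_L2 m ref (res \<alpha> f)"
          by (rule L2.form_sym) (use fD ref_L2 D_L2 in auto)
        also have "\<dots> = Ea \<alpha> (res \<alpha> ref) (res \<alpha> f)" using Ea_res[OF \<alpha> ref_L2 fD] by simp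
        also have "\<dots> = Ea \<alpha> (res \<alpha> f) (res \<alpha> ref)"
          unfolding Ea_def using D.form_sym[OF fD r] L2.form_sym[OF D_L2[OF fD] D_L2[OF r]] by simp
        finally show ?thesis using Ea_res[OF \<alpha> f r] by simp
      qed
      show ?thesis
        using *[OF h(1)] *[OF hj, of j] h hj w wj r ref_L2 D_L2 by (simp add: L2.form_linear)
    qed
    finally show ?thesis by (simp add: inner_L2_def)
  qed
  have "(\<lambda>j. ennreal (\<integral>x. (h x - hj j x) * res \<alpha> ref x \<partial>m)) \<longlonglongrightarrow> ennreal 0"
    using tendsto_ennrealI[OF lim] by simp
  then have "(\<integral>\<^sup>+x. (ennreal (res \<alpha> h x) - ?S x) * ennreal (ref x) \<partial>m) \<le> ennreal 0"
    by (rule LIMSEQ_le_const) (use le_j in blast)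
  then have "AE x in m. (ennreal (res \<alpha> h x) - ?S x) * ennreal (ref x) = 0"
    by (subst nn_integral_0_iff_AE[symmetric]) auto
  then show ?thesis using ref_pos
  proof eventually_elim
    case (elim x)
    then have "ennreal (res \<alpha> h x) - ?S x = 0" by auto
    then show ?case by (simp add: diff_eq_0_iff_ennreal)
  qed
qed

text \<open>The sequences chosen for \<open>p\<close> and for \<open>q\<close> are unrelated, so
  monotonicity of the resolvent cannot be applied member by member; every member of the first is
  compared with the supremum over the second.\<close>

lemma potential_nonneg_mono:
  assumes p: "integrable m p" "\<And>x. 0 \<le> p x" and q: "integrable m q" "\<And>x. p x \<le> q x"
  shows "AE x in m. potential_nonneg m D \<E> p x \<le> potential_nonneg m D \<E> q x"
proof -
  have P: "L2_incseq p (L2_seq p)" by (rule L2_incseq_L2_seq) (use p in auto)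
  have Q: "L2_incseq q (L2_seq q)" by (rule L2_incseq_L2_seq[OF q(1) order_trans[OF p(2) q(2)]])
  have "AE x in m. \<forall>n k. ennreal (res (1 / real (Suc n)) (L2_seq p k) x)
      \<le> (SUP j. ennreal (res (1 / real (Suc n)) (L2_seq q j) x))"
    unfolding AE_all_countable
    by (intro allI res_le_SUP[OF _ L2_incseq_L2[OF P] L2_incseq_nonneg[OF P] Q]
        order_trans[OF L2_incseq_le[OF P] q(2)]) simp
  then show ?thesis
  proof eventually_elim
    case (elim x)
    show ?case unfolding potential_nonneg_def resolvent_nonneg_eq
      by (intro SUP_mono' SUP_least) (use elim in blast)
  qed
qed

text \<open>A potential that is bounded has finite energy, because the energies of the approximants
  are at most \<open>C\<close> times the integral of \<open>p\<close>. As these energies increase,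
  the approximants are Cauchy. The potential equation is passed to the limit first for bounded
  elements of \<open>D\<close>, then for bounded \<open>v\<close>.\<close>

lemma
  assumes p: "integrable m p" "\<And>x. 0 \<le> p x"
    and bdd: "AE x in m. potential_nonneg m D \<E> p x \<le> ennreal C" and C: "0 \<le> C"
  shows potential_nonneg_mem: "(\<lambda>x. enn2real (potential_nonneg m D \<E> p x)) \<in> De"
    and form_potential_nonneg: "\<And>v c. v \<in> De \<Longrightarrow> (\<And>x. \<bar>v x\<bar> \<le> c) \<Longrightarrow>
      Be (\<lambda>x. enn2real (potential_nonneg m D \<E> p x)) v = (\<integral>x. v x * p x \<partial>m)"
proof -
  let ?G = "potential_nonneg m D \<E> p"
  define h where "h = L2_seq p"
  define \<alpha> where "\<alpha> n = 1 / real (Suc n)" for n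
  \<comment> \<open>The diagonal of the two suprema, over \<open>\<alpha>\<close> and over the
    approximation of \<open>p\<close>: by monotonicity in both indices it has the same supremum
    a.e.\<close>
  define w where "w n = res (\<alpha> n) (h n)" for n
  have \<alpha>: "0 < \<alpha> n" for n by (simp add: \<alpha>_def)
  have \<alpha>_anti: "\<alpha> j \<le> \<alpha> i" if "i \<le> j" for i j using that by (simp add: \<alpha>_def frac_le)
  have h: "L2_incseq p h" unfolding h_def by (rule L2_incseq_L2_seq[OF p])
  note hL2 = L2_incseq_L2[OF h] and h0 = L2_incseq_nonneg[OF h] and hp = L2_incseq_le[OF h]
    and hmono = L2_incseq_mono[OF h]
  have rD: "res (\<alpha> n) (h k) \<in> D" for n k using \<alpha> hL2 by simp
  have wD: "w n \<in> D" for n unfolding w_def by (rule rD)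
  note [measurable] = D.measurable[OF rD] D.measurable[OF wD] L2.measurable[OF hL2]
  have G_eq: "?G x = (SUP n. SUP k. ennreal (res (\<alpha> n) (h k) x))" for x
    by (simp add: potential_nonneg_def resolvent_nonneg_eq \<alpha>_def h_def)
  have G_meas [measurable]: "?G \<in> borel_measurable m"
    unfolding G_eq[abs_def] by measurable
  have nn: "AE x in m. \<forall>n. 0 \<le> w n x"
    unfolding AE_all_countable w_def using \<alpha> hL2 h0 by (intro allI res_nonneg) auto
  have mono: "AE x in m. \<forall>n k j. n \<le> j \<longrightarrow> k \<le> j \<longrightarrow> res (\<alpha> n) (h k) x \<le> w j x"
    unfolding AE_all_countable
  proof (intro allI)
    fix n k j
    have "AE x in m. res (\<alpha> n) (h k) x \<le> res (\<alpha> j) (h k) x" if "n \<le> j"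
      using that \<alpha> \<alpha>_anti hL2 h0 by (intro res_antimono) auto
    moreover have "AE x in m. res (\<alpha> j) (h k) x \<le> w j x" if "k \<le> j"
      unfolding w_def using that \<alpha> hL2 hmono by (intro res_mono) auto
    ultimately show "AE x in m. n \<le> j \<longrightarrow> k \<le> j \<longrightarrow> res (\<alpha> n) (h k) x \<le> w j x"
      by (cases "n \<le> j \<and> k \<le> j") (auto elim!: eventually_elim2)
  qed
  have GS: "AE x in m. ?G x = (SUP n. ennreal (w n x))"
    using mono
  proof eventually_elim
    case (elim x)
    show ?case unfolding G_eq
    proof (rule antisym)
      show "(SUP n. SUP k. ennreal (res (\<alpha> n) (h k) x)) \<le> (SUP n. ennreal (w n x))"
      proof (intro SUP_least)
        fix n k
        have "res (\<alpha> n) (h k) x \<le> w (max n k) x" using elim by simp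
        then show "ennreal (res (\<alpha> n) (h k) x) \<le> (SUP n. ennreal (w n x))"
          by (intro SUP_upper2[of "max n k"]) (auto intro: ennreal_leI)
      qed
      show "(SUP n. ennreal (w n x)) \<le> (SUP n. SUP k. ennreal (res (\<alpha> n) (h k) x))"
        by (intro SUP_least) (auto simp: w_def intro!: SUP_upper2)
    qed
  qed
  have wC: "AE x in m. \<forall>n. w n x \<le> C"
    using GS bdd nn
  proof eventually_elim
    case (elim x)
    have "ennreal (w n x) \<le> ennreal C" for n
      by (rule order_trans[OF _ elim(2)]) (unfold elim(1), rule SUP_upper, simp)
    then show ?case using C by simp
  qed
  have w_inc: "AE x in m. \<forall>i j. i \<le> j \<longrightarrow> w i x \<le> w j x"
    using mono by eventually_elim (simp add: w_def)
  have lim: "AE x in m. (\<lambda>n. w n x) \<longlonglongrightarrow> enn2real (?G x)"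
    using GS w_inc nn bdd
  proof eventually_elim
    case (elim x)
    have "incseq (\<lambda>n. ennreal (w n x))" using elim by (auto simp: incseq_def intro: ennreal_leI)
    then have "(\<lambda>n. ennreal (w n x)) \<longlonglongrightarrow> ?G x" unfolding elim(1) by (rule LIMSEQ_SUP)
    moreover have "?G x = ennreal (enn2real (?G x))" using elim(4) by (metis ennreal_enn2real ennreal_less_top le_less_trans)
    ultimately have "(\<lambda>n. enn2real (ennreal (w n x))) \<longlonglongrightarrow> enn2real (?G x)"
      by (intro tendsto_enn2real) simp_all
    then show ?case using elim by simp
  qed
  define I where "I n = inner_L2 m (h n) (w n)" for n
  have I_le: "I i \<le> inner_L2 m (h j) (w i)" "I i \<le> I j" if "i \<le> j" for i j
    unfolding I_def
    by (rule inner_L2_mono_AE[OF hL2 hL2 D_L2[OF wD] D_L2[OF wD]],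
        use nn w_inc in \<open>eventually_elim, auto intro!: mult_mono simp: hmono h0 that\<close>)+
  have I_bdd: "I n \<le> C * (\<integral>x. p x \<partial>m)" for n
  proof -
    have "I n \<le> (\<integral>x. C * p x \<partial>m)"
      unfolding I_def inner_L2_def
    proof (rule integral_mono_AE)
      show "integrable m (\<lambda>x. h n x * w n x)" using L2_mult_integrable hL2 D_L2[OF wD] by blast
      show "AE x in m. h n x * w n x \<le> C * p x"
        using nn wC
      proof eventually_elim
        case (elim x)
        then have "w n x * h n x \<le> C * p x" using hp h0 C by (intro mult_mono) auto
        then show ?case by (simp add: mult.commute)
      qed
    qed (use p in simp)
    then show ?thesis by simp
  qed
  have "incseq I" using I_le by (simp add: incseq_def)
  then obtain l where l: "I \<longlonglongrightarrow> l" "\<And>n. I n \<le> l"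
    using incseq_convergent[of I] I_bdd by blast
  have I_self: "Ea (\<alpha> n) (w n) (w n) = I n" for n
    unfolding I_def w_def using Ea_res[OF \<alpha> hL2 rD] by simp
  have "D.form_Cauchy w"
  proof (rule D.form_CauchyI[OF wD])
    show "(\<lambda>n. l - I n) \<longlonglongrightarrow> 0" using tendsto_diff[OF tendsto_const l(1), of l] by simp
    fix i j :: nat assume ij: "i \<le> j"
    let ?d = "\<lambda>x. w i x - w j x"
    interpret A: definite_markov_form m D "Ea (\<alpha> j)" by (rule markov_Ea[OF \<alpha>])
    have "0 \<le> inner_L2 m ?d ?d" using wD D_L2 by simp
    then have "\<E> ?d ?d \<le> Ea (\<alpha> j) ?d ?d" using \<alpha>[of j] by (simp add: Ea_def)
    \<comment> \<open>The forms for \<open>i\<close> and \<open>j\<close> differ, but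
      \<open>\<alpha> j \<le> \<alpha> i\<close> bounds the first term by \<open>I i\<close>. The
      cross term is \<open>inner_L2 m (h j) (w i)\<close>, at least \<open>I i\<close>, and the last
      term is \<open>I j\<close>, at most \<open>l\<close>.\<close>
    also have "\<dots> = Ea (\<alpha> j) (w i) (w i) - 2 * Ea (\<alpha> j) (w j) (w i) + Ea (\<alpha> j) (w j) (w j)"
      using A.form_diff_sq[OF wD wD] A.form_sym[OF wD wD] by simp
    also have "\<dots> = Ea (\<alpha> j) (w i) (w i) - 2 * inner_L2 m (h j) (w i) + I j"
      using Ea_res[OF \<alpha> hL2 wD, of j j i] I_self[of j] by (simp add: w_def)
    also have "Ea (\<alpha> j) (w i) (w i) \<le> Ea (\<alpha> i) (w i) (w i)"
      using \<alpha>_anti[OF ij] wD D_L2 by (simp add: Ea_def mult_right_mono)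
    also have "\<dots> - 2 * inner_L2 m (h j) (w i) + I j \<le> l - I i"
      using I_le(1)[OF ij] l(2)[of j] I_self[of i] by simp
    finally show "\<E> ?d ?d \<le> l - I i" by simp
  qed
  then have ap: "approx w (\<lambda>x. enn2real (?G x))" using wD lim by (simp add: approx_iff)
  show G_mem: "(\<lambda>x. enn2real (?G x)) \<in> De" by (rule approx_mem[OF ap]) measurable
  fix v c assume v: "v \<in> De" "\<And>x. \<bar>v x\<bar> \<le> c"
  \<comment> \<open>The bound \<open>c\<close> may be 0, whereas the approximation lemma truncates
    at a positive level.\<close>
  then have c: "0 < c + 1" "\<And>x. \<bar>v x\<bar> \<le> c + 1"
    using abs_ge_zero order_trans[OF abs_ge_zero v(2)[of undefined]] by (auto intro: order_trans[OF v(2)])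
  obtain d where d: "\<And>n. d n \<in> D" "\<And>n x. \<bar>d n x\<bar> \<le> c + 1" "AE x in m. (\<lambda>n. d n x) \<longlonglongrightarrow> v x"
    "(\<lambda>n. V.nrm (\<lambda>x. d n x - v x)) \<longlonglongrightarrow> 0"
    by (rule bounded_approximation[OF v(1) c]) (rule that)
  note [measurable] = D.measurable[OF d(1)] De_measurable[OF v(1)]
  have int_p: "integrable m (\<lambda>x. (c + 1) * p x)" using p by simp
  have D_case: "Be (\<lambda>x. enn2real (?G x)) (d i) = (\<integral>x. d i x * p x \<partial>m)" for i
  proof -
    have "(\<lambda>n. \<integral>x. h n x * d i x \<partial>m) \<longlonglongrightarrow> (\<integral>x. p x * d i x \<partial>m)"
    proof (rule integral_dominated_convergence[OF _ _ int_p])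
      show "AE x in m. (\<lambda>n. h n x * d i x) \<longlonglongrightarrow> p x * d i x"
        by (intro AE_I2 tendsto_intros L2_incseq_tendsto[OF h])
      show "AE x in m. norm (h n x * d i x) \<le> (c + 1) * p x" for n
      proof (rule AE_I2)
        fix x
        have "\<bar>d i x\<bar> * h n x \<le> (c + 1) * p x" using d(2) h0 hp c by (intro mult_mono) auto
        then show "norm (h n x * d i x) \<le> (c + 1) * p x" using h0[of n x] by (simp add: abs_mult mult.commute)
      qed
    qed (use p in auto)
    then have "(\<lambda>n. inner_L2 m (h n) (d i)) \<longlonglongrightarrow> (\<integral>x. d i x * p x \<partial>m)"
      by (simp add: inner_L2_def mult.commute)
    \<comment> \<open>The L2 norms of \<open>w n\<close> may be unbounded, but
      \<open>\<alpha> n * inner_L2 m (w n) (w n)\<close> is at most \<open>l\<close>. Cauchy-Schwarz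
      then leaves a factor of order \<open>sqrt (\<alpha> n)\<close>.\<close>
    moreover have "(\<lambda>n. \<alpha> n * inner_L2 m (w n) (d i)) \<longlonglongrightarrow> 0"
    proof (rule Lim_null_comparison)
      have "\<alpha> \<longlonglongrightarrow> 0" unfolding \<alpha>_def using LIMSEQ_inverse_real_of_nat by (simp add: inverse_eq_divide)
      then have "(\<lambda>n. sqrt (\<alpha> n * l) * L2.nrm (d i)) \<longlonglongrightarrow> sqrt (0 * l) * L2.nrm (d i)"
        by (intro tendsto_intros)
      then show "(\<lambda>n. sqrt (\<alpha> n * l) * L2.nrm (d i)) \<longlonglongrightarrow> 0" by simp
      show "\<forall>\<^sub>F n in sequentially. norm (\<alpha> n * inner_L2 m (w n) (d i)) \<le> sqrt (\<alpha> n * l) * L2.nrm (d i)"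
      proof (intro always_eventually allI)
        fix n
        have "\<alpha> n * inner_L2 m (w n) (w n) \<le> l"
          using I_self[of n, unfolded Ea_def] l(2)[of n] D.form_nonneg[OF wD[of n]] by linarith
        then have "\<alpha> n * (\<alpha> n * inner_L2 m (w n) (w n)) \<le> \<alpha> n * l"
          using \<alpha>[of n] by (intro mult_left_mono) auto
        then have "\<alpha> n * L2.nrm (w n) \<le> sqrt (\<alpha> n * l)"
          by (intro real_le_rsqrt) (simp add: power_mult_distrib L2.nrm_sq[OF D_L2[OF wD]] power2_eq_square[of "\<alpha> n"] mult.assoc)
        then have "\<alpha> n * L2.nrm (w n) * L2.nrm (d i) \<le> sqrt (\<alpha> n * l) * L2.nrm (d i)"
          using d D_L2 by (intro mult_right_mono) auto
        moreover have "\<bar>\<alpha> n * inner_L2 m (w n) (d i)\<bar> \<le> \<alpha> n * (L2.nrm (w n) * L2.nrm (d i))"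
          using L2.Cauchy_Schwarz[OF D_L2[OF wD] D_L2[OF d(1)]] \<alpha>[of n] by (simp add: abs_mult)
        ultimately show "norm (\<alpha> n * inner_L2 m (w n) (d i)) \<le> sqrt (\<alpha> n * l) * L2.nrm (d i)"
          by (simp add: mult.assoc)
      qed
    qed
    ultimately have "(\<lambda>n. inner_L2 m (h n) (d i) - \<alpha> n * inner_L2 m (w n) (d i)) \<longlonglongrightarrow> (\<integral>x. d i x * p x \<partial>m) - 0"
      by (intro tendsto_intros)
    moreover have "inner_L2 m (h n) (d i) - \<alpha> n * inner_L2 m (w n) (d i) = \<E> (w n) (d i)" for n
      using Ea_res[OF \<alpha>[of n] hL2[of n] d(1)[of i]] by (simp add: w_def Ea_def)
    ultimately have "(\<lambda>n. \<E> (w n) (d i)) \<longlonglongrightarrow> (\<integral>x. d i x * p x \<partial>m)" by simp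
    then show ?thesis
      using LIMSEQ_unique[OF approx_form_tendsto[OF ap approx_const[OF d(1)]]] by blast
  qed
  have "(\<lambda>i. Be (\<lambda>x. enn2real (?G x)) (d i)) \<longlonglongrightarrow> Be (\<lambda>x. enn2real (?G x)) v"
    by (rule V.form_tendsto) (use G_mem D_subset_De d v in simp_all)
  moreover have "(\<lambda>i. \<integral>x. d i x * p x \<partial>m) \<longlonglongrightarrow> (\<integral>x. v x * p x \<partial>m)"
  proof (rule integral_dominated_convergence[OF _ _ int_p])
    show "AE x in m. (\<lambda>i. d i x * p x) \<longlonglongrightarrow> v x * p x"
      using d(3) by eventually_elim (intro tendsto_intros)
    show "AE x in m. norm (d i x * p x) \<le> (c + 1) * p x" for i
      using d(2) p by (intro AE_I2) (simp add: abs_mult mult_right_mono)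
  qed (use p in auto)
  ultimately show "Be (\<lambda>x. enn2real (?G x)) v = (\<integral>x. v x * p x \<partial>m)"
    unfolding D_case by (rule LIMSEQ_unique)
qed

lemma potential_properties:
  assumes \<eta>: "integrable m \<eta>"
    and bdd: "AE x in m. potential_nonneg m D \<E> (\<lambda>y. \<bar>\<eta> y\<bar>) x \<le> ennreal C" and C: "0 \<le> C"
  shows potential_mem: "potential m D \<E> \<eta> \<in> De"
    and potential_bounded: "AE x in m. \<bar>potential m D \<E> \<eta> x\<bar> \<le> C"
    and form_potential: "\<And>v c. v \<in> De \<Longrightarrow> (\<And>x. \<bar>v x\<bar> \<le> c) \<Longrightarrow>
      Be (potential m D \<E> \<eta>) v = (\<integral>x. v x * \<eta> x \<partial>m)"
proof -
  let ?p = "\<lambda>y. max (\<eta> y) 0" and ?n = "\<lambda>y. max (- \<eta> y) 0"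
  let ?G = "\<lambda>p x. enn2real (potential_nonneg m D \<E> p x)"
  have p: "integrable m ?p" "\<And>x. 0 \<le> ?p x" and n: "integrable m ?n" "\<And>x. 0 \<le> ?n x"
    using \<eta> by (auto intro!: integrable_max)
  have le_p: "?p x \<le> \<bar>\<eta> x\<bar>" and le_n: "?n x \<le> \<bar>\<eta> x\<bar>" for x by auto
  have abs: "integrable m (\<lambda>y. \<bar>\<eta> y\<bar>)" using \<eta> by simp
  have pb: "AE x in m. potential_nonneg m D \<E> ?p x \<le> ennreal C"
    using potential_nonneg_mono[OF p abs le_p] bdd by eventually_elim (rule order_trans)
  have nb: "AE x in m. potential_nonneg m D \<E> ?n x \<le> ennreal C"
    using potential_nonneg_mono[OF n abs le_n] bdd by eventually_elim (rule order_trans)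
  note P = potential_nonneg_mem[OF p pb C] form_potential_nonneg[OF p pb C]
  note N = potential_nonneg_mem[OF n nb C] form_potential_nonneg[OF n nb C]
  have eq: "potential m D \<E> \<eta> = (\<lambda>x. ?G ?p x - ?G ?n x)"
    by (auto simp: potential_def)
  show "potential m D \<E> \<eta> \<in> De" unfolding eq using P(1) N(1) by (rule V.diff_mem)
  have le_C: "enn2real a \<le> C" if "a \<le> ennreal C" for a
    using enn2real_mono[OF that] C by simp
  from pb nb show "AE x in m. \<bar>potential m D \<E> \<eta> x\<bar> \<le> C"
  proof (eventually_elim)
    case (elim x)
    have "0 \<le> ?G ?p x" "?G ?p x \<le> C" "0 \<le> ?G ?n x" "?G ?n x \<le> C" using elim le_C by auto
    then show ?case unfolding eq by linarith
  qed
  fix v c assume v: "v \<in> De" "\<And>x. \<bar>v x\<bar> \<le> c"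
  note [measurable] = De_measurable[OF v(1)]
  have int: "integrable m (\<lambda>x. v x * q x)" if q: "integrable m q" for q
  proof (rule Bochner_Integration.integrable_bound)
    show "integrable m (\<lambda>x. c * q x)" using q by simp
    have "\<bar>v x\<bar> \<le> \<bar>c\<bar>" for x using v(2)[of x] by linarith
    then show "AE x in m. norm (v x * q x) \<le> norm (c * q x)"
      by (intro AE_I2) (simp add: abs_mult mult_right_mono)
  qed (use q in auto)
  have "Be (potential m D \<E> \<eta>) v = (\<integral>x. v x * ?p x \<partial>m) - (\<integral>x. v x * ?n x \<partial>m)"
    unfolding eq by (simp only: V.form_diff_left[OF P(1) N(1) v(1)] P(2)[OF v] N(2)[OF v])
  also have "\<dots> = (\<integral>x. v x * ?p x - v x * ?n x \<partial>m)"
    by (rule Bochner_Integration.integral_diff[symmetric]) (use int p n in auto)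
  also have "(\<lambda>x. v x * ?p x - v x * ?n x) = (\<lambda>x. v x * \<eta> x)"
    by (auto simp: max_def algebra_simps)
  finally show "Be (potential m D \<E> \<eta>) v = (\<integral>x. v x * \<eta> x \<partial>m)" .
qed

end

section \<open>Capacity and quasi-continuous versions\<close>

locale regular_dirichlet_space = dirichlet_space m D \<E>
  for m :: "'a::{metric_space, second_countable_topology} measure" and D \<E> +
  assumes sets_m: "sets m = sets borel" and regular: "regular_form m D \<E>"
begin

lemma borel_measurable_m: "borel_measurable m = borel_measurable borel"
  using measurable_cong_sets[OF sets_m refl] by blast

text \<open>In terms of the square root of the capacity, countable subadditivity is the triangle inequality
  for the norm of the extended Dirichlet space.\<close>

definition small :: "'a set \<Rightarrow> real \<Rightarrow> bool" where
  "small A \<delta> \<longleftrightarrow> (\<exists>U u. open U \<and> A \<subseteq> U \<and> u \<in> De \<and> V.nrm u \<le> \<delta> \<and> (AE x in m. x \<in> U \<longrightarrow> 1 \<le> u x))"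

lemma small_if_cap0_less:
  assumes "cap0 m D \<E> A < ennreal (\<delta>\<^sup>2)" "0 < \<delta>"
  shows "small A \<delta>"
proof -
  obtain U where U: "open U" "A \<subseteq> U" "cap0_open m D \<E> U < ennreal (\<delta>\<^sup>2)"
    using assms(1) unfolding cap0_def INF_less_iff by blast
  then obtain u where u: "u \<in> De" "AE x in m. x \<in> U \<longrightarrow> 1 \<le> u x" "ennreal (ext_energy m D \<E> u) < ennreal (\<delta>\<^sup>2)"
    unfolding cap0_open_def INF_less_iff by blast
  have "Be u u < \<delta>\<^sup>2"
    using u Be_self[OF u(1)] V.form_nonneg[OF u(1)] by (simp add: ennreal_less_iff)
  then have "V.nrm u \<le> \<delta>" unfolding V.nrm_def using assms(2) by (simp add: real_le_lsqrt)
  then show ?thesis using U u unfolding small_def by blast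
qed

lemma cap0_le_if_small:
  assumes "small A \<delta>"
  shows "cap0 m D \<E> A \<le> ennreal (\<delta>\<^sup>2)"
proof -
  obtain U u where U: "open U" "A \<subseteq> U" and u: "u \<in> De" "V.nrm u \<le> \<delta>" "AE x in m. x \<in> U \<longrightarrow> 1 \<le> u x"
    using assms unfolding small_def by blast
  have "cap0 m D \<E> A \<le> cap0_open m D \<E> U"
    unfolding cap0_def using U by (intro INF_lower) auto
  also have "\<dots> \<le> ennreal (ext_energy m D \<E> u)"
    unfolding cap0_open_def using u by (intro INF_lower) auto
  also have "ext_energy m D \<E> u = (V.nrm u)\<^sup>2" using u by (simp add: V.nrm_sq Be_self)
  also have "ennreal ((V.nrm u)\<^sup>2) \<le> ennreal (\<delta>\<^sup>2)"
    using u by (intro ennreal_leI power_mono) auto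
  finally show ?thesis .
qed

lemma small_mono: "small A \<delta> \<Longrightarrow> B \<subseteq> A \<Longrightarrow> \<delta> \<le> \<delta>' \<Longrightarrow> small B \<delta>'"
  unfolding small_def by (meson order_trans)

lemma cap0_eq_0_if_small:
  assumes "\<And>\<delta>. \<delta> > 0 \<Longrightarrow> small A \<delta>"
  shows "cap0 m D \<E> A = 0"
proof -
  have "cap0 m D \<E> A \<le> 0 + ennreal e" if "e > 0" for e
    using cap0_le_if_small[OF assms[of "sqrt e"]] that by simp
  then have "cap0 m D \<E> A \<le> 0" by (rule ennreal_le_epsilon)
  then show ?thesis by simp
qed

lemma small_empty: "small {} 0"
  unfolding small_def by (intro exI[of _ "{}"] exI[of _ "\<lambda>x. 0"]) auto

text \<open>Clipping costs no energy and gives a nonnegative witness; without nonnegativity,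
  witnesses for different sets could not be added.\<close>

lemma smallE:
  assumes "small A \<delta>"
  obtains U u where "open U" "A \<subseteq> U" "u \<in> De" "V.nrm u \<le> \<delta>" "AE x in m. x \<in> U \<longrightarrow> 1 \<le> u x" "\<And>x. 0 \<le> u x"
proof -
  obtain U u where U: "open U" "A \<subseteq> U" and u: "u \<in> De" "V.nrm u \<le> \<delta>" "AE x in m. x \<in> U \<longrightarrow> 1 \<le> u x"
    using assms unfolding small_def by blast
  have "V.nrm (clip 1 u) \<le> V.nrm u"
    unfolding V.nrm_def using V.form_clip_le[OF u(1), of 1] by simp
  moreover have "AE x in m. x \<in> U \<longrightarrow> 1 \<le> clip 1 u x"
    using u(3) by eventually_elim (auto simp: clip_def)
  moreover have "0 \<le> clip 1 u x" for x by (simp add: clip_bounds)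
  ultimately show ?thesis using that[OF U, of "clip 1 u"] u by simp
qed

lemma small_Un:
  assumes "small A \<delta>" "small A' \<delta>'"
  shows "small (A \<union> A') (\<delta> + \<delta>')"
proof -
  obtain U u where u: "open U" "A \<subseteq> U" "u \<in> De" "V.nrm u \<le> \<delta>" "AE x in m. x \<in> U \<longrightarrow> 1 \<le> u x" "\<And>x. 0 \<le> u x"
    using smallE[OF assms(1)] by blast
  obtain U' u' where u': "open U'" "A' \<subseteq> U'" "u' \<in> De" "V.nrm u' \<le> \<delta>'" "AE x in m. x \<in> U' \<longrightarrow> 1 \<le> u' x" "\<And>x. 0 \<le> u' x"
    using smallE[OF assms(2)] by blast
  have "V.nrm (\<lambda>x. u x + u' x) \<le> \<delta> + \<delta>'" using V.nrm_triangle[OF u(3) u'(3)] u u' by simp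
  moreover have "AE x in m. x \<in> U \<union> U' \<longrightarrow> 1 \<le> u x + u' x"
    using u(5) u'(5) by eventually_elim (use u(6) u'(6) in \<open>auto intro: add_increasing add_increasing2\<close>)
  ultimately show ?thesis unfolding small_def using u u'
    by (intro exI[of _ "U \<union> U'"] exI[of _ "\<lambda>x. u x + u' x"]) auto
qed

text \<open>The witness is the sum of the individual witnesses. Its partial sums are Cauchy by the
  geometric bounds and converge a.e., so their limit is in the extended space; the factor 2 is the
  sum of the geometric series.\<close>

lemma small_UN:
  assumes "\<And>n. small (A n) (c * (1/2)^n)" and c: "0 \<le> c"
  shows "small (\<Union>n. A n) (2 * c)"
proof -
  define P where "P n U u \<longleftrightarrow> open U \<and> A n \<subseteq> U \<and> u \<in> De \<and> V.nrm u \<le> c * (1/2)^n \<and>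
      (AE x in m. x \<in> U \<longrightarrow> 1 \<le> u x) \<and> (\<forall>x. 0 \<le> u x)" for n U u
  have "\<exists>U u. P n U u" for n
    unfolding P_def by (rule smallE[OF assms(1)[of n]]) blast
  then obtain U u where P: "\<And>n. P n (U n) (u n)" by metis
  then have u: "\<And>n. open (U n)" "\<And>n. A n \<subseteq> U n" "\<And>n. u n \<in> De" "\<And>n. V.nrm (u n) \<le> c * (1/2)^n"
    "\<And>n. AE x in m. x \<in> U n \<longrightarrow> 1 \<le> u n x" "\<And>n x. 0 \<le> u n x"
    unfolding P_def by auto
  note [measurable] = De_measurable[OF u(3)]
  have summ: "AE x in m. summable (\<lambda>n. u n x)"
    using AE_summable_if_nrm_geometric[OF u(3,4)] u(6) by simp
  define W where "W N x = (\<Sum>n<N. u n x)" for N x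
  define S where "S x = (\<Sum>n. u n x)" for x
  have W: "W N \<in> De" for N unfolding W_def using V.nrm_sum[of "{..<N}" u] u by simp
  have S_meas: "S \<in> borel_measurable m" unfolding S_def by measurable
  have geo: "(\<Sum>n\<in>I. c * (1/2)^n) \<le> 2 * c * (1/2)^i" if "I \<subseteq> {i..}" "finite I" for I i
  proof -
    have "(\<Sum>n\<in>I. (1/2::real)^n) \<le> (\<Sum>n\<in>(\<lambda>k. k + i) ` {..Max I}. (1/2)^n)"
    proof (rule sum_mono2)
      show "I \<subseteq> (\<lambda>k. k + i) ` {..Max I}"
      proof
        fix n assume n: "n \<in> I"
        then have "i \<le> n" "n \<le> Max I" using that by auto
        then show "n \<in> (\<lambda>k. k + i) ` {..Max I}" by (intro image_eqI[of _ _ "n - i"]) auto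
      qed
    qed auto
    also have "\<dots> = (\<Sum>k\<le>Max I. (1/2)^k) * (1/2)^i"
      by (subst sum.reindex) (auto simp: inj_on_def power_add sum_distrib_right)
    also have "(\<Sum>k\<le>Max I. (1/2::real)^k) \<le> 2"
    proof -
      have "(\<Sum>k\<in>{..Max I}. (1/2::real)^k) \<le> (\<Sum>k. (1/2)^k)"
        by (rule sum_le_suminf) auto
      then show ?thesis by (simp add: suminf_geometric)
    qed
    finally have "(\<Sum>n\<in>I. (1/2::real)^n) \<le> 2 * (1/2)^i" by simp
    then have "c * (\<Sum>n\<in>I. (1/2)^n) \<le> c * (2 * (1/2)^i)" using c by (rule mult_left_mono)
    then show ?thesis by (simp add: sum_distrib_left mult.left_commute mult.commute)
  qed
  have "V.form_Cauchy W"
  proof (rule V.form_CauchyI[OF W])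
    have "(\<lambda>i. (2 * c * (1/2)^i)\<^sup>2) \<longlonglongrightarrow> (2 * c * 0)\<^sup>2"
      by (intro tendsto_intros LIMSEQ_realpow_zero) auto
    then show "(\<lambda>i. (2 * c * (1/2)^i)\<^sup>2) \<longlonglongrightarrow> 0" by simp
    fix i j :: nat assume ij: "i \<le> j"
    have eq: "W j x - W i x = (\<Sum>n\<in>{i..<j}. u n x)" for x
      unfolding W_def using ij sum_diff_nat_ivl[of 0 i j "\<lambda>n. u n x"] by (simp add: lessThan_atLeast0)
    have "V.nrm (\<lambda>x. W j x - W i x) \<le> (\<Sum>n\<in>{i..<j}. V.nrm (u n))"
      unfolding eq using V.nrm_sum[of "{i..<j}" u] u by simp
    also have "\<dots> \<le> (\<Sum>n\<in>{i..<j}. c * (1/2)^n)" by (intro sum_mono u)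
    also have "\<dots> \<le> 2 * c * (1/2)^i" by (rule geo) auto
    finally have "(V.nrm (\<lambda>x. W j x - W i x))\<^sup>2 \<le> (2 * c * (1/2)^i)\<^sup>2"
      using W by (intro power_mono) auto
    then show "Be (\<lambda>x. W i x - W j x) (\<lambda>x. W i x - W j x) \<le> (2 * c * (1/2)^i)\<^sup>2"
      using W V.form_diff_commute[OF W W, of i j] by (simp add: V.nrm_sq)
  qed
  moreover have "AE x in m. (\<lambda>N. W N x) \<longlonglongrightarrow> S x"
    using summ by eventually_elim (simp add: W_def S_def summable_LIMSEQ)
  ultimately have S: "S \<in> De" "(\<lambda>N. V.nrm (\<lambda>x. W N x - S x)) \<longlonglongrightarrow> 0"
    using V_complete_AE[of W S, OF W _ S_meas] by blast+
  have "(\<lambda>N. V.nrm (W N)) \<longlonglongrightarrow> V.nrm S"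
    unfolding V.nrm_def by (intro tendsto_real_sqrt V.form_tendsto W S)
  moreover have "V.nrm (W N) \<le> 2 * c" for N
  proof -
    have "V.nrm (W N) \<le> (\<Sum>n<N. V.nrm (u n))"
      unfolding W_def using V.nrm_sum[of "{..<N}" u] u by simp
    also have "\<dots> \<le> (\<Sum>n<N. c * (1/2)^n)" by (intro sum_mono u)
    also have "\<dots> \<le> 2 * c * (1/2)^0" by (rule geo) auto
    finally show ?thesis by simp
  qed
  ultimately have "V.nrm S \<le> 2 * c" by (intro LIMSEQ_le_const2) auto
  moreover have "AE x in m. x \<in> (\<Union>n. U n) \<longrightarrow> 1 \<le> S x"
  proof -
    have "AE x in m. \<forall>n. x \<in> U n \<longrightarrow> 1 \<le> u n x" using u(5) by (simp add: AE_all_countable)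
    then show ?thesis using summ
    proof eventually_elim
      case (elim x)
      have "u n x \<le> S x" for n
        using sum_le_suminf[OF elim(2), of "{n}"] u(6) by (simp add: S_def)
      then show ?case using elim(1) by (auto intro: order_trans)
    qed
  qed
  ultimately show ?thesis unfolding small_def using u S
    by (intro exI[of _ "\<Union>n. U n"] exI[of _ S]) (auto intro!: open_UN)
qed

section \<open>Quasi-continuous functions and the existence of quasi-continuous versions\<close>

lemma quasi_continuous_iff:
  "quasi_continuous m D \<E> w \<longleftrightarrow> (\<forall>\<delta>>0. \<exists>U. open U \<and> small U \<delta> \<and> continuous_on (- U) w)"
proof
  assume q: "quasi_continuous m D \<E> w"
  show "\<forall>\<delta>>0. \<exists>U. open U \<and> small U \<delta> \<and> continuous_on (- U) w"
  proof (intro allI impI)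
    fix \<delta> :: real assume "\<delta> > 0"
    then obtain U where "open U" "cap0 m D \<E> U < ennreal (\<delta>\<^sup>2)" "continuous_on (- U) w"
      using q unfolding quasi_continuous_def by (meson zero_less_power)
    then show "\<exists>U. open U \<and> small U \<delta> \<and> continuous_on (- U) w"
      using small_if_cap0_less \<open>\<delta> > 0\<close> by blast
  qed
next
  assume s: "\<forall>\<delta>>0. \<exists>U. open U \<and> small U \<delta> \<and> continuous_on (- U) w"
  show "quasi_continuous m D \<E> w"
    unfolding quasi_continuous_def
  proof (intro allI impI)
    fix e :: real assume e: "e > 0"
    then have "sqrt (e / 2) > 0" by simp
    then obtain U where U: "open U" "small U (sqrt (e / 2))" "continuous_on (- U) w" using s by blast
    have "cap0 m D \<E> U \<le> ennreal (e / 2)" using cap0_le_if_small[OF U(2)] e by simp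
    also have "\<dots> < ennreal e" using e by (intro ennreal_lessI) auto
    finally show "\<exists>U. open U \<and> cap0 m D \<E> U < ennreal e \<and> continuous_on (- U) w" using U by blast
  qed
qed

lemma quasi_continuousE:
  assumes "quasi_continuous m D \<E> w" "\<delta> > 0"
  obtains U where "open U" "small U \<delta>" "continuous_on (- U) w"
  using assms unfolding quasi_continuous_iff by blast

lemma quasi_continuous_continuous: "continuous_on UNIV w \<Longrightarrow> quasi_continuous m D \<E> w"
  unfolding quasi_continuous_iff
  by (intro allI impI exI[of _ "{}"]) (auto intro: small_mono[OF small_empty])

lemma quasi_continuous_lincomb:
  assumes "quasi_continuous m D \<E> w" "quasi_continuous m D \<E> w'"
  shows "quasi_continuous m D \<E> (\<lambda>x. a * w x + b * w' x)"
  unfolding quasi_continuous_iff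
proof (intro allI impI)
  fix \<delta> :: real assume "\<delta> > 0"
  then have d: "\<delta> / 2 > 0" by simp
  obtain U where U: "open U" "small U (\<delta>/2)" "continuous_on (- U) w" using quasi_continuousE[OF assms(1) d] by blast
  obtain U' where U': "open U'" "small U' (\<delta>/2)" "continuous_on (- U') w'" using quasi_continuousE[OF assms(2) d] by blast
  have "continuous_on (- (U \<union> U')) w" "continuous_on (- (U \<union> U')) w'"
    using U U' by (auto elim: continuous_on_subset)
  then have "continuous_on (- (U \<union> U')) (\<lambda>x. a * w x + b * w' x)" by (intro continuous_intros)
  moreover have "small (U \<union> U') \<delta>" using small_Un[OF U(2) U'(2)] by simp
  ultimately show "\<exists>U. open U \<and> small U \<delta> \<and> continuous_on (- U) (\<lambda>x. a * w x + b * w' x)"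
    using U U' by (intro exI[of _ "U \<union> U'"]) auto
qed

text \<open>Witnesses for smallness live on open sets. Adding the exceptional set turns a relatively
  open set into an open one at a capacity cost that is under control.\<close>

lemma open_Un_vimage:
  assumes "open U" "continuous_on (- U) w" "open B"
  shows "open (U \<union> w -` B)"
proof -
  obtain A where A: "open A" "A \<inter> - U = w -` B \<inter> - U"
    using assms unfolding continuous_on_open_invariant by blast
  then have eq: "U \<union> w -` B = U \<union> A" by blast
  show ?thesis unfolding eq by (intro open_Un A assms)
qed

text \<open>If \<open>w\<close> is continuous off the open set \<open>U\<close>, then \<open>U \<union> {w < 0}\<close> is open, and it differs from
  \<open>U\<close> by a null set if \<open>w \<ge> 0\<close> almost everywhere.\<close>

lemma quasi_continuous_nonneg:
  assumes w: "quasi_continuous m D \<E> w" "AE x in m. 0 \<le> w x" and \<delta>: "\<delta> > 0"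
  shows "small {x. w x < 0} \<delta>"
proof -
  obtain U where U: "open U" "small U \<delta>" "continuous_on (- U) w" using quasi_continuousE[OF w(1) \<delta>] by blast
  obtain U' u where u: "open U'" "U \<subseteq> U'" "u \<in> De" "V.nrm u \<le> \<delta>" "AE x in m. x \<in> U' \<longrightarrow> 1 \<le> u x"
    using U(2) unfolding small_def by blast
  have "open (U' \<union> w -` {..<0})"
    by (rule open_Un_vimage) (use u U in \<open>auto elim: continuous_on_subset\<close>)
  moreover have "AE x in m. x \<in> U' \<union> w -` {..<0} \<longrightarrow> 1 \<le> u x"
    using u(5) w(2) by eventually_elim auto
  ultimately show ?thesis unfolding small_def using u
    by (intro exI[of _ "U' \<union> w -` {..<0}"] exI[of _ u]) auto
qed

text \<open>The witness is \<open>(1/r) * min \<bar>u\<bar> r + h\<close>. The first summand equals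
  1 where \<open>\<bar>u\<bar>\<close> exceeds \<open>r\<close>, and \<open>h\<close> takes care of
  the open set off which \<open>w\<close> is continuous; this second part accounts for the slack
  \<open>\<delta>\<close>.\<close>

lemma quasi_continuous_Chebyshev:
  assumes w: "quasi_continuous m D \<E> w" "AE x in m. w x = u x" and u: "u \<in> De" and r: "r > 0" and \<delta>: "\<delta> > 0"
  shows "small {x. r < \<bar>w x\<bar>} (V.nrm u / r + \<delta>)"
proof -
  obtain U where U: "open U" "small U \<delta>" "continuous_on (- U) w" using quasi_continuousE[OF w(1) \<delta>] by blast
  obtain U' h where h: "open U'" "U \<subseteq> U'" "h \<in> De" "V.nrm h \<le> \<delta>" "AE x in m. x \<in> U' \<longrightarrow> 1 \<le> h x" "\<And>x. 0 \<le> h x"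
    using smallE[OF U(2)] by blast
  let ?O = "U' \<union> w -` (- {- r..r})"
  let ?a = "\<lambda>x. min \<bar>u x\<bar> r"
  have O: "open ?O"
    by (rule open_Un_vimage) (use h U in \<open>auto elim: continuous_on_subset\<close>)
  have sub: "{x. r < \<bar>w x\<bar>} \<subseteq> ?O" by auto
  have a: "?a \<in> De" using u r by simp
  have le: "V.nrm (\<lambda>x. (1/r) * ?a x + h x) \<le> V.nrm u / r + \<delta>"
  proof -
    have "V.nrm ?a \<le> V.nrm u"
      unfolding V.nrm_def using V.form_min_abs_le[OF u r] V.form_trunc_le(2)[OF u r] by simp
    then have "V.nrm (\<lambda>x. (1/r) * ?a x) \<le> V.nrm u / r"
      using V.nrm_scale[OF a, of "1/r"] r by (simp add: divide_right_mono)
    then show ?thesis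
      using V.nrm_triangle[OF V.scale_mem[OF a, of "1/r"] h(3)] h(4) by linarith
  qed
  have ge: "AE x in m. x \<in> ?O \<longrightarrow> 1 \<le> (1/r) * ?a x + h x"
    using h(5) w(2)
  proof eventually_elim
    case (elim x)
    have nn: "0 \<le> (1/r) * ?a x" using r by simp
    show ?case
    proof
      assume "x \<in> ?O"
      then consider "x \<in> U'" | "r < \<bar>u x\<bar>" using elim(2) by auto
      then show "1 \<le> (1/r) * ?a x + h x"
      proof cases
        case 1
        then show ?thesis using elim(1) nn by linarith
      next
        case 2
        then have "(1/r) * ?a x = 1" using r by simp
        then show ?thesis using h(6)[of x] by linarith
      qed
    qed
  qed
  show ?thesis unfolding small_def
    by (intro exI conjI) (rule O, rule sub, rule V.add_mem[OF V.scale_mem[OF a] h(3)], rule le, rule ge)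
qed

lemma Cc_approximable:
  assumes u: "u \<in> De" and e: "e > 0"
  shows "\<exists>v\<in>D. continuous_on UNIV v \<and> V.nrm (\<lambda>x. u x - v x) < e"
proof -
  obtain d where d: "d \<in> D" "V.nrm (\<lambda>x. u x - d x) < e / 2"
    using De_approximable[OF u, of "e / 2"] e by auto
  have "(e / 2)\<^sup>2 > 0" using e by simp
  then obtain v where v: "v \<in> D" "v \<in> C_c" "energy1 m \<E> (\<lambda>x. d x - v x) < (e / 2)\<^sup>2"
    using regular d unfolding regular_form_def by (meson IntE)
  have "0 \<le> inner_L2 m (\<lambda>x. d x - v x) (\<lambda>x. d x - v x)" using d v D_L2 by simp
  then have "\<E> (\<lambda>x. d x - v x) (\<lambda>x. d x - v x) < (e / 2)\<^sup>2" using v(3) by (simp add: energy1_def)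
  then have "D.nrm (\<lambda>x. d x - v x) < e / 2"
    unfolding D.nrm_def using e by (intro real_less_lsqrt) auto
  then have "V.nrm (\<lambda>x. d x - v x) < e / 2" using d v by (simp add: V_nrm_D)
  then have "V.nrm (\<lambda>x. u x - v x) < e"
    using V.nrm_triangle_diff[OF u D_subset_De[OF d(1)] D_subset_De[OF v(1)]] d(2) by linarith
  then show ?thesis using v by (auto simp: C_c_def)
qed

text \<open>Continuous functions approximate \<open>u\<close> in energy at the rate
  \<open>(1/8)^n\<close>. By the Chebyshev estimate, successive differences exceed
  \<open>(1/2)^n\<close> only on open sets of size of order \<open>(1/4)^n\<close>; these are
  summable, and off the union of a tail the convergence is uniform.\<close>

lemma quasi_continuous_version_exists:
  assumes u: "u \<in> De"
  shows "\<exists>w. w \<in> borel_measurable borel \<and> quasi_continuous m D \<E> w \<and> (AE x in m. w x = u x)"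
proof -
  have "\<exists>v\<in>D. continuous_on UNIV v \<and> V.nrm (\<lambda>x. u x - v x) < (1/8)^n" for n
    by (rule Cc_approximable[OF u]) simp
  then obtain v where v: "\<And>n. v n \<in> D" "\<And>n. continuous_on UNIV (v n)" "\<And>n. V.nrm (\<lambda>x. u x - v n x) < (1/8)^n"
    by metis
  have vV: "v n \<in> De" for n using v D_subset_De by blast
  define A where "A n = {x. (1/2)^n < \<bar>v (Suc n) x - v n x\<bar>}" for n
  have A_open: "open (A n)" for n
    unfolding A_def using v(2) by (intro open_Collect_less continuous_intros) auto
  have A_small: "small (A n) (3 * (1/4)^n)" for n
  proof -
    let ?d = "\<lambda>x. v (Suc n) x - v n x"
    have "V.nrm ?d \<le> V.nrm (\<lambda>x. v (Suc n) x - u x) + V.nrm (\<lambda>x. u x - v n x)"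
      by (rule V.nrm_triangle_diff[OF vV u vV])
    also have "\<dots> \<le> (1/8)^Suc n + (1/8)^n"
      using v(3)[of "Suc n"] v(3)[of n] V.nrm_diff_commute[OF u vV, of "Suc n"] by linarith
    also have "\<dots> \<le> 2 * (1/8)^n" by simp
    finally have "V.nrm ?d / (1/2)^n \<le> 2 * (1/8)^n / (1/2)^n" by (rule divide_right_mono) simp
    also have "\<dots> = 2 * ((1/8) / (1/2))^n" by (simp only: power_divide times_divide_eq_right)
    also have "\<dots> = 2 * (1/4)^n" by simp
    finally have le: "V.nrm ?d / (1/2)^n + (1/4)^n \<le> 3 * (1/4)^n" by simp
    have "small {x. (1/2)^n < \<bar>?d x\<bar>} (V.nrm ?d / (1/2)^n + (1/4)^n)"
      by (rule quasi_continuous_Chebyshev[OF quasi_continuous_continuous])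
        (use v vV in \<open>auto intro!: continuous_intros\<close>)
    then show ?thesis unfolding A_def by (rule small_mono[OF _ order_refl le])
  qed
  define W where "W N = (\<Union>n. A (N + n))" for N
  have W_open: "open (W N)" for N unfolding W_def using A_open by (intro open_UN) auto
  have W_small: "small (W N) (2 * (3 * (1/4)^N))" for N
    unfolding W_def
  proof (rule small_UN)
    fix n
    have "3 * (1/4::real)^(N + n) \<le> 3 * (1/4)^N * (1/2)^n"
      by (simp add: power_add power_mono)
    then show "small (A (N + n)) (3 * (1/4)^N * (1/2)^n)"
      by (rule small_mono[OF A_small order_refl])
  qed simp
  \<comment> \<open>Where the sequence diverges, \<open>lim\<close> has a fixed default value, so
    \<open>w\<close> is Borel on the whole space without any correction.\<close>
  define w where "w x = lim (\<lambda>n. v n x)" for x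
  have "continuous_on (- W N) w" for N
  proof -
    let ?f = "\<lambda>i x. v (Suc (N + i)) x - v (N + i) x"
    have ul: "uniform_limit (- W N) (\<lambda>n x. \<Sum>i<n. ?f i x) (\<lambda>x. \<Sum>i. ?f i x) sequentially"
    proof (rule Weierstrass_m_test)
      fix n x assume "x \<in> - W N"
      then have "x \<notin> A (N + n)" by (auto simp: W_def)
      then have "\<bar>?f n x\<bar> \<le> (1/2)^(N + n)" by (simp add: A_def)
      also have "\<dots> \<le> (1/2)^n" by (rule power_decreasing) auto
      finally show "norm (?f n x) \<le> (1/2)^n" by simp
    qed simp
    have tele: "(\<Sum>i<n. ?f i x) = v (N + n) x - v N x" for n x
      using sum_lessThan_telescope[of "\<lambda>i. v (N + i) x" n] by simp
    have "continuous_on (- W N) (\<lambda>x. \<Sum>i. ?f i x)"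
      by (rule uniform_limit_theorem[OF always_eventually ul])
        (use continuous_on_subset[OF v(2)] in \<open>auto intro!: continuous_intros simp: tele\<close>)
    then have "continuous_on (- W N) (\<lambda>x. v N x + (\<Sum>i. ?f i x))"
      using continuous_on_subset[OF v(2)] by (intro continuous_intros) auto
    moreover have "v N x + (\<Sum>i. ?f i x) = w x" if "x \<in> - W N" for x
    proof -
      have "(\<lambda>n. v (N + n) x - v N x) \<longlonglongrightarrow> (\<Sum>i. ?f i x)"
        using tendsto_uniform_limitI[OF ul that] by (simp only: tele)
      from tendsto_add[OF tendsto_const[of "v N x"] this]
      have "(\<lambda>n. v (n + N) x) \<longlonglongrightarrow> v N x + (\<Sum>i. ?f i x)" by (simp add: add.commute)
      then have "(\<lambda>n. v n x) \<longlonglongrightarrow> v N x + (\<Sum>i. ?f i x)" by (rule LIMSEQ_offset)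
      then show ?thesis unfolding w_def by (rule limI[symmetric])
    qed
    ultimately show ?thesis by (rule continuous_on_eq)
  qed
  moreover have "\<exists>N. 2 * (3 * (1/4)^N) \<le> \<delta>" if "\<delta> > 0" for \<delta> :: real
  proof -
    have "\<delta> / 6 > 0" using that by simp
    from real_arch_pow_inv[OF this, of "1/4"] obtain N where "(1/4)^N < \<delta> / 6" by auto
    then show ?thesis by (intro exI[of _ N]) simp
  qed
  ultimately have "quasi_continuous m D \<E> w"
    unfolding quasi_continuous_iff using W_open W_small small_mono[OF _ order_refl] by meson
  moreover have "w \<in> borel_measurable borel"
  proof -
    have [measurable]: "v n \<in> borel_measurable borel" for n
      using v(2) borel_measurable_continuous_onI by blast
    show ?thesis unfolding w_def by measurable
  qed
  moreover have "AE x in m. w x = u x"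
  proof -
    have "AE x in m. (\<lambda>n. u x - v n x) \<longlonglongrightarrow> 0"
    proof (rule AE_tendsto_zero_if_nrm_geometric[where C = 1])
      fix n
      have "V.nrm (\<lambda>x. u x - v n x) \<le> (1/8)^n" using v(3)[of n] by simp
      also have "\<dots> \<le> (1/2)^n" by (rule power_mono) auto
      finally show "V.nrm (\<lambda>x. u x - v n x) \<le> 1 * (1/2)^n" by simp
    qed (use u vV in auto)
    then show ?thesis
    proof eventually_elim
      case (elim x)
      from tendsto_diff[OF tendsto_const[of "u x"] elim] have "(\<lambda>n. v n x) \<longlonglongrightarrow> u x" by simp
      then show ?case unfolding w_def by (rule limI)
    qed
  qed
  ultimately show ?thesis by blast
qed

abbreviation ver :: "('a \<Rightarrow> real) \<Rightarrow> 'a \<Rightarrow> real" where "ver \<equiv> qc_version m D \<E>"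

lemma
  assumes "u \<in> De"
  shows ver_borel: "ver u \<in> borel_measurable borel" and ver_qc: "quasi_continuous m D \<E> (ver u)"
    and ver_AE: "AE x in m. ver u x = u x"
  using someI_ex[OF quasi_continuous_version_exists[OF assms], folded qc_version_def] by auto

end

subsection \<open>Diffuse measures as functionals on bounded functions of finite energy\<close>

text \<open>To be instantiated with the two Jordan parts of \<open>\<mu>\<close>. Signs are
  recovered later by subtracting the two functionals.\<close>

locale diffuse_functional = regular_dirichlet_space m D \<E>
  for m :: "'a::{metric_space, second_countable_topology} measure" and D \<E> +
  fixes \<nu> :: "'a measure"
  assumes sets_\<nu>: "sets \<nu> = sets borel" and finite_\<nu>: "finite_measure \<nu>"
    and diffuse: "A \<in> sets borel \<Longrightarrow> cap0 m D \<E> A = 0 \<Longrightarrow> emeasure \<nu> A = 0"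
begin

interpretation finite_measure \<nu> by (rule finite_\<nu>)

lemma borel_measurable_\<nu>: "borel_measurable \<nu> = borel_measurable borel"
  using measurable_cong_sets[OF sets_\<nu> refl] by blast

lemma ver_measurable [measurable]: "u \<in> De \<Longrightarrow> ver u \<in> borel_measurable \<nu>"
  using ver_borel borel_measurable_\<nu> by blast

lemma AE_if_small:
  assumes "A \<in> sets borel" "\<And>\<delta>. \<delta> > 0 \<Longrightarrow> small A \<delta>"
  shows "AE x in \<nu>. x \<notin> A"
  using diffuse[OF assms(1) cap0_eq_0_if_small[OF assms(2)]] assms(1) sets_\<nu>
  by (intro AE_not_in) (auto simp: null_sets_def)

text \<open>The bridge from \<open>m\<close> to \<open>\<nu>\<close>, which may be mutually
  singular: for quasi-continuous functions an inequality valid \<open>m\<close>-a.e. fails only on a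
  set of capacity zero, and \<open>\<nu>\<close> does not see such a set.\<close>

lemma AE_nonneg_quasi_continuous:
  assumes "w \<in> borel_measurable borel" "quasi_continuous m D \<E> w" "AE x in m. 0 \<le> w x"
  shows "AE x in \<nu>. 0 \<le> w x"
proof -
  have [measurable]: "w \<in> borel_measurable borel" by fact
  have "{x \<in> space borel. w x < 0} \<in> sets borel" by measurable
  then have "AE x in \<nu>. x \<notin> {x. w x < 0}"
    using quasi_continuous_nonneg[OF assms(2,3)] by (intro AE_if_small) auto
  then show ?thesis by eventually_elim auto
qed

text \<open>The constant is a separate summand because constants are quasi-continuous but need not
  belong to \<open>De\<close>.\<close>

lemma ver_nonneg_lincomb:
  assumes "u \<in> De" "v \<in> De" and ae: "AE x in m. 0 \<le> a * u x + b * v x + c"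
  shows "AE x in \<nu>. 0 \<le> a * ver u x + b * ver v x + c"
proof -
  have "AE x in \<nu>. 0 \<le> 1 * (a * ver u x + b * ver v x) + 1 * c"
  proof (rule AE_nonneg_quasi_continuous)
    show "(\<lambda>x. 1 * (a * ver u x + b * ver v x) + 1 * c) \<in> borel_measurable borel"
      using ver_borel[OF assms(1)] ver_borel[OF assms(2)] by measurable
    show "quasi_continuous m D \<E> (\<lambda>x. 1 * (a * ver u x + b * ver v x) + 1 * c)"
      by (rule quasi_continuous_lincomb[OF quasi_continuous_lincomb[OF ver_qc ver_qc]
            quasi_continuous_continuous[OF continuous_on_const]]) (use assms in auto)
    show "AE x in m. 0 \<le> 1 * (a * ver u x + b * ver v x) + 1 * c"
      using ae ver_AE[OF assms(1)] ver_AE[OF assms(2)] by eventually_elim simp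
  qed
  then show ?thesis by simp
qed

lemma ver_mono:
  assumes "u \<in> De" "v \<in> De" "AE x in m. u x \<le> v x"
  shows "AE x in \<nu>. ver u x \<le> ver v x"
  using ver_nonneg_lincomb[of u v "-1" 1 0] assms by simp

lemma ver_cong:
  assumes "u \<in> De" "v \<in> De" "AE x in m. u x = v x"
  shows "AE x in \<nu>. ver u x = ver v x"
proof -
  have "AE x in \<nu>. ver u x \<le> ver v x" "AE x in \<nu>. ver v x \<le> ver u x"
    using assms by (auto intro!: ver_mono elim!: eventually_mono)
  then show ?thesis by eventually_elim simp
qed

lemma ver_bounded:
  assumes "u \<in> De" "AE x in m. \<bar>u x\<bar> \<le> C"
  shows "AE x in \<nu>. \<bar>ver u x\<bar> \<le> C"
proof -
  have "AE x in \<nu>. 0 \<le> 1 * ver u x + 0 * ver u x + C"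
    by (rule ver_nonneg_lincomb[OF assms(1,1)]) (use assms(2) in \<open>eventually_elim, simp add: abs_le_iff\<close>)
  moreover have "AE x in \<nu>. 0 \<le> -1 * ver u x + 0 * ver u x + C"
    by (rule ver_nonneg_lincomb[OF assms(1,1)]) (use assms(2) in \<open>eventually_elim, simp add: abs_le_iff\<close>)
  ultimately show ?thesis by eventually_elim (simp add: abs_le_iff)
qed

lemma ver_add:
  assumes "u \<in> De" "v \<in> De"
  shows "AE x in \<nu>. ver (\<lambda>x. u x + v x) x = ver u x + ver v x"
proof -
  let ?w = "\<lambda>x. ver (\<lambda>x. u x + v x) x" and ?z = "\<lambda>x. 1 * ver u x + 1 * ver v x"
  have uv: "(\<lambda>x. u x + v x) \<in> De" using assms by simp
  have q: "quasi_continuous m D \<E> ?w" "quasi_continuous m D \<E> ?z"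
    using ver_qc[OF uv] quasi_continuous_lincomb[OF ver_qc[OF assms(1)] ver_qc[OF assms(2)], of 1 1] by simp_all
  have meas [measurable]: "?w \<in> borel_measurable borel" "?z \<in> borel_measurable borel"
    using ver_borel[OF uv] ver_borel[OF assms(1)] ver_borel[OF assms(2)] by simp_all
  have ae: "AE x in m. ?w x = ?z x"
    using ver_AE[OF uv] ver_AE[OF assms(1)] ver_AE[OF assms(2)] by eventually_elim simp
  have "AE x in \<nu>. 0 \<le> 1 * ?w x + -1 * ?z x"
  proof (rule AE_nonneg_quasi_continuous[OF _ quasi_continuous_lincomb[OF q]])
    show "AE x in m. 0 \<le> 1 * ?w x + -1 * ?z x" using ae by eventually_elim simp
  qed measurable
  moreover have "AE x in \<nu>. 0 \<le> -1 * ?w x + 1 * ?z x"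
  proof (rule AE_nonneg_quasi_continuous[OF _ quasi_continuous_lincomb[OF q]])
    show "AE x in m. 0 \<le> -1 * ?w x + 1 * ?z x" using ae by eventually_elim simp
  qed measurable
  ultimately show ?thesis by eventually_elim simp
qed

lemma ver_scale:
  assumes "u \<in> De"
  shows "AE x in \<nu>. ver (\<lambda>x. c * u x) x = c * ver u x"
proof -
  have cu: "(\<lambda>x. c * u x) \<in> De" using assms by simp
  have "AE x in \<nu>. 0 \<le> 1 * ver (\<lambda>x. c * u x) x + (- c) * ver u x + 0"
    by (rule ver_nonneg_lincomb[OF cu assms]) simp
  moreover have "AE x in \<nu>. 0 \<le> -1 * ver (\<lambda>x. c * u x) x + c * ver u x + 0"
    by (rule ver_nonneg_lincomb[OF cu assms]) simp
  ultimately show ?thesis by eventually_elim simp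
qed

definition pair :: "('a \<Rightarrow> real) \<Rightarrow> real" where "pair u = (\<integral>x. ver u x \<partial>\<nu>)"

lemma ver_integrable:
  assumes "u \<in> De" "AE x in m. \<bar>u x\<bar> \<le> C"
  shows "integrable \<nu> (ver u)"
  by (rule integrable_const_bound[of _ C]) (use ver_bounded[OF assms] assms in auto)

lemma pair_add:
  assumes "u \<in> De" "AE x in m. \<bar>u x\<bar> \<le> C" "v \<in> De" "AE x in m. \<bar>v x\<bar> \<le> C'"
  shows "pair (\<lambda>x. u x + v x) = pair u + pair v"
proof -
  have "pair (\<lambda>x. u x + v x) = (\<integral>x. ver u x + ver v x \<partial>\<nu>)"
    unfolding pair_def using ver_add assms by (intro integral_cong_AE) auto
  then show ?thesis
    using ver_integrable assms by (simp add: pair_def)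
qed

lemma pair_scale:
  assumes "u \<in> De"
  shows "pair (\<lambda>x. c * u x) = c * pair u"
proof -
  have "pair (\<lambda>x. c * u x) = (\<integral>x. c * ver u x \<partial>\<nu>)"
    unfolding pair_def using ver_scale assms by (intro integral_cong_AE) auto
  then show ?thesis by (simp add: pair_def)
qed

lemma pair_mono:
  assumes "u \<in> De" "AE x in m. \<bar>u x\<bar> \<le> C" "v \<in> De" "AE x in m. \<bar>v x\<bar> \<le> C'" "AE x in m. u x \<le> v x"
  shows "pair u \<le> pair v"
  unfolding pair_def using ver_integrable ver_mono assms by (intro integral_mono_AE) auto

lemma pair_cong:
  assumes "u \<in> De" "v \<in> De" "AE x in m. u x = v x"
  shows "pair u = pair v"
  unfolding pair_def using ver_cong assms by (intro integral_cong_AE) auto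

lemma pair_le:
  assumes "u \<in> De" "AE x in m. \<bar>u x\<bar> \<le> C"
  shows "pair u \<le> C * measure \<nu> (space \<nu>)"
proof -
  have "pair u \<le> (\<integral>x. C \<partial>\<nu>)"
    unfolding pair_def using ver_integrable[OF assms] ver_bounded[OF assms]
    by (intro integral_mono_AE) (auto elim!: eventually_mono)
  then show ?thesis by (simp add: mult.commute)
qed

text \<open>Borel-Cantelli for capacities. A counterexample provides \<open>u n\<close> of norm at
  most \<open>(1/8)^n\<close>; then \<open>\<bar>ver (u n)\<bar>\<close> exceeds
  \<open>(1/2)^n\<close> only on sets of size \<open>2 * (1/4)^n\<close>. Their limes superior has
  capacity zero, so \<open>ver (u n)\<close> tends to 0 \<open>\<nu>\<close>-a.e., and dominated
  convergence with majorant 1 contradicts the lower bound \<open>e\<close>.\<close>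

lemma pair_continuous:
  assumes e: "e > 0"
  shows "\<exists>\<delta>>0. \<forall>u\<in>De. (AE x in m. \<bar>u x\<bar> \<le> 1) \<longrightarrow> Be u u \<le> \<delta> \<longrightarrow> \<bar>pair u\<bar> \<le> e"
proof (rule ccontr)
  assume neg: "\<not> ?thesis"
  have "\<exists>u\<in>De. (AE x in m. \<bar>u x\<bar> \<le> 1) \<and> Be u u \<le> ((1/8)^n)\<^sup>2 \<and> e < \<bar>pair u\<bar>" for n :: nat
  proof -
    have "((1/8::real)^n)\<^sup>2 > 0" by simp
    then show ?thesis using neg not_le by blast
  qed
  then obtain u where u: "\<And>n. u n \<in> De" "\<And>n. AE x in m. \<bar>u n x\<bar> \<le> 1" "\<And>n. Be (u n) (u n) \<le> ((1/8)^n)\<^sup>2"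
    "\<And>n. e < \<bar>pair (u n)\<bar>" by metis
  have nrm: "V.nrm (u n) \<le> (1/8)^n" for n
    unfolding V.nrm_def by (rule real_le_lsqrt) (use u(3) in auto)
  define A where "A n = {x. (1/2)^n < \<bar>ver (u n) x\<bar>}" for n
  have A_small: "small (A n) (2 * (1/4)^n)" for n
  proof -
    have "V.nrm (u n) / (1/2)^n \<le> (1/8)^n / (1/2)^n" by (rule divide_right_mono[OF nrm]) simp
    also have "\<dots> = (1/4)^n" by (subst power_divide[symmetric]) simp
    finally have le: "V.nrm (u n) / (1/2)^n + (1/4)^n \<le> 2 * (1/4)^n" by simp
    have "small (A n) (V.nrm (u n) / (1/2)^n + (1/4)^n)"
      unfolding A_def by (rule quasi_continuous_Chebyshev[OF ver_qc ver_AE]) (use u in auto)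
    then show ?thesis by (rule small_mono[OF _ order_refl le])
  qed
  define Z where "Z = (\<Inter>N. \<Union>n. A (N + n))"
  have A_borel: "A n \<in> sets borel" for n
  proof -
    have [measurable]: "ver (u n) \<in> borel_measurable borel" using ver_borel u by blast
    have "{x \<in> space borel. (1/2)^n < \<bar>ver (u n) x\<bar>} \<in> sets borel" by measurable
    then show ?thesis by (simp add: A_def)
  qed
  have "AE x in \<nu>. x \<notin> Z"
  proof (rule AE_if_small)
    show "Z \<in> sets borel" unfolding Z_def using A_borel by auto
    fix \<delta> :: real assume "\<delta> > 0"
    then have "\<delta> / 4 > 0" by simp
    from real_arch_pow_inv[OF this, of "1/4"] obtain N where N: "(1/4)^N < \<delta> / 4" by auto
    have "small (\<Union>n. A (N + n)) (2 * (2 * (1/4)^N))"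
    proof (rule small_UN)
      fix n
      have "2 * (1/4::real)^(N + n) \<le> 2 * (1/4)^N * (1/2)^n"
        by (simp add: power_add power_mono)
      then show "small (A (N + n)) (2 * (1/4)^N * (1/2)^n)"
        by (rule small_mono[OF A_small order_refl])
    qed simp
    then show "small Z \<delta>" by (rule small_mono) (use N in \<open>auto simp: Z_def\<close>)
  qed
  then have lim: "AE x in \<nu>. (\<lambda>n. ver (u n) x) \<longlonglongrightarrow> 0"
  proof eventually_elim
    case (elim x)
    then obtain N where N: "\<And>n. x \<notin> A (N + n)" by (auto simp: Z_def)
    show ?case
    proof (rule Lim_null_comparison)
      show "\<forall>\<^sub>F n in sequentially. norm (ver (u n) x) \<le> (1/2)^n"
      proof (rule eventually_sequentiallyI[of N])
        fix n assume "N \<le> n"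
        then show "norm (ver (u n) x) \<le> (1/2)^n" using N[of "n - N"] by (simp add: A_def)
      qed
      show "(\<lambda>n. (1/2::real)^n) \<longlonglongrightarrow> 0" by (rule LIMSEQ_realpow_zero) auto
    qed
  qed
  have "(\<lambda>n. pair (u n)) \<longlonglongrightarrow> (\<integral>x. 0 \<partial>\<nu>)"
    unfolding pair_def
    by (rule integral_dominated_convergence[where w = "\<lambda>_. 1"]) (use u lim ver_bounded in auto)
  then have "(\<lambda>n. \<bar>pair (u n)\<bar>) \<longlonglongrightarrow> 0" by (simp add: tendsto_rabs_zero)
  then have "e \<le> 0" using u(4) by (intro LIMSEQ_le_const[of _ 0 e]) (auto intro: less_imp_le)
  then show False using e by simp
qed

end

section \<open>Obstacle problems\<close>

subsection \<open>Absorption terms and their primitives\<close>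

text \<open>Rounding \<open>u\<close> down to multiples of \<open>1 / (n + 1)\<close> leaves
  countably many values, for which measurability of \<open>F\<close> in its first variable is
  enough; continuity in the second variable gives the limit.\<close>

lemma caratheodory_comp_measurable:
  fixes F :: "'z \<Rightarrow> real \<Rightarrow> real"
  assumes F: "\<And>y. (\<lambda>z. F z y) \<in> borel_measurable M" "\<And>z. continuous_on UNIV (F z)"
    and u [measurable]: "u \<in> borel_measurable M"
  shows "(\<lambda>z. F z (u z)) \<in> borel_measurable M"
proof (rule borel_measurable_LIMSEQ_real)
  let ?s = "\<lambda>n z. real_of_int \<lfloor>real (Suc n) * u z\<rfloor> / real (Suc n)"
  fix z assume "z \<in> space M"
  have "(\<lambda>n. ?s n z) \<longlonglongrightarrow> u z"
  proof (rule LIM_zero_cancel, rule Lim_null_comparison)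
    show "\<forall>\<^sub>F n in sequentially. norm (?s n z - u z) \<le> 1 / real (Suc n)"
    proof (intro always_eventually allI)
      fix n
      have "\<bar>real_of_int \<lfloor>real (Suc n) * u z\<rfloor> - real (Suc n) * u z\<bar> \<le> 1" by linarith
      then have "\<bar>real_of_int \<lfloor>real (Suc n) * u z\<rfloor> - real (Suc n) * u z\<bar> / real (Suc n) \<le> 1 / real (Suc n)"
        by (rule divide_right_mono) simp
      moreover have "?s n z - u z = (real_of_int \<lfloor>real (Suc n) * u z\<rfloor> - real (Suc n) * u z) / real (Suc n)"
        by (simp only: diff_divide_distrib) simp
      ultimately show "norm (?s n z - u z) \<le> 1 / real (Suc n)" by (simp only: real_norm_def abs_divide abs_of_nat)
    qed
    show "(\<lambda>n. 1 / real (Suc n)) \<longlonglongrightarrow> 0"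
      using LIMSEQ_inverse_real_of_nat by (simp add: inverse_eq_divide)
  qed
  moreover have "isCont (F z) (u z)" using F(2) continuous_on_eq_continuous_at open_UNIV by blast
  ultimately show "(\<lambda>n. F z (?s n z)) \<longlonglongrightarrow> F z (u z)" by (rule isCont_tendsto_compose[rotated])
next
  fix n
  have "(\<lambda>z. \<lfloor>real (Suc n) * u z\<rfloor>) \<in> measurable M (count_space UNIV)" by measurable
  from measurable_compose_countable[OF _ this, of "\<lambda>i z. F z (real_of_int i / real (Suc n))"] F(1)
  show "(\<lambda>z. F z (real_of_int \<lfloor>real (Suc n) * u z\<rfloor> / real (Suc n))) \<in> borel_measurable M" by simp
qed

text \<open>Instead of the supremum, some integrable majorant on each bounded interval is required.
  The class then contains 0 and is visibly stable under the reflection in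
  \<open>absorption_uminus\<close>.\<close>

definition absorption :: "'a measure \<Rightarrow> ('a \<Rightarrow> real \<Rightarrow> real) \<Rightarrow> bool" where
  "absorption m f \<longleftrightarrow>
     (\<forall>y. (\<lambda>x. f x y) \<in> borel_measurable m) \<and> (\<forall>x. continuous_on UNIV (f x)) \<and>
     (\<forall>x. f x 0 = 0) \<and> (\<forall>x y. f x y * y \<le> 0) \<and>
     (\<forall>a>0. \<exists>F. integrable m F \<and> (\<forall>x y. \<bar>y\<bar> \<le> a \<longrightarrow> \<bar>f x y\<bar> \<le> F x))"

lemma absorption_zero: "absorption m (\<lambda>x y. 0)"
  by (auto simp: absorption_def intro!: exI[of _ "\<lambda>x. 0"])

lemma absorption_uminus:
  assumes "absorption m f"
  shows "absorption m (\<lambda>x y. - f x (- y))"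
proof -
  have f: "(\<lambda>x. f x y) \<in> borel_measurable m" "continuous_on UNIV (f x)" "f x 0 = 0" "f x y * y \<le> 0" for x y
    using assms by (auto simp: absorption_def)
  have "\<exists>F. integrable m F \<and> (\<forall>x y. \<bar>y\<bar> \<le> a \<longrightarrow> \<bar>- f x (- y)\<bar> \<le> F x)" if a: "a > 0" for a
  proof -
    obtain F where "integrable m F" "\<And>x y. \<bar>y\<bar> \<le> a \<Longrightarrow> \<bar>f x y\<bar> \<le> F x"
      using assms a unfolding absorption_def by blast
    then show ?thesis by (intro exI[of _ F]) simp
  qed
  moreover have "continuous_on UNIV (\<lambda>y. - f x (- y))" for x
    by (intro continuous_intros continuous_on_compose2[OF f(2)]) auto
  moreover have "- f x (- y) * y \<le> 0" for x y using f(4)[of x "- y"] by simp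
  ultimately show ?thesis using f by (simp add: absorption_def)
qed

lemma absorption_measurable:
  assumes "absorption m f" "u \<in> borel_measurable m"
  shows "(\<lambda>x. f x (u x)) \<in> borel_measurable m"
  by (rule caratheodory_comp_measurable) (use assms in \<open>auto simp: absorption_def\<close>)

lemma absorption_bound:
  assumes "absorption m f" "a > 0"
  obtains F where "integrable m F" "\<And>x y. \<bar>y\<bar> \<le> a \<Longrightarrow> \<bar>f x y\<bar> \<le> F x" "\<And>x. 0 \<le> F x"
proof -
  obtain F where F: "integrable m F" "\<And>x y. \<bar>y\<bar> \<le> a \<Longrightarrow> \<bar>f x y\<bar> \<le> F x"
    using assms unfolding absorption_def by blast
  moreover have "0 \<le> F x" for x using F(2)[of 0 x] assms(2) by auto
  ultimately show ?thesis using that by blast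
qed

lemma absorption_mult:
  assumes "absorption m f"
    and "0 \<le> t * y"
  shows "f x y * t = - (\<bar>f x y\<bar> * \<bar>t\<bar>)"
proof -
  have y: "f x y * y \<le> 0" "y = 0 \<Longrightarrow> f x y = 0" using assms by (auto simp: absorption_def)
  consider "y = 0" | "y > 0" | "y < 0" by linarith
  then show ?thesis
  proof cases
    case 1
    then show ?thesis using y by simp
  next
    case 2
    then have "f x y \<le> 0" "0 \<le> t" using y assms(2) by (simp_all add: mult_le_0_iff zero_le_mult_iff)
    then show ?thesis by simp
  next
    case 3
    then have "0 \<le> f x y" "t \<le> 0" using y assms(2) by (simp_all add: mult_le_0_iff zero_le_mult_iff)
    then show ?thesis by simp
  qed
qed

lemma absorption_primitive:
  assumes f: "absorption m f"
  obtains H where "\<And>x y. (H x has_real_derivative f x y) (at y)" "\<And>x. H x 0 = 0"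
    "\<And>y. (\<lambda>x. H x y) \<in> borel_measurable m"
proof -
  have cont: "continuous_on UNIV (f x)" and meas: "(\<lambda>x. f x y) \<in> borel_measurable m" for x y
    using f by (auto simp: absorption_def)
  have "\<exists>A. \<forall>y::real. (A has_real_derivative f x y) (at y)" for x
  proof -
    have "isCont (f x) y" for y using cont continuous_on_eq_continuous_at open_UNIV by blast
    then show ?thesis
      using einterval_antiderivative[of "-\<infinity>" \<infinity> "f x"] by (auto simp: has_real_derivative_iff_has_vector_derivative)
  qed
  then obtain A where A: "\<And>x y. (A x has_real_derivative f x y) (at y)" by metis
  \<comment> \<open>Rescaling to the unit interval replaces an endpoint of either sign by a fixed
    domain. Joint measurability of the integrand then yields measurability in \<open>x\<close>,
    although \<open>A x\<close> was chosen separately for each \<open>x\<close>.\<close>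
  have eq: "A x y - A x 0 = (\<integral>t. indicator {0..1} t *\<^sub>R (f x (t * y) * y) \<partial>lborel)" for x y
  proof -
    have d: "((\<lambda>t. A x (t * y)) has_real_derivative f x (t * y) * y) (at t)" for t
      by (rule DERIV_chain2[OF A]) (auto intro!: derivative_eq_intros)
    have "(\<integral>t. indicator {0..1} t *\<^sub>R (f x (t * y) * y) \<partial>lborel) = A x (1 * y) - A x (0 * y)"
    proof (rule integral_FTC_atLeastAtMost)
      fix t :: real
      show "((\<lambda>t. A x (t * y)) has_vector_derivative f x (t * y) * y) (at t within {0..1})"
        using has_field_derivative_at_within[OF d] by (simp only: has_real_derivative_iff_has_vector_derivative)
    qed (auto intro!: continuous_intros continuous_on_compose2[OF cont])
    then show ?thesis by simp
  qed
  have "(\<lambda>x. A x y - A x 0) \<in> borel_measurable m" for y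
  proof -
    have 1: "(\<lambda>z. f (fst z) s) \<in> borel_measurable (m \<Otimes>\<^sub>M lborel)" for s
      by (rule measurable_compose[OF measurable_fst meas])
    have "(\<lambda>z. f (fst z) (snd z * y)) \<in> borel_measurable (m \<Otimes>\<^sub>M lborel)"
      by (rule caratheodory_comp_measurable[OF 1 cont]) measurable
    then have "case_prod (\<lambda>x t. indicator {0..1} t *\<^sub>R (f x (t * y) * y)) \<in> borel_measurable (m \<Otimes>\<^sub>M lborel)"
      unfolding case_prod_beta' by measurable
    then show ?thesis unfolding eq by (rule lborel.borel_measurable_lebesgue_integral)
  qed
  then show ?thesis
    by (intro that[of "\<lambda>x y. A x y - A x 0"]) (auto intro!: derivative_eq_intros A)
qed

lemma primitive_lipschitz:
  assumes H: "\<And>x y. (H x has_real_derivative f x y) (at y)"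
    and F: "\<And>y. \<bar>y\<bar> \<le> a \<Longrightarrow> \<bar>f x y\<bar> \<le> (K::real)" and yz: "\<bar>y\<bar> \<le> a" "\<bar>z\<bar> \<le> a"
  shows "\<bar>H x y - H x z\<bar> \<le> K * \<bar>y - z\<bar>"
proof -
  have "norm (H x y - H x z) \<le> K * norm (y - z)"
    by (rule field_differentiable_bound[of "{-a..a}" "H x" "f x"])
      (use H F yz in \<open>auto intro: has_field_derivative_at_within\<close>)
  then show ?thesis by simp
qed

lemma primitive_nonpos:
  assumes H: "\<And>x y. (H x has_real_derivative f x y) (at y)" "H x 0 = 0" and f: "absorption m f"
  shows "H x y \<le> 0"
proof -
  have sgn: "f x t * t \<le> 0" for t using f by (auto simp: absorption_def)
  consider "y = 0" | "y > 0" | "y < 0" by linarith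
  then show ?thesis
  proof cases
    case 2
    obtain z where "0 < z" "H x y - H x 0 = (y - 0) * f x z"
      using MVT2[of 0 y "H x" "f x"] H 2 by blast
    then show ?thesis using sgn[of z] 2 H(2) by (simp add: mult_le_0_iff)
  next
    case 3
    obtain z where "z < 0" "H x 0 - H x y = (0 - y) * f x z"
      using MVT2[of y 0 "H x" "f x"] H 3 by blast
    then show ?thesis using sgn[of z] 3 H(2) by (simp add: mult_le_0_iff)
  qed (use H in simp)
qed

subsection \<open>Variational inequalities\<close>

context dirichlet_space
begin

text \<open>The bounds hold at every point rather than a.e., so that obstacles and test functions
  can be handled pointwise; functions bounded a.e. are first replaced by truncations.\<close>

definition Db :: "('a \<Rightarrow> real) set" where "Db = {u \<in> De. \<exists>C. \<forall>x. \<bar>u x\<bar> \<le> C}"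

text \<open>\<open>M\<close> plays the role of the total mass. The last clause is continuity at 0 in
  energy on the unit ball of the supremum norm; this is weaker than boundedness in energy, which
  would describe a measure of finite energy integral.\<close>

definition energy_functional :: "(('a \<Rightarrow> real) \<Rightarrow> real) \<Rightarrow> real \<Rightarrow> bool" where
  "energy_functional \<phi> M \<longleftrightarrow>
     (\<forall>u\<in>Db. \<forall>v\<in>Db. \<phi> (\<lambda>x. u x + v x) = \<phi> u + \<phi> v) \<and> (\<forall>c. \<forall>u\<in>Db. \<phi> (\<lambda>x. c * u x) = c * \<phi> u) \<and>
     (\<forall>u\<in>Db. \<forall>C. (\<forall>x. \<bar>u x\<bar> \<le> C) \<longrightarrow> \<phi> u \<le> C * M) \<and>
     (\<forall>e>0. \<exists>\<delta>>0. \<forall>u\<in>Db. (\<forall>x. \<bar>u x\<bar> \<le> 1) \<longrightarrow> Be u u \<le> \<delta> \<longrightarrow> \<bar>\<phi> u\<bar> \<le> e)"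

lemma DbI: "u \<in> De \<Longrightarrow> (\<And>x. \<bar>u x\<bar> \<le> C) \<Longrightarrow> u \<in> Db"
  by (auto simp: Db_def)

lemma Db_De: "u \<in> Db \<Longrightarrow> u \<in> De" by (simp add: Db_def)

lemma Db_add: "u \<in> Db \<Longrightarrow> v \<in> Db \<Longrightarrow> (\<lambda>x. u x + v x) \<in> Db"
proof -
  assume "u \<in> Db" "v \<in> Db"
  then obtain C C' where C: "u \<in> De" "v \<in> De" "\<And>x. \<bar>u x\<bar> \<le> C" "\<And>x. \<bar>v x\<bar> \<le> C'" by (auto simp: Db_def)
  have "\<bar>u x + v x\<bar> \<le> C + C'" for x using C(3)[of x] C(4)[of x] by linarith
  then show ?thesis using C by (intro DbI[where C = "C + C'"]) simp_all
qed

lemma Db_scale: "u \<in> Db \<Longrightarrow> (\<lambda>x. c * u x) \<in> Db"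
proof -
  assume "u \<in> Db"
  then obtain C where C: "u \<in> De" "\<And>x. \<bar>u x\<bar> \<le> C" by (auto simp: Db_def)
  have "\<bar>c * u x\<bar> \<le> \<bar>c\<bar> * C" for x using C(2)[of x] by (simp add: abs_mult mult_left_mono)
  then show ?thesis using C by (intro DbI[where C = "\<bar>c\<bar> * C"]) simp_all
qed

lemma Db_uminus: "u \<in> Db \<Longrightarrow> (\<lambda>x. - u x) \<in> Db"
  using Db_scale[of u "-1"] by simp

lemma Db_diff: "u \<in> Db \<Longrightarrow> v \<in> Db \<Longrightarrow> (\<lambda>x. u x - v x) \<in> Db"
  using Db_add[OF _ Db_uminus, of u v] by simp

lemma
  assumes "energy_functional \<phi> M"
  shows functional_add: "u \<in> Db \<Longrightarrow> v \<in> Db \<Longrightarrow> \<phi> (\<lambda>x. u x + v x) = \<phi> u + \<phi> v"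
    and functional_scale: "u \<in> Db \<Longrightarrow> \<phi> (\<lambda>x. c * u x) = c * \<phi> u"
    and functional_le: "u \<in> Db \<Longrightarrow> (\<And>x. \<bar>u x\<bar> \<le> C) \<Longrightarrow> \<phi> u \<le> C * M"
    and functional_continuous: "e > 0 \<Longrightarrow> \<exists>\<delta>>0. \<forall>u\<in>Db. (\<forall>x. \<bar>u x\<bar> \<le> 1) \<longrightarrow> Be u u \<le> \<delta> \<longrightarrow> \<bar>\<phi> u\<bar> \<le> e"
  using assms by (auto simp: energy_functional_def)

lemma functional_uminus: "energy_functional \<phi> M \<Longrightarrow> u \<in> Db \<Longrightarrow> \<phi> (\<lambda>x. - u x) = - \<phi> u"
  using functional_scale[of \<phi> M u "-1"] by simp

lemma functional_diff: "energy_functional \<phi> M \<Longrightarrow> u \<in> Db \<Longrightarrow> v \<in> Db \<Longrightarrow> \<phi> (\<lambda>x. u x - v x) = \<phi> u - \<phi> v"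
  using functional_add[of \<phi> M u "\<lambda>x. - v x"] by (simp add: functional_uminus Db_uminus)

lemma functional_abs_le: "energy_functional \<phi> M \<Longrightarrow> u \<in> Db \<Longrightarrow> (\<And>x. \<bar>u x\<bar> \<le> C) \<Longrightarrow> \<bar>\<phi> u\<bar> \<le> C * M"
  using functional_le[of \<phi> M u C] functional_le[of \<phi> M "\<lambda>x. - u x" C]
  by (simp add: functional_uminus Db_uminus)

lemma functional_tendsto:
  assumes \<phi>: "energy_functional \<phi> M" and w: "\<And>n. w n \<in> De" "\<And>n x. \<bar>w n x\<bar> \<le> C" and u: "u \<in> De" "\<And>x. \<bar>u x\<bar> \<le> C"
    and lim: "(\<lambda>n. V.nrm (\<lambda>x. w n x - u x)) \<longlonglongrightarrow> 0" and C: "0 < C"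
  shows "(\<lambda>n. \<phi> (w n)) \<longlonglongrightarrow> \<phi> u"
proof (rule LIMSEQ_I)
  fix r :: real assume r: "r > 0"
  define e where "e = r / (4 * C)"
  have e: "e > 0" using r C by (simp add: e_def)
  obtain \<delta> where \<delta>: "\<delta> > 0" "\<And>v. v \<in> Db \<Longrightarrow> (\<forall>x. \<bar>v x\<bar> \<le> 1) \<Longrightarrow> Be v v \<le> \<delta> \<Longrightarrow> \<bar>\<phi> v\<bar> \<le> e"
    using functional_continuous[OF \<phi> e] by blast
  let ?d = "\<lambda>n x. w n x - u x"
  let ?s = "\<lambda>n x. (1 / (2 * C)) * (w n x - u x)"
  have d: "?d n \<in> De" for n using w u by simp
  have db: "\<bar>?d n x\<bar> \<le> 2 * C" for n x using w(2)[of n x] u(2)[of x] by linarith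
  have dDb: "?d n \<in> Db" for n by (rule DbI[OF d db])
  have wDb: "w n \<in> Db" "u \<in> Db" for n using w u DbI by blast+
  have "(\<lambda>n. (1 / (2 * C)) * V.nrm (?d n)) \<longlonglongrightarrow> 0" using tendsto_mult_right_zero[OF lim] by blast
  moreover have "V.nrm (?s n) = (1 / (2 * C)) * V.nrm (?d n)" for n using C by (subst V.nrm_scale[OF d]) simp
  ultimately have "(\<lambda>n. V.nrm (?s n)) \<longlonglongrightarrow> 0" by simp
  moreover have s: "?s n \<in> De" for n by (rule V.scale_mem[OF d])
  ultimately have "(\<lambda>n. Be (?s n) (?s n)) \<longlonglongrightarrow> 0" using V.nrm_tendsto_iff[of ?s] by blast
  then have "\<forall>\<^sub>F n in sequentially. Be (?s n) (?s n) < \<delta>" using \<delta>(1) by (rule order_tendstoD(2))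
  then obtain N where N: "\<And>n. n \<ge> N \<Longrightarrow> Be (?s n) (?s n) < \<delta>" by (auto simp: eventually_sequentially)
  show "\<exists>N. \<forall>n\<ge>N. norm (\<phi> (w n) - \<phi> u) < r"
  proof (intro exI allI impI)
    fix n assume n: "n \<ge> N"
    have s1: "\<bar>?s n x\<bar> \<le> 1" for x using db[of n x] C by (simp add: abs_mult field_simps)
    have "\<bar>\<phi> (?s n)\<bar> \<le> e"
      by (rule \<delta>(2)[OF Db_scale[OF dDb] _ less_imp_le[OF N[OF n]]]) (rule allI, rule s1)
    moreover have "\<phi> (?s n) = (1 / (2 * C)) * (\<phi> (w n) - \<phi> u)"
      by (simp only: functional_scale[OF \<phi> dDb] functional_diff[OF \<phi> wDb])
    ultimately have "\<bar>(1 / (2 * C)) * (\<phi> (w n) - \<phi> u)\<bar> \<le> e" by (simp only:)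
    then have "\<bar>\<phi> (w n) - \<phi> u\<bar> \<le> 2 * C * e" using C by (simp add: abs_mult field_simps)
    also have "\<dots> < r" using r C by (simp add: e_def)
    finally show "norm (\<phi> (w n) - \<phi> u) < r" by simp
  qed
qed

definition obstacle_solution ::
  "('a \<Rightarrow> real \<Rightarrow> real) \<Rightarrow> (('a \<Rightarrow> real) \<Rightarrow> real) \<Rightarrow> real \<Rightarrow> ('a \<Rightarrow> real) \<Rightarrow> bool" where
  "obstacle_solution f \<phi> j u \<longleftrightarrow> u \<in> De \<and> (\<forall>x. \<bar>u x\<bar> \<le> j) \<and>
     (\<forall>w\<in>De. (\<forall>x. \<bar>w x\<bar> \<le> j) \<longrightarrow>
        (\<integral>x. f x (u x) * (w x - u x) \<partial>m) + \<phi> (\<lambda>x. w x - u x) \<le> Be u (\<lambda>x. w x - u x))"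

lemma absorption_integrable:
  assumes f: "absorption m f" and u: "u \<in> borel_measurable m" "\<And>x. \<bar>u x\<bar> \<le> j"
    and h: "h \<in> borel_measurable m" "\<And>x. \<bar>h x\<bar> \<le> C"
  shows "integrable m (\<lambda>x. f x (u x) * h x)"
proof -
  have "0 < \<bar>j\<bar> + 1" by simp
  then obtain F where F: "integrable m F" "\<And>x y. \<bar>y\<bar> \<le> \<bar>j\<bar> + 1 \<Longrightarrow> \<bar>f x y\<bar> \<le> F x" "\<And>x. 0 \<le> F x"
    using absorption_bound[OF f] by metis
  have ju: "\<bar>u x\<bar> \<le> \<bar>j\<bar> + 1" for x using u(2)[of x] by linarith
  show ?thesis
  proof (rule Bochner_Integration.integrable_bound)
    show "integrable m (\<lambda>x. F x * C)" using F by simp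
    show "AE x in m. norm (f x (u x) * h x) \<le> norm (F x * C)"
    proof (rule AE_I2)
      fix x
      have "\<bar>f x (u x)\<bar> * \<bar>h x\<bar> \<le> F x * C" using F(2)[OF ju] h(2) F(3) by (intro mult_mono) auto
      then show "norm (f x (u x) * h x) \<le> norm (F x * C)" by (simp add: abs_mult[symmetric])
    qed
  qed (use absorption_measurable[OF f u(1)] h in simp)
qed

end

section \<open>Existence for obstacle problems under the compactness assumption\<close>

locale compact_dirichlet_space = dirichlet_space +
  assumes compact: "(\<And>n. u n \<in> De) \<Longrightarrow> (\<And>n. Be (u n) (u n) \<le> K) \<Longrightarrow>
    \<exists>r v. strict_mono (r :: nat \<Rightarrow> nat) \<and> (AE x in m. (\<lambda>n. u (r n) x) \<longlonglongrightarrow> v x)"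
begin

text \<open>The three terms are treated differently along a minimizing sequence that converges a.e.:
  the integral of \<open>H\<close> by dominated convergence, the energy by lower semicontinuity, and
  \<open>\<phi>\<close> through Mazur combinations. Being linear, \<open>\<phi>\<close> has nearly
  the same value on the combinations as on the tail, and it is continuous along them because they
  converge in energy.\<close>

lemma minimizer_exists:
  assumes \<phi>: "energy_functional \<phi> M" and j: "0 < j"
    and H: "\<And>x y. H x y \<le> (0::real)" "\<And>y. (\<lambda>x. H x y) \<in> borel_measurable m" "\<And>x. continuous_on UNIV (H x)"
    and F: "integrable m F" "\<And>x y. \<bar>y\<bar> \<le> j \<Longrightarrow> \<bar>H x y\<bar> \<le> F x"
  shows "\<exists>u\<in>De. (\<forall>x. \<bar>u x\<bar> \<le> j) \<and> (\<forall>w\<in>De. (\<forall>x. \<bar>w x\<bar> \<le> j) \<longrightarrow>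
      Be u u / 2 - (\<integral>x. H x (u x) \<partial>m) - \<phi> u \<le> Be w w / 2 - (\<integral>x. H x (w x) \<partial>m) - \<phi> w)"
proof -
  define K where "K = {w \<in> De. \<forall>x. \<bar>w x\<bar> \<le> j}"
  define I where "I w = (\<integral>x. H x (w x) \<partial>m)" for w
  define J where "J w = Be w w / 2 - I w - \<phi> w" for w
  have KDb: "w \<in> Db" if "w \<in> K" for w using that DbI by (auto simp: K_def)
  have meas: "(\<lambda>x. H x (w x)) \<in> borel_measurable m" if "w \<in> borel_measurable m" for w
    by (rule caratheodory_comp_measurable[OF H(2,3) that])
  have I0: "I w \<le> 0" for w unfolding I_def using integral_nonneg_AE[of "\<lambda>x. - H x (w x)" m] H(1) by simp
  have \<phi>j: "\<bar>\<phi> w\<bar> \<le> j * M" if "w \<in> K" for w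
    using functional_abs_le[OF \<phi> KDb[OF that], of j] that by (simp add: K_def)
  have lower: "- (j * M) \<le> J w" and energy: "Be w w \<le> 2 * (J w + j * M)" if "w \<in> K" for w
  proof -
    have "0 \<le> Be w w" using that by (simp add: K_def)
    then show "- (j * M) \<le> J w" "Be w w \<le> 2 * (J w + j * M)"
      using I0[of w] \<phi>j[OF that] by (simp_all add: J_def)
  qed
  have zK: "(\<lambda>x. 0) \<in> K" using j by (simp add: K_def)
  define d where "d = (INF w\<in>K. J w)"
  have bd: "bdd_below (J ` K)" using lower by (intro bdd_belowI[of _ "- (j * M)"]) auto
  have d_le: "d \<le> J w" if "w \<in> K" for w unfolding d_def by (rule cINF_lower[OF bd that])
  have "\<exists>w\<in>K. J w < d + 1 / real (Suc n)" for n
  proof -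
    have "d < d + 1 / real (Suc n)" by simp
    then show ?thesis unfolding d_def using cINF_less_iff[OF _ bd] zK by blast
  qed
  then obtain v where v: "\<And>n. v n \<in> K" "\<And>n. J (v n) < d + 1 / real (Suc n)" by metis
  have vDe: "v n \<in> De" and vb: "\<bar>v n x\<bar> \<le> j" for n x using v(1)[of n] by (auto simp: K_def)
  have vE: "Be (v n) (v n) \<le> 2 * (d + 1 + j * M)" for n
  proof -
    have "1 / real (Suc n) \<le> 1" by simp
    then have "J (v n) \<le> d + 1" using order_trans[OF less_imp_le[OF v(2)] add_left_mono] by blast
    then show ?thesis using energy[OF v(1), of n] by (simp add: algebra_simps)
  qed
  obtain r z where r: "strict_mono r" "AE x in m. (\<lambda>n. v (r n) x) \<longlonglongrightarrow> z x"
    using compact[of v, OF vDe vE] by blast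
  \<comment> \<open>Energies and values of \<open>\<phi>\<close> as one point of the plane, so that
    a single extraction makes both converge.\<close>
  define s where "s n = (Be (v (r n)) (v (r n)), \<phi> (v (r n)))" for n
  have "range s \<subseteq> {0..2 * (d + 1 + j * M)} \<times> {- (j * M)..j * M}"
    using vE vDe \<phi>j[OF v(1)] by (auto simp: s_def abs_le_iff minus_le_iff)
  then have "bounded (range s)"
    by (rule bounded_subset[rotated]) (intro bounded_Times bounded_closed_interval)
  then obtain l r' where r': "strict_mono r'" "(s \<circ> r') \<longlonglongrightarrow> l"
    using bounded_imp_convergent_subsequence by blast
  define q where "q n = r (r' n)" for n
  have q: "strict_mono q" unfolding q_def using strict_mono_o[OF r(1) r'(1)] by (simp add: o_def)
  have lim_B: "(\<lambda>n. Be (v (q n)) (v (q n))) \<longlonglongrightarrow> fst l" and lim_\<phi>: "(\<lambda>n. \<phi> (v (q n))) \<longlonglongrightarrow> snd l"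
    using tendsto_fst[OF r'(2)] tendsto_snd[OF r'(2)] by (simp_all add: s_def q_def)
  have ae_z: "AE x in m. (\<lambda>n. v (q n) x) \<longlonglongrightarrow> z x"
    using r(2)
  proof eventually_elim
    case (elim x)
    from LIMSEQ_subseq_LIMSEQ[OF elim r'(1)] show ?case by (simp add: q_def o_def)
  qed
  \<comment> \<open>The limit \<open>z\<close> provided by compactness need not be measurable. The
    function \<open>lim\<close> is, and truncation enforces the obstacle also on the exceptional
    null set.\<close>
  define u where "u = trunc j (\<lambda>x. lim (\<lambda>n. v (q n) x))"
  note [measurable] = De_measurable[OF vDe]
  have u_meas: "u \<in> borel_measurable m" unfolding u_def by measurable
  have ub: "\<bar>u x\<bar> \<le> j" for x using j by (simp add: u_def abs_trunc)
  have ae: "AE x in m. (\<lambda>n. v (q n) x) \<longlonglongrightarrow> u x"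
    using ae_z
  proof eventually_elim
    case (elim x)
    have "\<bar>z x\<bar> \<le> j" by (rule LIMSEQ_le_const2[OF tendsto_rabs[OF elim]]) (use vb in auto)
    then have "u x = z x" unfolding u_def using limI[OF elim] by (simp add: trunc_def)
    then show ?case using elim by simp
  qed
  obtain w where w: "u \<in> De" "\<And>N. w N \<in> mix {v (q n) | n. n \<ge> N}" "(\<lambda>n. V.nrm (\<lambda>x. w n x - u x)) \<longlonglongrightarrow> 0"
    by (rule Mazur[OF vDe vE u_meas ae]) (rule that)
  have uK: "u \<in> K" using w(1) ub by (simp add: K_def)
  have B_le: "Be u u \<le> fst l"
    by (rule form_lower_semicontinuous(2)[OF vDe order_refl lim_B u_meas ae])
  have wK: "w N \<in> K" for N
  proof -
    have "w N \<in> De" by (rule V.mix_mem[OF w(2)]) (use vDe in auto)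
    moreover have "\<bar>w N x - 0\<bar> \<le> j" for x
      by (rule mix_pointwise_bound[OF w(2)]) (use vb in auto)
    ultimately show ?thesis by (simp add: K_def)
  qed
  have \<phi>w: "(\<lambda>N. \<phi> (w N)) \<longlonglongrightarrow> snd l"
  proof (rule LIMSEQ_I)
    fix e :: real assume e: "e > 0"
    then have "e / 2 > 0" by simp
    from LIMSEQ_D[OF lim_\<phi> this] obtain N where N: "\<And>n. n \<ge> N \<Longrightarrow> \<bar>\<phi> (v (q n)) - snd l\<bar> < e / 2" by auto
    \<comment> \<open>Membership in \<open>K\<close> is carried through the induction because
      linearity of \<open>\<phi>\<close> is available only on bounded functions.\<close>
    have "\<bar>\<phi> a - snd l\<bar> \<le> e / 2 \<and> a \<in> K" if "a \<in> mix {v (q n) | n. n \<ge> M'}" "M' \<ge> N" for a M'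
      using that(1)
    proof induction
      case (base a)
      then show ?case using N that(2) v(1) by (auto intro: less_imp_le)
    next
      case (comb a b t)
      have ab: "a \<in> Db" "b \<in> Db" using comb KDb by auto
      have "\<phi> (\<lambda>x. t * a x + (1 - t) * b x) = t * \<phi> a + (1 - t) * \<phi> b"
        by (simp only: functional_add[OF \<phi> Db_scale[OF ab(1)] Db_scale[OF ab(2)]]
            functional_scale[OF \<phi> ab(1)] functional_scale[OF \<phi> ab(2)])
      then have eq: "\<phi> (\<lambda>x. t * a x + (1 - t) * b x) - snd l = t * (\<phi> a - snd l) + (1 - t) * (\<phi> b - snd l)"
        by (simp only:) (simp add: algebra_simps)
      have "\<bar>\<phi> (\<lambda>x. t * a x + (1 - t) * b x) - snd l\<bar> \<le> e / 2"
        unfolding eq using comb by (intro convex_comb_abs_le) auto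
      moreover have "\<bar>t * a x + (1 - t) * b x\<bar> \<le> j" for x
        using comb by (intro convex_comb_abs_le) (auto simp: K_def)
      moreover have "(\<lambda>x. t * a x + (1 - t) * b x) \<in> De" using ab Db_De by simp
      ultimately show ?case unfolding K_def by blast
    qed
    then have "\<bar>\<phi> (w M') - snd l\<bar> \<le> e / 2" if "M' \<ge> N" for M' using w(2) that by blast
    then show "\<exists>N. \<forall>n\<ge>N. norm (\<phi> (w n) - snd l) < e" using e by (intro exI[of _ N]) force
  qed
  have "(\<lambda>N. \<phi> (w N)) \<longlonglongrightarrow> \<phi> u"
    by (rule functional_tendsto[OF \<phi> _ _ w(1) ub w(3) j]) (use wK in \<open>auto simp: K_def\<close>)
  with \<phi>w have \<phi>u: "\<phi> u = snd l" by (rule LIMSEQ_unique[symmetric])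
  have I_lim: "(\<lambda>n. I (v (q n))) \<longlonglongrightarrow> I u"
    unfolding I_def
  proof (rule integral_dominated_convergence[OF _ _ F(1)])
    show "AE x in m. (\<lambda>n. H x (v (q n) x)) \<longlonglongrightarrow> H x (u x)"
      using ae
    proof eventually_elim
      case (elim x)
      have "isCont (H x) (u x)" using H(3) continuous_on_eq_continuous_at open_UNIV by blast
      then show ?case using elim by (rule isCont_tendsto_compose)
    qed
  qed (use F(2) vb meas u_meas in auto)
  have "(\<lambda>n. J (v (q n))) \<longlonglongrightarrow> fst l / 2 - I u - snd l"
    unfolding J_def by (intro tendsto_intros lim_B lim_\<phi> I_lim) simp
  moreover have "(\<lambda>n. d + 1 / real (Suc (q n))) \<longlonglongrightarrow> d + 0"
  proof (intro tendsto_intros)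
    have "(\<lambda>n. 1 / real (Suc n)) \<longlonglongrightarrow> 0"
      using LIMSEQ_inverse_real_of_nat by (simp add: inverse_eq_divide)
    from LIMSEQ_subseq_LIMSEQ[OF this q] show "(\<lambda>n. 1 / real (Suc (q n))) \<longlonglongrightarrow> 0" by (simp add: o_def)
  qed
  ultimately have "fst l / 2 - I u - snd l \<le> d + 0"
    by (rule LIMSEQ_le) (use v(2) in \<open>auto intro: less_imp_le\<close>)
  then have "J u \<le> d" using B_le \<phi>u by (simp add: J_def)
  then have "J u \<le> J w'" if "w' \<in> K" for w' using d_le[OF that] by linarith
  then show ?thesis using uK by (intro bexI[of _ u]) (auto simp: K_def J_def I_def)
qed

text \<open>First-order condition for the minimizer along the segment from \<open>u\<close> to
  \<open>w\<close>, which stays below the obstacle by convexity. The integral of the primitive is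
  differentiated by dominated convergence, the Lipschitz bound of \<open>H\<close> controlling the
  difference quotients by \<open>F x * (2 * j)\<close>.\<close>

lemma obstacle_solution_exists:
  assumes f: "absorption m f" and \<phi>: "energy_functional \<phi> M" and j: "0 < j"
  shows "\<exists>u. obstacle_solution f \<phi> j u"
proof -
  obtain H where H: "\<And>x y. (H x has_real_derivative f x y) (at y)" "\<And>x. H x 0 = 0"
    "\<And>y. (\<lambda>x. H x y) \<in> borel_measurable m"
    using absorption_primitive[OF f] by metis
  obtain F where F: "integrable m F" "\<And>x y. \<bar>y\<bar> \<le> j \<Longrightarrow> \<bar>f x y\<bar> \<le> F x" "\<And>x. 0 \<le> F x"
    using absorption_bound[OF f j] by metis
  have Hlip: "\<bar>H x y - H x z\<bar> \<le> F x * \<bar>y - z\<bar>" if "\<bar>y\<bar> \<le> j" "\<bar>z\<bar> \<le> j" for x y z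
    by (rule primitive_lipschitz[where f = f]) (use H F(2) that in auto)
  have Hb: "\<bar>H x y\<bar> \<le> F x * j" if "\<bar>y\<bar> \<le> j" for x y
  proof -
    have "\<bar>H x y - H x 0\<bar> \<le> F x * \<bar>y - 0\<bar>" by (rule Hlip) (use that j in auto)
    also have "\<dots> \<le> F x * j" using that F(3) by (intro mult_left_mono) auto
    finally show ?thesis using H(2) by simp
  qed
  have Hc: "continuous_on UNIV (H x)" for x
    using H(1) DERIV_isCont by (intro continuous_at_imp_continuous_on) blast
  have Fj: "integrable m (\<lambda>x. F x * j)" using F by simp
  obtain u where u: "u \<in> De" "\<And>x. \<bar>u x\<bar> \<le> j"
    "\<And>w. w \<in> De \<Longrightarrow> (\<And>x. \<bar>w x\<bar> \<le> j) \<Longrightarrow>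
      Be u u / 2 - (\<integral>x. H x (u x) \<partial>m) - \<phi> u \<le> Be w w / 2 - (\<integral>x. H x (w x) \<partial>m) - \<phi> w"
    using minimizer_exists[OF \<phi> j primitive_nonpos[OF H(1,2) f] H(3) Hc Fj Hb] by blast
  have meas: "(\<lambda>x. H x (w x)) \<in> borel_measurable m" if "w \<in> borel_measurable m" for w
    by (rule caratheodory_comp_measurable[OF H(3) Hc that])
  have intH: "integrable m (\<lambda>x. H x (w x))" if "w \<in> borel_measurable m" "\<And>x. \<bar>w x\<bar> \<le> j" for w
  proof (rule Bochner_Integration.integrable_bound[OF Fj meas[OF that(1)]])
    show "AE x in m. norm (H x (w x)) \<le> norm (F x * j)"
      using Hb[OF that(2)] F(3) j by (intro AE_I2) simp
  qed
  have "(\<integral>x. f x (u x) * (w x - u x) \<partial>m) + \<phi> (\<lambda>x. w x - u x) \<le> Be u (\<lambda>x. w x - u x)"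
    if w: "w \<in> De" "\<And>x. \<bar>w x\<bar> \<le> j" for w
  proof -
    let ?h = "\<lambda>x. w x - u x"
    have h: "?h \<in> De" and hDb: "?h \<in> Db" and uDb: "u \<in> Db"
      using u w DbI[OF u(1,2)] DbI[OF w] Db_diff by auto
    note [measurable] = De_measurable[OF u(1)] De_measurable[OF h]
    define t where "t n = 1 / real (Suc n)" for n
    have t: "0 < t n" "t n \<le> 1" for n by (simp_all add: t_def)
    have t0: "t \<longlonglongrightarrow> 0" unfolding t_def using LIMSEQ_inverse_real_of_nat by (simp add: inverse_eq_divide)
    have cb: "\<bar>u x + t n * ?h x\<bar> \<le> j" for n x
    proof -
      have "u x + t n * ?h x = t n * w x + (1 - t n) * u x" by (simp add: algebra_simps)
      also have "\<bar>\<dots>\<bar> \<le> j"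
        using t[of n] u(2)[of x] w(2)[of x] by (intro convex_comb_abs_le) auto
      finally show ?thesis .
    qed
    let ?Q = "\<lambda>n x. (H x (u x + t n * ?h x) - H x (u x)) / t n"
    have Qlim: "(\<lambda>n. \<integral>x. ?Q n x \<partial>m) \<longlonglongrightarrow> (\<integral>x. f x (u x) * ?h x \<partial>m)"
    proof (rule integral_dominated_convergence)
      show "integrable m (\<lambda>x. F x * (2 * j))" using F by simp
      show "AE x in m. (\<lambda>n. ?Q n x) \<longlonglongrightarrow> f x (u x) * ?h x"
      proof (rule AE_I2)
        fix x
        have "((\<lambda>s. H x (u x + s * ?h x)) has_real_derivative f x (u x + 0 * ?h x) * ?h x) (at 0)"
          by (rule DERIV_chain2[OF H(1)]) (auto intro!: derivative_eq_intros)
        then have "(\<lambda>s. (H x (u x + (0 + s) * ?h x) - H x (u x + 0 * ?h x)) / s) \<midarrow>0\<rightarrow> f x (u x) * ?h x"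
          unfolding DERIV_def by simp
        then have "(\<lambda>s. (H x (u x + s * ?h x) - H x (u x)) / s) \<midarrow>0\<rightarrow> f x (u x) * ?h x" by simp
        moreover have "\<forall>n. t n \<noteq> 0" using t(1) by (metis less_irrefl)
        ultimately show "(\<lambda>n. ?Q n x) \<longlonglongrightarrow> f x (u x) * ?h x"
          using t0 LIMSEQ_SEQ_conv[of 0 "\<lambda>s. (H x (u x + s * ?h x) - H x (u x)) / s"] by blast
      qed
      fix n
      show "AE x in m. norm (?Q n x) \<le> F x * (2 * j)"
      proof (rule AE_I2)
        fix x
        have "\<bar>H x (u x + t n * ?h x) - H x (u x)\<bar> \<le> F x * \<bar>(u x + t n * ?h x) - u x\<bar>"
          by (rule Hlip[OF cb u(2)])
        also have "\<bar>(u x + t n * ?h x) - u x\<bar> = \<bar>?h x\<bar> * t n"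
          using t(1)[of n] by (simp add: abs_mult mult.commute)
        finally have "\<bar>H x (u x + t n * ?h x) - H x (u x)\<bar> / t n \<le> F x * \<bar>?h x\<bar>"
          using t(1)[of n] by (simp only: pos_divide_le_eq mult.assoc)
        also have "\<dots> \<le> F x * (2 * j)"
          using u(2)[of x] w(2)[of x] F(3) by (intro mult_left_mono) auto
        finally show "norm (?Q n x) \<le> F x * (2 * j)" using t(1)[of n] by simp
      qed
    next
      fix n show "(\<lambda>x. ?Q n x) \<in> borel_measurable m"
        using meas[of "\<lambda>x. u x + t n * ?h x"] meas[of u] by measurable
    next
      show "(\<lambda>x. f x (u x) * ?h x) \<in> borel_measurable m"
        using absorption_measurable[OF f De_measurable[OF u(1)]] by measurable
    qed
    have "(\<integral>x. ?Q n x \<partial>m) + \<phi> ?h \<le> Be u ?h + t n / 2 * Be ?h ?h" for n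
    proof -
      let ?v = "\<lambda>x. u x + t n * ?h x"
      have v: "?v \<in> De" by (rule V.add_mem[OF u(1) V.scale_mem[OF h]])
      have "Be u u / 2 - (\<integral>x. H x (u x) \<partial>m) - \<phi> u \<le> Be ?v ?v / 2 - (\<integral>x. H x (?v x) \<partial>m) - \<phi> ?v"
        by (rule u(3)[OF v cb])
      moreover have "Be ?v ?v = Be u u + 2 * t n * Be u ?h + (t n)\<^sup>2 * Be ?h ?h"
        by (rule V.form_add_scale_sq[OF u(1) h])
      moreover have "\<phi> ?v = \<phi> u + t n * \<phi> ?h"
        using functional_add[OF \<phi> uDb Db_scale[OF hDb]] functional_scale[OF \<phi> hDb] by simp
      moreover have "(\<integral>x. ?Q n x \<partial>m) = ((\<integral>x. H x (?v x) \<partial>m) - (\<integral>x. H x (u x) \<partial>m)) / t n"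
        using intH[OF De_measurable[OF v] cb] intH[OF De_measurable[OF u(1)] u(2)] by simp
      ultimately have "t n * ((\<integral>x. ?Q n x \<partial>m) + \<phi> ?h) \<le> t n * (Be u ?h + t n / 2 * Be ?h ?h)"
        using t(1)[of n] by (simp add: power2_eq_square algebra_simps)
      then show ?thesis using t(1)[of n] by (simp only: mult_le_cancel_left_pos)
    qed
    moreover have "(\<lambda>n. (\<integral>x. ?Q n x \<partial>m) + \<phi> ?h) \<longlonglongrightarrow> (\<integral>x. f x (u x) * ?h x \<partial>m) + \<phi> ?h"
      by (intro tendsto_intros Qlim)
    moreover have "(\<lambda>n. Be u ?h + t n / 2 * Be ?h ?h) \<longlonglongrightarrow> Be u ?h + 0 / 2 * Be ?h ?h"
      by (intro tendsto_intros t0) simp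
    ultimately have "(\<integral>x. f x (u x) * ?h x \<partial>m) + \<phi> ?h \<le> Be u ?h + 0 / 2 * Be ?h ?h"
      by (intro LIMSEQ_le) auto
    then show ?thesis by simp
  qed
  then show ?thesis using u by (auto simp: obstacle_solution_def)
qed

end

subsection \<open>Estimates for solutions of obstacle problems\<close>

lemma
  fixes f g :: "'a \<Rightarrow> real"
  assumes g: "integrable m g" and f: "f \<in> borel_measurable m" and le: "AE x in m. \<bar>f x\<bar> \<le> g x"
  shows integrable_if_abs_le: "integrable m f" and abs_integral_le: "\<bar>\<integral>x. f x \<partial>m\<bar> \<le> (\<integral>x. g x \<partial>m)"
proof -
  show int: "integrable m f"
    by (rule Bochner_Integration.integrable_bound[OF g f]) (use le in \<open>eventually_elim, simp\<close>)
  have "\<bar>\<integral>x. f x \<partial>m\<bar> \<le> (\<integral>x. \<bar>f x\<bar> \<partial>m)" by (rule integral_abs_bound)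
  also have "\<dots> \<le> (\<integral>x. g x \<partial>m)" by (rule integral_mono_AE) (use int g le in auto)
  finally show "\<bar>\<integral>x. f x \<partial>m\<bar> \<le> (\<integral>x. g x \<partial>m)" .
qed

text \<open>A continuous substitute for the sign of \<open>u\<close> times the indicator of
  \<open>{\<bar>u\<bar> > k}\<close>, obtained by interpolating between the levels \<open>k\<close>
  and \<open>k + 1\<close>.\<close>

definition layer :: "real \<Rightarrow> ('a \<Rightarrow> real) \<Rightarrow> 'a \<Rightarrow> real" where
  "layer k u x = trunc (k + 1) u x - trunc k u x"

lemma layer_abs_le: "0 \<le> k \<Longrightarrow> \<bar>layer k u x\<bar> \<le> 1"
  by (auto simp: layer_def trunc_def)

lemma layer_abs_le_min: "0 < k \<Longrightarrow> \<bar>layer k u x\<bar> \<le> (1 / k) * min \<bar>u x\<bar> k"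
proof -
  assume k: "0 < k"
  show ?thesis
  proof (cases "\<bar>u x\<bar> \<le> k")
    case True
    then have "layer k u x = 0" by (simp add: layer_def trunc_eq)
    then show ?thesis using k by simp
  next
    case False
    then show ?thesis using k layer_abs_le[of k u x] by (simp add: min_def)
  qed
qed

lemma layer_abs_eq_1: "0 \<le> k \<Longrightarrow> k + 1 \<le> \<bar>u x\<bar> \<Longrightarrow> \<bar>layer k u x\<bar> = 1"
  by (auto simp: layer_def trunc_def)

lemma layer_sign: "0 \<le> k \<Longrightarrow> 0 \<le> layer k u x * u x"
  by (auto simp: layer_def trunc_def min_def max_def zero_le_mult_iff)

lemma trunc_sign: "0 \<le> k \<Longrightarrow> 0 \<le> trunc k u x * u x"
  by (auto simp: trunc_def min_def max_def zero_le_mult_iff)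

lemma layer_tendsto: "(\<lambda>n. v n x) \<longlonglongrightarrow> u x \<Longrightarrow> (\<lambda>n. layer k (v n) x) \<longlonglongrightarrow> layer k u x"
  unfolding layer_def by (intro tendsto_intros trunc_tendsto)

lemma borel_measurable_layer [measurable]:
  "u \<in> borel_measurable m \<Longrightarrow> layer k u \<in> borel_measurable m"
  unfolding layer_def by (intro borel_measurable_diff borel_measurable_trunc)

context dirichlet_space
begin

definition positive_functional :: "(('a \<Rightarrow> real) \<Rightarrow> real) \<Rightarrow> real \<Rightarrow> bool" where
  "positive_functional \<phi> M \<longleftrightarrow> energy_functional \<phi> M \<and>
     (\<forall>u\<in>Db. \<forall>v\<in>Db. (\<forall>x. u x \<le> v x) \<longrightarrow> \<phi> u \<le> \<phi> v)"

lemma positive_functional_mono: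
  "positive_functional \<phi> M \<Longrightarrow> u \<in> Db \<Longrightarrow> v \<in> Db \<Longrightarrow> (\<And>x. u x \<le> v x) \<Longrightarrow> \<phi> u \<le> \<phi> v"
  by (auto simp: positive_functional_def)

lemma positive_functional_energy: "positive_functional \<phi> M \<Longrightarrow> energy_functional \<phi> M"
  by (simp add: positive_functional_def)

lemma positive_functional_nonneg:
  assumes "positive_functional \<phi> M" "u \<in> Db" "\<And>x. 0 \<le> u x"
  shows "0 \<le> \<phi> u"
proof -
  have z: "(\<lambda>x. 0) \<in> Db" by (rule DbI[where C = 0]) auto
  have "\<phi> (\<lambda>x. 0 * u x) = 0"
    using functional_scale[OF positive_functional_energy[OF assms(1)] assms(2), of 0] by simp
  then show ?thesis using positive_functional_mono[OF assms(1) z assms(2)] assms(3) by simp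
qed

lemma energy_functional_add:
  assumes \<phi>: "energy_functional \<phi> M" and \<psi>: "energy_functional \<psi> K"
  shows "energy_functional (\<lambda>v. \<phi> v + \<psi> v) (M + K)"
  unfolding energy_functional_def
proof (intro conjI ballI allI impI)
  fix u v c C assume u: "u \<in> Db"
  show "\<phi> (\<lambda>x. u x + v x) + \<psi> (\<lambda>x. u x + v x) = (\<phi> u + \<psi> u) + (\<phi> v + \<psi> v)" if "v \<in> Db"
    using functional_add[OF \<phi> u that] functional_add[OF \<psi> u that] by simp
  show "\<phi> (\<lambda>x. c * u x) + \<psi> (\<lambda>x. c * u x) = c * (\<phi> u + \<psi> u)"
    using functional_scale[OF \<phi> u] functional_scale[OF \<psi> u] by (simp add: algebra_simps)
  show "\<phi> u + \<psi> u \<le> C * (M + K)" if "\<forall>x. \<bar>u x\<bar> \<le> C"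
    using functional_le[OF \<phi> u, of C] functional_le[OF \<psi> u, of C] that by (simp add: algebra_simps)
next
  fix e :: real assume "e > 0"
  then have e2: "e / 2 > 0" by simp
  obtain \<delta>1 where 1: "\<delta>1 > 0" "\<And>u. u \<in> Db \<Longrightarrow> (\<forall>x. \<bar>u x\<bar> \<le> 1) \<Longrightarrow> Be u u \<le> \<delta>1 \<Longrightarrow> \<bar>\<phi> u\<bar> \<le> e / 2"
    using functional_continuous[OF \<phi> e2] by blast
  obtain \<delta>2 where 2: "\<delta>2 > 0" "\<And>u. u \<in> Db \<Longrightarrow> (\<forall>x. \<bar>u x\<bar> \<le> 1) \<Longrightarrow> Be u u \<le> \<delta>2 \<Longrightarrow> \<bar>\<psi> u\<bar> \<le> e / 2"
    using functional_continuous[OF \<psi> e2] by blast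
  show "\<exists>\<delta>>0. \<forall>u\<in>Db. (\<forall>x. \<bar>u x\<bar> \<le> 1) \<longrightarrow> Be u u \<le> \<delta> \<longrightarrow> \<bar>\<phi> u + \<psi> u\<bar> \<le> e"
  proof (intro exI[of _ "min \<delta>1 \<delta>2"] conjI ballI impI)
    fix u assume "u \<in> Db" "\<forall>x. \<bar>u x\<bar> \<le> 1" "Be u u \<le> min \<delta>1 \<delta>2"
    then show "\<bar>\<phi> u + \<psi> u\<bar> \<le> e" using 1(2)[of u] 2(2)[of u] by simp
  qed (use 1 2 in simp)
qed

lemma energy_functional_uminus:
  assumes \<phi>: "energy_functional \<phi> M"
  shows "energy_functional (\<lambda>v. - \<phi> v) M"
  unfolding energy_functional_def
proof (intro conjI ballI allI impI)
  fix u v c C assume u: "u \<in> Db"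
  show "- \<phi> (\<lambda>x. u x + v x) = - \<phi> u + - \<phi> v" if "v \<in> Db" using functional_add[OF \<phi> u that] by simp
  show "- \<phi> (\<lambda>x. c * u x) = c * - \<phi> u" using functional_scale[OF \<phi> u] by simp
  show "- \<phi> u \<le> C * M" if "\<forall>x. \<bar>u x\<bar> \<le> C"
    using functional_abs_le[OF \<phi> u, of C] that by (simp add: abs_le_iff)
next
  fix e :: real assume "e > 0"
  from functional_continuous[OF \<phi> this]
  show "\<exists>\<delta>>0. \<forall>u\<in>Db. (\<forall>x. \<bar>u x\<bar> \<le> 1) \<longrightarrow> Be u u \<le> \<delta> \<longrightarrow> \<bar>- \<phi> u\<bar> \<le> e" by simp
qed

lemma positive_functional_add:
  assumes "positive_functional \<phi> M" "positive_functional \<psi> K"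
  shows "positive_functional (\<lambda>v. \<phi> v + \<psi> v) (M + K)"
  using assms energy_functional_add by (auto simp: positive_functional_def add_mono)

lemma trunc_Db: "u \<in> De \<Longrightarrow> 0 < k \<Longrightarrow> trunc k u \<in> Db"
  by (rule DbI[where C = k]) (auto simp: abs_trunc)

lemma layer_Db:
  assumes "u \<in> De" "0 < k"
  shows "layer k u \<in> Db"
proof -
  have "(\<lambda>x. trunc (k + 1) u x - trunc k u x) \<in> Db"
    using assms by (intro Db_diff trunc_Db) auto
  then show ?thesis by (simp add: layer_def[abs_def])
qed

lemma
  assumes "obstacle_solution f \<phi> j u"
  shows obstacle_mem: "u \<in> De" and obstacle_le: "\<bar>u x\<bar> \<le> j" and obstacle_Db: "u \<in> Db"
  using assms by (auto simp: obstacle_solution_def intro: DbI)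

lemma obstacle_test:
  assumes u: "obstacle_solution f \<phi> j u" and h: "h \<in> De" "\<And>x. \<bar>u x + h x\<bar> \<le> j"
  shows "(\<integral>x. f x (u x) * h x \<partial>m) + \<phi> h \<le> Be u h"
proof -
  have "(\<lambda>x. u x + h x) \<in> De" using obstacle_mem[OF u] h by simp
  from u[unfolded obstacle_solution_def, THEN conjunct2, THEN conjunct2, THEN bspec, OF this] h(2)
  show ?thesis by simp
qed

text \<open>Reflection preserves the class of obstacle problems, so lower bounds follow from upper
  bounds for the reflected data.\<close>

lemma obstacle_uminus:
  assumes u: "obstacle_solution f \<phi> j u" and \<phi>: "energy_functional \<phi> M"
  shows "obstacle_solution (\<lambda>x y. - f x (- y)) (\<lambda>v. - \<phi> v) j (\<lambda>x. - u x)"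
  unfolding obstacle_solution_def
proof (intro conjI ballI allI impI)
  show "(\<lambda>x. - u x) \<in> De" using obstacle_mem[OF u] by simp
  show "\<bar>- u x\<bar> \<le> j" for x using obstacle_le[OF u] by simp
  fix w assume w: "w \<in> De" "\<forall>x. \<bar>w x\<bar> \<le> j"
  let ?g = "\<lambda>x. w x - - u x"
  have "(\<lambda>x. w x + u x) \<in> Db"
    by (rule Db_add[OF DbI[where C = j] obstacle_Db[OF u]]) (use w in blast)+
  then have g: "?g \<in> De" "?g \<in> Db" using Db_De by simp_all
  have "(\<integral>x. f x (u x) * (- ?g x) \<partial>m) + \<phi> (\<lambda>x. - ?g x) \<le> Be u (\<lambda>x. - ?g x)"
  proof (rule obstacle_test[OF u V.uminus_mem[OF g(1)]])
    fix x show "\<bar>u x + - ?g x\<bar> \<le> j" using w(2) by simp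
  qed
  moreover have "\<phi> (\<lambda>x. - ?g x) = - \<phi> ?g" by (rule functional_uminus[OF \<phi> g(2)])
  moreover have "Be u (\<lambda>x. - ?g x) = - Be u ?g" by (rule V.form_uminus_right[OF g(1) obstacle_mem[OF u]])
  moreover have "Be (\<lambda>x. - u x) ?g = - Be u ?g" by (rule V.form_uminus_left[OF obstacle_mem[OF u] g(1)])
  moreover have "(\<lambda>x. f x (u x) * (- ?g x)) = (\<lambda>x. - f x (- (- u x)) * ?g x)"
    by (rule ext) (simp add: algebra_simps)
  ultimately show "(\<integral>x. - f x (- (- u x)) * ?g x \<partial>m) + - \<phi> ?g \<le> Be (\<lambda>x. - u x) ?g"
    by (simp only:)
qed

text \<open>Subtracting its truncation from \<open>u\<close> only shrinks
  \<open>\<bar>u\<bar>\<close>, hence is admissible. The absorption term then has a favourable sign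
  and drops out, so the bound depends neither on \<open>f\<close> nor on \<open>j\<close>.\<close>

lemma obstacle_trunc_le:
  assumes f: "absorption m f" and \<phi>: "energy_functional \<phi> M" and u: "obstacle_solution f \<phi> j u" and k: "0 < k"
  shows "Be (trunc k u) (trunc k u) \<le> k * M"
proof -
  let ?t = "trunc k u"
  have uDe: "u \<in> De" by (rule obstacle_mem[OF u])
  have t: "?t \<in> De" "?t \<in> Db" using uDe k trunc_Db by auto
  have "(\<integral>x. f x (u x) * (- ?t x) \<partial>m) + \<phi> (\<lambda>x. - ?t x) \<le> Be u (\<lambda>x. - ?t x)"
  proof (rule obstacle_test[OF u V.uminus_mem[OF t(1)]])
    fix x
    have "\<bar>u x + - ?t x\<bar> \<le> \<bar>u x\<bar>" using k by (auto simp: trunc_def)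
    then show "\<bar>u x + - ?t x\<bar> \<le> j" using obstacle_le[OF u, of x] by linarith
  qed
  moreover have "0 \<le> (\<integral>x. f x (u x) * (- ?t x) \<partial>m)"
  proof (rule integral_nonneg_AE, rule AE_I2)
    fix x show "0 \<le> f x (u x) * (- ?t x)"
      using absorption_mult[OF f, of "?t x" "u x" x] trunc_sign[of k u x] k by simp
  qed
  ultimately have "Be u ?t \<le> \<phi> ?t"
    using functional_uminus[OF \<phi> t(2)] V.form_uminus_right[OF t(1) uDe] by simp
  also have "\<dots> \<le> k * M" by (rule functional_le[OF \<phi> t(2)]) (use k in \<open>simp add: abs_trunc\<close>)
  finally show ?thesis using V.form_trunc_le(1)[OF uDe k] by simp
qed

text \<open>Now the energy term drops out, by \<open>form_layer_nonneg\<close>, and the absorption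
  term is kept: it is the integral of \<open>\<bar>f\<bar>\<close> over the layer.\<close>

lemma obstacle_layer_le:
  assumes f: "absorption m f" and \<phi>: "energy_functional \<phi> M" and u: "obstacle_solution f \<phi> j u" and k: "0 < k"
  shows "(\<integral>x. \<bar>f x (u x)\<bar> * \<bar>layer k u x\<bar> \<partial>m) \<le> \<phi> (layer k u)"
proof -
  let ?t = "layer k u"
  have uDe: "u \<in> De" by (rule obstacle_mem[OF u])
  have t: "?t \<in> Db" "?t \<in> De" using layer_Db[OF uDe k] Db_De by auto
  have "(\<integral>x. f x (u x) * (- ?t x) \<partial>m) + \<phi> (\<lambda>x. - ?t x) \<le> Be u (\<lambda>x. - ?t x)"
  proof (rule obstacle_test[OF u V.uminus_mem[OF t(2)]])
    fix x
    have "\<bar>u x + - ?t x\<bar> \<le> \<bar>u x\<bar>" using k by (auto simp: layer_def trunc_def)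
    then show "\<bar>u x + - ?t x\<bar> \<le> j" using obstacle_le[OF u, of x] by linarith
  qed
  moreover have "0 \<le> Be u ?t"
    using V.form_layer_nonneg[OF uDe k] by (simp add: layer_def[abs_def])
  moreover have "(\<lambda>x. f x (u x) * (- ?t x)) = (\<lambda>x. \<bar>f x (u x)\<bar> * \<bar>?t x\<bar>)"
  proof
    fix x show "f x (u x) * (- ?t x) = \<bar>f x (u x)\<bar> * \<bar>?t x\<bar>"
      using absorption_mult[OF f, of "?t x" "u x" x] layer_sign[of k u x] k by simp
  qed
  then have "(\<integral>x. f x (u x) * (- ?t x) \<partial>m) = (\<integral>x. \<bar>f x (u x)\<bar> * \<bar>?t x\<bar> \<partial>m)" by (simp only:)
  ultimately show ?thesis
    using functional_uminus[OF \<phi> t(1)] V.form_uminus_right[OF t(2) uDe] by simp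
qed

text \<open>\<open>(\<bar>u\<bar> \<and> k) / k\<close> is bounded by \<open>1\<close> and dominates the indicator function of \<open>{\<bar>u\<bar> \<ge> k}\<close>; its
  energy is at most \<open>M / k\<close>.  This is what makes all tails small uniformly in \<open>u\<close>.\<close>

lemma functional_tail_small:
  assumes \<phi>: "energy_functional \<phi> M" and e: "e > 0"
  shows "\<exists>k0>0. \<forall>k\<ge>k0. \<forall>u\<in>De. Be (trunc k u) (trunc k u) \<le> k * M' \<longrightarrow>
    \<bar>\<phi> (\<lambda>x. (1 / k) * min \<bar>u x\<bar> k)\<bar> \<le> e"
proof -
  obtain \<delta> where \<delta>: "\<delta> > 0" "\<And>v. v \<in> Db \<Longrightarrow> (\<forall>x. \<bar>v x\<bar> \<le> 1) \<Longrightarrow> Be v v \<le> \<delta> \<Longrightarrow> \<bar>\<phi> v\<bar> \<le> e"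
    using functional_continuous[OF \<phi> e] by blast
  define k0 where "k0 = \<bar>M'\<bar> / \<delta> + 1"
  have "k0 > 0" using \<delta>(1) by (simp add: k0_def add_nonneg_pos)
  moreover have "\<bar>\<phi> (\<lambda>x. (1 / k) * min \<bar>u x\<bar> k)\<bar> \<le> e"
    if k: "k \<ge> k0" and u: "u \<in> De" and le: "Be (trunc k u) (trunc k u) \<le> k * M'" for k u
  proof -
    have k0: "k > 0" using k \<open>k0 > 0\<close> by linarith
    let ?a = "\<lambda>x. min \<bar>u x\<bar> k"
    have a: "?a \<in> De" using u k0 by simp
    have b: "\<bar>(1 / k) * ?a x\<bar> \<le> 1" for x using k0 by (simp add: abs_mult)
    have "Be (\<lambda>x. (1 / k) * ?a x) (\<lambda>x. (1 / k) * ?a x) = (1 / k) * ((1 / k) * Be ?a ?a)"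
      by (simp only: V.form_scale_left[OF a V.scale_mem[OF a]] V.form_scale_right[OF a a])
    also have "\<dots> \<le> (1 / k) * ((1 / k) * (k * M'))"
      using V.form_min_abs_le[OF u k0] le k0 by (intro mult_left_mono) auto
    also have "\<dots> = M' / k" using k0 by simp
    also have "\<dots> \<le> \<delta>"
    proof -
      have "\<bar>M'\<bar> / \<delta> \<le> k" using k by (simp add: k0_def)
      then have "M' \<le> \<delta> * k" using \<delta>(1) by (simp add: pos_divide_le_eq mult.commute)
      then show ?thesis using k0 by (simp add: pos_divide_le_eq)
    qed
    finally show ?thesis
      by (intro \<delta>(2)) (use DbI[OF V.scale_mem[OF a] b] b in auto)
  qed
  ultimately show ?thesis by blast
qed

section \<open>Comparison principles and bounds that do not depend on the obstacle\<close>

lemma obstacle_nonneg: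
  assumes \<psi>: "obstacle_solution (\<lambda>x y. 0) \<phi> j \<psi>" and \<phi>: "positive_functional \<phi> M"
  shows "AE x in m. 0 \<le> \<psi> x"
proof -
  let ?n = "\<lambda>x. max (- \<psi> x) 0"
  have \<psi>De: "\<psi> \<in> De" by (rule obstacle_mem[OF \<psi>])
  have b: "\<bar>- \<psi> x\<bar> \<le> j" for x using obstacle_le[OF \<psi>] by simp
  have n: "?n \<in> De" by (rule V.pos_part_mem[OF V.uminus_mem[OF \<psi>De] b])
  have nDb: "?n \<in> Db"
  proof (rule DbI[OF n])
    fix x show "\<bar>?n x\<bar> \<le> j" using b[of x] by auto
  qed
  have "(\<integral>x. 0 * ?n x \<partial>m) + \<phi> ?n \<le> Be \<psi> ?n"
  proof (rule obstacle_test[OF \<psi> n])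
    fix x show "\<bar>\<psi> x + ?n x\<bar> \<le> j" using b[of x] by auto
  qed
  moreover have "0 \<le> \<phi> ?n" by (rule positive_functional_nonneg[OF \<phi> nDb]) simp
  ultimately have "0 \<le> Be \<psi> ?n" by simp
  moreover have "Be ?n ?n \<le> Be (\<lambda>x. - \<psi> x) ?n" by (rule V.form_pos_part[OF V.uminus_mem[OF \<psi>De] b])
  ultimately have "Be ?n ?n \<le> 0" using V.form_uminus_left[OF \<psi>De n] by simp
  then have "Be ?n ?n = 0" using V.form_nonneg[OF n] by simp
  from V.definite[OF n this] show ?thesis by eventually_elim (simp add: max_def split: if_splits)
qed

text \<open>Both inequalities are tested with \<open>p\<close>, the positive part of the excess of
  \<open>u\<close> over \<open>\<psi>\<close>: lowering \<open>u\<close> and raising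
  \<open>\<psi>\<close> by \<open>p\<close> respects both obstacles because
  \<open>j \<le> j'\<close>. Absorption only helps, so no monotonicity of \<open>f\<close> is
  involved. With \<open>f = 0\<close> this also shows that the linear solutions increase with the
  obstacle.\<close>

lemma obstacle_comparison:
  assumes f: "absorption m f" and u: "obstacle_solution f \<phi> j u" and \<phi>: "energy_functional \<phi> M"
    and \<psi>: "obstacle_solution (\<lambda>x y. 0) \<theta> j' \<psi>" and \<theta>: "positive_functional \<theta> M'" and j: "j \<le> j'"
    and le: "\<And>p. p \<in> Db \<Longrightarrow> (\<And>x. 0 \<le> p x) \<Longrightarrow> \<phi> p \<le> \<theta> p"
  shows "AE x in m. u x \<le> \<psi> x"
proof -
  have uDe: "u \<in> De" and \<psi>De: "\<psi> \<in> De" using obstacle_mem u \<psi> by auto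
  have ub: "\<bar>u x\<bar> \<le> j" and \<psi>b: "\<bar>\<psi> x\<bar> \<le> j'" for x using obstacle_le u \<psi> by auto
  have nn: "AE x in m. 0 \<le> \<psi> x" by (rule obstacle_nonneg[OF \<psi> \<theta>])
  \<comment> \<open>\<open>\<psi>\<close> is nonnegative only a.e. With its positive part,
    \<open>u\<close> is positive at every point where \<open>?p\<close> is, which gives the
    absorption term its sign pointwise.\<close>
  let ?s = "\<lambda>x. max (\<psi> x) 0"
  have s: "?s \<in> De" by (rule V.pos_part_mem[OF \<psi>De \<psi>b])
  let ?d = "\<lambda>x. u x - ?s x"
  have d: "?d \<in> De" using uDe s by simp
  have db: "\<bar>?d x\<bar> \<le> j + j'" for x
  proof -
    have "\<bar>?s x\<bar> \<le> j'" using \<psi>b[of x] by auto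
    then show ?thesis using ub[of x] by linarith
  qed
  let ?p = "\<lambda>x. max (?d x) 0"
  have p: "?p \<in> De" by (rule V.pos_part_mem[OF d db])
  have pb: "\<bar>?p x\<bar> \<le> j + j'" for x using db[of x] by auto
  have pDb: "?p \<in> Db" by (rule DbI[OF p pb])
  have "(\<integral>x. f x (u x) * (- ?p x) \<partial>m) + \<phi> (\<lambda>x. - ?p x) \<le> Be u (\<lambda>x. - ?p x)"
  proof (rule obstacle_test[OF u V.uminus_mem[OF p]])
    fix x show "\<bar>u x + - ?p x\<bar> \<le> j" using ub[of x] by (auto simp: max_def)
  qed
  moreover have "0 \<le> (\<integral>x. f x (u x) * (- ?p x) \<partial>m)"
  proof (rule integral_nonneg_AE, rule AE_I2)
    fix x
    have "0 \<le> ?p x * u x" by (auto simp: max_def zero_le_mult_iff)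
    then show "0 \<le> f x (u x) * (- ?p x)" using absorption_mult[OF f, of "?p x" "u x" x] by simp
  qed
  moreover have "\<phi> ?p \<le> \<theta> ?p" by (rule le[OF pDb]) simp
  ultimately have Bu: "Be u ?p \<le> \<theta> ?p"
    using functional_uminus[OF \<phi> pDb] V.form_uminus_right[OF p uDe] by simp
  have "(\<integral>x. 0 * ?p x \<partial>m) + \<theta> ?p \<le> Be \<psi> ?p"
  proof (rule obstacle_test[OF \<psi> p])
    fix x show "\<bar>\<psi> x + ?p x\<bar> \<le> j'" using ub[of x] \<psi>b[of x] j by (auto simp: max_def)
  qed
  moreover have "Be ?s ?p = Be \<psi> ?p"
    by (rule V.AE_form[OF s \<psi>De p]) (use nn in \<open>eventually_elim, simp\<close>)
  ultimately have "Be ?d ?p \<le> 0" using Bu V.form_diff_left[OF uDe s p] by simp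
  moreover have "Be ?p ?p \<le> Be ?d ?p" by (rule V.form_pos_part[OF d db])
  ultimately have "Be ?p ?p = 0" using V.form_nonneg[OF p] by linarith
  from V.definite[OF p this] nn show ?thesis by eventually_elim (simp add: max_def split: if_splits)
qed

text \<open>Adding \<open>h\<close> may violate the obstacle, so \<open>u + h\<close> is truncated
  at level \<open>j\<close> and \<open>e\<close> is the part cut off. Since \<open>e\<close> pairs
  nonnegatively with \<open>u + h\<close>, the term \<open>Be u e\<close> can be traded for
  \<open>Be h e\<close>, in which \<open>u\<close> no longer occurs.\<close>

lemma obstacle_test_bounded:
  assumes u: "obstacle_solution f \<phi> j u" and j: "0 < j" and h: "h \<in> De" "\<And>x. \<bar>h x\<bar> \<le> C"
  defines "e \<equiv> \<lambda>x. (u x + h x) - trunc j (\<lambda>x. u x + h x) x"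
  shows "e \<in> Db" "\<And>x. \<bar>e x\<bar> \<le> C" "\<And>x. \<bar>u x\<bar> \<le> j - C \<Longrightarrow> e x = 0"
    "(\<integral>x. f x (u x) * (h x - e x) \<partial>m) + \<phi> (\<lambda>x. h x - e x) - Be h e \<le> Be u h"
proof -
  have uDe: "u \<in> De" by (rule obstacle_mem[OF u])
  have ub: "\<bar>u x\<bar> \<le> j" for x by (rule obstacle_le[OF u])
  let ?z = "\<lambda>x. u x + h x"
  have z: "?z \<in> De" using uDe h by simp
  have t: "trunc j ?z \<in> De" using z j by simp
  have eDe: "e \<in> De" unfolding e_def using z t by simp
  show eb: "\<bar>e x\<bar> \<le> C" for x
    unfolding e_def trunc_def using ub[of x] h(2)[of x] by (auto simp: min_def max_def)
  show "e \<in> Db" by (rule DbI[OF eDe eb])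
  show "e x = 0" if "\<bar>u x\<bar> \<le> j - C" for x
    unfolding e_def using h(2)[of x] that by (subst trunc_eq) auto
  have he: "(\<lambda>x. h x - e x) \<in> De" using h eDe by simp
  have "(\<integral>x. f x (u x) * (h x - e x) \<partial>m) + \<phi> (\<lambda>x. h x - e x) \<le> Be u (\<lambda>x. h x - e x)"
  proof (rule obstacle_test[OF u he])
    fix x
    have "u x + (h x - e x) = trunc j ?z x" by (simp add: e_def)
    then show "\<bar>u x + (h x - e x)\<bar> \<le> j" using j by (simp add: abs_trunc)
  qed
  moreover have "0 \<le> Be ?z e"
  proof -
    have "0 \<le> Be (trunc j ?z) e" unfolding e_def by (rule V.form_trunc_rest[OF z j])
    moreover have "0 \<le> Be e e" using eDe by simp
    moreover have "Be ?z e = Be (\<lambda>x. trunc j ?z x + e x) e" by (simp add: e_def)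
    ultimately show ?thesis using V.form_add_left[OF t eDe eDe] by simp
  qed
  ultimately show "(\<integral>x. f x (u x) * (h x - e x) \<partial>m) + \<phi> (\<lambda>x. h x - e x) - Be h e \<le> Be u h"
    using V.form_add_left[OF uDe h(1) eDe] V.form_diff_right[OF h(1) eDe uDe] by simp
qed

text \<open>Here \<open>h\<close> is a bounded potential of \<open>\<eta>\<close>, and the test
  direction is \<open>- h\<close>. The bound does not depend on \<open>j\<close>, so it passes to
  the limit of the increasing linear solutions.\<close>

lemma obstacle_potential_le:
  assumes \<psi>: "obstacle_solution (\<lambda>x y. 0) \<phi> j \<psi>" and \<phi>: "energy_functional \<phi> M" and j: "0 < j"
    and h: "h \<in> De" "\<And>x. \<bar>h x\<bar> \<le> C" and \<eta>: "integrable m \<eta>" "\<And>x. 0 \<le> \<eta> x"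
    and pot: "\<And>v. v \<in> Db \<Longrightarrow> Be h v = (\<integral>x. v x * \<eta> x \<partial>m)"
  shows "(\<integral>x. \<psi> x * \<eta> x \<partial>m) \<le> 2 * C * M + C * (\<integral>x. \<eta> x \<partial>m)"
proof -
  let ?h = "\<lambda>x. - h x"
  have nh: "?h \<in> De" "\<And>x. \<bar>?h x\<bar> \<le> C" using h by auto
  obtain e where e: "e \<in> Db" "\<And>x. \<bar>e x\<bar> \<le> C"
    "(\<integral>x. 0 * (?h x - e x) \<partial>m) + \<phi> (\<lambda>x. ?h x - e x) - Be ?h e \<le> Be \<psi> ?h"
    using obstacle_test_bounded(1,2,4)[OF \<psi> j nh] by blast
  have hDb: "?h \<in> Db" by (rule DbI[OF nh])
  have "\<bar>?h x - e x\<bar> \<le> 2 * C" for x using nh(2)[of x] e(2)[of x] by linarith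
  then have "\<bar>\<phi> (\<lambda>x. ?h x - e x)\<bar> \<le> 2 * C * M"
    by (rule functional_abs_le[OF \<phi> Db_diff[OF hDb e(1)]])
  moreover have "Be ?h e = - (\<integral>x. e x * \<eta> x \<partial>m)"
    using V.form_uminus_left[OF h(1) Db_De[OF e(1)]] pot[OF e(1)] by simp
  moreover have "\<bar>\<integral>x. e x * \<eta> x \<partial>m\<bar> \<le> C * (\<integral>x. \<eta> x \<partial>m)"
  proof -
    have int: "integrable m (\<lambda>x. C * \<eta> x)" using \<eta> by simp
    have le: "\<bar>e x * \<eta> x\<bar> \<le> C * \<eta> x" for x
      using e(2)[of x] \<eta>(2)[of x] by (simp add: abs_mult mult_right_mono)
    have "\<bar>\<integral>x. e x * \<eta> x \<partial>m\<bar> \<le> (\<integral>x. C * \<eta> x \<partial>m)"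
      by (rule abs_integral_le[OF int]) (use le \<eta> De_measurable[OF Db_De[OF e(1)]] in auto)
    then show ?thesis by simp
  qed
  moreover have "Be \<psi> ?h = - (\<integral>x. \<psi> x * \<eta> x \<partial>m)"
    using V.form_uminus_right[OF h(1) obstacle_mem[OF \<psi>]] pot[OF obstacle_Db[OF \<psi>]]
      V.form_sym[OF h(1) obstacle_mem[OF \<psi>]] by simp
  ultimately show ?thesis using e(3) by (simp add: abs_le_iff)
qed

text \<open>The energy norm of a truncation at level \<open>k\<close> grows only like
  \<open>sqrt k\<close>. By transience its \<open>ref\<close>-weighted integral divided by
  \<open>k\<close> tends to 0, whereas this quotient would stay equal to 1 at points where the
  sequence is unbounded.\<close>

lemma AE_bdd_above_if_trunc_energy:
  assumes \<psi>: "\<And>n. \<psi> n \<in> De" and inc: "AE x in m. incseq (\<lambda>n. \<psi> n x)" and nn: "AE x in m. \<forall>n. 0 \<le> \<psi> n x"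
    and le: "\<And>n k. 0 < k \<Longrightarrow> Be (trunc k (\<psi> n)) (trunc k (\<psi> n)) \<le> k * M"
  shows "AE x in m. bdd_above (range (\<lambda>n. \<psi> n x))"
proof -
  note [measurable] = De_measurable[OF \<psi>]
  define k where "k i = real (Suc i)" for i
  have k: "0 < k i" for i by (simp add: k_def)
  define s where "s i x = lim (\<lambda>n. trunc (k i) (\<psi> n) x)" for i x
  have [measurable]: "s i \<in> borel_measurable m" for i unfolding s_def by measurable
  have lim: "AE x in m. \<forall>i. (\<lambda>n. trunc (k i) (\<psi> n) x) \<longlonglongrightarrow> s i x"
    using inc
  proof eventually_elim
    case (elim x)
    show ?case
    proof
      fix i
      have "incseq (\<lambda>n. trunc (k i) (\<psi> n) x)"
        using elim unfolding incseq_def trunc_def by (intro allI impI min.mono max.mono) auto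
      moreover have "trunc (k i) (\<psi> n) x \<le> k i" for n by (simp add: trunc_def)
      ultimately obtain l where "(\<lambda>n. trunc (k i) (\<psi> n) x) \<longlonglongrightarrow> l"
        using incseq_convergent by blast
      then show "(\<lambda>n. trunc (k i) (\<psi> n) x) \<longlonglongrightarrow> s i x"
        unfolding s_def using limI by fastforce
    qed
  qed
  have M: "0 \<le> M" using le[of 1 0] V.form_nonneg[OF V.trunc_mem[OF \<psi>, of 1 0]] by simp
  have int: "(\<integral>\<^sup>+x. ennreal (\<bar>s i x\<bar> * ref x) \<partial>m) \<le> ennreal (sqrt (k i * M))" for i
  proof (rule nn_integral_weighted_Fatou)
    show "AE x in m. (\<lambda>n. trunc (k i) (\<psi> n) x) \<longlonglongrightarrow> s i x" using lim by eventually_elim blast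
    show "\<forall>\<^sub>F n in sequentially. (\<integral>\<^sup>+x. ennreal (\<bar>trunc (k i) (\<psi> n) x\<bar> * ref x) \<partial>m) \<le> ennreal (sqrt (k i * M))"
    proof (intro always_eventually allI)
      fix n
      have "(\<integral>\<^sup>+x. ennreal (\<bar>trunc (k i) (\<psi> n) x\<bar> * ref x) \<partial>m) \<le> ennreal (V.nrm (trunc (k i) (\<psi> n)))"
        by (rule ref_le_V_nrm) (use \<psi> k in simp)
      also have "\<dots> \<le> ennreal (sqrt (k i * M))"
        unfolding V.nrm_def using le[OF k] by (intro ennreal_leI real_sqrt_le_mono)
      finally show "(\<integral>\<^sup>+x. ennreal (\<bar>trunc (k i) (\<psi> n) x\<bar> * ref x) \<partial>m) \<le> ennreal (sqrt (k i * M))" .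
    qed
  qed measurable
  \<comment> \<open>\<open>s i\<close> is the limit of the truncations at level \<open>k i\<close>.
    Where \<open>\<psi> n\<close> is unbounded, \<open>s i x = k i\<close> for all \<open>i\<close>,
    and the infimum is 1.\<close>
  let ?q = "\<lambda>x. (INF i. ennreal (\<bar>s i x\<bar> / k i)) * ennreal (ref x)"
  have q_le: "(\<integral>\<^sup>+x. ?q x \<partial>m) \<le> ennreal (sqrt (M * (1 / k i)))" for i
  proof -
    have "(\<integral>\<^sup>+x. ?q x \<partial>m) \<le> (\<integral>\<^sup>+x. ennreal (1 / k i) * ennreal (\<bar>s i x\<bar> * ref x) \<partial>m)"
    proof (rule nn_integral_mono)
      fix x
      have "?q x \<le> ennreal (\<bar>s i x\<bar> / k i) * ennreal (ref x)"
        by (intro mult_right_mono INF_lower) auto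
      also have "\<dots> = ennreal (1 / k i) * ennreal (\<bar>s i x\<bar> * ref x)"
        using k[of i] ref_nonneg[of x] by (simp flip: ennreal_mult)
      finally show "?q x \<le> ennreal (1 / k i) * ennreal (\<bar>s i x\<bar> * ref x)" .
    qed
    also have "\<dots> = ennreal (1 / k i) * (\<integral>\<^sup>+x. ennreal (\<bar>s i x\<bar> * ref x) \<partial>m)"
      by (rule nn_integral_cmult) measurable
    also have "\<dots> \<le> ennreal (1 / k i) * ennreal (sqrt (k i * M))"
      by (rule mult_left_mono[OF int]) simp
    also have "\<dots> = ennreal (1 / k i * sqrt (k i * M))" using k[of i] M by (simp flip: ennreal_mult)
    also have "1 / k i * sqrt (k i * M) = sqrt ((1 / k i)\<^sup>2 * (k i * M))"
      using k[of i] by (simp only: real_sqrt_mult real_sqrt_abs) simp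
    also have "(1 / k i)\<^sup>2 * (k i * M) = M * (1 / k i)" using k[of i] by (simp add: power2_eq_square)
    finally show ?thesis .
  qed
  have "(\<lambda>i. 1 / k i) \<longlonglongrightarrow> 0"
    unfolding k_def using LIMSEQ_inverse_real_of_nat by (simp add: inverse_eq_divide)
  then have "(\<lambda>i. ennreal (sqrt (M * (1 / k i)))) \<longlonglongrightarrow> ennreal (sqrt (M * 0))"
    by (intro tendsto_ennrealI tendsto_real_sqrt tendsto_mult_left)
  then have "(\<integral>\<^sup>+x. ?q x \<partial>m) \<le> ennreal (sqrt (M * 0))"
    by (rule LIMSEQ_le_const) (use q_le in blast)
  then have "AE x in m. ?q x = 0"
    by (subst nn_integral_0_iff_AE[symmetric]) auto
  then show ?thesis using ref_pos lim nn inc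
  proof eventually_elim
    case (elim x)
    then have "(INF i. ennreal (\<bar>s i x\<bar> / k i)) < 1" by (auto simp: ennreal_eq_0_iff)
    then obtain i where i: "ennreal (\<bar>s i x\<bar> / k i) < 1" by (auto simp: INF_less_iff)
    then have "\<bar>s i x\<bar> / k i < 1" using k[of i] by (simp add: ennreal_less_one_iff)
    then have si: "s i x < k i" using k[of i] by (simp add: pos_divide_less_eq)
    have "\<psi> n x \<le> s i x" for n
    proof -
      have inc': "incseq (\<lambda>n. trunc (k i) (\<psi> n) x)"
        using elim(5) unfolding incseq_def trunc_def by (intro allI impI min.mono max.mono) auto
      have "trunc (k i) (\<psi> n) x \<le> s i x" by (rule incseq_le[OF inc']) (use elim in blast)
      then have "trunc (k i) (\<psi> n) x < k i" using si by linarith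
      then have "\<psi> n x \<le> trunc (k i) (\<psi> n) x" by (auto simp: trunc_def min_def max_def split: if_splits)
      then show ?thesis using \<open>trunc (k i) (\<psi> n) x \<le> s i x\<close> by linarith
    qed
    then show ?case by (intro bdd_aboveI[of _ "s i x"]) auto
  qed
qed

end

section \<open>Semilinear equations\<close>

context dirichlet_space
begin

text \<open>Vitali's theorem with \<open>tail\<close> as equi-integrability. The splitting weight
  \<open>1 - \<bar>layer k v x\<bar>\<close> is continuous in \<open>v x\<close>, unlike an
  indicator, so both parts pass to a.e. limits; it vanishes from level \<open>k + 1\<close> on,
  which leaves a dominated main part.\<close>

lemma absorption_limit:
  assumes f: "absorption m f"
    and U: "\<And>n. U n \<in> borel_measurable m" "\<And>n x. \<bar>U n x\<bar> \<le> J n" and u: "u \<in> borel_measurable m"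
    and lim: "AE x in m. (\<lambda>n. U n x) \<longlonglongrightarrow> u x"
    and tail: "\<And>e. e > 0 \<Longrightarrow> \<exists>k>0. \<forall>n. (\<integral>x. \<bar>f x (U n x)\<bar> * \<bar>layer k (U n) x\<bar> \<partial>m) \<le> e"
  shows absorption_limit_integrable: "integrable m (\<lambda>x. f x (u x))"
    and absorption_limit_tendsto: "\<And>h h0 C. (\<And>n. h n \<in> borel_measurable m) \<Longrightarrow> h0 \<in> borel_measurable m \<Longrightarrow>
      (\<And>n x. \<bar>h n x\<bar> \<le> C) \<Longrightarrow> AE x in m. (\<lambda>n. h n x) \<longlonglongrightarrow> h0 x \<Longrightarrow>
      (\<lambda>n. \<integral>x. f x (U n x) * h n x \<partial>m) \<longlonglongrightarrow> (\<integral>x. f x (u x) * h0 x \<partial>m)"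
proof -
  note [measurable] = U(1) u absorption_measurable[OF f U(1)] absorption_measurable[OF f u]
    borel_measurable_layer[OF U(1)] borel_measurable_layer[OF u]
  have flim: "AE x in m. (\<lambda>n. f x (U n x)) \<longlonglongrightarrow> f x (u x)"
    using lim
  proof eventually_elim
    case (elim x)
    have "continuous_on UNIV (f x)" using f by (simp add: absorption_def)
    then have "isCont (f x) (u x)" using continuous_on_eq_continuous_at open_UNIV by blast
    then show ?case using elim by (rule isCont_tendsto_compose)
  qed
  have llim: "AE x in m. (\<lambda>n. layer k (U n) x) \<longlonglongrightarrow> layer k u x" for k
    using lim by eventually_elim (rule layer_tendsto)
  have int_layer: "integrable m (\<lambda>x. \<bar>f x (U n x)\<bar> * \<bar>layer k (U n) x\<bar>)" if "0 < k" for n k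
    using integrable_abs[OF absorption_integrable[OF f U(1) U(2), of "layer k (U n)" 1]] layer_abs_le[of k "U n"] that
    by (simp add: abs_mult)
  have core: "\<bar>f x (v x)\<bar> * (1 - \<bar>layer k v x\<bar>) \<le> F x" and core0: "0 \<le> 1 - \<bar>layer k v x\<bar>"
    if k: "0 < k" and F: "\<And>x y. \<bar>y\<bar> \<le> k + 1 \<Longrightarrow> \<bar>f x y\<bar> \<le> F x" "\<And>x. 0 \<le> F x" for k F x and v :: "'a \<Rightarrow> real"
  proof -
    show 0: "0 \<le> 1 - \<bar>layer k v x\<bar>" using layer_abs_le[of k v x] k by simp
    show "\<bar>f x (v x)\<bar> * (1 - \<bar>layer k v x\<bar>) \<le> F x"
    proof (cases "\<bar>v x\<bar> \<le> k + 1")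
      case True
      then have "\<bar>f x (v x)\<bar> * (1 - \<bar>layer k v x\<bar>) \<le> F x * 1" using F 0 by (intro mult_mono) auto
      then show ?thesis by simp
    next
      case False
      then show ?thesis using layer_abs_eq_1[of k v x] k F(2)[of x] by simp
    qed
  qed
  show int_fu: "integrable m (\<lambda>x. f x (u x))"
  proof -
    obtain k where k: "k > 0" "\<And>n. (\<integral>x. \<bar>f x (U n x)\<bar> * \<bar>layer k (U n) x\<bar> \<partial>m) \<le> 1"
      using tail[of 1] by auto
    have "k + 1 > 0" using k by simp
    then obtain F where F: "integrable m F" "\<And>x y. \<bar>y\<bar> \<le> k + 1 \<Longrightarrow> \<bar>f x y\<bar> \<le> F x" "\<And>x. 0 \<le> F x"
      using absorption_bound[OF f] by metis
    have "(\<integral>\<^sup>+x. ennreal (\<bar>f x (U n x)\<bar> * 1) \<partial>m) \<le> ennreal ((\<integral>x. F x \<partial>m) + 1)" for n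
    proof -
      have split: "\<bar>f x (U n x)\<bar> * 1 \<le> F x + \<bar>f x (U n x)\<bar> * \<bar>layer k (U n) x\<bar>" for x
        using core[OF k(1) F(2,3), of x "U n"] by (simp add: algebra_simps)
      have "(\<integral>\<^sup>+x. ennreal (\<bar>f x (U n x)\<bar> * 1) \<partial>m) \<le> (\<integral>\<^sup>+x. ennreal (F x + \<bar>f x (U n x)\<bar> * \<bar>layer k (U n) x\<bar>) \<partial>m)"
        by (intro nn_integral_mono ennreal_leI split)
      also have "\<dots> = ennreal (\<integral>x. F x + \<bar>f x (U n x)\<bar> * \<bar>layer k (U n) x\<bar> \<partial>m)"
        by (rule nn_integral_eq_integral) (use F int_layer[OF k(1)] in auto)
      also have "\<dots> \<le> ennreal ((\<integral>x. F x \<partial>m) + 1)"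
        using F int_layer[OF k(1), of n] k(2)[of n] by (intro ennreal_leI) simp
      finally show ?thesis .
    qed
    then have "(\<integral>\<^sup>+x. ennreal (\<bar>f x (u x)\<bar> * 1) \<partial>m) \<le> ennreal ((\<integral>x. F x \<partial>m) + 1)"
      by (intro nn_integral_weighted_Fatou[OF _ _ flim]) auto
    also have "\<dots> < \<infinity>" by simp
    finally show ?thesis by (intro integrableI_bounded) simp_all
  qed
  fix h h0 C
  assume h [measurable]: "\<And>n. h n \<in> borel_measurable m" "h0 \<in> borel_measurable m"
    and hC: "\<And>n x. \<bar>h n x\<bar> \<le> (C::real)" and hlim: "AE x in m. (\<lambda>n. h n x) \<longlonglongrightarrow> h0 x"
  have C: "0 \<le> C" using order_trans[OF abs_ge_zero hC] .
  have h0C: "AE x in m. \<bar>h0 x\<bar> \<le> C"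
    using hlim by eventually_elim (rule LIMSEQ_le_const2[OF tendsto_rabs], assumption, use hC in auto)
  show "(\<lambda>n. \<integral>x. f x (U n x) * h n x \<partial>m) \<longlonglongrightarrow> (\<integral>x. f x (u x) * h0 x \<partial>m)"
  proof (rule LIMSEQ_I)
    fix r :: real assume r: "r > 0"
    define e where "e = r / (4 * (C + 1))"
    have e: "e > 0" using r C by (simp add: e_def)
    have Ce: "C * e \<le> r / 4" unfolding e_def using r C by (simp add: field_simps)
    obtain k where k: "k > 0" "\<And>n. (\<integral>x. \<bar>f x (U n x)\<bar> * \<bar>layer k (U n) x\<bar> \<partial>m) \<le> e"
      using tail[OF e] by auto
    have "k + 1 > 0" using k by simp
    then obtain F where F: "integrable m F" "\<And>x y. \<bar>y\<bar> \<le> k + 1 \<Longrightarrow> \<bar>f x y\<bar> \<le> F x" "\<And>x. 0 \<le> F x"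
      using absorption_bound[OF f] by metis
    have int_lu: "integrable m (\<lambda>x. \<bar>f x (u x)\<bar> * \<bar>layer k u x\<bar>)"
      by (rule integrable_if_abs_le[OF integrable_abs[OF int_fu]])
        (use layer_abs_le[of k u] k in \<open>auto simp: abs_mult intro!: mult_left_le\<close>)
    have tail_u: "(\<integral>x. \<bar>f x (u x)\<bar> * \<bar>layer k u x\<bar> \<partial>m) \<le> e"
    proof -
      have "(\<integral>\<^sup>+x. ennreal (\<bar>f x (u x) * layer k u x\<bar> * 1) \<partial>m) \<le> ennreal e"
      proof (rule nn_integral_weighted_Fatou)
        show "AE x in m. (\<lambda>n. f x (U n x) * layer k (U n) x) \<longlonglongrightarrow> f x (u x) * layer k u x"
          using flim llim[of k] by eventually_elim (rule tendsto_mult)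
        show "\<forall>\<^sub>F n in sequentially. (\<integral>\<^sup>+x. ennreal (\<bar>f x (U n x) * layer k (U n) x\<bar> * 1) \<partial>m) \<le> ennreal e"
        proof (intro always_eventually allI)
          fix n
          have "(\<integral>\<^sup>+x. ennreal (\<bar>f x (U n x) * layer k (U n) x\<bar> * 1) \<partial>m)
              = ennreal (\<integral>x. \<bar>f x (U n x)\<bar> * \<bar>layer k (U n) x\<bar> \<partial>m)"
            using nn_integral_eq_integral[OF int_layer[OF k(1), of n]] by (simp add: abs_mult)
          then show "(\<integral>\<^sup>+x. ennreal (\<bar>f x (U n x) * layer k (U n) x\<bar> * 1) \<partial>m) \<le> ennreal e"
            using k(2)[of n] by (simp add: ennreal_leI)
        qed
      qed auto
      moreover have "(\<integral>\<^sup>+x. ennreal (\<bar>f x (u x) * layer k u x\<bar> * 1) \<partial>m)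
          = ennreal (\<integral>x. \<bar>f x (u x)\<bar> * \<bar>layer k u x\<bar> \<partial>m)"
        using nn_integral_eq_integral[OF int_lu] by (simp add: abs_mult)
      ultimately show ?thesis using e by simp
    qed
    let ?g = "\<lambda>v x. f x (v x) * (1 - \<bar>layer k v x\<bar>)"
    let ?t = "\<lambda>v x. f x (v x) * \<bar>layer k v x\<bar>"
    have IF: "integrable m (\<lambda>x. F x * C)" using F by simp
    have gb: "\<bar>?g v x * c\<bar> \<le> F x * C" if "\<bar>c\<bar> \<le> C" for v x c
    proof -
      have "\<bar>?g v x * c\<bar> = (\<bar>f x (v x)\<bar> * (1 - \<bar>layer k v x\<bar>)) * \<bar>c\<bar>"
        using core0[OF k(1) F(2,3), of v x] by (simp add: abs_mult)
      also have "\<dots> \<le> F x * C" by (rule mult_mono[OF core[OF k(1) F(2,3)] that F(3) abs_ge_zero])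
      finally show ?thesis .
    qed
    have main: "(\<lambda>n. \<integral>x. ?g (U n) x * h n x \<partial>m) \<longlonglongrightarrow> (\<integral>x. ?g u x * h0 x \<partial>m)"
    proof (rule integral_dominated_convergence[OF _ _ IF])
      show "AE x in m. (\<lambda>n. ?g (U n) x * h n x) \<longlonglongrightarrow> ?g u x * h0 x"
        using flim llim[of k] hlim by eventually_elim (intro tendsto_intros)
      show "AE x in m. norm (?g (U n) x * h n x) \<le> F x * C" for n
        using gb[OF hC] by (intro AE_I2) (simp only: real_norm_def)
    qed measurable
    have tb: "\<bar>?t v x * c\<bar> \<le> (\<bar>f x (v x)\<bar> * \<bar>layer k v x\<bar>) * C" if "\<bar>c\<bar> \<le> C" for v x c
      using that by (simp add: abs_mult mult_left_mono)
    have rest: "integrable m (\<lambda>x. ?t v x * w x)" "\<bar>\<integral>x. ?t v x * w x \<partial>m\<bar> \<le> C * e"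
      if i: "integrable m (\<lambda>x. \<bar>f x (v x)\<bar> * \<bar>layer k v x\<bar>)" "(\<integral>x. \<bar>f x (v x)\<bar> * \<bar>layer k v x\<bar> \<partial>m) \<le> e"
        and w: "(\<lambda>x. ?t v x * w x) \<in> borel_measurable m" "AE x in m. \<bar>w x\<bar> \<le> C" for v w
    proof -
      have ic: "integrable m (\<lambda>x. (\<bar>f x (v x)\<bar> * \<bar>layer k v x\<bar>) * C)" using i by simp
      have ae: "AE x in m. \<bar>?t v x * w x\<bar> \<le> (\<bar>f x (v x)\<bar> * \<bar>layer k v x\<bar>) * C"
        using w(2) by eventually_elim (rule tb)
      show "integrable m (\<lambda>x. ?t v x * w x)" by (rule integrable_if_abs_le[OF ic w(1) ae])
      have "\<bar>\<integral>x. ?t v x * w x \<partial>m\<bar> \<le> (\<integral>x. (\<bar>f x (v x)\<bar> * \<bar>layer k v x\<bar>) * C \<partial>m)"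
        by (rule abs_integral_le[OF ic w(1) ae])
      also have "\<dots> = C * (\<integral>x. \<bar>f x (v x)\<bar> * \<bar>layer k v x\<bar> \<partial>m)" by simp
      also have "\<dots> \<le> C * e" using i(2) C by (rule mult_left_mono)
      finally show "\<bar>\<integral>x. ?t v x * w x \<partial>m\<bar> \<le> C * e" .
    qed
    have split: "(\<integral>x. f x (v x) * w x \<partial>m) = (\<integral>x. ?g v x * w x \<partial>m) + (\<integral>x. ?t v x * w x \<partial>m)"
      if "integrable m (\<lambda>x. ?g v x * w x)" "integrable m (\<lambda>x. ?t v x * w x)" for v w
    proof -
      have "(\<integral>x. ?g v x * w x + ?t v x * w x \<partial>m) = (\<integral>x. ?g v x * w x \<partial>m) + (\<integral>x. ?t v x * w x \<partial>m)"
        by (rule Bochner_Integration.integral_add[OF that])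
      then show ?thesis by (simp add: algebra_simps)
    qed
    have Rn: "integrable m (\<lambda>x. ?t (U n) x * h n x)" "\<bar>\<integral>x. ?t (U n) x * h n x \<partial>m\<bar> \<le> C * e" for n
      by (rule rest[OF int_layer[OF k(1)] k(2)]; use hC in simp)+
    have R0: "integrable m (\<lambda>x. ?t u x * h0 x)" "\<bar>\<integral>x. ?t u x * h0 x \<partial>m\<bar> \<le> C * e"
      by (rule rest[OF int_lu tail_u]; use h0C in simp)+
    have Gn: "integrable m (\<lambda>x. ?g (U n) x * h n x)" for n
      by (rule integrable_if_abs_le[OF IF]) (use gb[OF hC] in auto)
    have G0: "integrable m (\<lambda>x. ?g u x * h0 x)"
      by (rule integrable_if_abs_le[OF IF]) (use h0C in \<open>auto elim!: eventually_mono intro: gb\<close>)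
    have "r / 4 > 0" using r by simp
    from LIMSEQ_D[OF main this] obtain N where N: "\<And>n. n \<ge> N \<Longrightarrow>
      \<bar>(\<integral>x. ?g (U n) x * h n x \<partial>m) - (\<integral>x. ?g u x * h0 x \<partial>m)\<bar> < r / 4" by auto
    show "\<exists>N. \<forall>n\<ge>N. norm ((\<integral>x. f x (U n x) * h n x \<partial>m) - (\<integral>x. f x (u x) * h0 x \<partial>m)) < r"
    proof (intro exI allI impI)
      fix n assume "n \<ge> N"
      from N[OF this] show "norm ((\<integral>x. f x (U n x) * h n x \<partial>m) - (\<integral>x. f x (u x) * h0 x \<partial>m)) < r"
        unfolding split[OF Gn Rn(1)] split[OF G0 R0(1)] real_norm_def
        using Rn(2)[of n] R0(2) Ce by linarith
    qed
  qed
qed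

end

context compact_dirichlet_space
begin

text \<open>\<open>\<theta>1\<close> and \<open>\<theta>2\<close> represent the positive and the
  negative part of \<open>\<mu>\<close>, while \<open>h\<close> and \<open>g\<close> are bounded
  potentials of \<open>\<eta>\<close> and \<open>\<bar>\<eta>\<bar>\<close>. The function
  \<open>g\<close> provides the integrable majorant for the products of the approximants with
  \<open>\<eta>\<close>.\<close>

lemma semilinear_solution:
  assumes f: "absorption m f" and \<theta>1: "positive_functional \<theta>1 M1" and \<theta>2: "positive_functional \<theta>2 M2"
  shows "\<exists>u. u \<in> borel_measurable m \<and> integrable m (\<lambda>x. f x (u x)) \<and>
    (\<forall>k>0. trunc k u \<in> De \<and> Be (trunc k u) (trunc k u) \<le> k * (M1 + M2)) \<and>
    (\<forall>\<eta> h g C. integrable m \<eta> \<longrightarrow> h \<in> De \<longrightarrow> (\<forall>x. \<bar>h x\<bar> \<le> C) \<longrightarrow> g \<in> De \<longrightarrow> (\<forall>x. \<bar>g x\<bar> \<le> C) \<longrightarrow>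
      (\<forall>v\<in>Db. Be h v = (\<integral>x. v x * \<eta> x \<partial>m)) \<longrightarrow> (\<forall>v\<in>Db. Be g v = (\<integral>x. v x * \<bar>\<eta> x\<bar> \<partial>m)) \<longrightarrow>
      integrable m (\<lambda>x. u x * \<eta> x) \<and>
      (\<integral>x. u x * \<eta> x \<partial>m) = (\<integral>x. f x (u x) * h x \<partial>m) + (\<theta>1 h - \<theta>2 h))"
proof -
  note E1 = positive_functional_energy[OF \<theta>1] and E2 = positive_functional_energy[OF \<theta>2]
  define M where "M = M1 + M2"
  define L where "L v = \<theta>1 v - \<theta>2 v" for v
  define \<Lambda> where "\<Lambda> v = \<theta>1 v + \<theta>2 v" for v
  have L: "energy_functional L M"
    using energy_functional_add[OF E1 energy_functional_uminus[OF E2]] by (simp add: L_def[abs_def] M_def)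
  have \<Lambda>: "positive_functional \<Lambda> M"
    using positive_functional_add[OF \<theta>1 \<theta>2] by (simp add: \<Lambda>_def[abs_def] M_def)
  have dom: "\<bar>L v\<bar> \<le> \<Lambda> p" if v: "v \<in> Db" and p: "p \<in> Db" and le: "\<And>x. \<bar>v x\<bar> \<le> p x" for v p
  proof -
    have "\<bar>\<theta> v\<bar> \<le> \<theta> p" if \<theta>: "positive_functional \<theta> K" for \<theta> K
    proof -
      have "\<theta> v \<le> \<theta> p" "\<theta> (\<lambda>x. - v x) \<le> \<theta> p"
        by (rule positive_functional_mono[OF \<theta>]; use v p Db_uminus le in \<open>auto simp: abs_le_iff\<close>)+
      then show ?thesis using functional_uminus[OF positive_functional_energy[OF \<theta>] v] by simp
    qed
    from this[OF \<theta>1] this[OF \<theta>2] show ?thesis by (simp add: L_def \<Lambda>_def)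
  qed
  have j: "0 < real (Suc n)" for n by simp
  obtain U0 where U0: "\<And>n. obstacle_solution f L (real (Suc n)) (U0 n)"
    using obstacle_solution_exists[OF f L j] by metis
  obtain \<psi> where \<psi>: "\<And>n. obstacle_solution (\<lambda>x y. 0) \<theta>1 (real (Suc n)) (\<psi> n)"
    using obstacle_solution_exists[OF absorption_zero E1 j] by metis
  obtain \<xi> where \<xi>: "\<And>n. obstacle_solution (\<lambda>x y. 0) \<theta>2 (real (Suc n)) (\<xi> n)"
    using obstacle_solution_exists[OF absorption_zero E2 j] by metis
  have mono: "AE x in m. incseq (\<lambda>n. p n x)" and nonneg: "AE x in m. \<forall>n. 0 \<le> p n x"
    and bdd: "AE x in m. bdd_above (range (\<lambda>n. p n x))"
    if p: "\<And>n. obstacle_solution (\<lambda>x y. 0) \<theta> (real (Suc n)) (p n)" and \<theta>: "positive_functional \<theta> K" for p \<theta> K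
  proof -
    note E = positive_functional_energy[OF \<theta>]
    have "AE x in m. \<forall>n. p n x \<le> p (Suc n) x"
      unfolding AE_all_countable
      by (intro allI obstacle_comparison[OF absorption_zero p E p \<theta>]) auto
    then show inc: "AE x in m. incseq (\<lambda>n. p n x)" by eventually_elim (rule incseq_SucI, blast)
    show nn: "AE x in m. \<forall>n. 0 \<le> p n x"
      unfolding AE_all_countable using obstacle_nonneg[OF p \<theta>] by blast
    show "AE x in m. bdd_above (range (\<lambda>n. p n x))"
      by (rule AE_bdd_above_if_trunc_energy[OF obstacle_mem[OF p] inc nn obstacle_trunc_le[OF absorption_zero E p]])
  qed
  have \<theta>_nonneg: "0 \<le> \<theta>1 p" "0 \<le> \<theta>2 p" if "p \<in> Db" "\<And>x. 0 \<le> p x" for p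
    using positive_functional_nonneg[OF \<theta>1] positive_functional_nonneg[OF \<theta>2] that by auto
  have U0_le: "AE x in m. \<forall>n. U0 n x \<le> \<psi> n x"
    unfolding AE_all_countable
    by (intro allI obstacle_comparison[OF f U0 L \<psi> \<theta>1]) (use \<theta>_nonneg in \<open>auto simp: L_def\<close>)
  \<comment> \<open>The upper bound for the reflected problem: its functional \<open>- L\<close> is
    dominated by \<open>\<theta>2\<close> on nonnegative functions.\<close>
  have U0_ge: "AE x in m. \<forall>n. - U0 n x \<le> \<xi> n x"
    unfolding AE_all_countable
    by (intro allI obstacle_comparison[OF absorption_uminus[OF f] obstacle_uminus[OF U0 L] energy_functional_uminus[OF L] \<xi> \<theta>2])
      (use \<theta>_nonneg in \<open>auto simp: L_def\<close>)
  define Sup1 where "Sup1 x = lim (\<lambda>n. \<psi> n x)" for x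
  define Sup2 where "Sup2 x = lim (\<lambda>n. \<xi> n x)" for x
  have lim_sup: "(\<lambda>n. a n) \<longlonglongrightarrow> lim a" "a n \<le> lim a" if a: "incseq a" "bdd_above (range a)" for a :: "nat \<Rightarrow> real" and n
  proof -
    obtain B where "\<forall>i. a i \<le> B" using a(2) by (auto simp: bdd_above_def)
    then obtain l where l: "a \<longlonglongrightarrow> l" using incseq_convergent[OF a(1)] by blast
    then show "(\<lambda>n. a n) \<longlonglongrightarrow> lim a" using limI[OF l] by simp
    then show "a n \<le> lim a" by (rule incseq_le[OF a(1)])
  qed
  have lim1: "AE x in m. (\<lambda>n. \<psi> n x) \<longlonglongrightarrow> Sup1 x" and le1: "AE x in m. \<forall>n. \<psi> n x \<le> Sup1 x"
    using mono[OF \<psi> \<theta>1] bdd[OF \<psi> \<theta>1] unfolding Sup1_def by (eventually_elim, use lim_sup in blast)+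
  have lim2: "AE x in m. (\<lambda>n. \<xi> n x) \<longlonglongrightarrow> Sup2 x" and le2: "AE x in m. \<forall>n. \<xi> n x \<le> Sup2 x"
    using mono[OF \<xi> \<theta>2] bdd[OF \<xi> \<theta>2] unfolding Sup2_def by (eventually_elim, use lim_sup in blast)+
  have U0_abs: "AE x in m. \<forall>n. \<bar>U0 n x\<bar> \<le> Sup1 x + Sup2 x"
    using U0_le U0_ge le1 le2 nonneg[OF \<psi> \<theta>1] nonneg[OF \<xi> \<theta>2]
  proof eventually_elim
    case (elim x)
    show ?case
    proof
      fix n
      have "U0 n x \<le> \<psi> n x" "- U0 n x \<le> \<xi> n x" "\<psi> n x \<le> Sup1 x" "\<xi> n x \<le> Sup2 x" "0 \<le> \<psi> n x" "0 \<le> \<xi> n x"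
        using elim by blast+
      then show "\<bar>U0 n x\<bar> \<le> Sup1 x + Sup2 x" by linarith
    qed
  qed
  note U0De = obstacle_mem[OF U0]
  note [measurable] = De_measurable[OF U0De] De_measurable[OF obstacle_mem[OF \<psi>]] De_measurable[OF obstacle_mem[OF \<xi>]]
  have [measurable]: "Sup1 \<in> borel_measurable m" "Sup2 \<in> borel_measurable m"
    unfolding Sup1_def Sup2_def by measurable
  have energy0: "Be (trunc k (U0 n)) (trunc k (U0 n)) \<le> k * M" if "0 < k" for k n
    by (rule obstacle_trunc_le[OF f L U0 that])
  \<comment> \<open>The energies of \<open>U0 n\<close> may be unbounded, and only truncations have
    bounded energy. Compactness is applied at each integer level, and the diagonal sequence serves
    all levels.\<close>
  interpret subseqs "\<lambda>k r. AE x in m. convergent (\<lambda>n. trunc (real (Suc k)) (U0 (r n)) x)"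
  proof
    fix k :: nat and s :: "nat \<Rightarrow> nat" assume "strict_mono s"
    have "\<exists>r v. strict_mono (r :: nat \<Rightarrow> nat) \<and> (AE x in m. (\<lambda>n. trunc (real (Suc k)) (U0 (s (r n))) x) \<longlonglongrightarrow> v x)"
      by (rule compact[of "\<lambda>n. trunc (real (Suc k)) (U0 (s n))" "real (Suc k) * M"]) (use U0De energy0[OF j] in auto)
    then obtain r v where r: "strict_mono (r :: nat \<Rightarrow> nat)"
      "AE x in m. (\<lambda>n. trunc (real (Suc k)) (U0 (s (r n))) x) \<longlonglongrightarrow> v x" by blast
    from r(2) have "AE x in m. convergent (\<lambda>n. trunc (real (Suc k)) (U0 ((s \<circ> r) n)) x)"
      by eventually_elim (auto simp: convergent_def)
    then show "\<exists>r'. strict_mono r' \<and> (AE x in m. convergent (\<lambda>n. trunc (real (Suc k)) (U0 ((s \<circ> r') n)) x))"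
      using r(1) by blast
  qed
  have conv: "AE x in m. convergent (\<lambda>n. trunc (real (Suc k)) (U0 (diagseq n)) x)" for k
  proof -
    have "AE x in m. convergent (\<lambda>n. trunc (real (Suc k)) (U0 ((diagseq \<circ> (+) (Suc k)) n)) x)"
    proof (rule diagseq_holds)
      fix r s :: "nat \<Rightarrow> nat" and n :: nat
      assume r: "strict_mono r" and s: "AE x in m. convergent (\<lambda>i. trunc (real (Suc n)) (U0 (s i)) x)"
      from s show "AE x in m. convergent (\<lambda>i. trunc (real (Suc n)) (U0 ((s \<circ> r) i)) x)"
      proof eventually_elim
        case (elim x)
        from convergent_subseq_convergent[OF elim r] show ?case by (simp add: o_def)
      qed
    qed
    then show ?thesis
    proof eventually_elim
      case (elim x)
      then have "convergent (\<lambda>n. trunc (real (Suc k)) (U0 (diagseq (n + Suc k))) x)" by (simp add: o_def add.commute)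
      then show ?case using convergent_ignore_initial_segment[of "\<lambda>n. trunc (real (Suc k)) (U0 (diagseq n)) x" "Suc k"] by simp
    qed
  qed
  define U where "U n = U0 (diagseq n)" for n
  define J where "J n = real (Suc (diagseq n))" for n
  have U: "obstacle_solution f L (J n) (U n)" for n unfolding U_def J_def by (rule U0)
  have J0: "0 < J n" for n by (simp add: J_def)
  have J_lim: "filterlim J at_top sequentially"
  proof -
    have "n \<le> diagseq n" for n by (rule seq_suble[OF subseq_diagseq])
    then have "real n \<le> J n" for n unfolding J_def by (metis le_SucI of_nat_mono)
    then show ?thesis
      by (intro filterlim_at_top_mono[OF filterlim_real_sequentially]) (auto intro: always_eventually)
  qed
  note UDe = obstacle_mem[OF U] and UDb = obstacle_Db[OF U] and U_le = obstacle_le[OF U]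
  have U_meas [measurable]: "U n \<in> borel_measurable m" for n by (rule De_measurable[OF UDe])
  have U_abs: "AE x in m. \<forall>n. \<bar>U n x\<bar> \<le> Sup1 x + Sup2 x"
    using U0_abs by eventually_elim (simp add: U_def)
  define u where "u x = lim (\<lambda>n. U n x)" for x
  have u_meas [measurable]: "u \<in> borel_measurable m" unfolding u_def by measurable
  have "AE x in m. \<forall>k. convergent (\<lambda>n. trunc (real (Suc k)) (U0 (diagseq n)) x)"
    using conv by (simp add: AE_all_countable)
  then have U_lim: "AE x in m. (\<lambda>n. U n x) \<longlonglongrightarrow> u x" using U_abs
  proof eventually_elim
    case (elim x)
    \<comment> \<open>At almost every point the sequence is bounded, so truncation at a sufficiently
      high level does nothing and convergence of the truncations is convergence of the
      sequence.\<close>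
    obtain k :: nat where "Sup1 x + Sup2 x \<le> real k" using real_arch_simple by blast
    then have "\<bar>U n x\<bar> \<le> real (Suc k)" for n using elim(2)[rule_format, of n] by simp
    then have "trunc (real (Suc k)) (U n) x = U n x" for n by (rule trunc_eq)
    then have "convergent (\<lambda>n. U n x)" using elim(1)[rule_format, of k] by (simp add: U_def)
    then show ?case unfolding u_def by (simp add: convergent_LIMSEQ_iff)
  qed
  have energy: "Be (trunc k (U n)) (trunc k (U n)) \<le> k * M" if "0 < k" for k n
    by (rule obstacle_trunc_le[OF f L U that])
  have u_energy: "trunc k u \<in> De \<and> Be (trunc k u) (trunc k u) \<le> k * (M1 + M2)" if k: "0 < k" for k
  proof -
    have "AE x in m. (\<lambda>n. trunc k (U n) x) \<longlonglongrightarrow> trunc k u x"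
      using U_lim by eventually_elim (rule trunc_tendsto)
    from form_lower_semicontinuous[OF V.trunc_mem[OF UDe k] energy[OF k] tendsto_const borel_measurable_trunc[OF u_meas] this]
    show ?thesis by (simp add: M_def)
  qed
  have small: "\<exists>k0>0. \<forall>k\<ge>k0. \<forall>n. \<Lambda> (\<lambda>x. (1 / k) * min \<bar>U n x\<bar> k) \<le> e" if e: "e > 0" for e
  proof -
    obtain k0 where k0: "k0 > 0" "\<And>k v. k \<ge> k0 \<Longrightarrow> v \<in> De \<Longrightarrow> Be (trunc k v) (trunc k v) \<le> k * M \<Longrightarrow>
        \<bar>\<Lambda> (\<lambda>x. (1 / k) * min \<bar>v x\<bar> k)\<bar> \<le> e"
      using functional_tail_small[OF positive_functional_energy[OF \<Lambda>] e, of M] by blast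
    have "\<Lambda> (\<lambda>x. (1 / k) * min \<bar>U n x\<bar> k) \<le> e" if "k \<ge> k0" for k n
    proof -
      have "0 < k" using that k0(1) by linarith
      from k0(2)[OF that UDe energy[OF this]] show ?thesis by (rule abs_le_D1)
    qed
    then show ?thesis using k0(1) by blast
  qed
  have min_Db: "(\<lambda>x. (1 / k) * min \<bar>U n x\<bar> k) \<in> Db" if k: "0 < k" for k n
  proof (rule Db_scale, rule DbI[where C = k])
    show "(\<lambda>x. min \<bar>U n x\<bar> k) \<in> De" using UDe k by (rule V.min_abs_mem)
  qed (use k in simp)
  have layer_tail: "(\<integral>x. \<bar>f x (U n x)\<bar> * \<bar>layer k (U n) x\<bar> \<partial>m) \<le> \<Lambda> (\<lambda>x. (1 / k) * min \<bar>U n x\<bar> k)" if k: "0 < k" for k n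
  proof -
    have "(\<integral>x. \<bar>f x (U n x)\<bar> * \<bar>layer k (U n) x\<bar> \<partial>m) \<le> L (layer k (U n))"
      by (rule obstacle_layer_le[OF f L U k])
    also have "\<dots> \<le> \<Lambda> (\<lambda>x. (1 / k) * min \<bar>U n x\<bar> k)"
      using dom[OF layer_Db[OF UDe k] min_Db[OF k] layer_abs_le_min[OF k]] by (rule abs_le_D1)
    finally show ?thesis .
  qed
  have tail: "\<exists>k>0. \<forall>n. (\<integral>x. \<bar>f x (U n x)\<bar> * \<bar>layer k (U n) x\<bar> \<partial>m) \<le> e" if e: "e > 0" for e
  proof -
    obtain k where k: "k > 0" "\<And>n. \<Lambda> (\<lambda>x. (1 / k) * min \<bar>U n x\<bar> k) \<le> e" using small[OF e] by blast
    show ?thesis using k(1) order_trans[OF layer_tail[OF k(1)] k(2)] by blast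
  qed
  have f_int: "integrable m (\<lambda>x. f x (u x))"
    by (rule absorption_limit_integrable[OF f U_meas U_le u_meas U_lim tail])
  have duality: "integrable m (\<lambda>x. u x * \<eta> x) \<and>
      (\<integral>x. u x * \<eta> x \<partial>m) = (\<integral>x. f x (u x) * h x \<partial>m) + (\<theta>1 h - \<theta>2 h)"
    if \<eta>: "integrable m \<eta>" and h: "h \<in> De" "\<And>x. \<bar>h x\<bar> \<le> C" and g: "g \<in> De" "\<And>x. \<bar>g x\<bar> \<le> C"
      and hpot: "\<And>v. v \<in> Db \<Longrightarrow> Be h v = (\<integral>x. v x * \<eta> x \<partial>m)"
      and gpot: "\<And>v. v \<in> Db \<Longrightarrow> Be g v = (\<integral>x. v x * \<bar>\<eta> x\<bar> \<partial>m)" for \<eta> h g C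
  proof -
    have [measurable]: "\<eta> \<in> borel_measurable m" using \<eta> by auto
    have abs\<eta>: "integrable m (\<lambda>x. \<bar>\<eta> x\<bar>)" using \<eta> by simp
    have sup_int: "integrable m (\<lambda>x. S x * \<bar>\<eta> x\<bar>)"
      if p: "\<And>n. obstacle_solution (\<lambda>x y. 0) \<theta> (real (Suc n)) (p n)" and \<theta>: "positive_functional \<theta> K"
        and S [measurable]: "S \<in> borel_measurable m" and plim: "AE x in m. (\<lambda>n. p n x) \<longlonglongrightarrow> S x" for p \<theta> K S
    proof -
      note E = positive_functional_energy[OF \<theta>]
      note [measurable] = De_measurable[OF obstacle_mem[OF p]]
      have "(\<integral>\<^sup>+x. ennreal (\<bar>p n x\<bar> * \<bar>\<eta> x\<bar>) \<partial>m) \<le> ennreal (2 * C * K + C * (\<integral>x. \<bar>\<eta> x\<bar> \<partial>m))" for n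
      proof -
        have pos: "AE x in m. 0 \<le> p n x" by (rule obstacle_nonneg[OF p \<theta>])
        have int: "integrable m (\<lambda>x. p n x * \<bar>\<eta> x\<bar>)"
        proof (rule integrable_if_abs_le)
          show "integrable m (\<lambda>x. real (Suc n) * \<bar>\<eta> x\<bar>)" using abs\<eta> by simp
          show "AE x in m. \<bar>p n x * \<bar>\<eta> x\<bar>\<bar> \<le> real (Suc n) * \<bar>\<eta> x\<bar>"
            using obstacle_le[OF p] by (intro AE_I2) (simp only: abs_mult abs_abs, rule mult_right_mono, simp_all)
        qed measurable
        have "(\<integral>\<^sup>+x. ennreal (\<bar>p n x\<bar> * \<bar>\<eta> x\<bar>) \<partial>m) = (\<integral>\<^sup>+x. ennreal (p n x * \<bar>\<eta> x\<bar>) \<partial>m)"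
          by (rule nn_integral_cong_AE) (use pos in \<open>eventually_elim, simp\<close>)
        also have "\<dots> = ennreal (\<integral>x. p n x * \<bar>\<eta> x\<bar> \<partial>m)"
          by (rule nn_integral_eq_integral[OF int]) (use pos in \<open>eventually_elim, simp\<close>)
        also have "\<dots> \<le> ennreal (2 * C * K + C * (\<integral>x. \<bar>\<eta> x\<bar> \<partial>m))"
          by (rule ennreal_leI) (rule obstacle_potential_le[OF p E j g abs\<eta> _ gpot], simp_all)
        finally show ?thesis .
      qed
      then have "(\<integral>\<^sup>+x. ennreal (\<bar>S x\<bar> * \<bar>\<eta> x\<bar>) \<partial>m) \<le> ennreal (2 * C * K + C * (\<integral>x. \<bar>\<eta> x\<bar> \<partial>m))"
        by (intro nn_integral_weighted_Fatou[OF _ _ plim]) auto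
      also have "\<dots> < \<infinity>" by simp
      finally show ?thesis by (intro integrableI_bounded) (simp_all add: abs_mult)
    qed
    have dom_int: "integrable m (\<lambda>x. (Sup1 x + Sup2 x) * \<bar>\<eta> x\<bar>)"
      using sup_int[OF \<psi> \<theta>1 _ lim1] sup_int[OF \<xi> \<theta>2 _ lim2] by (simp add: distrib_right)
    have U_dom: "AE x in m. \<bar>U n x * \<eta> x\<bar> \<le> (Sup1 x + Sup2 x) * \<bar>\<eta> x\<bar>" for n
      using U_abs by eventually_elim (simp add: abs_mult mult_right_mono)
    have "AE x in m. \<bar>u x\<bar> \<le> Sup1 x + Sup2 x"
      using U_lim U_abs by eventually_elim (rule LIMSEQ_le_const2[OF tendsto_rabs], assumption, blast)
    then have "AE x in m. \<bar>u x * \<eta> x\<bar> \<le> (Sup1 x + Sup2 x) * \<bar>\<eta> x\<bar>"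
      by eventually_elim (simp add: abs_mult mult_right_mono)
    then have u\<eta>: "integrable m (\<lambda>x. u x * \<eta> x)"
      by (intro integrable_if_abs_le[OF dom_int]) measurable
    have lhs: "(\<lambda>n. \<integral>x. U n x * \<eta> x \<partial>m) \<longlonglongrightarrow> (\<integral>x. u x * \<eta> x \<partial>m)"
    proof (rule integral_dominated_convergence[OF _ _ dom_int])
      show "AE x in m. (\<lambda>n. U n x * \<eta> x) \<longlonglongrightarrow> u x * \<eta> x"
        using U_lim by eventually_elim (intro tendsto_intros)
    qed (use U_dom in auto)
    \<comment> \<open>The obstacle leaves an inequality. It is stated for a pair \<open>q\<close>,
      \<open>\<zeta>\<close> so that it can be used for \<open>h\<close>, \<open>\<eta>\<close> and
      for \<open>- h\<close>, \<open>- \<eta>\<close>, which together give the identity.\<close>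
    have ineq: "(\<integral>x. f x (u x) * q x \<partial>m) + L q \<le> (\<integral>x. u x * \<zeta> x \<partial>m)"
      if q: "q \<in> De" "\<And>x. \<bar>q x\<bar> \<le> C" and \<zeta>: "integrable m \<zeta>"
        and qpot: "\<And>v. v \<in> Db \<Longrightarrow> Be q v = (\<integral>x. v x * \<zeta> x \<partial>m)"
        and qlim: "(\<lambda>n. \<integral>x. U n x * \<zeta> x \<partial>m) \<longlonglongrightarrow> (\<integral>x. u x * \<zeta> x \<partial>m)" for q \<zeta>
    proof -
      have qDb: "q \<in> Db" by (rule DbI[OF q])
      have [measurable]: "\<zeta> \<in> borel_measurable m" "q \<in> borel_measurable m"
        using \<zeta> De_measurable[OF q(1)] by auto
      have C0: "0 \<le> C" using order_trans[OF abs_ge_zero q(2)] .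
      define e where "e n = (\<lambda>x. (U n x + q x) - trunc (J n) (\<lambda>x. U n x + q x) x)" for n
      have e: "e n \<in> Db" "\<bar>e n x\<bar> \<le> C" "\<bar>U n x\<bar> \<le> J n - C \<Longrightarrow> e n x = 0"
        "(\<integral>x. f x (U n x) * (q x - e n x) \<partial>m) + L (\<lambda>x. q x - e n x) - Be q (e n) \<le> Be (U n) q" for n x
        unfolding e_def by (rule obstacle_test_bounded[OF U J0 q], assumption?)+
      have [measurable]: "e n \<in> borel_measurable m" for n using e(1) Db_De De_measurable by blast
      \<comment> \<open>At almost every point \<open>U n x\<close> is bounded in \<open>n\<close>
        while the obstacles tend to infinity, so the part cut off is eventually zero there.\<close>
      have e_lim: "AE x in m. (\<lambda>n. e n x) \<longlonglongrightarrow> 0"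
        using U_abs
      proof eventually_elim
        case (elim x)
        have "\<forall>\<^sub>F n in sequentially. Sup1 x + Sup2 x + C \<le> J n"
          using J_lim by (simp add: filterlim_at_top)
        then have "\<forall>\<^sub>F n in sequentially. e n x = 0"
        proof eventually_elim
          case (elim n)
          then have "\<bar>U n x\<bar> \<le> J n - C"
            using \<open>\<forall>n. \<bar>U n x\<bar> \<le> Sup1 x + Sup2 x\<close>[rule_format, of n] by linarith
          then show ?case by (rule e(3))
        qed
        then show ?case by (rule tendsto_eventually)
      qed
      have t1: "(\<lambda>n. \<integral>x. f x (U n x) * (q x - e n x) \<partial>m) \<longlonglongrightarrow> (\<integral>x. f x (u x) * q x \<partial>m)"
      proof (rule absorption_limit_tendsto[OF f U_meas U_le u_meas U_lim tail])
        show "\<bar>q x - e n x\<bar> \<le> 2 * C" for n x using q(2)[of x] e(2)[of n x] by linarith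
        show "AE x in m. (\<lambda>n. q x - e n x) \<longlonglongrightarrow> q x"
          using e_lim by eventually_elim (auto intro!: tendsto_eq_intros)
      qed measurable
      \<comment> \<open>Convergence of \<open>e n\<close> to 0 a.e. for \<open>m\<close> says
        nothing about \<open>L\<close>, which may come from a measure singular to \<open>m\<close>.
        Instead \<open>e n\<close> is supported where \<open>\<bar>U n\<bar>\<close> exceeds
        \<open>k\<close> as soon as \<open>J n \<ge> k + C\<close>, hence is dominated by
        \<open>C\<close> times the function whose \<open>\<Lambda>\<close>-value is small uniformly
        in \<open>n\<close>.\<close>
      have t2: "(\<lambda>n. L (e n)) \<longlonglongrightarrow> 0"
      proof (rule LIMSEQ_I)
        fix r :: real assume r: "r > 0"
        define d where "d = r / (C + 1)"
        have d: "d > 0" using r C0 by (simp add: d_def)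
        obtain k where k: "k > 0" "\<And>n. \<Lambda> (\<lambda>x. (1 / k) * min \<bar>U n x\<bar> k) \<le> d" using small[OF d] by blast
        have "\<forall>\<^sub>F n in sequentially. k + C \<le> J n" using J_lim by (simp add: filterlim_at_top)
        then obtain N where N: "\<And>n. n \<ge> N \<Longrightarrow> k + C \<le> J n" by (auto simp: eventually_sequentially)
        have "\<bar>L (e n)\<bar> < r" if n: "n \<ge> N" for n
        proof -
          have "\<bar>L (e n)\<bar> \<le> \<Lambda> (\<lambda>x. C * ((1 / k) * min \<bar>U n x\<bar> k))"
          proof (rule dom[OF e(1) Db_scale[OF min_Db[OF k(1)]]])
            fix x
            show "\<bar>e n x\<bar> \<le> C * ((1 / k) * min \<bar>U n x\<bar> k)"
            proof (cases "\<bar>U n x\<bar> \<le> k")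
              case True
              then have "e n x = 0" using N[OF n] by (intro e(3)) simp
              then show ?thesis using C0 k(1) by simp
            next
              case False
              then show ?thesis using e(2)[of n x] k(1) by (simp add: min_def)
            qed
          qed
          also have "\<dots> = C * \<Lambda> (\<lambda>x. (1 / k) * min \<bar>U n x\<bar> k)"
            by (rule functional_scale[OF positive_functional_energy[OF \<Lambda>] min_Db[OF k(1)]])
          also have "\<dots> \<le> C * d" using k(2) C0 by (rule mult_left_mono)
          also have "\<dots> < r" unfolding d_def using r C0 by (simp add: field_simps)
          finally show ?thesis .
        qed
        then show "\<exists>N. \<forall>n\<ge>N. norm (L (e n) - 0) < r" by auto
      qed
      have t3: "(\<lambda>n. Be q (e n)) \<longlonglongrightarrow> 0"
      proof -
        have "(\<lambda>n. \<integral>x. e n x * \<zeta> x \<partial>m) \<longlonglongrightarrow> (\<integral>x. 0 \<partial>m)"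
        proof (rule integral_dominated_convergence)
          show "integrable m (\<lambda>x. C * \<bar>\<zeta> x\<bar>)" using \<zeta> by simp
          show "AE x in m. (\<lambda>n. e n x * \<zeta> x) \<longlonglongrightarrow> 0"
            using e_lim by eventually_elim (auto intro: tendsto_mult_left_zero)
          show "AE x in m. norm (e n x * \<zeta> x) \<le> C * \<bar>\<zeta> x\<bar>" for n
            using e(2) by (intro AE_I2) (simp add: abs_mult mult_right_mono)
        qed measurable
        then show ?thesis using qpot[OF e(1)] by simp
      qed
      have "(\<lambda>n. (\<integral>x. f x (U n x) * (q x - e n x) \<partial>m) + (L q - L (e n)) - Be q (e n))
          \<longlonglongrightarrow> (\<integral>x. f x (u x) * q x \<partial>m) + (L q - 0) - 0"
        by (intro tendsto_intros t1 t2 t3)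
      moreover have "(\<integral>x. f x (U n x) * (q x - e n x) \<partial>m) + (L q - L (e n)) - Be q (e n) \<le> (\<integral>x. U n x * \<zeta> x \<partial>m)" for n
        using e(4)[of n] functional_diff[OF L qDb e(1)] qpot[OF UDb] V.form_sym[OF q(1) UDe] by simp
      ultimately have "(\<integral>x. f x (u x) * q x \<partial>m) + (L q - 0) - 0 \<le> (\<integral>x. u x * \<zeta> x \<partial>m)"
        using qlim by (intro LIMSEQ_le) auto
      then show ?thesis by simp
    qed
    have "(\<integral>x. f x (u x) * h x \<partial>m) + L h \<le> (\<integral>x. u x * \<eta> x \<partial>m)"
      by (rule ineq[OF h \<eta> hpot lhs])
    moreover have "(\<integral>x. f x (u x) * - h x \<partial>m) + L (\<lambda>x. - h x) \<le> (\<integral>x. u x * - \<eta> x \<partial>m)"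
    proof (rule ineq)
      show "Be (\<lambda>x. - h x) v = (\<integral>x. v x * - \<eta> x \<partial>m)" if "v \<in> Db" for v
        using V.form_uminus_left[OF h(1) Db_De[OF that]] hpot[OF that] by simp
      show "(\<lambda>n. \<integral>x. U n x * - \<eta> x \<partial>m) \<longlonglongrightarrow> (\<integral>x. u x * - \<eta> x \<partial>m)"
        using tendsto_minus[OF lhs] by simp
    qed (use h \<eta> in auto)
    moreover have "L (\<lambda>x. - h x) = - L h" by (rule functional_uminus[OF L DbI[OF h]])
    ultimately have "(\<integral>x. u x * \<eta> x \<partial>m) = (\<integral>x. f x (u x) * h x \<partial>m) + L h" by simp
    then show ?thesis using u\<eta> by (simp add: L_def)
  qed
  show ?thesis
  proof (rule exI[of _ u], rule conjI[OF u_meas conjI[OF f_int conjI]]; intro allI impI)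
    fix k :: real assume "0 < k"
    then show "trunc k u \<in> De \<and> Be (trunc k u) (trunc k u) \<le> k * (M1 + M2)" by (rule u_energy)
  next
    fix \<eta> h g :: "'a \<Rightarrow> real" and C
    assume "integrable m \<eta>" "h \<in> De" "\<forall>x. \<bar>h x\<bar> \<le> C" "g \<in> De" "\<forall>x. \<bar>g x\<bar> \<le> C"
      "\<forall>v\<in>Db. Be h v = (\<integral>x. v x * \<eta> x \<partial>m)" "\<forall>v\<in>Db. Be g v = (\<integral>x. v x * \<bar>\<eta> x\<bar> \<partial>m)"
    then show "integrable m (\<lambda>x. u x * \<eta> x) \<and>
        (\<integral>x. u x * \<eta> x \<partial>m) = (\<integral>x. f x (u x) * h x \<partial>m) + (\<theta>1 h - \<theta>2 h)"
      using duality[of \<eta> h C g] by blast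
  qed
qed

end

subsection \<open>Finite signed measures\<close>

lemma finite_signed_measure_Un:
  assumes \<mu>: "finite_signed_measure \<mu>" and AB: "A \<in> sets borel" "B \<in> sets borel" "A \<inter> B = {}"
  shows "\<mu> (A \<union> B) = \<mu> A + \<mu> B"
proof -
  have "range (binaryset A B) \<subseteq> sets borel" using AB by (auto simp: range_binaryset_eq)
  moreover have "disjoint_family (binaryset A B)"
    using AB by (auto simp: disjoint_family_on_def binaryset_def)
  ultimately have "(\<lambda>i. \<mu> (binaryset A B i)) sums \<mu> (A \<union> B)"
    using \<mu> unfolding finite_signed_measure_def UN_binaryset_eq[symmetric] by blast
  moreover have "(\<lambda>i. \<mu> (binaryset A B i)) sums (\<mu> A + \<mu> B)"
    by (rule binaryset_sums) (use \<mu> in \<open>simp add: finite_signed_measure_def\<close>)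
  ultimately show ?thesis by (rule sums_unique2)
qed

text \<open>If \<open>\<mu>\<close> were unbounded on the subsets of \<open>A\<close>, one could remove from \<open>A\<close> a set of measure
  at least \<open>1\<close> in absolute value without losing this property; iterating contradicts summability.\<close>

lemma finite_signed_measure_bounded:
  fixes \<mu> :: "'a::topological_space set \<Rightarrow> real"
  assumes \<mu>: "finite_signed_measure \<mu>"
  shows "\<exists>K. \<forall>A\<in>sets borel. \<bar>\<mu> A\<bar> \<le> K"
proof (rule ccontr)
  assume neg: "\<not> ?thesis"
  define unbdd where "unbdd A \<longleftrightarrow> A \<in> sets borel \<and> (\<forall>K. \<exists>B\<in>sets borel. B \<subseteq> A \<and> K < \<bar>\<mu> B\<bar>)" for A
  have step: "\<exists>A'. unbdd A' \<and> A' \<subseteq> A \<and> 1 \<le> \<bar>\<mu> (A - A')\<bar>" if A: "unbdd A" for A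
  proof -
    \<comment> \<open>The margin over \<open>\<bar>\<mu> A\<bar>\<close> makes both \<open>B\<close>
      and \<open>A - B\<close> of measure at least 1 in absolute value. One of the two remains
      unbounded and is kept; the other may be removed.\<close>
    obtain B where B: "B \<in> sets borel" "B \<subseteq> A" "\<bar>\<mu> A\<bar> + 1 < \<bar>\<mu> B\<bar>" using A unfolding unbdd_def by blast
    have Ab: "A \<in> sets borel" using A by (simp add: unbdd_def)
    have "\<mu> (B \<union> (A - B)) = \<mu> B + \<mu> (A - B)"
      by (rule finite_signed_measure_Un[OF \<mu>]) (use Ab B in auto)
    moreover have "B \<union> (A - B) = A" using B by blast
    ultimately have AB: "1 \<le> \<bar>\<mu> (A - B)\<bar>" using B(3) by simp
    show ?thesis
    proof (cases "unbdd B")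
      case True
      then show ?thesis using B AB by blast
    next
      case False
      then obtain K where K: "\<And>C. C \<in> sets borel \<Longrightarrow> C \<subseteq> B \<Longrightarrow> \<bar>\<mu> C\<bar> \<le> K"
        using B(1) unfolding unbdd_def by (meson not_le)
      have "\<exists>C\<in>sets borel. C \<subseteq> A - B \<and> K' < \<bar>\<mu> C\<bar>" for K'
      proof -
        obtain C where C: "C \<in> sets borel" "C \<subseteq> A" "K' + K < \<bar>\<mu> C\<bar>" using A unfolding unbdd_def by blast
        have "\<mu> ((C \<inter> B) \<union> (C - B)) = \<mu> (C \<inter> B) + \<mu> (C - B)"
          by (rule finite_signed_measure_Un[OF \<mu>]) (use C B in auto)
        moreover have "(C \<inter> B) \<union> (C - B) = C" by blast
        moreover have "\<bar>\<mu> (C \<inter> B)\<bar> \<le> K" by (rule K) (use C B in auto)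
        ultimately have "K' < \<bar>\<mu> (C - B)\<bar>" using C(3) by simp
        then show ?thesis using C B by (intro bexI[of _ "C - B"]) auto
      qed
      then have "unbdd (A - B)" using Ab B by (auto simp: unbdd_def)
      moreover have "A - (A - B) = B" using B by blast
      moreover have "1 \<le> \<bar>\<mu> B\<bar>" using B(3) by simp
      ultimately show ?thesis by (intro exI[of _ "A - B"]) auto
    qed
  qed
  have "unbdd UNIV" using neg by (auto simp: unbdd_def not_le)
  then have "\<exists>A. \<forall>n. unbdd (A n) \<and> (A (Suc n) \<subseteq> A n \<and> 1 \<le> \<bar>\<mu> (A n - A (Suc n))\<bar>)"
    by (intro dependent_nat_choice[where P = "\<lambda>_. unbdd" and Q = "\<lambda>_ A A'. A' \<subseteq> A \<and> 1 \<le> \<bar>\<mu> (A - A')\<bar>"])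
      (use step in blast)+
  then obtain A where A: "\<And>n. unbdd (A n)" "\<And>n. A (Suc n) \<subseteq> A n" "\<And>n. 1 \<le> \<bar>\<mu> (A n - A (Suc n))\<bar>"
    by blast
  define D where "D n = A n - A (Suc n)" for n
  have dec: "A j \<subseteq> A i" if "i \<le> j" for i j using lift_Suc_antimono_le[of A] A(2) that by blast
  have disj: "D i \<inter> D j = {}" if "i < j" for i j
    using dec[of "Suc i" j] that by (auto simp: D_def)
  have "disjoint_family D"
    unfolding disjoint_family_on_def
  proof (intro ballI impI)
    fix i j :: nat assume "i \<noteq> j"
    then show "D i \<inter> D j = {}" using disj[of i j] disj[of j i] by (cases "i < j") auto
  qed
  moreover have "range D \<subseteq> sets borel" using A(1) by (auto simp: D_def unbdd_def)
  ultimately have "(\<lambda>i. \<mu> (D i)) sums \<mu> (\<Union>i. D i)"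
    using \<mu> unfolding finite_signed_measure_def by blast
  then have "(\<lambda>i. \<mu> (D i)) \<longlonglongrightarrow> 0" by (intro summable_LIMSEQ_zero) (rule sums_summable)
  from LIMSEQ_D[OF this, of 1] obtain N where "\<bar>\<mu> (D N)\<bar> < 1" by auto
  then show False using A(3)[of N] by (simp add: D_def)
qed

lemma sets_jordan_pos [simp]: "sets (jordan_pos \<mu>) = sets borel"
  using sets.sigma_sets_eq[of borel] by (simp add: jordan_pos_def)

lemma space_jordan_pos [simp]: "space (jordan_pos \<mu>) = UNIV"
  by (simp add: jordan_pos_def)

lemma finite_measure_jordan_pos:
  assumes "finite_signed_measure \<mu>"
  shows "finite_measure (jordan_pos \<mu>)"
proof
  obtain K where K: "\<And>A. A \<in> sets borel \<Longrightarrow> \<bar>\<mu> A\<bar> \<le> K" using finite_signed_measure_bounded[OF assms] by blast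
  let ?s = "\<lambda>A. SUP B \<in> {B \<in> sets borel. B \<subseteq> A}. ennreal (\<mu> B)"
  \<comment> \<open>A measure built by \<open>measure_of\<close> takes either the prescribed values
    or the value 0, so the supremum bounds it from above in both cases.\<close>
  have "emeasure (jordan_pos \<mu>) UNIV \<le> ?s UNIV"
    unfolding jordan_pos_def emeasure_measure_of_conv by auto
  also have "\<dots> \<le> ennreal K" using K by (intro SUP_least ennreal_leI) (auto simp: abs_le_iff)
  also have "\<dots> < \<infinity>" by simp
  finally show "emeasure (jordan_pos \<mu>) (space (jordan_pos \<mu>)) \<noteq> \<infinity>" by simp
qed

lemma finite_signed_measure_uminus:
  "finite_signed_measure \<mu> \<Longrightarrow> finite_signed_measure (\<lambda>A. - \<mu> A)"
  by (auto simp: finite_signed_measure_def intro: sums_minus)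

context diffuse_functional
begin

lemma positive_functional_pair: "positive_functional pair (measure \<nu> (space \<nu>))"
  unfolding positive_functional_def energy_functional_def
proof (intro conjI ballI allI impI)
  fix u v c C assume u: "u \<in> Db"
  obtain K where K: "u \<in> De" "AE x in m. \<bar>u x\<bar> \<le> K" using u by (auto simp: Db_def)
  show "pair (\<lambda>x. u x + v x) = pair u + pair v" if "v \<in> Db"
    using that pair_add[OF K] by (auto simp: Db_def)
  show "pair (\<lambda>x. c * u x) = c * pair u" by (rule pair_scale[OF K(1)])
  show "pair u \<le> C * measure \<nu> (space \<nu>)" if "\<forall>x. \<bar>u x\<bar> \<le> C"
    by (rule pair_le[OF K(1)]) (use that in simp)
  show "pair u \<le> pair v" if v: "v \<in> Db" "\<forall>x. u x \<le> v x"
  proof -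
    obtain K' where K': "v \<in> De" "AE x in m. \<bar>v x\<bar> \<le> K'" using v by (auto simp: Db_def)
    show ?thesis by (rule pair_mono[OF K K']) (use v in simp)
  qed
next
  fix e :: real assume "e > 0"
  from pair_continuous[OF this] obtain \<delta> where \<delta>: "\<delta> > 0"
    "\<forall>u\<in>De. (AE x in m. \<bar>u x\<bar> \<le> 1) \<longrightarrow> Be u u \<le> \<delta> \<longrightarrow> \<bar>pair u\<bar> \<le> e" by blast
  then show "\<exists>\<delta>>0. \<forall>u\<in>Db. (\<forall>x. \<bar>u x\<bar> \<le> 1) \<longrightarrow> Be u u \<le> \<delta> \<longrightarrow> \<bar>pair u\<bar> \<le> e"
    using Db_De by (intro exI[of _ \<delta>]) auto
qed

end

theorem theorem3p10:
  fixes m :: "'a::{metric_space, second_countable_topology} measure"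
    and D :: "('a \<Rightarrow> real) set"
    and \<E> :: "('a \<Rightarrow> real) \<Rightarrow> ('a \<Rightarrow> real) \<Rightarrow> real"
    and \<mu> :: "'a set \<Rightarrow> real"
    and f :: "'a \<Rightarrow> real \<Rightarrow> real"
  assumes "locally_compact_space (euclidean :: 'a topology)"
    and "radon_full_support m"
    and "dirichlet_form m D \<E>"
    and "regular_form m D \<E>"
    and "transient_form m D \<E>"
    and "\<And>u :: nat \<Rightarrow> 'a \<Rightarrow> real.
           (\<And>n. u n \<in> ext_space m D \<E>) \<Longrightarrow>
           bdd_above (range (\<lambda>n. ext_energy m D \<E> (u n))) \<Longrightarrow>
           \<exists>r v. strict_mono (r :: nat \<Rightarrow> nat) \<and> (AE x in m. (\<lambda>n. u (r n) x) \<longlonglongrightarrow> v x)"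
    and "diffuse_measure m D \<E> \<mu>"
    and "caratheodory f"
    and "\<And>x. f x 0 = 0"
    and "\<And>x y. f x y * y \<le> 0"
    and "\<And>a. a > 0 \<Longrightarrow> integrable m (\<lambda>x. SUP y\<in>{y. \<bar>y\<bar> \<le> a}. \<bar>f x y\<bar>)"
  shows "\<exists>u. duality_solution m D \<E> f \<mu> u \<and>
           (\<forall>k\<ge>0. trunc k u \<in> ext_space m D \<E> \<and>
                  ext_energy m D \<E> (trunc k u) \<le> 2 * k * tv_norm \<mu>)"
proof -
  have sets_m: "sets m = sets borel" using assms(2) by (simp add: radon_full_support_def)
  interpret regular_dirichlet_space m D \<E>
    by unfold_locales (use assms sets_m in auto)
  interpret C: compact_dirichlet_space m D \<E>
  proof
    fix u :: "nat \<Rightarrow> 'a \<Rightarrow> real" and K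
    assume u: "\<And>n. u n \<in> De" "\<And>n. Be (u n) (u n) \<le> K"
    then have "bdd_above (range (\<lambda>n. ext_energy m D \<E> (u n)))"
      by (intro bdd_aboveI[of _ K]) (auto simp: Be_self)
    then show "\<exists>r v. strict_mono (r :: nat \<Rightarrow> nat) \<and> (AE x in m. (\<lambda>n. u (r n) x) \<longlonglongrightarrow> v x)"
      using assms(6)[of u, OF u(1)] by blast
  qed
  have f: "absorption m f"
    unfolding absorption_def
  proof (intro conjI allI impI)
    show "(\<lambda>x. f x y) \<in> borel_measurable m" for y
      using assms(8) by (simp add: caratheodory_def borel_measurable_m)
    show cont: "continuous_on UNIV (f x)" for x using assms(8) by (simp add: caratheodory_def)
    fix a :: real assume a: "a > 0"
    \<comment> \<open>A real supremum dominates its members only if the set is bounded above; here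
      it is, by continuity of \<open>f x\<close> on a compact interval.\<close>
    have "\<bar>f x y\<bar> \<le> (SUP y\<in>{y. \<bar>y\<bar> \<le> a}. \<bar>f x y\<bar>)" if "\<bar>y\<bar> \<le> a" for x y
    proof (rule cSUP_upper)
      have "compact ((\<lambda>y. \<bar>f x y\<bar>) ` {- a..a})"
        by (intro compact_continuous_image continuous_intros continuous_on_subset[OF cont]) auto
      moreover have "{y. \<bar>y\<bar> \<le> a} = {- a..a}" by auto
      ultimately show "bdd_above ((\<lambda>y. \<bar>f x y\<bar>) ` {y. \<bar>y\<bar> \<le> a})"
        by (simp add: bounded_imp_bdd_above compact_imp_bounded)
    qed (use that in simp)
    then show "\<exists>F. integrable m F \<and> (\<forall>x y. \<bar>y\<bar> \<le> a \<longrightarrow> \<bar>f x y\<bar> \<le> F x)"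
      using assms(11)[OF a] by blast
  qed (use assms(9,10) in auto)
  have fsm: "finite_signed_measure \<mu>" and diff: "\<And>A. A \<in> sets borel \<Longrightarrow> cap0 m D \<E> A = 0 \<Longrightarrow> variation \<mu> A = 0"
    using assms(7) by (auto simp: diffuse_measure_def)
  have fin: "finite_measure (jordan_pos \<mu>)" "finite_measure (jordan_neg \<mu>)"
    using finite_measure_jordan_pos[OF fsm] finite_measure_jordan_pos[OF finite_signed_measure_uminus[OF fsm]]
    by (simp_all add: jordan_neg_def)
  have null: "emeasure (jordan_pos \<mu>) A = 0" "emeasure (jordan_neg \<mu>) A = 0"
    if "A \<in> sets borel" "cap0 m D \<E> A = 0" for A
  proof -
    have "measure (jordan_pos \<mu>) A + measure (jordan_neg \<mu>) A = 0"
      using diff[OF that] by (simp add: variation_def)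
    then have "measure (jordan_pos \<mu>) A = 0" "measure (jordan_neg \<mu>) A = 0"
      by (smt (verit) measure_nonneg)+
    then show "emeasure (jordan_pos \<mu>) A = 0" "emeasure (jordan_neg \<mu>) A = 0"
      using fin by (simp_all add: finite_measure.emeasure_eq_measure)
  qed
  interpret P: diffuse_functional m D \<E> "jordan_pos \<mu>"
    by (intro diffuse_functional.intro diffuse_functional_axioms.intro regular_dirichlet_space_axioms)
      (use fin null in simp_all)
  interpret N: diffuse_functional m D \<E> "jordan_neg \<mu>"
    by (intro diffuse_functional.intro diffuse_functional_axioms.intro regular_dirichlet_space_axioms)
      (use fin null in \<open>simp_all add: jordan_neg_def\<close>)
  have tv: "measure (jordan_pos \<mu>) (space (jordan_pos \<mu>)) + measure (jordan_neg \<mu>) (space (jordan_neg \<mu>)) = tv_norm \<mu>"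
    by (simp add: tv_norm_def variation_def jordan_neg_def)
  from C.semilinear_solution[OF f P.positive_functional_pair N.positive_functional_pair, unfolded tv]
  obtain u where u: "u \<in> borel_measurable m" "integrable m (\<lambda>x. f x (u x))"
    "\<forall>k>0. trunc k u \<in> De \<and> Be (trunc k u) (trunc k u) \<le> k * tv_norm \<mu>"
    "\<forall>\<eta> h g C. integrable m \<eta> \<longrightarrow> h \<in> De \<longrightarrow> (\<forall>x. \<bar>h x\<bar> \<le> C) \<longrightarrow> g \<in> De \<longrightarrow> (\<forall>x. \<bar>g x\<bar> \<le> C) \<longrightarrow>
      (\<forall>v\<in>Db. Be h v = (\<integral>x. v x * \<eta> x \<partial>m)) \<longrightarrow> (\<forall>v\<in>Db. Be g v = (\<integral>x. v x * \<bar>\<eta> x\<bar> \<partial>m)) \<longrightarrow>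
      integrable m (\<lambda>x. u x * \<eta> x) \<and>
      (\<integral>x. u x * \<eta> x \<partial>m) = (\<integral>x. f x (u x) * h x \<partial>m) + (P.pair h - N.pair h)"
    by (elim exE conjE) (rule that)
  have "integrable m (\<lambda>x. u x * \<eta> x) \<and>
      (\<integral>x. u x * \<eta> x \<partial>m) = (\<integral>x. f x (u x) * potential m D \<E> \<eta> x \<partial>m)
        + signed_integral \<mu> (qc_version m D \<E> (potential m D \<E> \<eta>))"
    if \<eta>: "integrable m \<eta>" and C0: "AE x in m. potential_nonneg m D \<E> (\<lambda>y. \<bar>\<eta> y\<bar>) x \<le> ennreal C0" for \<eta> C0
  proof -
    \<comment> \<open>\<open>C0\<close> may be zero or negative, whereas truncation requires a
      positive level.\<close>
    define C where "C = max C0 1"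
    have C: "0 < C" "0 \<le> C" by (auto simp: C_def)
    have bd: "AE x in m. potential_nonneg m D \<E> (\<lambda>y. \<bar>\<eta> y\<bar>) x \<le> ennreal C"
      using C0 by eventually_elim (rule order_trans, assumption, simp add: C_def ennreal_leI)
    let ?G = "potential m D \<E> \<eta>" and ?A = "\<lambda>x. enn2real (potential_nonneg m D \<E> (\<lambda>y. \<bar>\<eta> y\<bar>) x)"
    note G = potential_mem[OF \<eta> bd C(2)] and Gb = potential_bounded[OF \<eta> bd C(2)]
      and Gf = form_potential[OF \<eta> bd C(2)]
    have abs: "integrable m (\<lambda>y. \<bar>\<eta> y\<bar>)" using \<eta> by simp
    note A = potential_nonneg_mem[OF abs abs_ge_zero bd C(2)]
      and Af = form_potential_nonneg[OF abs abs_ge_zero bd C(2)]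
    have Ab: "AE x in m. \<bar>?A x\<bar> \<le> C"
      using bd by eventually_elim (use C enn2real_mono[of _ "ennreal C"] in simp)
    \<comment> \<open>The potentials are bounded only a.e. Truncation changes them on a null set,
      hence alters neither the form nor the pairings, and makes the bound hold at every
      point.\<close>
    let ?h = "trunc C ?G" and ?g = "trunc C ?A"
    have h: "?h \<in> De" "\<And>x. \<bar>?h x\<bar> \<le> C" and g: "?g \<in> De" "\<And>x. \<bar>?g x\<bar> \<le> C"
      using G A C by (auto simp: abs_trunc)
    have hG: "AE x in m. ?h x = ?G x" using Gb by eventually_elim (rule trunc_eq)
    have gA: "AE x in m. ?g x = ?A x" using Ab by eventually_elim (rule trunc_eq)
    have hf: "Be ?h v = (\<integral>x. v x * \<eta> x \<partial>m)" and gf: "Be ?g v = (\<integral>x. v x * \<bar>\<eta> x\<bar> \<partial>m)" if v: "v \<in> Db" for v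
    proof -
      obtain c where c: "\<And>x. \<bar>v x\<bar> \<le> c" using v by (auto simp: Db_def)
      show "Be ?h v = (\<integral>x. v x * \<eta> x \<partial>m)"
        using V.AE_form[OF h(1) G Db_De[OF v] hG] Gf[OF Db_De[OF v] c] by simp
      show "Be ?g v = (\<integral>x. v x * \<bar>\<eta> x\<bar> \<partial>m)"
        using V.AE_form[OF g(1) A Db_De[OF v] gA] Af[OF Db_De[OF v] c] by simp
    qed
    from u(4)[rule_format, OF \<eta> h g hf gf] have dual: "integrable m (\<lambda>x. u x * \<eta> x)"
      "(\<integral>x. u x * \<eta> x \<partial>m) = (\<integral>x. f x (u x) * ?h x \<partial>m) + (P.pair ?h - N.pair ?h)" by auto
    have "(\<integral>x. f x (u x) * ?h x \<partial>m) = (\<integral>x. f x (u x) * ?G x \<partial>m)"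
    proof (rule integral_cong_AE)
      note [measurable] = De_measurable[OF h(1)] De_measurable[OF G] absorption_measurable[OF f u(1)]
      show "(\<lambda>x. f x (u x) * ?h x) \<in> borel_measurable m" "(\<lambda>x. f x (u x) * ?G x) \<in> borel_measurable m"
        by measurable
      show "AE x in m. f x (u x) * ?h x = f x (u x) * ?G x" using hG by eventually_elim simp
    qed
    moreover have "P.pair ?h = P.pair ?G" "N.pair ?h = N.pair ?G"
      using P.pair_cong[OF h(1) G hG] N.pair_cong[OF h(1) G hG] by auto
    ultimately show ?thesis using dual by (simp add: signed_integral_def P.pair_def N.pair_def)
  qed
  then have "duality_solution m D \<E> f \<mu> u"
    unfolding duality_solution_def using u(1,2) by blast
  moreover have "trunc k u \<in> De \<and> ext_energy m D \<E> (trunc k u) \<le> 2 * k * tv_norm \<mu>" if k: "0 \<le> k" for k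
  proof (cases "k = 0")
    \<comment> \<open>Level 0 is treated apart because the truncation lemmas rescale the unit
      contraction by the level.\<close>
    case True
    have z: "trunc 0 u = (\<lambda>x. 0)" by (auto simp: trunc_def)
    show ?thesis using Be_self[OF V.zero_mem] V.form_zero_left[OF V.zero_mem] by (simp add: True z)
  next
    case False
    then have k: "0 < k" using k by simp
    have "0 \<le> tv_norm \<mu>" by (simp add: tv_norm_def variation_def)
    then have "k * tv_norm \<mu> \<le> 2 * k * tv_norm \<mu>" using k by simp
    then show ?thesis using u(3)[rule_format, OF k] Be_self[of "trunc k u"] by linarith
  qed
  ultimately show ?thesis by blast
qed

end
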